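(* Let $C$ be a manifold with a pre-contact distribution $\xi_C$, line bundle $\ell=TC/\xi_C$, and characteristic foliation $\mathcal{F}$. For any choice of complement $G$ to $T\mathcal{F}\subset TC$, the chain map $$\Phi_G\colon(\Omega^\bullet(\mathcal{F},\ell),d_{\nabla^\ell})\longrightarrow(\Omega^\bullet(\mathcal{F},N\mathcal{F}),-d_{\nabla^{N\mathcal{F}}})$$ induces a map in cohomology $H^\bullet(\mathcal{F},\ell)\to H^\bullet(\mathcal{F},N\mathcal{F})$ which is canonical, i.e. independent of $G$.
   Context: Pre-contact data. For a hyperplane distribution $\xi_C$ on $C$, let $\ell:=TC/\xi_C$, let $\theta_C\in\Omega^1(C,\ell)$ be the quotient projection, and let $\omega(X,Y)=\theta_C([X,Y])$ for $X,Y\in\Gamma(\xi_C)$. $\xi_C$ is pre-contact if $\ker\omega^\flat\subset\xi_C$ has constant rank; it is then involutive and its foliation $\mathcal{F}$ is the characteristic foliation, $T\mathcal{F}=\ker\omega^\flat$. Let $N\mathcal{F}=TC/T\mathcal{F}$. Complexes. $\Omega^\bullet(\mathcal{F},E)=\Gamma(\wedge^\bullet T^*\mathcal{F}\otimes E)$, with Koszul differential $d_\nabla$ for a flat $T\mathcal{F}$-connection $\nabla$ on $E$; $H^\bullet(\mathcal{F},E)$ is its cohomology. Here $\nabla^\ell_X\theta_C(Y)=\theta_C([X,Y])$ on $\ell$, and $\nabla^{N\mathcal{F}}_X(Y\bmod T\mathcal{F})=[X,Y]\bmod T\mathcal{F}$ on $N\mathcal{F}$, for $X\in\Gamma(T\mathcal{F})$,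 $Y\in\mathfrak{X}(C)$. Atiyah algebroid. Sections of $D\ell\to C$ are derivations of $\ell$: $\mathbb{R}$-linear maps $\square\colon\Gamma(\ell)\to\Gamma(\ell)$ with $\square(f\lambda)=\sigma(\square)(f)\lambda+f\square\lambda$ for a unique vector field $\sigma(\square)$. $D\ell$ is a Lie algebroid with commutator bracket and anchor the symbol $\sigma\colon D\ell\to TC$; it acts tautologically on $\ell$, giving the Koszul differential $d_D$ on $\Omega^\bullet_D(\ell):=\Gamma(\wedge^\bullet(D\ell)^*\otimes\ell)$. Put $\varpi:=d_D(\sigma^*\theta_C)$, $\varpi^\flat\colon D\ell\to(D\ell)^*\otimes\ell$, $K:=\ker\varpi^\flat$, a Lie subalgebroid which $\sigma$ maps isomorphically onto $T\mathcal{F}$. For a complement $TC=T\mathcal{F}\oplus G$, let $\widetilde G:=\sigma^{-1}(G)$, so $D\ell=K\oplus\widetilde G$ with projection $\mathrm{pr}_K$; $\varpi^\flat$ restricts to an isomorphism $\varpi^\flat|_{\widetilde G}\colon\widetilde G\to\widetilde G^*\otimes\ell$. The map $\Phi_G\colon\Omega^\bullet(\mathcal{F},\ell)\to\Omega^\bullet(\mathcal{F},N\mathcal{F})$ is defined by $$\langle\beta,\Phi_G(\eta)(\sigma(\Delta_1),\ldots,\sigma(\Delta_n))\rangle=d_D(\mathrm{pr}_K^*\sigma^*\eta)\big(\Delta_1,\ldots,\Delta_n,(\varpi^\flat|_{\widetilde G})^{-1}(\sigma^*\beta)\big)$$ for $\eta\in\Omega^n(\mathcal{F},\ell)$, $\beta\in\Gamma(N^*\mathcal{F}\otimes\ell)$,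 $\Delta_i\in\Gamma(K)$, where $N^*\mathcal{F}\otimes\ell\simeq G^*\otimes\ell$. It is a chain map between the complexes in the claim. *)

theory Defs
  imports
    "HOL-Analysis.Analysis"
    "HOL-Library.Function_Algebras"
    "HOL-Algebra.AbelCoset"
    "HOL-Algebra.Module"
begin

section \<open>Smooth manifolds\<close>

text \<open>
  The manifold is the whole type \<open>'a\<close> (Hausdorff, second countable, without boundary), equipped
  with a smooth atlas of charts into the Euclidean space \<open>'b\<close>; its dimension is \<open>DIM('b)\<close>.
  The atlas need not be maximal.
\<close>

primrec Ck_on :: "nat \<Rightarrow> 'b::euclidean_space set \<Rightarrow> ('b \<Rightarrow> 'c::real_normed_vector) \<Rightarrow> bool" where
  "Ck_on 0 S f \<longleftrightarrow> continuous_on S f"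
| "Ck_on (Suc k) S f \<longleftrightarrow>
     (\<forall>x\<in>S. f differentiable (at x)) \<and> (\<forall>v. Ck_on k S (\<lambda>x. frechet_derivative f (at x) v))"

text \<open>Only used for open \<open>S\<close>.\<close>

definition smooth_on :: "'b::euclidean_space set \<Rightarrow> ('b \<Rightarrow> 'c::real_normed_vector) \<Rightarrow> bool" where
  "smooth_on S f \<longleftrightarrow> (\<forall>k. Ck_on k S f)"

type_synonym ('a, 'b) chart = "'a set \<times> ('a \<Rightarrow> 'b)"

definition smooth_atlas ::
  "('a::{t2_space,second_countable_topology}, 'b::euclidean_space) chart set \<Rightarrow> bool" where
  "smooth_atlas A \<longleftrightarrow>
     (\<Union>(U, \<phi>)\<in>A. U) = UNIV \<and>
     (\<forall>(U, \<phi>)\<in>A. open U \<and> open (\<phi> ` U) \<and> (\<exists>\<psi>. homeomorphism U (\<phi> ` U) \<phi> \<psi>)) \<and>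
     (\<forall>(U, \<phi>)\<in>A. \<forall>(V, \<psi>)\<in>A. smooth_on (\<phi> ` (U \<inter> V)) (\<psi> \<circ> inv_into U \<phi>))"

definition smooth_funs ::
  "('a::{t2_space,second_countable_topology}, 'b::euclidean_space) chart set \<Rightarrow> ('a \<Rightarrow> real) set" where
  "smooth_funs A = {f. \<forall>(U, \<phi>)\<in>A. smooth_on (\<phi> ` U) (f \<circ> inv_into U \<phi>)}"


section \<open>Modules\<close>

text \<open>
  Modules are records of type \<open>module\<close>, of which only the carrier, the additive
  structure and the scalar multiplication are relevant.
\<close>

definition linear_map ::
  "'s set \<Rightarrow> ('s, 'x) module \<Rightarrow> ('s, 'y) module \<Rightarrow> ('x \<Rightarrow> 'y) \<Rightarrow> bool" where
  "linear_map S M N f \<longleftrightarrow>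
     f \<in> carrier M \<rightarrow> carrier N \<and>
     (\<forall>x\<in>carrier M. \<forall>y\<in>carrier M. f (x \<oplus>\<^bsub>M\<^esub> y) = f x \<oplus>\<^bsub>N\<^esub> f y) \<and>
     (\<forall>c\<in>S. \<forall>x\<in>carrier M. f (c \<odot>\<^bsub>M\<^esub> x) = c \<odot>\<^bsub>N\<^esub> f x)"

definition submod :: "('s, 'x) module \<Rightarrow> 'x set \<Rightarrow> ('s, 'x) module" where
  "submod M N = M\<lparr>carrier := N\<rparr>"

definition quot_module :: "('s, 'x) module \<Rightarrow> 'x set \<Rightarrow> ('s, 'x set) module" where
  "quot_module M N =
     \<lparr>carrier = a_rcosets\<^bsub>M\<^esub> N, mult = undefined, one = undefined,
      zero = N, add = set_add M, smult = (\<lambda>c S. \<Union>x\<in>S. N +>\<^bsub>M\<^esub> (c \<odot>\<^bsub>M\<^esub> x))\<rparr>"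

definition alt_sign :: "('s, 'x) module \<Rightarrow> nat \<Rightarrow> 'x \<Rightarrow> 'x" where
  "alt_sign M i x = (if even i then x else \<ominus>\<^bsub>M\<^esub> x)"


section \<open>Tangent vectors, vector fields, distributions\<close>

text \<open>
  A tangent vector at a point is a derivation of the algebra of smooth functions at that point,
  extended by 0 to all functions.  A vector field is a smooth section of the tangent bundle, written
  as the operator \<open>X\<close> with \<open>X f p = X\<^sub>p(f)\<close>.
\<close>

type_synonym 'a tvec = "('a \<Rightarrow> real) \<Rightarrow> real"
type_synonym 'a vfield = "('a \<Rightarrow> real) \<Rightarrow> ('a \<Rightarrow> real)"
type_synonym 'a distribution = "'a \<Rightarrow> 'a tvec set"

definition tangent_space ::
  "('a::{t2_space,second_countable_topology}, 'b::euclidean_space) chart set \<Rightarrow> 'a \<Rightarrow> (real, 'a tvec) module"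
  where
  "tangent_space A p =
     \<lparr>carrier =
        {v. (\<forall>f\<in>smooth_funs A. \<forall>g\<in>smooth_funs A.
               v (\<lambda>x. f x + g x) = v f + v g \<and>
               v (\<lambda>x. f x * g x) = f p * v g + g p * v f) \<and>
            (\<forall>c. \<forall>f\<in>smooth_funs A. v (\<lambda>x. c * f x) = c * v f) \<and>
            (\<forall>f. f \<notin> smooth_funs A \<longrightarrow> v f = 0)},
      mult = undefined, one = undefined,
      zero = (\<lambda>f. 0), add = (\<lambda>u v f. u f + v f), smult = (\<lambda>c v f. c * v f)\<rparr>"

abbreviation tvec_span :: "'a tvec set \<Rightarrow> 'a tvec set" where
  "tvec_span \<equiv> module.span (\<lambda>(c::real) v f. c * v f)"

abbreviation tvec_dim :: "'a tvec set \<Rightarrow> nat" where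
  "tvec_dim \<equiv> vector_space.dim (\<lambda>(c::real) v f. c * v f)"

definition vec_at :: "'a vfield \<Rightarrow> 'a \<Rightarrow> 'a tvec" where
  "vec_at X p = (\<lambda>f. X f p)"

definition vfields ::
  "('a::{t2_space,second_countable_topology}, 'b::euclidean_space) chart set
     \<Rightarrow> ('a \<Rightarrow> real, 'a vfield) module" where
  "vfields A =
     \<lparr>carrier = {X. (\<forall>p. vec_at X p \<in> carrier (tangent_space A p)) \<and>
                    (\<forall>f\<in>smooth_funs A. X f \<in> smooth_funs A)},
      mult = undefined, one = undefined,
      zero = (\<lambda>f p. 0), add = (\<lambda>X Y f p. X f p + Y f p), smult = (\<lambda>h X f p. h p * X f p)\<rparr>"

definition lie :: "'a vfield \<Rightarrow> 'a vfield \<Rightarrow> 'a vfield" where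
  "lie X Y = (\<lambda>f p. X (Y f) p - Y (X f) p)"

text \<open>Smooth subbundles of the tangent bundle of rank \<open>k\<close>, given by local frames.\<close>

definition subbundle ::
  "('a::{t2_space,second_countable_topology}, 'b::euclidean_space) chart set
     \<Rightarrow> nat \<Rightarrow> 'a distribution \<Rightarrow> bool" where
  "subbundle A k D \<longleftrightarrow>
     (\<forall>p. \<exists>U (X :: nat \<Rightarrow> 'a vfield). open U \<and> p \<in> U \<and> (\<forall>i<k. X i \<in> carrier (vfields A)) \<and>
        (\<forall>q\<in>U. D q = tvec_span ((\<lambda>i. vec_at (X i) q) ` {..<k}) \<and> tvec_dim (D q) = k))"

definition dist_sections ::
  "('a::{t2_space,second_countable_topology}, 'b::euclidean_space) chart set
     \<Rightarrow> 'a distribution \<Rightarrow> ('a \<Rightarrow> real, 'a vfield) module" where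
  "dist_sections A D = submod (vfields A) {X \<in> carrier (vfields A). \<forall>p. vec_at X p \<in> D p}"

definition complementary ::
  "('a::{t2_space,second_countable_topology}, 'b::euclidean_space) chart set
     \<Rightarrow> 'a distribution \<Rightarrow> 'a distribution \<Rightarrow> bool" where
  "complementary A D G \<longleftrightarrow>
     (\<exists>k. subbundle A k G) \<and>
     (\<forall>p. D p \<inter> G p = {\<zero>\<^bsub>tangent_space A p\<^esub>} \<and>
          D p <+>\<^bsub>tangent_space A p\<^esub> G p = carrier (tangent_space A p))"


section \<open>The quotient bundle of a distribution\<close>

text \<open>
  The fibre over \<open>p\<close> is the quotient vector space \<open>T\<^sub>pC/D\<^sub>p\<close>, whose elements are cosets.
  A section is smooth if it is locally the class of a smooth vector field.
\<close>

type_synonym 'a qsection = "'a \<Rightarrow> 'a tvec set"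

definition quot_fibre ::
  "('a::{t2_space,second_countable_topology}, 'b::euclidean_space) chart set
     \<Rightarrow> 'a distribution \<Rightarrow> 'a \<Rightarrow> (real, 'a tvec set) module" where
  "quot_fibre A D p = quot_module (tangent_space A p) (D p)"

definition quot_proj ::
  "('a::{t2_space,second_countable_topology}, 'b::euclidean_space) chart set
     \<Rightarrow> 'a distribution \<Rightarrow> 'a vfield \<Rightarrow> 'a qsection" where
  "quot_proj A D X = (\<lambda>p. D p +>\<^bsub>tangent_space A p\<^esub> vec_at X p)"

definition quot_sections ::
  "('a::{t2_space,second_countable_topology}, 'b::euclidean_space) chart set
     \<Rightarrow> 'a distribution \<Rightarrow> ('a \<Rightarrow> real, 'a qsection) module" where
  "quot_sections A D =
     \<lparr>carrier = {s. \<forall>p. \<exists>U. open U \<and> p \<in> U \<and>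
                     (\<exists>X\<in>carrier (vfields A). \<forall>q\<in>U. s q = quot_proj A D X q)},
      mult = undefined, one = undefined,
      zero = (\<lambda>p. \<zero>\<^bsub>quot_fibre A D p\<^esub>),
      add = (\<lambda>s t p. s p \<oplus>\<^bsub>quot_fibre A D p\<^esub> t p),
      smult = (\<lambda>h s p. h p \<odot>\<^bsub>quot_fibre A D p\<^esub> s p)\<rparr>"

text \<open>
  The partial connection \<open>\<nabla>\<^sub>X (Y mod D) = [X,Y] mod D\<close> on \<open>TC/D\<close>.  The formula is imposed on every open
  set on which the given section is of the form \<open>Y mod D\<close>, so that no global lift \<open>Y\<close> is needed.
\<close>

definition bott ::
  "('a::{t2_space,second_countable_topology}, 'b::euclidean_space) chart set
     \<Rightarrow> 'a distribution \<Rightarrow> 'a vfield \<Rightarrow> 'a qsection \<Rightarrow> 'a qsection" where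
  "bott A D X s =
     (THE t. t \<in> carrier (quot_sections A D) \<and>
        (\<forall>U. \<forall>Y\<in>carrier (vfields A). open U \<and> (\<forall>q\<in>U. s q = quot_proj A D Y q) \<longrightarrow>
           (\<forall>q\<in>U. t q = quot_proj A D (lie X Y) q)))"


section \<open>Forms, Koszul differentials, cohomology\<close>

definition tuples :: "('s, 'x) module \<Rightarrow> nat \<Rightarrow> 'x list set" where
  "tuples L n = {xs. set xs \<subseteq> carrier L \<and> length xs = n}"

text \<open>
  For \<open>L = \<Gamma>(V)\<close> and \<open>M = \<Gamma>(E)\<close>, the sections of \<open>\<And>\<^sup>n V\<^sup>* \<otimes> E\<close> are the alternating
  maps \<open>L\<^sup>n \<rightarrow> M\<close> that are multilinear over the smooth functions.  Arguments are
  passed as lists; values outside the domain are \<open>undefined\<close>.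
  The forms are regarded as a real vector space.
\<close>

definition forms ::
  "('a \<Rightarrow> real) set \<Rightarrow> ('a \<Rightarrow> real, 'x) module \<Rightarrow> ('a \<Rightarrow> real, 'm) module
     \<Rightarrow> nat \<Rightarrow> (real, 'x list \<Rightarrow> 'm) module" where
  "forms R L M n =
     \<lparr>carrier = {\<eta> \<in> tuples L n \<rightarrow>\<^sub>E carrier M.
        \<forall>xs\<in>tuples L n.
          (\<forall>i<n. linear_map R L M (\<lambda>x. \<eta> (xs[i := x]))) \<and>
          (\<forall>i<n. \<forall>j<n. i \<noteq> j \<and> xs ! i = xs ! j \<longrightarrow> \<eta> xs = \<zero>\<^bsub>M\<^esub>)},
      mult = undefined, one = undefined,
      zero = (\<lambda>xs\<in>tuples L n. \<zero>\<^bsub>M\<^esub>),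
      add = (\<lambda>\<eta> \<zeta>. \<lambda>xs\<in>tuples L n. \<eta> xs \<oplus>\<^bsub>M\<^esub> \<zeta> xs),
      smult = (\<lambda>c \<eta>. \<lambda>xs\<in>tuples L n. (\<lambda>p. c) \<odot>\<^bsub>M\<^esub> \<eta> xs)\<rparr>"

text \<open>
  Koszul differential of an \<open>n\<close>-form, for the bracket \<open>br\<close> on \<open>L\<close> and the action \<open>nab\<close> of \<open>L\<close> on \<open>M\<close>:
  \<open>(d\<eta>)(x\<^sub>0,\<dots>,x\<^sub>n) = \<Sum>\<^sub>i (-1)\<^sup>i nab x\<^sub>i (\<eta>(\<dots>,x\<^sub>i omitted,\<dots>))
     + \<Sum>\<^sub>i\<^sub><\<^sub>j (-1)\<^sup>i\<^sup>+\<^sup>j \<eta>([x\<^sub>i,x\<^sub>j],\<dots>,x\<^sub>i omitted,\<dots>,x\<^sub>j omitted,\<dots>)\<close>.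
\<close>

definition koszul ::
  "('s, 'x) module \<Rightarrow> ('s, 'm) module \<Rightarrow> ('x \<Rightarrow> 'x \<Rightarrow> 'x) \<Rightarrow> ('x \<Rightarrow> 'm \<Rightarrow> 'm)
     \<Rightarrow> nat \<Rightarrow> ('x list \<Rightarrow> 'm) \<Rightarrow> ('x list \<Rightarrow> 'm)" where
  "koszul L M br nab n \<eta> =
     (\<lambda>xs\<in>tuples L (Suc n).
        (\<Oplus>\<^bsub>M\<^esub>i\<in>{..n}. alt_sign M i (nab (xs ! i) (\<eta> (nths xs (- {i}))))) \<oplus>\<^bsub>M\<^esub>
        (\<Oplus>\<^bsub>M\<^esub>j\<in>{..n}. \<Oplus>\<^bsub>M\<^esub>i\<in>{..<j}.
           alt_sign M (i + j) (\<eta> (br (xs ! i) (xs ! j) # nths xs (- {i, j})))))"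

definition cocycles :: "(nat \<Rightarrow> (real, 'w) module) \<Rightarrow> (nat \<Rightarrow> 'w \<Rightarrow> 'w) \<Rightarrow> nat \<Rightarrow> 'w set" where
  "cocycles \<Omega> d n = {\<eta> \<in> carrier (\<Omega> n). d n \<eta> = \<zero>\<^bsub>\<Omega> (Suc n)\<^esub>}"

definition coboundaries :: "(nat \<Rightarrow> (real, 'w) module) \<Rightarrow> (nat \<Rightarrow> 'w \<Rightarrow> 'w) \<Rightarrow> nat \<Rightarrow> 'w set" where
  "coboundaries \<Omega> d n =
     (case n of 0 \<Rightarrow> {\<zero>\<^bsub>\<Omega> 0\<^esub>} | Suc m \<Rightarrow> d m ` carrier (\<Omega> m))"

definition cohomology ::
  "(nat \<Rightarrow> (real, 'w) module) \<Rightarrow> (nat \<Rightarrow> 'w \<Rightarrow> 'w) \<Rightarrow> nat \<Rightarrow> (real, 'w set) module" where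
  "cohomology \<Omega> d n = quot_module (submod (\<Omega> n) (cocycles \<Omega> d n)) (coboundaries \<Omega> d n)"

definition cohomology_class ::
  "(nat \<Rightarrow> (real, 'w) module) \<Rightarrow> (nat \<Rightarrow> 'w \<Rightarrow> 'w) \<Rightarrow> nat \<Rightarrow> 'w \<Rightarrow> 'w set" where
  "cohomology_class \<Omega> d n \<eta> = coboundaries \<Omega> d n +>\<^bsub>submod (\<Omega> n) (cocycles \<Omega> d n)\<^esub> \<eta>"

definition chain_map ::
  "(nat \<Rightarrow> (real, 'v) module) \<Rightarrow> (nat \<Rightarrow> 'v \<Rightarrow> 'v) \<Rightarrow>
   (nat \<Rightarrow> (real, 'w) module) \<Rightarrow> (nat \<Rightarrow> 'w \<Rightarrow> 'w) \<Rightarrow> (nat \<Rightarrow> 'v \<Rightarrow> 'w) \<Rightarrow> bool" where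
  "chain_map \<Omega> d \<Omega>' d' F \<longleftrightarrow>
     (\<forall>n. linear_map UNIV (\<Omega> n) (\<Omega>' n) (F n)) \<and>
     (\<forall>n. \<forall>\<eta>\<in>carrier (\<Omega> n). F (Suc n) (d n \<eta>) = d' n (F n \<eta>))"


section \<open>Pre-contact distributions\<close>

text \<open>\<open>\<xi>\<close> is the distribution, \<open>\<ell> = TC/\<xi>\<close>, and the quotient projection is \<open>\<theta> = quot_proj A \<xi>\<close>.\<close>

definition curvature ::
  "('a::{t2_space,second_countable_topology}, 'b::euclidean_space) chart set
     \<Rightarrow> 'a distribution \<Rightarrow> 'a vfield \<Rightarrow> 'a vfield \<Rightarrow> 'a qsection" where
  "curvature A \<xi> X Y = quot_proj A \<xi> (lie X Y)"

text \<open>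
  The fibrewise kernel \<open>T\<F>\<close> of the curvature \<open>\<omega>\<close>.  As \<open>\<omega>\<close> is tensorial, the condition on the vector
  \<open>X\<^sub>p\<close> does not depend on its extension \<open>X\<close>.
\<close>

definition char_dist ::
  "('a::{t2_space,second_countable_topology}, 'b::euclidean_space) chart set
     \<Rightarrow> 'a distribution \<Rightarrow> 'a distribution" where
  "char_dist A \<xi> p =
     {vec_at X p | X. X \<in> carrier (dist_sections A \<xi>) \<and>
        (\<forall>Y\<in>carrier (dist_sections A \<xi>). curvature A \<xi> X Y p = \<zero>\<^bsub>quot_fibre A \<xi> p\<^esub>)}"

definition pre_contact ::
  "('a::{t2_space,second_countable_topology}, 'b::euclidean_space) chart set
     \<Rightarrow> 'a distribution \<Rightarrow> bool" where
  "pre_contact A \<xi> \<longleftrightarrow>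
     subbundle A (DIM('b) - 1) \<xi> \<and> (\<exists>r. \<forall>p. tvec_dim (char_dist A \<xi> p) = r)"

abbreviation ell ::
  "('a::{t2_space,second_countable_topology}, 'b::euclidean_space) chart set
     \<Rightarrow> 'a distribution \<Rightarrow> ('a \<Rightarrow> real, 'a qsection) module" where
  "ell A \<xi> \<equiv> quot_sections A \<xi>"

abbreviation TF ::
  "('a::{t2_space,second_countable_topology}, 'b::euclidean_space) chart set
     \<Rightarrow> 'a distribution \<Rightarrow> ('a \<Rightarrow> real, 'a vfield) module" where
  "TF A \<xi> \<equiv> dist_sections A (char_dist A \<xi>)"

abbreviation NF ::
  "('a::{t2_space,second_countable_topology}, 'b::euclidean_space) chart set
     \<Rightarrow> 'a distribution \<Rightarrow> ('a \<Rightarrow> real, 'a qsection) module" where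
  "NF A \<xi> \<equiv> quot_sections A (char_dist A \<xi>)"

abbreviation \<Omega>_ell ::
  "('a::{t2_space,second_countable_topology}, 'b::euclidean_space) chart set
     \<Rightarrow> 'a distribution \<Rightarrow> nat \<Rightarrow> (real, 'a vfield list \<Rightarrow> 'a qsection) module" where
  "\<Omega>_ell A \<xi> n \<equiv> forms (smooth_funs A) (TF A \<xi>) (ell A \<xi>) n"

abbreviation \<Omega>_NF ::
  "('a::{t2_space,second_countable_topology}, 'b::euclidean_space) chart set
     \<Rightarrow> 'a distribution \<Rightarrow> nat \<Rightarrow> (real, 'a vfield list \<Rightarrow> 'a qsection) module" where
  "\<Omega>_NF A \<xi> n \<equiv> forms (smooth_funs A) (TF A \<xi>) (NF A \<xi>) n"

definition d_ell ::
  "('a::{t2_space,second_countable_topology}, 'b::euclidean_space) chart set \<Rightarrow> 'a distribution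
     \<Rightarrow> nat \<Rightarrow> ('a vfield list \<Rightarrow> 'a qsection) \<Rightarrow> ('a vfield list \<Rightarrow> 'a qsection)" where
  "d_ell A \<xi> = koszul (TF A \<xi>) (ell A \<xi>) lie (bott A \<xi>)"

definition d_NF ::
  "('a::{t2_space,second_countable_topology}, 'b::euclidean_space) chart set \<Rightarrow> 'a distribution
     \<Rightarrow> nat \<Rightarrow> ('a vfield list \<Rightarrow> 'a qsection) \<Rightarrow> ('a vfield list \<Rightarrow> 'a qsection)" where
  "d_NF A \<xi> = koszul (TF A \<xi>) (NF A \<xi>) lie (bott A (char_dist A \<xi>))"

definition minus_d_NF ::
  "('a::{t2_space,second_countable_topology}, 'b::euclidean_space) chart set \<Rightarrow> 'a distribution
     \<Rightarrow> nat \<Rightarrow> ('a vfield list \<Rightarrow> 'a qsection) \<Rightarrow> ('a vfield list \<Rightarrow> 'a qsection)" where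
  "minus_d_NF A \<xi> n \<eta> = \<ominus>\<^bsub>\<Omega>_NF A \<xi> (Suc n)\<^esub> d_NF A \<xi> n \<eta>"


section \<open>The Atiyah algebroid\<close>

type_synonym 'a deriv = "'a qsection \<Rightarrow> 'a qsection"

definition is_symbol ::
  "('a::{t2_space,second_countable_topology}, 'b::euclidean_space) chart set
     \<Rightarrow> 'a distribution \<Rightarrow> 'a deriv \<Rightarrow> 'a vfield \<Rightarrow> bool" where
  "is_symbol A \<xi> \<Delta> X \<longleftrightarrow>
     X \<in> carrier (vfields A) \<and>
     (\<forall>f\<in>smooth_funs A. \<forall>s\<in>carrier (ell A \<xi>).
        \<Delta> (f \<odot>\<^bsub>ell A \<xi>\<^esub> s) = (X f \<odot>\<^bsub>ell A \<xi>\<^esub> s) \<oplus>\<^bsub>ell A \<xi>\<^esub> (f \<odot>\<^bsub>ell A \<xi>\<^esub> \<Delta> s))"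

text \<open>Derivations are \<open>undefined\<close> outside \<open>\<Gamma>(\<ell>)\<close>.\<close>

definition Dl ::
  "('a::{t2_space,second_countable_topology}, 'b::euclidean_space) chart set
     \<Rightarrow> 'a distribution \<Rightarrow> ('a \<Rightarrow> real, 'a deriv) module" where
  "Dl A \<xi> =
     \<lparr>carrier = {\<Delta> \<in> carrier (ell A \<xi>) \<rightarrow>\<^sub>E carrier (ell A \<xi>).
        linear_map (range (\<lambda>c p. c)) (ell A \<xi>) (ell A \<xi>) \<Delta> \<and> (\<exists>X. is_symbol A \<xi> \<Delta> X)},
      mult = undefined, one = undefined,
      zero = (\<lambda>s\<in>carrier (ell A \<xi>). \<zero>\<^bsub>ell A \<xi>\<^esub>),
      add = (\<lambda>\<Delta> \<Delta>'. \<lambda>s\<in>carrier (ell A \<xi>). \<Delta> s \<oplus>\<^bsub>ell A \<xi>\<^esub> \<Delta>' s),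
      smult = (\<lambda>h \<Delta>. \<lambda>s\<in>carrier (ell A \<xi>). h \<odot>\<^bsub>ell A \<xi>\<^esub> \<Delta> s)\<rparr>"

definition symb ::
  "('a::{t2_space,second_countable_topology}, 'b::euclidean_space) chart set
     \<Rightarrow> 'a distribution \<Rightarrow> 'a deriv \<Rightarrow> 'a vfield" where
  "symb A \<xi> \<Delta> = (THE X. is_symbol A \<xi> \<Delta> X)"

definition commutator ::
  "('a::{t2_space,second_countable_topology}, 'b::euclidean_space) chart set
     \<Rightarrow> 'a distribution \<Rightarrow> 'a deriv \<Rightarrow> 'a deriv \<Rightarrow> 'a deriv" where
  "commutator A \<xi> \<Delta> \<Delta>' = (\<lambda>s\<in>carrier (ell A \<xi>). \<Delta> (\<Delta>' s) \<ominus>\<^bsub>ell A \<xi>\<^esub> \<Delta>' (\<Delta> s))"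

definition d_D ::
  "('a::{t2_space,second_countable_topology}, 'b::euclidean_space) chart set \<Rightarrow> 'a distribution
     \<Rightarrow> nat \<Rightarrow> ('a deriv list \<Rightarrow> 'a qsection) \<Rightarrow> ('a deriv list \<Rightarrow> 'a qsection)" where
  "d_D A \<xi> = koszul (Dl A \<xi>) (ell A \<xi>) (commutator A \<xi>) (\<lambda>\<Delta> s. \<Delta> s)"

definition varpi ::
  "('a::{t2_space,second_countable_topology}, 'b::euclidean_space) chart set
     \<Rightarrow> 'a distribution \<Rightarrow> 'a deriv list \<Rightarrow> 'a qsection" where
  "varpi A \<xi> = d_D A \<xi> 1 (\<lambda>\<Delta>s\<in>tuples (Dl A \<xi>) 1. quot_proj A \<xi> (symb A \<xi> (hd \<Delta>s)))"

definition Ker ::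
  "('a::{t2_space,second_countable_topology}, 'b::euclidean_space) chart set
     \<Rightarrow> 'a distribution \<Rightarrow> ('a \<Rightarrow> real, 'a deriv) module" where
  "Ker A \<xi> = submod (Dl A \<xi>)
     {\<Delta> \<in> carrier (Dl A \<xi>). \<forall>\<Delta>'\<in>carrier (Dl A \<xi>). varpi A \<xi> [\<Delta>, \<Delta>'] = \<zero>\<^bsub>ell A \<xi>\<^esub>}"

definition G_tilde ::
  "('a::{t2_space,second_countable_topology}, 'b::euclidean_space) chart set
     \<Rightarrow> 'a distribution \<Rightarrow> 'a distribution \<Rightarrow> ('a \<Rightarrow> real, 'a deriv) module" where
  "G_tilde A \<xi> G = submod (Dl A \<xi>)
     {\<Delta> \<in> carrier (Dl A \<xi>). symb A \<xi> \<Delta> \<in> carrier (dist_sections A G)}"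

definition pr_K ::
  "('a::{t2_space,second_countable_topology}, 'b::euclidean_space) chart set
     \<Rightarrow> 'a distribution \<Rightarrow> 'a distribution \<Rightarrow> 'a deriv \<Rightarrow> 'a deriv" where
  "pr_K A \<xi> G \<Delta> =
     (THE \<Delta>'. \<Delta>' \<in> carrier (Ker A \<xi>) \<and> \<Delta> \<ominus>\<^bsub>Dl A \<xi>\<^esub> \<Delta>' \<in> carrier (G_tilde A \<xi> G))"

definition pullback_K ::
  "('a::{t2_space,second_countable_topology}, 'b::euclidean_space) chart set
     \<Rightarrow> 'a distribution \<Rightarrow> 'a distribution \<Rightarrow> nat \<Rightarrow> ('a vfield list \<Rightarrow> 'a qsection)
     \<Rightarrow> ('a deriv list \<Rightarrow> 'a qsection)" where
  "pullback_K A \<xi> G n \<eta> =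
     (\<lambda>\<Delta>s\<in>tuples (Dl A \<xi>) n. \<eta> (map (\<lambda>\<Delta>. symb A \<xi> (pr_K A \<xi> G \<Delta>)) \<Delta>s))"

text \<open>
  Sections of \<open>N\<^sup>*\<F> \<otimes> \<ell>\<close> are function-linear maps \<open>\<beta>\<close> from \<open>\<Gamma>(N\<F>)\<close> to \<open>\<Gamma>(\<ell>)\<close>; the element of
  \<open>G\<^sup>* \<otimes> \<ell>\<close> identified with \<open>\<beta>\<close> is \<open>Y \<mapsto> \<beta>(Y mod T\<F>)\<close>.  The following derivation is
  the preimage of \<open>\<sigma>\<^sup>*\<beta>\<close> under the restriction of \<open>\<varpi>\<^sup>\<flat>\<close> to \<open>\<sigma>\<^sup>-\<^sup>1(G)\<close>.
\<close>

definition varpi_inv ::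
  "('a::{t2_space,second_countable_topology}, 'b::euclidean_space) chart set
     \<Rightarrow> 'a distribution \<Rightarrow> 'a distribution \<Rightarrow> ('a qsection \<Rightarrow> 'a qsection) \<Rightarrow> 'a deriv" where
  "varpi_inv A \<xi> G \<beta> =
     (THE \<Delta>. \<Delta> \<in> carrier (G_tilde A \<xi> G) \<and>
        (\<forall>\<Delta>'\<in>carrier (G_tilde A \<xi> G).
           varpi A \<xi> [\<Delta>, \<Delta>'] = \<beta> (quot_proj A (char_dist A \<xi>) (symb A \<xi> \<Delta>'))))"

definition \<Phi> ::
  "('a::{t2_space,second_countable_topology}, 'b::euclidean_space) chart set
     \<Rightarrow> 'a distribution \<Rightarrow> 'a distribution \<Rightarrow> nat \<Rightarrow> ('a vfield list \<Rightarrow> 'a qsection)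
     \<Rightarrow> ('a vfield list \<Rightarrow> 'a qsection)" where
  "\<Phi> A \<xi> G n \<eta> =
     (\<lambda>Xs\<in>tuples (TF A \<xi>) n.
        THE \<nu>. \<nu> \<in> carrier (NF A \<xi>) \<and>
          (\<forall>\<beta>. linear_map (smooth_funs A) (NF A \<xi>) (ell A \<xi>) \<beta> \<longrightarrow>
             (\<forall>\<Delta>s\<in>tuples (Ker A \<xi>) n. map (symb A \<xi>) \<Delta>s = Xs \<longrightarrow>
                \<beta> \<nu> = d_D A \<xi> n (pullback_K A \<xi> G n \<eta>) (\<Delta>s @ [varpi_inv A \<xi> G \<beta>]))))"

end

theory Submission
  imports Defs "Jordan_Normal_Form.Determinant"
begin

text \<open>
  Let \<open>\<theta>\<close> be the quotient projection to \<open>\<ell>\<close> and \<open>P\<close> the projection to \<open>T\<F>\<close> along \<open>G\<close>.  By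
  nondegeneracy of the curvature on \<open>\<xi> \<inter> G\<close>, a section \<open>N\<close> of \<open>G\<close> is the same as a section
  \<open>\<theta> N\<close> of \<open>\<ell>\<close> together with a function-linear map \<open>Y \<mapsto> \<theta>[N,Y]\<close> from sections of \<open>\<xi> \<inter> G\<close> to
  sections of \<open>\<ell>\<close>; all such pairs occur.  In this description
  \<open>(-1)\<^sup>n \<Phi>\<^sub>G(\<eta>)(X\<^sub>1,\<dots>,X\<^sub>n)\<close> is the class of the \<open>N\<close> with \<open>\<theta> N = \<eta>(X\<^sub>1,\<dots>,X\<^sub>n)\<close> and
  \<open>\<theta>[N,Y] = \<Sum>\<^sub>k \<eta>(\<dots>,P[X\<^sub>k,Y],\<dots>)\<close>, and the chain map property becomes a commutation rule between
  the Koszul differential and insertions of endomorphisms.  If \<open>P'\<close> belongs to another complement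
  and \<open>d\<eta> = 0\<close>, then \<open>\<Phi>\<^sub>G\<^sub>'(\<eta>) - \<Phi>\<^sub>G(\<eta>)\<close> is, up to sign, the differential of the form \<open>\<psi>\<close> given by
  \<open>\<theta> \<psi> = 0\<close> and \<open>\<theta>[\<psi>(X\<^sub>2,\<dots>,X\<^sub>n),Y] = \<eta>((P' - P)Y,X\<^sub>2,\<dots>,X\<^sub>n)\<close>.
\<close>

section \<open>Koszul differentials of alternating maps\<close>

text \<open>The description of \<Phi> by pairs is forced by its definition. For a function-linear
  \<beta> from N\<F> to \<ell>, the preimage E of \<beta> under the restricted \<varpi> has a symbol
  Y in \<xi> \<inter> G and acts by E(\<theta> N) = \<theta>[Y,N] + \<beta>(N). As P Y = 0, the only
  terms of the differential at (\<Delta>_1,...,\<Delta>_n,E) that survive are those in which E acts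
  or is bracketed; the last place of E gives the sign (-1)^n. If \<theta> N = \<eta>(X_1,...,X_n),
  they add up to \<beta>(N) + \<theta>[Y,N] + \<Sum> \<eta>(..,P[X_k,Y],..), so prescribing
  \<theta>[N,Y] as that sum leaves exactly \<beta>(N). The obstacle in the chain map property is
  that [X_k,Y] leaves \<xi> \<inter> G. Its part in T\<F> becomes a covariant derivative of \<eta>,
  its part in \<xi> \<inter> G a second insertion, and these are the terms that arise when the
  insertion of P[.,Y] is commuted with d. Global solutions N are glued from local ones by
  uniqueness. Sections and forms are computed in ambient additive groups and translated to the
  module records afterwards.\<close>

definition sg :: "nat => 'm::ab_group_add => 'm" where
  "sg i x = (if even i then x else - x)"

lemma sg_simps [simp]: "sg 0 x = x" "sg (Suc i) x = - sg i x" "sg i 0 = 0" "sg i (- x) = - sg i x"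
  by (auto simp: sg_def)

lemma sg_add: "sg i (x + y) = sg i x + sg i y"
  and sg_diff: "sg i (x - y) = sg i x - sg i y"
  and sg_sg [simp]: "sg i (sg i x) = x"
  by (auto simp: sg_def)

lemma sg_sum: "sg i (sum f I) = (\<Sum>k\<in>I. sg i (f k))"
  by (auto simp: sg_def sum_negf)

text \<open>The Koszul formula omits positions by \<open>nths\<close>; these recursions make its
  identities accessible to induction on the argument list.\<close>

lemma nths_compl_Cons:
  "nths (x # xs) (- {0}) = xs"
  "nths (x # xs) (- {Suc i}) = x # nths xs (- {i})"
  "nths (x # xs) (- {0, Suc i}) = nths xs (- {i})"
  "nths (x # xs) (- {Suc i, Suc j}) = x # nths xs (- {i, j})"
proof -
  have "{j. Suc j \<in> - {0}} = UNIV" "{j. Suc j \<in> - {Suc i}} = - {i}"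
    "{j. Suc j \<in> - {0, Suc i}} = - {i}" "{ja. Suc ja \<in> - {Suc i, Suc j}} = - {i, j}" by auto
  then show "nths (x # xs) (- {0}) = xs" "nths (x # xs) (- {Suc i}) = x # nths xs (- {i})"
    "nths (x # xs) (- {0, Suc i}) = nths xs (- {i})" "nths (x # xs) (- {Suc i, Suc j}) = x # nths xs (- {i, j})"
    by (simp_all add: nths_Cons nths_all)
qed

lemma length_nths_compl: "i < length xs ==> length (nths xs (- {i})) = length xs - 1"
proof (induction xs arbitrary: i)
  case (Cons x xs)
  then show ?case by (cases i) (auto simp: nths_compl_Cons)
qed simp

lemma length_nths_compl2: "i < j ==> j < length xs ==> length (nths xs (- {i, j})) = length xs - 2"
proof (induction xs arbitrary: i j)
  case (Cons x xs)
  then obtain j' where j: "j = Suc j'" by (cases j) auto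
  show ?case
    using Cons unfolding j by (cases i) (auto simp: nths_compl_Cons length_nths_compl)
qed simp

lemma set_nths_in: "set xs \<subseteq> L ==> set (nths xs I) \<subseteq> L"
  using set_nths_subset by fastforce

text \<open>\<open>koszul\<close> in an ambient additive group: ordinary sums replace
  \<open>finsum\<close>, and the result is not cut down to tuples.\<close>

definition kz :: "('x => 'x => 'x) => ('x => 'm => 'm::ab_group_add) => ('x list => 'm) => 'x list => 'm" where
  "kz br nab \<eta> xs =
     (\<Sum>i<length xs. sg i (nab (xs ! i) (\<eta> (nths xs (- {i}))))) +
     (\<Sum>j<length xs. \<Sum>i<j. sg (i + j) (\<eta> (br (xs ! i) (xs ! j) # nths xs (- {i, j}))))"

text \<open>The action of an endomorphism on multilinear maps, as a derivation of degree 0.\<close>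

definition ins :: "('x => 'x) => ('x list => 'm::ab_group_add) => 'x list => 'm" where
  "ins A \<eta> xs = (\<Sum>k<length xs. \<eta> (xs[k := A (xs ! k)]))"

text \<open>The first half of the Koszul differential has this shape, and so have the correction
  terms of the commutation rules below.\<close>

definition asum :: "('x => 'x list => 'm::ab_group_add) => 'x list => 'm" where
  "asum f xs = (\<Sum>i<length xs. sg i (f (xs ! i) (nths xs (- {i}))))"

lemma ins_Nil [simp]: "ins A \<eta> [] = 0"
  and ins_Cons: "ins A \<eta> (x # xs) = \<eta> (A x # xs) + ins A (\<lambda>ys. \<eta> (x # ys)) xs"
  by (simp_all add: ins_def sum.lessThan_Suc_shift del: sum.lessThan_Suc)

lemma asum_Nil [simp]: "asum f [] = 0"
  and asum_Cons: "asum f (x # xs) = f x xs - asum (\<lambda>y zs. f y (x # zs)) xs"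
  by (simp_all add: asum_def sum.lessThan_Suc_shift nths_compl_Cons sum_negf del: sum.lessThan_Suc)

lemma kz_Nil [simp]: "kz br nab \<eta> [] = 0"
  by (simp add: kz_def)

text \<open>Substitutions in two different slots commute, so the commutator consists of the terms
  with both substitutions in the same slot.\<close>

lemma ins_commute:
  fixes A B :: "'x => 'x" and \<eta> :: "'x list => 'm::ab_group_add"
  shows "ins A (ins B \<eta>) xs - ins B (ins A \<eta>) xs = ins (\<lambda>x. B (A x)) \<eta> xs - ins (\<lambda>x. A (B x)) \<eta> xs"
proof (induction xs arbitrary: \<eta>)
  case (Cons x xs)
  have i: "ins A (\<lambda>ys. ins B \<eta> (x # ys)) xs = ins A (\<lambda>ys. \<eta> (B x # ys)) xs + ins A (ins B (\<lambda>ys. \<eta> (x # ys))) xs"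
    for A B :: "'x => 'x"
    unfolding ins_Cons by (simp add: ins_def sum.distrib)
  have L: "ins A (ins B \<eta>) (x # xs) = \<eta> (B (A x) # xs) + ins B (\<lambda>ys. \<eta> (A x # ys)) xs +
      (ins A (\<lambda>ys. \<eta> (B x # ys)) xs + ins A (ins B (\<lambda>ys. \<eta> (x # ys))) xs)" for A B :: "'x => 'x"
    unfolding ins_Cons[of A "ins B \<eta>"] i ins_Cons[of B \<eta> "A x"] ..
  have aux: "p + q + (r + s) - (p' + r + (q + s')) = (p + u) - (p' + v)" if "s - s' = u - v" for p q r s p' s' u v :: 'm
  proof -
    have "s = u - v + s'" using that by (simp add: diff_eq_eq)
    then show ?thesis by simp
  qed
  show ?case
    unfolding L ins_Cons[of "\<lambda>x. _ (_ x)"] by (rule aux[OF Cons])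
qed simp

text \<open>\<open>L\<close> and \<open>M\<close> are subsets of types that are additive groups: the
  sums are those of the type class, and only closure has to be tracked.\<close>

locale bracket_action =
  fixes L :: "'x::ab_group_add set" and M :: "'m::ab_group_add set"
    and br :: "'x => 'x => 'x" and nab :: "'x => 'm => 'm"
  assumes L_zero: "0 \<in> L" and L_add: "x \<in> L ==> y \<in> L ==> x + y \<in> L" and L_uminus: "x \<in> L ==> - x \<in> L"
    and M_zero: "0 \<in> M" and M_add: "m \<in> M ==> n \<in> M ==> m + n \<in> M" and M_uminus: "m \<in> M ==> - m \<in> M"
    and br_L: "x \<in> L ==> y \<in> L ==> br x y \<in> L"
    and br_add_left: "x \<in> L ==> y \<in> L ==> z \<in> L ==> br (x + y) z = br x z + br y z"
    and br_add_right: "x \<in> L ==> y \<in> L ==> z \<in> L ==> br z (x + y) = br z x + br z y"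
    and br_self: "x \<in> L ==> br x x = 0"
    and nab_M: "x \<in> L ==> m \<in> M ==> nab x m \<in> M"
    and nab_add_left: "x \<in> L ==> y \<in> L ==> m \<in> M ==> nab (x + y) m = nab x m + nab y m"
    and nab_add_right: "x \<in> L ==> m \<in> M ==> n \<in> M ==> nab x (m + n) = nab x m + nab x n"
begin

abbreviation d where "d \<equiv> kz br nab"

lemma M_sum: "(\<And>i. i \<in> I ==> m i \<in> M) ==> sum m I \<in> M"
  by (induction I rule: infinite_finite_induct) (simp_all add: M_zero M_add)

lemma M_sg: "m \<in> M ==> sg i m \<in> M"
  by (simp add: sg_def M_uminus)

lemma nab_zero: "x \<in> L ==> nab x 0 = 0"
  using nab_add_right[of x 0 0] M_zero by simp

lemma nab_sum: "x \<in> L ==> (\<And>i. i \<in> I ==> m i \<in> M) ==> nab x (sum m I) = (\<Sum>i\<in>I. nab x (m i))"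
  by (induction I rule: infinite_finite_induct) (simp_all add: nab_zero nab_add_right M_sum)

lemma br_antisym: "x \<in> L ==> y \<in> L ==> br x y = - br y x"
  using br_self[of "x + y"] br_self[of x] br_self[of y]
  by (simp add: br_add_left br_add_right L_add eq_neg_iff_add_eq_0 add.commute)

definition dom :: "nat => 'x list set" where
  "dom n = {xs. set xs \<subseteq> L \<and> length xs = n}"

lemma domD: "xs \<in> dom n ==> set xs \<subseteq> L" "xs \<in> dom n ==> length xs = n"
  by (simp_all add: dom_def)

lemma dom_nth: "xs \<in> dom n ==> i < n ==> xs ! i \<in> L"
  using nth_mem[of i xs] by (auto simp: dom_def simp del: nth_mem)

lemma dom_Cons: "x # xs \<in> dom (Suc n) \<longleftrightarrow> x \<in> L \<and> xs \<in> dom n"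
  by (auto simp: dom_def)

lemma dom_Nil: "[] \<in> dom 0"
  by (simp add: dom_def)

lemma dom_0: "xs \<in> dom 0 \<longleftrightarrow> xs = []"
  by (auto simp: dom_def)

lemma dom_SucE:
  assumes "xs \<in> dom (Suc n)"
  obtains x ys where "xs = x # ys" "x \<in> L" "ys \<in> dom n"
  using assms by (cases xs) (auto simp: dom_def)

lemma dom_update: "xs \<in> dom n ==> x \<in> L ==> xs[i := x] \<in> dom n"
  using set_update_subset_insert[of xs i x] by (auto simp: dom_def)

lemma dom_nths: "xs \<in> dom (Suc n) ==> i < Suc n ==> nths xs (- {i}) \<in> dom n"
  by (simp add: dom_def set_nths_in length_nths_compl)

lemma dom_nths2: "xs \<in> dom (Suc (Suc n)) ==> i < j ==> j < Suc (Suc n) ==> nths xs (- {i, j}) \<in> dom n"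
  by (simp add: dom_def set_nths_in length_nths_compl2)

text \<open>Linearity over functions is kept apart as the predicate \<open>hom\<close>, because it
  involves the scalars of \<open>bracket_module\<close>.\<close>

definition aalt :: "nat => ('x list => 'm) => bool" where
  "aalt n \<eta> \<longleftrightarrow> (\<forall>xs\<in>dom n. \<eta> xs \<in> M \<and>
     (\<forall>i<n. \<forall>x\<in>L. \<forall>y\<in>L. \<eta> (xs[i := x + y]) = \<eta> (xs[i := x]) + \<eta> (xs[i := y])) \<and>
     (\<forall>i<n. \<forall>j<n. i \<noteq> j \<and> xs ! i = xs ! j \<longrightarrow> \<eta> xs = 0))"

lemma aalt_M: "aalt n \<eta> ==> xs \<in> dom n ==> \<eta> xs \<in> M"
  and aalt_add: "aalt n \<eta> ==> xs \<in> dom n ==> i < n ==> x \<in> L ==> y \<in> L ==>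
    \<eta> (xs[i := x + y]) = \<eta> (xs[i := x]) + \<eta> (xs[i := y])"
  and aalt_alt: "aalt n \<eta> ==> xs \<in> dom n ==> i < n ==> j < n ==> i \<noteq> j ==> xs ! i = xs ! j ==> \<eta> xs = 0"
  unfolding aalt_def by blast+

lemma aalt_cong:
  assumes "aalt n \<eta>" "\<And>xs. xs \<in> dom n ==> \<zeta> xs = \<eta> xs"
  shows "aalt n \<zeta>"
  unfolding aalt_def
  using aalt_M[OF assms(1)] aalt_add[OF assms(1)] aalt_alt[OF assms(1)] by (auto simp: assms(2) dom_update L_add)

lemma aalt_zero: "aalt n (\<lambda>xs. 0)"
  by (simp add: aalt_def M_zero)

lemma aalt_plus: "aalt n \<eta> ==> aalt n \<zeta> ==> aalt n (\<lambda>xs. \<eta> xs + \<zeta> xs)"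
  unfolding aalt_def by (auto simp: M_add)

lemma aalt_uminus: "aalt n \<eta> ==> aalt n (\<lambda>xs. - \<eta> xs)"
  unfolding aalt_def by (auto simp: M_uminus)

lemma aalt_minus: "aalt n \<eta> ==> aalt n \<zeta> ==> aalt n (\<lambda>xs. \<eta> xs - \<zeta> xs)"
  using aalt_plus[OF _ aalt_uminus] by fastforce

lemma aalt_nab: "aalt n \<eta> ==> x \<in> L ==> aalt n (\<lambda>xs. nab x (\<eta> xs))"
  unfolding aalt_def by (auto simp: nab_M nab_zero dom_update nab_add_right)

lemma aalt_iota:
  assumes "aalt (Suc n) \<eta>" "x \<in> L"
  shows "aalt n (\<lambda>ys. \<eta> (x # ys))"
  unfolding aalt_def
proof (intro ballI conjI allI impI)
  fix xs assume "xs \<in> dom n"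
  then have xs: "x # xs \<in> dom (Suc n)" using assms(2) by (simp add: dom_Cons)
  show "\<eta> (x # xs) \<in> M" by (rule aalt_M[OF assms(1) xs])
  show "\<eta> (x # xs[i := y + z]) = \<eta> (x # xs[i := y]) + \<eta> (x # xs[i := z])" if "i < n" "y \<in> L" "z \<in> L" for i y z
    using aalt_add[OF assms(1) xs, of "Suc i" y z] that by simp
  show "\<eta> (x # xs) = 0" if "i < n" "j < n" "i \<noteq> j \<and> xs ! i = xs ! j" for i j
    using aalt_alt[OF assms(1) xs, of "Suc i" "Suc j"] that by simp
qed

lemma aalt_hd_add:
  "aalt (Suc n) \<eta> ==> xs \<in> dom n ==> x \<in> L ==> y \<in> L ==> \<eta> ((x + y) # xs) = \<eta> (x # xs) + \<eta> (y # xs)"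
  using aalt_add[of "Suc n" \<eta> "x # xs" 0 x y] by (simp add: dom_Cons)

lemma aalt_hd2: "aalt (Suc (Suc n)) \<eta> ==> xs \<in> dom n ==> x \<in> L ==> \<eta> (x # x # xs) = 0"
  by (rule aalt_alt[of "Suc (Suc n)" _ _ 0 1]) (simp_all add: dom_Cons)

lemma aalt_swap:
  assumes \<eta>: "aalt (Suc (Suc n)) \<eta>" and xs: "xs \<in> dom n" and x: "x \<in> L" and y: "y \<in> L"
  shows "\<eta> (x # y # xs) = - \<eta> (y # x # xs)"
proof -
  have xy: "x + y \<in> L" using x y by (rule L_add)
  have "\<eta> ((x + y) # (x + y) # xs) = \<eta> (x # (x + y) # xs) + \<eta> (y # (x + y) # xs)"
    by (rule aalt_hd_add[OF \<eta> _ x y]) (simp add: dom_Cons xy xs)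
  also have "\<eta> (x # (x + y) # xs) = \<eta> (x # x # xs) + \<eta> (x # y # xs)"
    by (rule aalt_hd_add[OF aalt_iota[OF \<eta> x] xs x y])
  also have "\<eta> (y # (x + y) # xs) = \<eta> (y # x # xs) + \<eta> (y # y # xs)"
    by (rule aalt_hd_add[OF aalt_iota[OF \<eta> y] xs x y])
  finally show ?thesis
    using aalt_hd2[OF \<eta> xs] x y xy by (simp add: eq_neg_iff_add_eq_0)
qed

text \<open>Each entry that \<open>y\<close> passes between slot \<open>j\<close> and the front
  costs one transposition.\<close>

lemma aalt_move:
  assumes "aalt n \<eta>" "xs \<in> dom n" "y \<in> L" "j < n"
  shows "\<eta> (y # nths xs (- {j})) = sg j (\<eta> (xs[j := y]))"
  using assms
proof (induction xs arbitrary: n \<eta> j)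
  case Nil
  then show ?case by (simp add: dom_def)
next
  case (Cons x xs)
  then obtain n' where n: "n = Suc n'" by (cases n) auto
  have x: "x \<in> L" and xs: "xs \<in> dom n'" using Cons.prems n by (auto simp: dom_Cons)
  show ?case
  proof (cases j)
    case 0
    then show ?thesis by (simp add: nths_compl_Cons)
  next
    case (Suc j')
    then obtain n'' where n': "n' = Suc n''" using Cons.prems n by (cases n') auto
    have "\<eta> (y # x # nths xs (- {j'})) = - \<eta> (x # y # nths xs (- {j'}))"
      by (rule aalt_swap[OF _ _ Cons.prems(3) x, of n''])
        (use Cons.prems xs n n' Suc in \<open>simp_all add: dom_nths\<close>)
    also have "\<eta> (x # y # nths xs (- {j'})) = sg j' (\<eta> (x # xs[j' := y]))"
      by (rule Cons.IH[of n' "\<lambda>ys. \<eta> (x # ys)" j'])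
        (use Cons.prems xs n n' Suc x in \<open>simp_all add: aalt_iota\<close>)
    finally show ?thesis by (simp add: Suc nths_compl_Cons)
  qed
qed

text \<open>Alternation has to be tested on the first two entries only: an entry of the tail that
  equals the head is brought into second place by \<open>aalt_move\<close>, and two equal entries of
  the tail are covered by the contraction with the head.\<close>

lemma aalt_SucI:
  assumes i: "\<And>x. x \<in> L ==> aalt n (\<lambda>ys. \<omega> (x # ys))"
    and a: "\<And>x y xs. x \<in> L ==> y \<in> L ==> xs \<in> dom n ==> \<omega> ((x + y) # xs) = \<omega> (x # xs) + \<omega> (y # xs)"
    and z: "\<And>x zs m. n = Suc m ==> x \<in> L ==> zs \<in> dom m ==> \<omega> (x # x # zs) = 0"
  shows "aalt (Suc n) \<omega>"
  unfolding aalt_def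
proof (intro ballI conjI allI impI)
  fix xs assume xs: "xs \<in> dom (Suc n)"
  then obtain x ys where x: "xs = x # ys" "x \<in> L" "ys \<in> dom n" by (rule dom_SucE)
  show "\<omega> xs \<in> M" using aalt_M[OF i[OF x(2)] x(3)] x(1) by simp
  show "\<omega> (xs[k := y + z]) = \<omega> (xs[k := y]) + \<omega> (xs[k := z])" if "k < Suc n" "y \<in> L" "z \<in> L" for k y z
    using that x a aalt_add[OF i[OF x(2)] x(3), of "k - 1" y z] by (cases k) auto
  have key: "\<omega> (x # ys) = 0" if j: "j < n" "ys ! j = x" for j
  proof -
    obtain m where m: "n = Suc m" using j by (cases n) auto
    have "ys[j := x] = ys" using j by (simp add: list_update_same_conv domD(2)[OF x(3)])
    then have "\<omega> (x # x # nths ys (- {j})) = sg j (\<omega> (x # ys))"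
      using aalt_move[OF i[OF x(2)] x(3,2) j(1)] by simp
    moreover have "\<omega> (x # x # nths ys (- {j})) = 0"
      by (rule z[OF m x(2)]) (use x(3) j m in \<open>simp add: dom_nths\<close>)
    ultimately have "sg j (\<omega> (x # ys)) = 0" by simp
    then have "sg j (sg j (\<omega> (x # ys))) = sg j 0" by (rule arg_cong)
    then show ?thesis by simp
  qed
  show "\<omega> xs = 0" if h: "k < Suc n" "l < Suc n" "k \<noteq> l \<and> xs ! k = xs ! l" for k l
  proof (cases k)
    case 0
    then obtain l' where "l = Suc l'" using h by (cases l) auto
    then show ?thesis using key[of l'] h 0 x(1) by simp
  next
    case (Suc k')
    show ?thesis
    proof (cases l)
      case 0
      then show ?thesis using key[of k'] h Suc x(1) by simp
    next
      case (Suc l')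
      then show ?thesis
        using aalt_alt[OF i[OF x(2)] x(3), of k' l'] h \<open>k = Suc k'\<close> x(1) by simp
    qed
  qed
qed

lemma ins_cong:
  assumes "\<And>ys. ys \<in> dom n ==> \<eta> ys = \<zeta> ys" "\<And>x. x \<in> L ==> A x \<in> L" "xs \<in> dom n"
  shows "ins A \<eta> xs = ins A \<zeta> xs"
  unfolding ins_def
proof (rule sum.cong[OF refl])
  fix k assume "k \<in> {..<length xs}"
  then have k: "k < n" using domD(2)[OF assms(3)] by simp
  show "\<eta> (xs[k := A (xs ! k)]) = \<zeta> (xs[k := A (xs ! k)])"
    by (rule assms(1)[OF dom_update[OF assms(3) assms(2)[OF dom_nth[OF assms(3) k]]]])
qed

lemma ins_plus: "ins A (\<lambda>ys. \<eta> ys + \<zeta> ys) xs = ins A \<eta> xs + ins A \<zeta> xs"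
  and ins_minus: "ins A (\<lambda>ys. \<eta> ys - \<zeta> ys) xs = ins A \<eta> xs - ins A \<zeta> xs"
  by (simp_all add: ins_def sum.distrib sum_subtractf)

lemma ins_M: "aalt n \<eta> ==> (\<And>x. x \<in> L ==> A x \<in> L) ==> xs \<in> dom n ==> ins A \<eta> xs \<in> M"
  unfolding ins_def by (intro M_sum) (simp add: aalt_M dom_update dom_nth domD(2))

lemma nab_ins:
  assumes "aalt n \<eta>" "\<And>x. x \<in> L ==> A x \<in> L" "xs \<in> dom n" "x \<in> L"
  shows "nab x (ins A \<eta> xs) = ins A (\<lambda>ys. nab x (\<eta> ys)) xs"
  unfolding ins_def
  by (intro nab_sum assms(4)) (use assms in \<open>simp add: aalt_M dom_update dom_nth domD(2)\<close>)

lemma ins_op_add: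
  assumes "aalt n \<eta>" "\<And>x. x \<in> L ==> A x \<in> L" "\<And>x. x \<in> L ==> B x \<in> L" "\<And>x. x \<in> L ==> C x = A x + B x" "xs \<in> dom n"
  shows "ins C \<eta> xs = ins A \<eta> xs + ins B \<eta> xs"
  unfolding ins_def sum.distrib[symmetric]
proof (rule sum.cong[OF refl])
  fix k assume "k \<in> {..<length xs}"
  then have k: "k < n" using domD(2)[OF assms(5)] by simp
  then have x: "xs ! k \<in> L" by (rule dom_nth[OF assms(5)])
  show "\<eta> (xs[k := C (xs ! k)]) = \<eta> (xs[k := A (xs ! k)]) + \<eta> (xs[k := B (xs ! k)])"
    using aalt_add[OF assms(1,5) k assms(2)[OF x] assms(3)[OF x]] by (simp add: assms(4)[OF x])
qed

lemma aalt_ins: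
  assumes "aalt n \<eta>" "\<And>x. x \<in> L ==> A x \<in> L" "\<And>x y. x \<in> L ==> y \<in> L ==> A (x + y) = A x + A y"
  shows "aalt n (ins A \<eta>)"
  using assms(1)
proof (induction n arbitrary: \<eta>)
  case 0
  have "aalt 0 (\<lambda>xs. 0)" by (rule aalt_zero)
  then show ?case by (rule aalt_cong) (simp add: dom_0)
next
  case (Suc n)
  note A = assms(2,3)
  show ?case
  proof (rule aalt_SucI)
    show "aalt n (\<lambda>ys. ins A \<eta> (x # ys))" if "x \<in> L" for x
      unfolding ins_Cons by (intro aalt_plus aalt_iota[OF Suc.prems] A(1) that Suc.IH)
    fix x y xs assume x: "x \<in> L" and y: "y \<in> L" and xs: "xs \<in> dom n"
    have "ins A (\<lambda>ys. \<eta> ((x + y) # ys)) xs = ins A (\<lambda>ys. \<eta> (x # ys) + \<eta> (y # ys)) xs"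
      by (rule ins_cong[OF _ A(1) xs]) (simp_all add: aalt_hd_add[OF Suc.prems] x y)
    then show "ins A \<eta> ((x + y) # xs) = ins A \<eta> (x # xs) + ins A \<eta> (y # xs)"
      by (simp add: ins_Cons ins_plus A x y aalt_hd_add[OF Suc.prems xs] algebra_simps)
  next
    fix x zs m assume m: "n = Suc m" and x: "x \<in> L" and zs: "zs \<in> dom m"
    have "ins A (\<lambda>ys. \<eta> (x # x # ys)) zs = ins A (\<lambda>ys. 0) zs"
      by (rule ins_cong[OF _ A(1) zs]) (use aalt_hd2[OF _ _ x] Suc.prems m in simp_all)
    then show "ins A \<eta> (x # x # zs) = 0"
      using aalt_swap[OF Suc.prems[unfolded m] zs A(1)[OF x] x]
      by (simp add: ins_Cons) (simp add: ins_def)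
  qed
qed

text \<open>The Lie derivative along \<open>x\<close>.\<close>

definition lieop :: "'x => ('x list => 'm) => 'x list => 'm" where
  "lieop x \<eta> xs = nab x (\<eta> xs) - ins (br x) \<eta> xs"

lemma aalt_lieop: "aalt n \<eta> ==> x \<in> L ==> aalt n (lieop x \<eta>)"
  unfolding lieop_def[abs_def]
  by (intro aalt_minus aalt_nab aalt_ins) (simp_all add: br_L br_add_right)

lemma kz_asum: "kz br nab \<eta> xs = asum (\<lambda>x zs. nab x (\<eta> zs)) xs +
  (\<Sum>j<length xs. \<Sum>i<j. sg (i + j) (\<eta> (br (xs ! i) (xs ! j) # nths xs (- {i, j}))))"
  by (simp add: kz_def asum_def)

text \<open>Cartan's formula, contraction after \<open>d\<close> equals Lie derivative minus
  \<open>d\<close> after contraction. It is obtained by separating the terms in which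
  \<open>x\<close> acts or is bracketed, and it serves as the recursion for \<open>d\<close> in what
  follows.\<close>

lemma kz_Cons:
  assumes \<eta>: "aalt n \<eta>" and xs: "xs \<in> dom n" and x: "x \<in> L"
  shows "d \<eta> (x # xs) = lieop x \<eta> xs - d (\<lambda>ys. \<eta> (x # ys)) xs"
proof -
  let ?g = "\<lambda>i j. sg (i + j) (\<eta> (br ((x # xs) ! i) ((x # xs) ! j) # nths (x # xs) (- {i, j})))"
  have len: "length xs = n" by (rule domD(2)[OF xs])
  \<comment> \<open>The pairs (0, j+1) yield the insertion of \<open>br x\<close>, once the bracket
    is moved back into the slot of its second entry. The pairs (i+1, j+1) yield the differential of
    the contraction; their sign comes from swapping \<open>x\<close> with the bracket.\<close>
  have 0: "?g 0 (Suc j) = - \<eta> (xs[j := br x (xs ! j)])" if j: "j < n" for j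
  proof -
    have "\<eta> (br x (xs ! j) # nths xs (- {j})) = sg j (\<eta> (xs[j := br x (xs ! j)]))"
      by (rule aalt_move[OF \<eta> xs br_L[OF x dom_nth[OF xs j]] j])
    then show ?thesis by (simp add: nths_compl_Cons)
  qed
  have S: "?g (Suc i) (Suc j) = - sg (i + j) (\<eta> (x # br (xs ! i) (xs ! j) # nths xs (- {i, j})))" if j: "j < n" "i < j" for i j
  proof -
    obtain m where m: "n = Suc (Suc m)" using j by (cases n; cases "n - 1") auto
    have "\<eta> (br (xs ! i) (xs ! j) # x # nths xs (- {i, j})) = - \<eta> (x # br (xs ! i) (xs ! j) # nths xs (- {i, j}))"
      by (rule aalt_swap[OF \<eta>[unfolded m] _ br_L[OF dom_nth[OF xs] dom_nth[OF xs]] x])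
        (use j m xs in \<open>simp_all add: dom_nths2\<close>)
    then show ?thesis by (simp add: nths_compl_Cons)
  qed
  have "(\<Sum>j<Suc n. \<Sum>i<j. ?g i j) = (\<Sum>i<0. ?g i 0) + (\<Sum>j<n. \<Sum>i<Suc j. ?g i (Suc j))"
    by (rule sum.lessThan_Suc_shift)
  also have "\<dots> = (\<Sum>j<n. \<Sum>i<Suc j. ?g i (Suc j))"
    by (simp only: lessThan_0 sum.empty add_0_left)
  also have "\<dots> = (\<Sum>j<n. - \<eta> (xs[j := br x (xs ! j)]) - (\<Sum>i<j. sg (i + j) (\<eta> (x # br (xs ! i) (xs ! j) # nths xs (- {i, j})))))"
  proof (rule sum.cong[OF refl])
    fix j assume j: "j \<in> {..<n}"
    have "(\<Sum>i<Suc j. ?g i (Suc j)) = ?g 0 (Suc j) + (\<Sum>i<j. ?g (Suc i) (Suc j))"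
      by (rule sum.lessThan_Suc_shift)
    also have "(\<Sum>i<j. ?g (Suc i) (Suc j)) = (\<Sum>i<j. - sg (i + j) (\<eta> (x # br (xs ! i) (xs ! j) # nths xs (- {i, j}))))"
      by (rule sum.cong[OF refl], rule S) (use j in simp_all)
    also have "?g 0 (Suc j) = - \<eta> (xs[j := br x (xs ! j)])" by (rule 0) (use j in simp)
    finally show "(\<Sum>i<Suc j. ?g i (Suc j)) = - \<eta> (xs[j := br x (xs ! j)]) -
        (\<Sum>i<j. sg (i + j) (\<eta> (x # br (xs ! i) (xs ! j) # nths xs (- {i, j}))))"
      by (simp only: sum_negf add_uminus_conv_diff)
  qed
  also have "\<dots> = - ins (br x) \<eta> xs - (\<Sum>j<length xs. \<Sum>i<j. sg (i + j) (\<eta> (x # br (xs ! i) (xs ! j) # nths xs (- {i, j}))))"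
    by (simp only: sum_subtractf sum_negf ins_def len)
  finally have S: "(\<Sum>j<Suc n. \<Sum>i<j. ?g i j) = - ins (br x) \<eta> xs -
      (\<Sum>j<length xs. \<Sum>i<j. sg (i + j) (\<eta> (x # br (xs ! i) (xs ! j) # nths xs (- {i, j}))))" .
  have len': "length (x # xs) = Suc n" by (simp add: len)
  have aux: "a - b + (- c - t) = a - c - (b + t)" for a b c t :: 'm by simp
  show ?thesis
    unfolding kz_asum[of _ "x # xs"] kz_asum[of _ xs] len' S asum_Cons lieop_def by (rule aux)
qed

lemma kz_cong:
  assumes "\<And>ys. ys \<in> dom n ==> \<eta> ys = \<zeta> ys" "xs \<in> dom (Suc n)"
  shows "d \<eta> xs = d \<zeta> xs"
proof -
  note len = domD(2)[OF assms(2)]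
  have 1: "\<eta> (nths xs (- {i})) = \<zeta> (nths xs (- {i}))" if "i < length xs" for i
    using that len by (intro assms(1) dom_nths assms(2)) simp
  have 2: "\<eta> (br (xs ! i) (xs ! j) # nths xs (- {i, j})) = \<zeta> (br (xs ! i) (xs ! j) # nths xs (- {i, j}))"
    if ij: "i < j" "j < length xs" for i j
  proof (rule assms(1))
    obtain m where m: "n = Suc m" using ij len by (cases n) auto
    show "br (xs ! i) (xs ! j) # nths xs (- {i, j}) \<in> dom n"
      unfolding m dom_Cons
      by (intro conjI br_L dom_nth[OF assms(2)] dom_nths2[OF assms(2)[unfolded m]]) (use ij len m in simp_all)
  qed
  show ?thesis
    unfolding kz_def by (intro arg_cong2[where f = "(+)"] sum.cong refl) (simp_all add: 1 2)
qed

lemma kz_plus: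
  assumes "\<And>ys. ys \<in> dom n ==> \<eta> ys \<in> M" "\<And>ys. ys \<in> dom n ==> \<zeta> ys \<in> M" "xs \<in> dom (Suc n)"
  shows "d (\<lambda>ys. \<eta> ys + \<zeta> ys) xs = d \<eta> xs + d \<zeta> xs"
proof -
  note len = domD(2)[OF assms(3)]
  have "(\<Sum>i<length xs. sg i (nab (xs ! i) (\<eta> (nths xs (- {i})) + \<zeta> (nths xs (- {i}))))) =
      (\<Sum>i<length xs. sg i (nab (xs ! i) (\<eta> (nths xs (- {i})))) + sg i (nab (xs ! i) (\<zeta> (nths xs (- {i})))))"
  proof (rule sum.cong[OF refl])
    fix i assume "i \<in> {..<length xs}"
    then have i: "i < Suc n" using len by simp
    show "sg i (nab (xs ! i) (\<eta> (nths xs (- {i})) + \<zeta> (nths xs (- {i})))) =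
      sg i (nab (xs ! i) (\<eta> (nths xs (- {i})))) + sg i (nab (xs ! i) (\<zeta> (nths xs (- {i}))))"
      by (simp add: nab_add_right dom_nth[OF assms(3) i] assms(1,2) dom_nths[OF assms(3) i] sg_add)
  qed
  then show ?thesis
    unfolding kz_def by (simp add: sg_add sum.distrib algebra_simps)
qed

lemma kz_zero: "xs \<in> dom (Suc n) ==> d (\<lambda>ys. 0) xs = 0"
  by (simp add: kz_def nab_zero dom_nth domD(2))

lemma kz_uminus:
  assumes "\<And>ys. ys \<in> dom n ==> \<eta> ys \<in> M" "xs \<in> dom (Suc n)"
  shows "d (\<lambda>ys. - \<eta> ys) xs = - d \<eta> xs"
  using kz_plus[of n \<eta> "\<lambda>ys. - \<eta> ys", OF assms(1) M_uminus[OF assms(1)] assms(2)] kz_zero[OF assms(2)]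
  by (simp add: eq_neg_iff_add_eq_0 add.commute)

text \<open>Induction on the degree by Cartan's formula. For two equal leading arguments the
  contributions of the Lie derivative and of the differential of the contraction cancel, because
  \<open>br x x = 0\<close>.\<close>

lemma aalt_kz:
  assumes "aalt n \<eta>"
  shows "aalt (Suc n) (d \<eta>)"
  using assms
proof (induction n arbitrary: \<eta>)
  case 0
  show ?case
  proof (rule aalt_SucI)
    fix x assume x: "x \<in> L"
    have "aalt 0 (lieop x \<eta>)" by (rule aalt_lieop[OF 0 x])
    then show "aalt 0 (\<lambda>ys. d \<eta> (x # ys))"
      by (rule aalt_cong) (simp add: kz_Cons[OF 0 _ x] dom_0 dom_Nil)
  next
    fix x y xs assume "x \<in> L" "y \<in> L" "xs \<in> dom 0"
    then show "d \<eta> ((x + y) # xs) = d \<eta> (x # xs) + d \<eta> (y # xs)"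
      using aalt_M[OF 0 dom_Nil] by (simp add: dom_0 kz_Cons[OF 0 dom_Nil] L_add lieop_def nab_add_left)
  qed simp
next
  case (Suc n)
  note \<eta> = Suc.prems
  show ?case
  proof (rule aalt_SucI)
    fix x assume x: "x \<in> L"
    have "aalt (Suc n) (\<lambda>ys. lieop x \<eta> ys - d (\<lambda>ys. \<eta> (x # ys)) ys)"
      by (intro aalt_minus aalt_lieop \<eta> x Suc.IH aalt_iota[OF \<eta> x])
    then show "aalt (Suc n) (\<lambda>ys. d \<eta> (x # ys))"
      by (rule aalt_cong) (rule kz_Cons[OF \<eta> _ x])
  next
    fix x y xs assume x: "x \<in> L" and y: "y \<in> L" and xs: "xs \<in> dom (Suc n)"
    have "d (\<lambda>ys. \<eta> ((x + y) # ys)) xs = d (\<lambda>ys. \<eta> (x # ys) + \<eta> (y # ys)) xs"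
      by (rule kz_cong[OF _ xs]) (rule aalt_hd_add[OF \<eta> _ x y])
    also have "\<dots> = d (\<lambda>ys. \<eta> (x # ys)) xs + d (\<lambda>ys. \<eta> (y # ys)) xs"
      by (rule kz_plus[OF _ _ xs]) (rule aalt_M[OF aalt_iota[OF \<eta> x]] aalt_M[OF aalt_iota[OF \<eta> y]], assumption)+
    moreover have "ins (br (x + y)) \<eta> xs = ins (br x) \<eta> xs + ins (br y) \<eta> xs"
      by (rule ins_op_add[OF \<eta> _ _ _ xs]) (simp_all add: br_L br_add_left x y)
    moreover have "nab (x + y) (\<eta> xs) = nab x (\<eta> xs) + nab y (\<eta> xs)"
      by (rule nab_add_left[OF x y aalt_M[OF \<eta> xs]])
    ultimately show "d \<eta> ((x + y) # xs) = d \<eta> (x # xs) + d \<eta> (y # xs)"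
      by (simp add: kz_Cons[OF \<eta> xs] x y L_add lieop_def)
  next
    fix x zs m assume m: "Suc n = Suc m" and x: "x \<in> L" and "zs \<in> dom m"
    then have zs: "zs \<in> dom n" and xzs: "x # zs \<in> dom (Suc n)" by (simp_all add: dom_Cons)
    note \<eta>x = aalt_iota[OF \<eta> x]
    have "d (\<lambda>ys. \<eta> (x # x # ys)) zs = 0"
    proof (cases n)
      case 0
      then show ?thesis using zs by (simp add: dom_0)
    next
      case (Suc k)
      have "d (\<lambda>ys. \<eta> (x # x # ys)) zs = d (\<lambda>ys. 0) zs"
        by (rule kz_cong[of k]) (use aalt_hd2[OF _ _ x] \<eta> Suc zs in simp_all)
      then show ?thesis using kz_zero zs Suc by simp
    qed
    moreover have "\<eta> (br x x # zs) = 0"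
      using aalt_hd_add[OF \<eta> zs L_zero L_zero] br_self[OF x] by simp
    ultimately show "d \<eta> (x # x # zs) = 0"
      by (simp add: kz_Cons[OF \<eta> xzs x] kz_Cons[OF \<eta>x zs x] lieop_def ins_Cons)
  qed
qed

text \<open>By assumption \<open>AA'\<close> the failure of \<open>A\<close> to be a derivation of
  the bracket is the antisymmetrisation of a two-place map \<open>A'\<close>. In the application
  \<open>A x\<close> is P[x,Y] and \<open>A' x y\<close> is P[y,Q[x,Y]], where Q = 1 - P is the
  projection onto G.\<close>

lemma ins_kz:
  assumes "aalt n \<eta>" "xs \<in> dom (Suc n)"
    and A: "\<And>x. x \<in> L ==> A x \<in> L" "\<And>x y. x \<in> L ==> y \<in> L ==> A (x + y) = A x + A y"
    and A': "\<And>x y. x \<in> L ==> y \<in> L ==> A' x y \<in> L"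
    and AA': "\<And>x y. x \<in> L ==> y \<in> L ==> br x (A y) + br (A x) y - A (br x y) = A' x y - A' y x"
  shows "ins A (d \<eta>) xs - d (ins A \<eta>) xs = asum (\<lambda>x zs. nab (A x) (\<eta> zs) - ins (A' x) \<eta> zs) xs"
  using assms(1,2)
proof (induction n arbitrary: \<eta> xs)
  case 0
  then obtain x where xs: "xs = [x]" and x: "x \<in> L" by (metis dom_SucE dom_0)
  have iA: "aalt 0 (ins A \<eta>)" by (rule aalt_ins[OF 0(1)]) (simp_all add: A)
  show ?case
    by (simp add: xs ins_Cons asum_Cons kz_Cons[OF 0(1) dom_Nil] kz_Cons[OF iA dom_Nil] A x lieop_def nab_zero)
next
  case (Suc n)
  note \<eta> = Suc.prems(1)
  obtain x ys where xs: "xs = x # ys" and x: "x \<in> L" and ys: "ys \<in> dom (Suc n)"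
    using Suc.prems(2) by (rule dom_SucE)
  note \<eta>x = aalt_iota[OF \<eta> x] and \<eta>Ax = aalt_iota[OF \<eta> A(1)[OF x]]
  have iA: "aalt (Suc n) (ins A \<eta>)" by (rule aalt_ins[OF \<eta>]) (simp_all add: A)
  have 1: "ins A (d \<eta>) xs = lieop (A x) \<eta> ys - d (\<lambda>ys. \<eta> (A x # ys)) ys
      + ins A (lieop x \<eta>) ys - ins A (d (\<lambda>ys. \<eta> (x # ys))) ys"
  proof -
    have "ins A (\<lambda>zs. d \<eta> (x # zs)) ys = ins A (\<lambda>zs. lieop x \<eta> zs - d (\<lambda>ys. \<eta> (x # ys)) zs) ys"
      by (rule ins_cong[OF _ A(1) ys]) (rule kz_Cons[OF \<eta> _ x])
    then show ?thesis
      unfolding xs ins_Cons kz_Cons[OF \<eta> ys A(1)[OF x]] by (simp add: ins_minus)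
  qed
  have 2: "d (ins A \<eta>) xs = lieop x (ins A \<eta>) ys - d (\<lambda>ys. \<eta> (A x # ys)) ys - d (ins A (\<lambda>ys. \<eta> (x # ys))) ys"
  proof -
    have "d (\<lambda>zs. ins A \<eta> (x # zs)) ys = d (\<lambda>zs. \<eta> (A x # zs)) ys + d (ins A (\<lambda>ys. \<eta> (x # ys))) ys"
      unfolding ins_Cons
      by (rule kz_plus[OF _ _ ys]) (rule aalt_M[OF \<eta>Ax] ins_M[OF \<eta>x A(1)], assumption)+
    then show ?thesis
      unfolding xs kz_Cons[OF iA ys x] by simp
  qed
  have brx: "\<And>z. z \<in> L ==> br x z \<in> L" by (rule br_L[OF x])
  \<comment> \<open>The Lie derivative is an action minus an insertion. The action commutes with
    \<open>ins A\<close>, and two insertions commute up to \<open>ins_commute\<close>.\<close>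
  have 3: "ins A (lieop x \<eta>) ys - lieop x (ins A \<eta>) ys = ins (\<lambda>z. A (br x z)) \<eta> ys - ins (\<lambda>z. br x (A z)) \<eta> ys"
  proof -
    have "ins A (lieop x \<eta>) ys = ins A (\<lambda>ys. nab x (\<eta> ys)) ys - ins A (ins (br x) \<eta>) ys"
      unfolding lieop_def[abs_def] ins_minus ..
    moreover have "nab x (ins A \<eta> ys) = ins A (\<lambda>ys. nab x (\<eta> ys)) ys"
      by (rule nab_ins[OF \<eta> _ ys x]) (rule A(1))
    then have "lieop x (ins A \<eta>) ys = ins A (\<lambda>ys. nab x (\<eta> ys)) ys - ins (br x) (ins A \<eta>) ys"
      by (simp only: lieop_def)
    moreover have "P - Q = v - u" if "P = X - Y1" "Q = X - Y2" "Y1 - Y2 = u - v" for P Q X Y1 Y2 u v :: 'm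
    proof -
      have "Y1 = u - v + Y2" using that(3) by (simp add: diff_eq_eq)
      then show ?thesis using that(1,2) by simp
    qed
    ultimately show ?thesis
      using ins_commute[of A "br x" \<eta> ys] by blast
  qed
  have 4: "lieop (A x) \<eta> ys = nab (A x) (\<eta> ys) - ins (br (A x)) \<eta> ys"
    by (simp add: lieop_def)
  \<comment> \<open>This is \<open>AA'\<close> with first argument \<open>x\<close>, read as an
    identity between insertions.\<close>
  have 5: "ins (\<lambda>z. br x (A z)) \<eta> ys + ins (br (A x)) \<eta> ys + ins (\<lambda>z. A' z x) \<eta> ys
      = ins (\<lambda>z. A (br x z)) \<eta> ys + ins (A' x) \<eta> ys"
  proof -
    have e: "br x (A z) + br (A x) z + A' z x = A (br x z) + A' x z" if "z \<in> L" for z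
      using AA'[OF x that] by (simp add: algebra_simps)
    have "ins (\<lambda>z. br x (A z) + br (A x) z + A' z x) \<eta> ys =
        ins (\<lambda>z. br x (A z) + br (A x) z) \<eta> ys + ins (\<lambda>z. A' z x) \<eta> ys"
      by (rule ins_op_add[OF \<eta> _ _ _ ys]) (simp_all add: x A A' br_L L_add)
    moreover have "ins (\<lambda>z. br x (A z) + br (A x) z) \<eta> ys = ins (\<lambda>z. br x (A z)) \<eta> ys + ins (br (A x)) \<eta> ys"
      by (rule ins_op_add[OF \<eta> _ _ _ ys]) (simp_all add: x A A' br_L L_add)
    moreover have "ins (\<lambda>z. br x (A z) + br (A x) z + A' z x) \<eta> ys = ins (\<lambda>z. A (br x z)) \<eta> ys + ins (A' x) \<eta> ys"
      by (rule ins_op_add[OF \<eta> _ _ _ ys]) (simp_all add: x A A' br_L L_add e)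
    ultimately show ?thesis by simp
  qed
  \<comment> \<open>These are the terms with \<open>x\<close> as second argument of
    \<open>A'\<close>; moving the new entry back into its slot absorbs the sign of
    \<open>asum\<close>.\<close>
  have 6: "asum (\<lambda>y zs. \<eta> (A' y x # zs)) ys = ins (\<lambda>z. A' z x) \<eta> ys"
    unfolding asum_def ins_def
  proof (rule sum.cong[OF refl])
    fix k assume "k \<in> {..<length ys}"
    then have k: "k < Suc n" using domD(2)[OF ys] by simp
    show "sg k (\<eta> (A' (ys ! k) x # nths ys (- {k}))) = \<eta> (ys[k := A' (ys ! k) x])"
      using aalt_move[OF \<eta> ys A'[OF dom_nth[OF ys k] x] k] by simp
  qed
  have 7: "asum (\<lambda>x zs. nab (A x) (\<eta> zs) - ins (A' x) \<eta> zs) xs = nab (A x) (\<eta> ys) - ins (A' x) \<eta> ys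
     - asum (\<lambda>y zs. nab (A y) (\<eta> (x # zs)) - ins (A' y) (\<lambda>ys. \<eta> (x # ys)) zs) ys + ins (\<lambda>z. A' z x) \<eta> ys"
  proof -
    have "asum (\<lambda>y zs. nab (A y) (\<eta> (x # zs)) - ins (A' y) \<eta> (x # zs)) ys =
        asum (\<lambda>y zs. nab (A y) (\<eta> (x # zs)) - ins (A' y) (\<lambda>ys. \<eta> (x # ys)) zs) ys - asum (\<lambda>y zs. \<eta> (A' y x # zs)) ys"
      unfolding ins_Cons asum_def sum_subtractf[symmetric] by (simp add: sg_diff sg_add algebra_simps)
    then show ?thesis
      unfolding xs asum_Cons 6[symmetric] by simp
  qed
  have IH: "ins A (d (\<lambda>ys. \<eta> (x # ys))) ys - d (ins A (\<lambda>ys. \<eta> (x # ys))) ys =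
      asum (\<lambda>y zs. nab (A y) (\<eta> (x # zs)) - ins (A' y) (\<lambda>ys. \<eta> (x # ys)) zs) ys"
    by (rule Suc.IH[OF \<eta>x ys])
  show ?case
  proof -
    have "(n' - b - D + IL - Id) - (LI - D - dI) = n' - a' - (Id - dI) + w"
      if "IL - LI = v - u" "u + b + w = v + a'" for n' b D IL Id LI dI a' w u v :: 'm
    proof -
      have e: "IL = v - u + LI" using that(1) by (simp add: diff_eq_eq)
      have e': "w = v + a' - (u + b)" using that(2) by (simp add: eq_diff_eq add.commute)
      show ?thesis unfolding e e' by (simp add: algebra_simps)
    qed
    from this[OF 3 5] show ?thesis
      unfolding 1 2 7 IH[symmetric] 4 .
  qed
qed

end

text \<open>If an additive map \<open>b\<close> intertwines the two actions up to \<open>b'\<close>,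
  it passes through the differential up to the alternating sum of \<open>b'\<close>. It is used for
  the two data of a lift N, with \<open>b\<close> either \<theta> N, where \<open>b'\<close> is 0,
  or \<theta>[N,Y], where \<open>b'\<close> is \<theta>[N,[x,Y]].\<close>

lemma kz_pairing:
  assumes L: "set xs \<subseteq> L" "length xs = Suc n"
    and \<nu>: "\<And>ys. set ys \<subseteq> L ==> length ys = n ==> \<nu> ys \<in> M"
    and br: "\<And>x y. x \<in> L ==> y \<in> L ==> br x y \<in> L"
    and b0: "b 0 = 0" and M0: "0 \<in> M" and Madd: "\<And>m n. m \<in> M ==> n \<in> M ==> m + n \<in> M"
    and Mneg: "\<And>m. m \<in> M ==> - m \<in> M" and nM: "\<And>x m. x \<in> L ==> m \<in> M ==> nab x m \<in> M"
    and b: "\<And>m n. m \<in> M ==> n \<in> M ==> b (m + n) = b m + b n"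
    and bn: "\<And>x m. x \<in> L ==> m \<in> M ==> b (nab x m) = nab' x (b m) - b' x m"
  shows "b (kz br nab \<nu> xs) = kz br nab' (\<lambda>ys. b (\<nu> ys)) xs - asum (\<lambda>x zs. b' x (\<nu> zs)) xs"
proof -
  have Msum: "sum f I \<in> M" if "\<And>i. i \<in> I ==> f i \<in> M" for f :: "nat => _" and I
    using that by (induction I rule: infinite_finite_induct) (simp_all add: M0 Madd)
  have bneg: "b (- m) = - b m" if "m \<in> M" for m
    using b[OF that Mneg[OF that]] b0 by (simp add: eq_neg_iff_add_eq_0 add.commute)
  have bsg: "b (sg i m) = sg i (b m)" if "m \<in> M" for i m using bneg[OF that] by (simp add: sg_def)
  have Msg: "sg i m \<in> M" if "m \<in> M" for i m using Mneg[OF that] that by (simp add: sg_def)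
  have bsum: "b (sum f I) = (\<Sum>i\<in>I. b (f i))" if "\<And>i. i \<in> I ==> f i \<in> M" for f :: "nat => _" and I
    using that by (induction I rule: infinite_finite_induct) (simp_all add: b0 b Msum)
  have xL: "xs ! i \<in> L" if "i < length xs" for i using L(1) nth_mem[OF that] by blast
  have \<nu>1: "\<nu> (nths xs (- {i})) \<in> M" if "i < length xs" for i
    using that L by (intro \<nu>) (simp_all add: set_nths_in length_nths_compl)
  have \<nu>2: "\<nu> (br (xs ! i) (xs ! j) # nths xs (- {i, j})) \<in> M" if "j < length xs" "i < j" for i j
  proof (rule \<nu>)
    show "set (br (xs ! i) (xs ! j) # nths xs (- {i, j})) \<subseteq> L"
      using set_nths_in[OF L(1), of "- {i, j}"] br[OF xL xL, of i j] that by simp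
    show "length (br (xs ! i) (xs ! j) # nths xs (- {i, j})) = n"
      using length_nths_compl2[OF that(2,1)] that L(2) by simp
  qed
  let ?t = "\<lambda>j. \<Sum>i<j. sg (i + j) (\<nu> (br (xs ! i) (xs ! j) # nths xs (- {i, j})))"
  have s1: "(\<Sum>i<length xs. sg i (nab (xs ! i) (\<nu> (nths xs (- {i}))))) \<in> M"
    by (intro Msum Msg nM xL \<nu>1) simp_all
  have t: "?t j \<in> M" if "j < length xs" for j
    by (intro Msum Msg \<nu>2 that) simp
  have s2: "(\<Sum>j<length xs. ?t j) \<in> M"
    by (rule Msum, rule t) simp
  have "b (\<Sum>i<length xs. sg i (nab (xs ! i) (\<nu> (nths xs (- {i}))))) =
      (\<Sum>i<length xs. b (sg i (nab (xs ! i) (\<nu> (nths xs (- {i}))))))"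
    by (intro bsum Msg nM xL \<nu>1) simp_all
  also have "\<dots> = (\<Sum>i<length xs. sg i (nab' (xs ! i) (b (\<nu> (nths xs (- {i})))) - b' (xs ! i) (\<nu> (nths xs (- {i})))))"
    by (intro sum.cong refl) (simp add: bsg nM xL \<nu>1 bn)
  finally have "b (\<Sum>i<length xs. sg i (nab (xs ! i) (\<nu> (nths xs (- {i}))))) = \<dots>" .
  moreover have "b (\<Sum>j<length xs. ?t j) = (\<Sum>j<length xs. b (?t j))"
    by (rule bsum, rule t) simp
  moreover have "b (?t j) = (\<Sum>i<j. sg (i + j) (b (\<nu> (br (xs ! i) (xs ! j) # nths xs (- {i, j})))))" if "j < length xs" for j
  proof -
    have "b (?t j) = (\<Sum>i<j. b (sg (i + j) (\<nu> (br (xs ! i) (xs ! j) # nths xs (- {i, j})))))"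
      by (intro bsum Msg \<nu>2 that) simp
    then show ?thesis using \<nu>2[OF that] by (simp add: bsg)
  qed
  ultimately show ?thesis
    unfolding kz_def asum_def b[OF s1 s2] by (simp add: sg_diff sum_subtractf)
qed

text \<open>The Leibniz rules of a Lie-Rinehart pair, with \<open>act\<close> as the anchor.\<close>

locale bracket_module = bracket_action L M br nab
  for L :: "'x::ab_group_add set" and M :: "'m::ab_group_add set" and br nab +
  fixes S :: "'s set" and sx :: "'s => 'x => 'x" and sm :: "'s => 'm => 'm" and act :: "'x => 's => 's"
  assumes sx_L: "s \<in> S ==> x \<in> L ==> sx s x \<in> L"
    and sm_M: "s \<in> S ==> m \<in> M ==> sm s m \<in> M"
    and sm_add: "sm s (m + n) = sm s m + sm s n"
    and act_S: "x \<in> L ==> s \<in> S ==> act x s \<in> S"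
    and nab_sx: "s \<in> S ==> x \<in> L ==> m \<in> M ==> nab (sx s x) m = sm s (nab x m)"
    and nab_sm: "s \<in> S ==> x \<in> L ==> m \<in> M ==> nab x (sm s m) = sm s (nab x m) + sm (act x s) m"
    and sx_uminus: "s \<in> S ==> x \<in> L ==> sx s (- x) = - sx s x"
    and br_sx: "s \<in> S ==> x \<in> L ==> y \<in> L ==> br x (sx s y) = sx s (br x y) + sx (act x s) y"
begin

lemma aalt_uminus_arg:
  assumes "aalt n \<eta>" "xs \<in> dom n" "i < n" "x \<in> L"
  shows "\<eta> (xs[i := - x]) = - \<eta> (xs[i := x])"
proof -
  have "\<eta> (xs[i := 0 + 0]) = \<eta> (xs[i := 0]) + \<eta> (xs[i := 0])"
    by (rule aalt_add[OF assms(1-3) L_zero L_zero])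
  then have "\<eta> (xs[i := 0]) = 0" by simp
  moreover have "\<eta> (xs[i := - x + x]) = \<eta> (xs[i := - x]) + \<eta> (xs[i := x])"
    by (rule aalt_add[OF assms(1-3) L_uminus assms(4)]) (rule assms(4))
  ultimately show ?thesis by (simp add: eq_neg_iff_add_eq_0)
qed

lemma sm_zero: "sm s 0 = 0"
  using sm_add[of s 0 0] by simp

lemma sm_uminus: "sm s (- m) = - sm s m"
  using sm_add[of s m "- m"] by (simp add: sm_zero eq_neg_iff_add_eq_0 add.commute)

lemma sm_diff: "sm s (m - n) = sm s m - sm s n"
  using sm_add[of s m "- n"] by (simp add: sm_uminus)

lemma sm_sum: "sm s (sum f I) = (\<Sum>i\<in>I. sm s (f i))"
  by (induction I rule: infinite_finite_induct) (simp_all add: sm_zero sm_add)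

lemma sm_sg: "sm s (sg i m) = sg i (sm s m)"
  by (simp add: sg_def sm_uminus)

definition hom :: "nat => ('x list => 'm) => bool" where
  "hom n \<eta> \<longleftrightarrow> (\<forall>xs\<in>dom n. \<forall>i<n. \<forall>s\<in>S. \<forall>x\<in>L. \<eta> (xs[i := sx s x]) = sm s (\<eta> (xs[i := x])))"

lemma homD: "hom n \<eta> ==> xs \<in> dom n ==> i < n ==> s \<in> S ==> x \<in> L ==> \<eta> (xs[i := sx s x]) = sm s (\<eta> (xs[i := x]))"
  unfolding hom_def by blast

lemma hom_hd: "hom (Suc n) \<eta> ==> xs \<in> dom n ==> s \<in> S ==> x \<in> L ==> \<eta> (sx s x # xs) = sm s (\<eta> (x # xs))"
  using homD[of "Suc n" \<eta> "x # xs" 0 s x] by (simp add: dom_Cons)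

lemma hom_iota: "hom (Suc n) \<eta> ==> y \<in> L ==> hom n (\<lambda>ys. \<eta> (y # ys))"
  unfolding hom_def[of n]
proof (intro ballI allI impI)
  fix xs i s x assume "hom (Suc n) \<eta>" "y \<in> L" "xs \<in> dom n" "i < n" "s \<in> S" "x \<in> L"
  then show "\<eta> (y # xs[i := sx s x]) = sm s (\<eta> (y # xs[i := x]))"
    using homD[of "Suc n" \<eta> "y # xs" "Suc i" s x] by (simp add: dom_Cons)
qed

lemma hom_SucI:
  assumes "\<And>y. y \<in> L ==> hom n (\<lambda>ys. \<omega> (y # ys))"
    and "\<And>s x xs. s \<in> S ==> x \<in> L ==> xs \<in> dom n ==> \<omega> (sx s x # xs) = sm s (\<omega> (x # xs))"
  shows "hom (Suc n) \<omega>"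
  unfolding hom_def
proof (intro ballI allI impI)
  fix xs i s x assume xs: "xs \<in> dom (Suc n)" and i: "i < Suc n" and s: "s \<in> S" and x: "x \<in> L"
  obtain y ys where y: "xs = y # ys" "y \<in> L" "ys \<in> dom n" using xs by (rule dom_SucE)
  show "\<omega> (xs[i := sx s x]) = sm s (\<omega> (xs[i := x]))"
    using i y assms(2)[OF s x y(3)] homD[OF assms(1)[OF y(2)] y(3) _ s x] by (cases i) simp_all
qed

lemma hom_0: "hom 0 \<eta>"
  by (simp add: hom_def)

lemma hom_cong: "hom n \<eta> ==> (\<And>xs. xs \<in> dom n ==> \<zeta> xs = \<eta> xs) ==> hom n \<zeta>"
  unfolding hom_def by (simp add: dom_update sx_L)

lemma hom_minus: "hom n \<eta> ==> hom n \<zeta> ==> hom n (\<lambda>xs. \<eta> xs - \<zeta> xs)"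
  unfolding hom_def by (simp add: sm_diff)

text \<open>Only the substitution in slot \<open>i\<close> meets the scalar, so the derivative term
  occurs once. For the bracket with y the scalar \<open>t\<close> is y(s); for the operator
  \<open>AY Y\<close> it is -Y(s).\<close>

lemma ins_hom:
  assumes \<eta>: "aalt n \<eta>" "hom n \<eta>" and xs: "xs \<in> dom n" and i: "i < n" and s: "s \<in> S" "t \<in> S" and x: "x \<in> L"
    and A: "\<And>x. x \<in> L ==> A x \<in> L" and Ax: "A (sx s x) = sx s (A x) + sx t x"
  shows "ins A \<eta> (xs[i := sx s x]) = sm s (ins A \<eta> (xs[i := x])) + sm t (\<eta> (xs[i := x]))"
proof -
  have len: "length xs = n" by (rule domD(2)[OF xs])
  have "ins A \<eta> (xs[i := sx s x]) = (\<Sum>k<n. sm s (\<eta> (xs[i := x, k := A (xs[i := x] ! k)])) + (if k = i then sm t (\<eta> (xs[i := x])) else 0))"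
    unfolding ins_def length_list_update len
  proof (rule sum.cong[OF refl])
    fix k assume "k \<in> {..<n}"
    then have k: "k < n" by simp
    show "\<eta> (xs[i := sx s x, k := A (xs[i := sx s x] ! k)]) =
      sm s (\<eta> (xs[i := x, k := A (xs[i := x] ! k)])) + (if k = i then sm t (\<eta> (xs[i := x])) else 0)"
    proof (cases "k = i")
      case True
      have "\<eta> (xs[i := sx s (A x) + sx t x]) = \<eta> (xs[i := sx s (A x)]) + \<eta> (xs[i := sx t x])"
        by (rule aalt_add[OF \<eta>(1) xs i]) (intro sx_L s A x)+
      then show ?thesis
        using True i len by (simp add: Ax homD[OF \<eta>(2) xs i] s A x)
    next
      case False
      have "\<eta> (xs[k := A (xs ! k), i := sx s x]) = sm s (\<eta> (xs[k := A (xs ! k), i := x]))"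
        by (rule homD[OF \<eta>(2) dom_update[OF xs A[OF dom_nth[OF xs k]]] i s(1) x])
      then show ?thesis
        using False by (simp add: list_update_swap[of i k])
    qed
  qed
  also have "\<dots> = sm s (ins A \<eta> (xs[i := x])) + sm t (\<eta> (xs[i := x]))"
    using i by (simp add: ins_def len sum.distrib sm_sum)
  finally show ?thesis .
qed

lemma kz_sm:
  assumes \<eta>: "\<And>ys. ys \<in> dom n ==> \<eta> ys \<in> M" and xs: "xs \<in> dom (Suc n)" and s: "s \<in> S"
  shows "d (\<lambda>ys. sm s (\<eta> ys)) xs = sm s (d \<eta> xs) + asum (\<lambda>x zs. sm (act x s) (\<eta> zs)) xs"
proof -
  have "asum (\<lambda>x zs. nab x (sm s (\<eta> zs))) xs = sm s (asum (\<lambda>x zs. nab x (\<eta> zs)) xs) + asum (\<lambda>x zs. sm (act x s) (\<eta> zs)) xs"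
    unfolding asum_def sm_sum sum.distrib[symmetric]
  proof (rule sum.cong[OF refl])
    fix i assume "i \<in> {..<length xs}"
    then have i: "i < Suc n" using domD(2)[OF xs] by simp
    show "sg i (nab (xs ! i) (sm s (\<eta> (nths xs (- {i}))))) =
        sm s (sg i (nab (xs ! i) (\<eta> (nths xs (- {i}))))) + sg i (sm (act (xs ! i) s) (\<eta> (nths xs (- {i}))))"
      by (simp add: nab_sm[OF s dom_nth[OF xs i] \<eta>[OF dom_nths[OF xs i]]] sm_sg sg_add)
  qed
  moreover have "sm s (\<Sum>j<length xs. \<Sum>i<j. sg (i + j) (\<eta> (br (xs ! i) (xs ! j) # nths xs (- {i, j})))) =
     (\<Sum>j<length xs. \<Sum>i<j. sg (i + j) (sm s (\<eta> (br (xs ! i) (xs ! j) # nths xs (- {i, j})))))"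
    by (simp add: sm_sum sm_sg)
  ultimately show ?thesis
    unfolding kz_asum by (simp add: sm_add algebra_simps)
qed

lemma br_sx_left:
  assumes "s \<in> S" "x \<in> L" "y \<in> L"
  shows "br (sx s x) y = - sx s (br y x) - sx (act y s) x"
  using br_antisym[OF sx_L[OF assms(1,2)] assms(3)] br_sx[OF assms(1,3,2)] by simp

text \<open>Induction by Cartan's formula. In the Lie derivative the derivatives of \<open>s\<close>
  from the action and from the bracket cancel; in the first slot those from the differential of the
  contraction and from the bracket with \<open>sx s x\<close> do.\<close>

lemma hom_kz:
  assumes "aalt n \<eta>" "hom n \<eta>"
  shows "hom (Suc n) (d \<eta>)"
  using assms
proof (induction n arbitrary: \<eta>)
  case 0
  show ?case
  proof (rule hom_SucI[OF hom_0])
    fix s x xs assume "s \<in> S" "x \<in> L" "xs \<in> dom 0"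
    then show "d \<eta> (sx s x # xs) = sm s (d \<eta> (x # xs))"
      using aalt_M[OF 0(1) dom_Nil] by (simp add: dom_0 kz_Cons[OF 0(1) dom_Nil] sx_L lieop_def nab_sx)
  qed
next
  case (Suc n)
  note \<eta> = Suc.prems
  show ?case
  proof (rule hom_SucI)
    fix y assume y: "y \<in> L"
    have "hom (Suc n) (lieop y \<eta>)"
      unfolding hom_def
    proof (intro ballI allI impI)
      fix xs i s x assume xs: "xs \<in> dom (Suc n)" and i: "i < Suc n" and s: "s \<in> S" and x: "x \<in> L"
      have "ins (br y) \<eta> (xs[i := sx s x]) = sm s (ins (br y) \<eta> (xs[i := x])) + sm (act y s) (\<eta> (xs[i := x]))"
        by (rule ins_hom[OF \<eta> xs i s act_S[OF y s] x]) (simp_all add: br_L y br_sx s x)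
      moreover have "nab y (\<eta> (xs[i := sx s x])) = sm s (nab y (\<eta> (xs[i := x]))) + sm (act y s) (\<eta> (xs[i := x]))"
        unfolding homD[OF \<eta>(2) xs i s x]
        by (rule nab_sm[OF s y aalt_M[OF \<eta>(1) dom_update[OF xs x]]])
      ultimately show "lieop y \<eta> (xs[i := sx s x]) = sm s (lieop y \<eta> (xs[i := x]))"
        by (simp add: lieop_def sm_diff)
    qed
    then have "hom (Suc n) (\<lambda>ys. lieop y \<eta> ys - d (\<lambda>ys. \<eta> (y # ys)) ys)"
      by (intro hom_minus Suc.IH aalt_iota[OF \<eta>(1) y] hom_iota[OF \<eta>(2) y])
    then show "hom (Suc n) (\<lambda>ys. d \<eta> (y # ys))"
      by (rule hom_cong) (rule kz_Cons[OF \<eta>(1) _ y])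
  next
    fix s x xs assume s: "s \<in> S" and x: "x \<in> L" and xs: "xs \<in> dom (Suc n)"
    note len = domD(2)[OF xs]
    have "d (\<lambda>ys. \<eta> (sx s x # ys)) xs = d (\<lambda>ys. sm s (\<eta> (x # ys))) xs"
      by (rule kz_cong[OF _ xs]) (rule hom_hd[OF \<eta>(2) _ s x])
    also have "\<dots> = sm s (d (\<lambda>ys. \<eta> (x # ys)) xs) + asum (\<lambda>y zs. sm (act y s) (\<eta> (x # zs))) xs"
      by (rule kz_sm[OF _ xs s]) (rule aalt_M[OF aalt_iota[OF \<eta>(1) x]])
    finally have 1: "d (\<lambda>ys. \<eta> (sx s x # ys)) xs = \<dots>" .
    have 2: "ins (br (sx s x)) \<eta> xs = sm s (ins (br x) \<eta> xs) - asum (\<lambda>y zs. sm (act y s) (\<eta> (x # zs))) xs"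
      unfolding ins_def asum_def sm_sum sum_subtractf[symmetric]
    proof (rule sum.cong[OF refl])
      fix k assume "k \<in> {..<length xs}"
      then have k: "k < Suc n" using len by simp
      note z = dom_nth[OF xs k]
      have "br (sx s x) (xs ! k) = sx s (br x (xs ! k)) + - sx (act (xs ! k) s) x"
      proof -
        have e: "br (xs ! k) x = - br x (xs ! k)" by (rule br_antisym[OF z x])
        have "br (sx s x) (xs ! k) = - sx s (- br x (xs ! k)) - sx (act (xs ! k) s) x"
          unfolding br_sx_left[OF s x z] e ..
        moreover have "sx s (- br x (xs ! k)) = - sx s (br x (xs ! k))" by (rule sx_uminus[OF s br_L[OF x z]])
        ultimately show ?thesis by simp
      qed
      moreover have "\<eta> (xs[k := sx s (br x (xs ! k)) + - sx (act (xs ! k) s) x]) =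
          \<eta> (xs[k := sx s (br x (xs ! k))]) + \<eta> (xs[k := - sx (act (xs ! k) s) x])"
        by (rule aalt_add[OF \<eta>(1) xs k]) (intro sx_L L_uminus s br_L x z act_S)+
      moreover have "\<eta> (xs[k := - sx (act (xs ! k) s) x]) = - \<eta> (xs[k := sx (act (xs ! k) s) x])"
        by (rule aalt_uminus_arg[OF \<eta>(1) xs k]) (intro sx_L act_S z s x)
      moreover have "sg k (\<eta> (x # nths xs (- {k}))) = \<eta> (xs[k := x])"
        using aalt_move[OF \<eta>(1) xs x k] by simp
      ultimately show "\<eta> (xs[k := br (sx s x) (xs ! k)]) =
          sm s (\<eta> (xs[k := br x (xs ! k)])) - sg k (sm (act (xs ! k) s) (\<eta> (x # nths xs (- {k}))))"
        by (simp add: homD[OF \<eta>(2) xs k] s act_S z x br_L sm_sg[symmetric])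
    qed
    show "d \<eta> (sx s x # xs) = sm s (d \<eta> (x # xs))"
      unfolding kz_Cons[OF \<eta>(1) xs sx_L[OF s x]] kz_Cons[OF \<eta>(1) xs x] lieop_def 1 2
      by (simp add: nab_sx s x aalt_M[OF \<eta>(1) xs] sm_diff)
  qed
qed

end

section \<open>Smooth manifolds\<close>

lemma frechet_derivative_local:
  assumes "open S" "x \<in> S" "\<And>y. y \<in> S ==> f y = g y"
  shows "frechet_derivative f (at x) = frechet_derivative g (at x)"
    and "f differentiable (at x) \<longleftrightarrow> g differentiable (at x)"
proof -
  have *: "(f has_derivative f') (at x) \<longleftrightarrow> (g has_derivative f') (at x)" for f'
    using assms by (metis has_derivative_transform_within_open)
  show "frechet_derivative f (at x) = frechet_derivative g (at x)"
    by (simp add: frechet_derivative_def *)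
  show "f differentiable (at x) \<longleftrightarrow> g differentiable (at x)"
    by (simp add: differentiable_def *)
qed

lemma Ck_on_subset: "Ck_on k S f ==> T \<subseteq> S ==> Ck_on k T f"
  by (induction k arbitrary: f) (auto intro: continuous_on_subset)

lemma Ck_on_cong:
  assumes "open S" "Ck_on k S f" "\<And>x. x \<in> S ==> f x = g x"
  shows "Ck_on k S g"
  using assms(2,3)
proof (induction k arbitrary: f g)
  case 0
  then show ?case by (simp cong: continuous_on_cong)
next
  case (Suc k)
  have *: "frechet_derivative f (at x) = frechet_derivative g (at x)"
    "f differentiable (at x) \<longleftrightarrow> g differentiable (at x)" if "x \<in> S" for x
    using frechet_derivative_local[OF assms(1) that Suc.prems(2)] by simp_all
  have "Ck_on k S (\<lambda>x. frechet_derivative g (at x) v)" for v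
    by (rule Suc.IH[of "\<lambda>x. frechet_derivative f (at x) v"]) (use Suc.prems * in simp_all)
  then show ?case
    using Suc.prems(1) * by simp
qed

lemma Ck_on_SucD: "Ck_on (Suc k) S f ==> Ck_on k S f"
proof (induction k arbitrary: f)
  case 0
  then show ?case
    by (auto intro!: continuous_at_imp_continuous_on differentiable_imp_continuous_within)
qed simp

lemma Ck_on_has_derivative:
  "Ck_on (Suc k) S f ==> x \<in> S ==> (f has_derivative frechet_derivative f (at x)) (at x)"
  by (simp add: frechet_derivative_works)

text \<open>The derivative may be given by any formula, so the closure properties below follow from
  the usual differentiation rules.\<close>

lemma Ck_on_SucI:
  assumes "open S" "\<And>x. x \<in> S ==> (f has_derivative f' x) (at x)" "\<And>v. Ck_on k S (\<lambda>x. f' x v)"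
  shows "Ck_on (Suc k) S f"
proof -
  have "f' x v = frechet_derivative f (at x) v" if "x \<in> S" for x v
    using frechet_derivative_at[OF assms(2)[OF that]] by simp
  then have "Ck_on k S (\<lambda>x. frechet_derivative f (at x) v)" for v
    by (intro Ck_on_cong[OF assms(1) assms(3)[of v]])
  then show ?thesis
    using assms(2) by (auto simp: differentiable_def)
qed

lemma Ck_on_const: "Ck_on k S (\<lambda>x. c)"
  by (induction k arbitrary: c) auto

lemma Ck_on_add:
  assumes "open S" "Ck_on k S f" "Ck_on k S g"
  shows "Ck_on k S (\<lambda>x. f x + g x)"
  using assms(2,3)
proof (induction k arbitrary: f g)
  case 0
  then show ?case by (auto intro: continuous_intros)
next
  case (Suc k)
  note D = Suc.prems[THEN Ck_on_has_derivative]
  show ?case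
    by (rule Ck_on_SucI[OF assms(1) has_derivative_add[OF D]], assumption, assumption, rule Suc.IH)
      (use Suc.prems in simp_all)
qed

lemma Ck_on_mult:
  fixes f g :: "'b::euclidean_space => real"
  assumes "open S" "Ck_on k S f" "Ck_on k S g"
  shows "Ck_on k S (\<lambda>x. f x * g x)"
  using assms(2,3)
proof (induction k arbitrary: f g)
  case 0
  then show ?case by (auto intro: continuous_intros)
next
  case (Suc k)
  note D = Suc.prems[THEN Ck_on_has_derivative]
  have "Ck_on k S f" "Ck_on k S g"
    using Suc.prems Ck_on_SucD by blast+
  then show ?case
    by (intro Ck_on_SucI[OF assms(1) has_derivative_mult[OF D]] Ck_on_add[OF assms(1)] Suc.IH)
      (use Suc.prems in auto)
qed

lemma Ck_on_sum:
  assumes "open S" "\<And>i. i \<in> I ==> Ck_on k S (f i)"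
  shows "Ck_on k S (\<lambda>x. \<Sum>i\<in>I. f i x)"
  using assms(2) by (induction I rule: infinite_finite_induct) (auto intro: Ck_on_const Ck_on_add[OF assms(1)])

lemma Ck_on_bounded_linear:
  assumes "open S" "bounded_linear L" "Ck_on k S f"
  shows "Ck_on k S (\<lambda>x. L (f x))"
  using assms(3)
proof (induction k arbitrary: f)
  case 0
  then show ?case by (simp add: bounded_linear.continuous_on[OF assms(2)])
next
  case (Suc k)
  note D = Suc.prems[THEN Ck_on_has_derivative]
  show ?case
    by (rule Ck_on_SucI[OF assms(1) bounded_linear.has_derivative[OF assms(2) D]], assumption, rule Suc.IH)
      (use Suc.prems in simp)
qed

lemma Ck_on_linear:
  assumes "bounded_linear L"
  shows "open S ==> Ck_on k S L"
  using assms
  by (cases k)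
    (simp_all only: Ck_on.simps(1) linear_continuous_on,
      intro Ck_on_SucI[OF _ bounded_linear_imp_has_derivative] Ck_on_const)

lemma linear_eq_sum_Basis:
  fixes h :: "'b::euclidean_space => real"
  assumes "linear h"
  shows "h w = (\<Sum>b\<in>Basis. (w \<bullet> b) * h b)"
proof -
  have "h w = h (\<Sum>b\<in>Basis. (w \<bullet> b) *\<^sub>R b)"
    by (simp only: euclidean_representation)
  also have "\<dots> = (\<Sum>b\<in>Basis. (w \<bullet> b) * h b)"
    by (simp only: linear_sum[OF assms] linear_scale[OF assms] real_scaleR_def)
  finally show ?thesis .
qed

text \<open>The chain rule is expanded in the standard basis. Then the induction meets only products
  and sums of real functions, and the induction hypothesis applies to each partial derivative of
  \<open>f\<close>.\<close>

lemma Ck_on_compose: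
  fixes f :: "'b::euclidean_space => real" and g :: "'c::euclidean_space => 'b"
  assumes S: "open S" "open T" "g ` S \<subseteq> T" and "Ck_on k S g" "Ck_on k T f"
  shows "Ck_on k S (\<lambda>x. f (g x))"
  using assms(4,5)
proof (induction k arbitrary: f)
  case 0
  then show ?case
    using S continuous_on_compose2[of T f S g] by auto
next
  case (Suc k)
  let ?Df = "\<lambda>y. frechet_derivative f (at y)" and ?Dg = "\<lambda>x. frechet_derivative g (at x)"
  have D: "((\<lambda>x. f (g x)) has_derivative (\<lambda>v. \<Sum>b\<in>Basis. (?Dg x v \<bullet> b) * ?Df (g x) b)) (at x)"
    if x: "x \<in> S" for x
  proof -
    have gx: "g x \<in> T" using S(3) x by blast
    have f: "(f has_derivative ?Df (g x)) (at (g x))"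
      by (rule Ck_on_has_derivative[OF Suc.prems(2) gx])
    show ?thesis
      unfolding linear_eq_sum_Basis[OF has_derivative_linear[OF f], symmetric]
      by (rule has_derivative_compose[OF Ck_on_has_derivative[OF Suc.prems(1) x] f])
  qed
  have 1: "Ck_on k S (\<lambda>x. ?Df (g x) b)" for b
    by (rule Suc.IH[OF Ck_on_SucD[OF Suc.prems(1)], of "\<lambda>y. ?Df y b"])
      (use Suc.prems(2) in simp)
  have 2: "Ck_on k S (\<lambda>x. ?Dg x v \<bullet> b)" for v b
    by (rule Ck_on_bounded_linear[OF S(1) bounded_linear_inner_left]) (use Suc.prems(1) in simp)
  show ?case
    by (rule Ck_on_SucI[OF S(1) D], assumption)
      (intro Ck_on_sum[OF S(1)] Ck_on_mult[OF S(1)] 1 2)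
qed

lemma Ck_on_inverse:
  fixes f :: "'b::euclidean_space => real"
  assumes "open S" "Ck_on k S f" "\<And>x. x \<in> S ==> f x \<noteq> 0"
  shows "Ck_on k S (\<lambda>x. inverse (f x))"
  using assms(2)
proof (induction k)
  case 0
  then show ?case using assms(3) by (auto intro: continuous_intros)
next
  case (Suc k)
  have "Ck_on k S (\<lambda>x. - (inverse (f x) * frechet_derivative f (at x) v * inverse (f x)))" for v
    using Suc Ck_on_SucD
    by (intro Ck_on_bounded_linear[OF assms(1) bounded_linear_minus[OF bounded_linear_ident]] Ck_on_mult[OF assms(1)]) auto
  then show ?case
    using Suc.prems assms(3)
    by (intro Ck_on_SucI[OF assms(1) Deriv.has_derivative_inverse]) (auto intro: Ck_on_has_derivative)
qed

lemma Ck_on_UnI: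
  assumes "\<And>x. x \<in> S ==> \<exists>T. open T \<and> x \<in> T \<and> Ck_on k T f" 
  shows "Ck_on k S f"
  using assms
proof (induction k arbitrary: f)
  case 0
  then show ?case
    by (metis Ck_on.simps(1) continuous_at_imp_continuous_on continuous_on_eq_continuous_at)
next
  case (Suc k)
  show ?case
    unfolding Ck_on.simps
  proof (intro conjI ballI allI)
    show "f differentiable (at x)" if "x \<in> S" for x
      using Suc.prems[OF that] by auto
    show "Ck_on k S (\<lambda>x. frechet_derivative f (at x) v)" for v
      by (rule Suc.IH) (metis Suc.prems Ck_on.simps(2))
  qed
qed

section \<open>A smooth step and bump functions\<close>

definition flat_exp :: "nat => real => real" where
  "flat_exp m t = (if t > 0 then inverse t ^ m * exp (- inverse t) else 0)"

text \<open>The powers of 1/t in \<open>flat_exp\<close> make the family closed under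
  differentiation, so that its smoothness is one induction for all \<open>m\<close>.\<close>

lemma flat_exp_derivative:
  "(flat_exp m has_real_derivative (flat_exp (m + 2) t - m * flat_exp (m + 1) t)) (at t)"
proof -
  consider "t > 0" | "t < 0" | "t = 0" by linarith
  then show ?thesis
  proof cases
    case 1
    have "((\<lambda>t. inverse t ^ m * exp (- inverse t)) has_real_derivative
        (flat_exp (m + 2) t - m * flat_exp (m + 1) t)) (at t)"
      using 1 by (auto intro!: derivative_eq_intros simp: flat_exp_def power2_eq_square field_simps)
        (cases m; simp add: field_simps)
    then show ?thesis
      by (rule has_field_derivative_transform_within_open[of _ _ _ "{0<..}"]) (use 1 in \<open>auto simp: flat_exp_def\<close>)
  next
    case 2
    have "((\<lambda>t. 0) has_real_derivative 0) (at t)" by simp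
    then have "(flat_exp m has_real_derivative 0) (at t)"
      by (rule has_field_derivative_transform_within_open[of _ _ _ "{..<0}"]) (use 2 in \<open>auto simp: flat_exp_def\<close>)
    then show ?thesis using 2 by (simp add: flat_exp_def)
  next
    case 3
    \<comment> \<open>With x = 1/h this is the difference quotient at 0 from the right.\<close>
    have "((\<lambda>x. x ^ Suc m / exp x) \<longlongrightarrow> (0::real)) at_top"
      by (rule tendsto_power_div_exp_0)
    then have "((\<lambda>x. inverse x ^ Suc m / exp (inverse x)) \<longlongrightarrow> (0::real)) (at_right 0)"
      by (rule filterlim_compose[OF _ filterlim_inverse_at_top_right])
    then have "((\<lambda>h. flat_exp m h / h) \<longlongrightarrow> (0::real)) (at_right 0)"
      by (rule Lim_transform_eventually)
        (auto simp: flat_exp_def eventually_at_right_field exp_minus field_simps intro!: exI[of _ 1])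
    moreover have "((\<lambda>h. flat_exp m h / h) \<longlongrightarrow> (0::real)) (at_left 0)"
      by (rule Lim_transform_eventually[of "\<lambda>_. 0"])
        (auto simp: flat_exp_def eventually_at_left_field intro!: exI[of _ "-1"])
    ultimately have "((\<lambda>h. flat_exp m h / h) \<longlongrightarrow> (0::real)) (at 0)"
      by (simp add: filterlim_split_at)
    then show ?thesis
      using 3 by (simp add: has_field_derivative_iff flat_exp_def)
  qed
qed

lemma Ck_on_flat_exp: "Ck_on k UNIV (flat_exp m)"
proof (induction k arbitrary: m)
  case 0
  show ?case
    using flat_exp_derivative by (auto intro!: DERIV_isCont continuous_at_imp_continuous_on)
next
  case (Suc k)
  have "Ck_on k UNIV (\<lambda>t. (flat_exp (m + 2) t + (- real m) * flat_exp (m + 1) t) * v)" for v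
    by (intro Ck_on_mult Ck_on_add Ck_on_const Suc) auto
  then show ?case
    using flat_exp_derivative[of m, unfolded has_field_derivative_def]
    by (intro Ck_on_SucI[where f' = "\<lambda>t v. (flat_exp (m + 2) t - m * flat_exp (m + 1) t) * v"]) simp_all
qed

definition smooth_step :: "real => real" where
  "smooth_step t = flat_exp 0 t * inverse (flat_exp 0 t + flat_exp 0 (1 - t))"

lemma smooth_step_le0: "t \<le> 0 ==> smooth_step t = 0"
  and smooth_step_ge1: "t \<ge> 1 ==> smooth_step t = 1"
  by (auto simp: smooth_step_def flat_exp_def)

lemma Ck_on_smooth_step: "Ck_on k UNIV smooth_step"
proof -
  have "flat_exp 0 t + flat_exp 0 (1 - t) > 0" for t
    by (auto simp: flat_exp_def intro: add_pos_pos)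
  then have nz: "flat_exp 0 t + flat_exp 0 (1 - t) \<noteq> 0" for t
    by (simp add: less_imp_neq[symmetric])
  have "Ck_on k UNIV (\<lambda>t::real. 1 + (- t))"
    by (intro Ck_on_add Ck_on_const Ck_on_linear bounded_linear_minus bounded_linear_ident open_UNIV)
  then have "Ck_on k UNIV (\<lambda>t::real. 1 - t)"
    by simp
  from Ck_on_compose[OF open_UNIV open_UNIV subset_UNIV this Ck_on_flat_exp]
  show ?thesis
    unfolding smooth_step_def[abs_def]
    by (intro Ck_on_mult Ck_on_inverse Ck_on_add Ck_on_flat_exp open_UNIV nz)
qed

lemma Ck_on_bump_exists:
  fixes c :: "'b::euclidean_space"
  assumes "r > 0"
  obtains B :: "'b => real" where "\<And>k. Ck_on k UNIV B" "\<And>x. dist c x \<le> r ==> B x = 1"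
    "\<And>x. dist c x \<ge> 2 * r ==> B x = 0"
proof
  \<comment> \<open>The value is at least 1 within distance \<open>r\<close> and at most 0 beyond
    \<open>2 * r\<close>. The squared distance makes it a polynomial, hence smooth also at
    \<open>c\<close>.\<close>
  let ?q = "\<lambda>x. (4 * r\<^sup>2 - (x - c) \<bullet> (x - c)) / (3 * r\<^sup>2)"
  let ?B = "\<lambda>x. smooth_step (?q x)"
  have d: "(x - c) \<bullet> (x - c) = (dist c x)\<^sup>2" for x
    by (subst dist_commute) (simp add: dist_norm power2_norm_eq_inner)
  show "?B x = 1" if "dist c x \<le> r" for x
  proof (rule smooth_step_ge1)
    have "(dist c x)\<^sup>2 \<le> r\<^sup>2"
      using that by (rule power_mono) simp
    then show "1 \<le> ?q x"
      unfolding d using assms by (subst pos_le_divide_eq) auto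
  qed
  show "?B x = 0" if "dist c x \<ge> 2 * r" for x
  proof (rule smooth_step_le0)
    have "(2 * r)\<^sup>2 \<le> (dist c x)\<^sup>2"
      using that by (rule power_mono) (use assms in simp)
    then show "?q x \<le> 0"
      unfolding d using assms by (intro divide_nonpos_pos) (simp_all add: power_mult_distrib)
  qed
  fix k
  have l: "Ck_on k UNIV (\<lambda>x. (x - c) \<bullet> b)" for b
  proof -
    have "Ck_on k UNIV (\<lambda>x. x \<bullet> b + (- (c \<bullet> b)))"
      by (intro Ck_on_add Ck_on_const Ck_on_linear bounded_linear_inner_left open_UNIV)
    then show ?thesis by (simp only: inner_diff_left add_uminus_conv_diff)
  qed
  have "Ck_on k UNIV (\<lambda>x. (4 * r\<^sup>2 + (-1) * (\<Sum>b\<in>Basis. ((x - c) \<bullet> b) * ((x - c) \<bullet> b))) * inverse (3 * r\<^sup>2))"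
    by (intro Ck_on_mult Ck_on_add Ck_on_const Ck_on_sum l open_UNIV)
  then have q: "Ck_on k UNIV ?q"
    by (simp only: euclidean_inner[symmetric] divide_inverse mult_minus_left mult_1_left add_uminus_conv_diff)
  show "Ck_on k UNIV ?B"
    by (rule Ck_on_compose[OF open_UNIV open_UNIV subset_UNIV q Ck_on_smooth_step])
qed

section \<open>Hadamard's lemma\<close>

lemma Ck_on_continuous: "Ck_on k S f ==> continuous_on S f"
  by (induction k) (use Ck_on_SucD in \<open>simp, blast\<close>)

text \<open>The weight \<open>t ^ m\<close> is there for the induction: differentiating under the
  integral sign produces one more factor \<open>t\<close>.\<close>

lemma Ck_on_ray_integral:
  fixes h :: "'b::euclidean_space => real"
  assumes "open S" "convex S" "y0 \<in> S" "Ck_on k S h"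
  shows "Ck_on k S (\<lambda>y. integral {0..1} (\<lambda>t. t ^ m * h (y0 + t *\<^sub>R (y - y0))))"
  using assms(4)
proof (induction k arbitrary: h m)
  case 0
  have S: "y0 + t *\<^sub>R (y - y0) \<in> S" if "y \<in> S" "t \<in> {0..1}" for y t
    using convexD_alt[OF assms(2,3) that(1), of t] that(2) by (simp add: algebra_simps)
  have h: "continuous_on S h" using 0 by simp
  have "continuous_on (S \<times> cbox 0 1) (\<lambda>(y, t). t ^ m * h (y0 + t *\<^sub>R (y - y0)))"
    unfolding case_prod_beta
    by (intro continuous_intros continuous_on_compose2[OF h]) (auto intro: S)
  from integral_continuous_on_param[OF this] show ?case by simp
next
  case (Suc k)
  have S: "y0 + t *\<^sub>R (y - y0) \<in> S" if "y \<in> S" "t \<in> {0..1}" for y t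
    using convexD_alt[OF assms(2,3) that(1), of t] that(2) by (simp add: algebra_simps)
  let ?D = "\<lambda>x. frechet_derivative h (at x)"
  have bl: "bounded_linear (?D x)" if "x \<in> S" for x
    using Ck_on_has_derivative[OF Suc.prems that] by (rule has_derivative_bounded_linear)
  have hc: "continuous_on S h"
    using Suc.prems by (auto intro!: continuous_at_imp_continuous_on differentiable_imp_continuous_within)
  have Dc: "continuous_on S (\<lambda>x. ?D x v)" for v
  proof -
    have "Ck_on k S (\<lambda>x. ?D x v)" using Suc.prems by simp
    then show ?thesis by (rule Ck_on_continuous)
  qed
  \<comment> \<open>\<open>leibniz_rule\<close> takes the derivative as a continuous family of
    bounded linear maps; its continuity is checked on basis vectors.\<close>
  define F where "F = (\<lambda>y t. t ^ Suc m *\<^sub>R Blinfun (?D (y0 + t *\<^sub>R (y - y0))))"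
  have F: "blinfun_apply (F y t) v = t ^ Suc m * ?D (y0 + t *\<^sub>R (y - y0)) v"
    if "y \<in> S" "t \<in> {0..1}" for y t v
    unfolding F_def by (simp add: scaleR_blinfun.rep_eq bounded_linear_Blinfun_apply[OF bl[OF S[OF that]]])
  have 1: "((\<lambda>y. t ^ m * h (y0 + t *\<^sub>R (y - y0))) has_derivative blinfun_apply (F y t)) (at y within S)"
    if "y \<in> S" "t \<in> cbox 0 1" for y t
  proof -
    have t: "t \<in> {0..1}" using that by simp
    have "((\<lambda>y. y0 + t *\<^sub>R (y - y0)) has_derivative (\<lambda>v. t *\<^sub>R v)) (at y)"
      by (auto intro!: derivative_eq_intros)
    from has_derivative_compose[OF this Ck_on_has_derivative[OF Suc.prems S[OF that(1) t]]]
    have "((\<lambda>y. t ^ m * h (y0 + t *\<^sub>R (y - y0))) has_derivative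
        (\<lambda>v. t ^ m * ?D (y0 + t *\<^sub>R (y - y0)) (t *\<^sub>R v))) (at y)"
      by (rule has_derivative_mult_right)
    also have "(\<lambda>v. t ^ m * ?D (y0 + t *\<^sub>R (y - y0)) (t *\<^sub>R v)) = blinfun_apply (F y t)"
      using linear_scale[OF bounded_linear.linear[OF bl[OF S[OF that(1) t]]]]
      by (auto simp: F[OF that(1) t])
    finally show ?thesis by (rule has_derivative_at_withinI)
  qed
  have 2: "(\<lambda>t. t ^ m * h (y0 + t *\<^sub>R (y - y0))) integrable_on cbox 0 1" if "y \<in> S" for y
    by (intro integrable_continuous continuous_intros continuous_on_compose2[OF hc])
      (use S[OF that] in auto)
  have 3: "continuous_on (S \<times> cbox 0 1) (\<lambda>(y, t). F y t)"
  proof (rule continuous_on_blinfun_componentwise)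
    fix i :: 'b
    have "continuous_on (S \<times> cbox 0 1) (\<lambda>z. snd z ^ Suc m * ?D (y0 + snd z *\<^sub>R (fst z - y0)) i)"
      by (intro continuous_intros continuous_on_compose2[OF Dc[of i]]) (auto intro: S)
    then show "continuous_on (S \<times> cbox 0 1) (\<lambda>z. blinfun_apply (case z of (y, t) => F y t) i)"
      by (rule continuous_on_eq) (auto simp: F)
  qed
  have D: "((\<lambda>y. integral {0..1} (\<lambda>t. t ^ m * h (y0 + t *\<^sub>R (y - y0)))) has_derivative
      (\<lambda>v. integral {0..1} (\<lambda>t. t ^ Suc m * ?D (y0 + t *\<^sub>R (y - y0)) v))) (at y)"
    if y: "y \<in> S" for y
  proof -
    have "F y integrable_on cbox 0 1"
      by (intro integrable_continuous continuous_on_compose2[OF 3, of _ "\<lambda>t. (y, t)", simplified] continuous_intros)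
        (use y in auto)
    then have "blinfun_apply (integral (cbox 0 1) (F y)) v
        = integral {0..1} (\<lambda>t. t ^ Suc m * ?D (y0 + t *\<^sub>R (y - y0)) v)" for v
      by (subst blinfun_apply_integral) (auto intro!: integral_cong simp: F[OF y] simp del: power_Suc)
    then have "blinfun_apply (integral (cbox 0 1) (F y)) =
        (\<lambda>v. integral {0..1} (\<lambda>t. t ^ Suc m * ?D (y0 + t *\<^sub>R (y - y0)) v))"
      by blast
    moreover note leibniz_rule[OF 1 2 3 y assms(2)]
    ultimately show ?thesis
      using at_within_open[OF y assms(1)] by simp
  qed
  show ?case
    by (rule Ck_on_SucI[OF assms(1) D], assumption, rule Suc.IH) (use Suc.prems in simp)
qed

text \<open>The fundamental theorem of calculus along the ray from \<open>y0\<close>. It will show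
  that a derivation at a point is determined by its values on coordinates.\<close>

lemma Hadamard:
  fixes f :: "'b::euclidean_space => real"
  assumes "open S" "convex S" "y0 \<in> S" "smooth_on S f"
  obtains g where "\<And>j. smooth_on S (g j)"
    "\<And>y. y \<in> S ==> f y = f y0 + (\<Sum>j\<in>Basis. ((y - y0) \<bullet> j) * g j y)"
proof
  let ?D = "\<lambda>x. frechet_derivative f (at x)"
  let ?g = "\<lambda>j y. integral {0..1} (\<lambda>t. t ^ 0 * ?D (y0 + t *\<^sub>R (y - y0)) j)"
  have f: "Ck_on k S f" for k using assms(4) by (simp add: smooth_on_def)
  have D: "Ck_on k S (\<lambda>x. ?D x j)" for k j
    using f[of "Suc k"] by simp
  show "smooth_on S (?g j)" for j
    unfolding smooth_on_def by (rule allI, rule Ck_on_ray_integral[OF assms(1-3) D])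
  fix y assume y: "y \<in> S"
  have S: "y0 + t *\<^sub>R (y - y0) \<in> S" if "t \<in> {0..1}" for t
    using convexD_alt[OF assms(2,3) y, of t] that by (simp add: algebra_simps)
  have "((\<lambda>t. f (y0 + t *\<^sub>R (y - y0))) has_vector_derivative ?D (y0 + t *\<^sub>R (y - y0)) (y - y0))
      (at t within {0..1})" if t: "t \<in> {0..1}" for t
  proof -
    have "((\<lambda>t. y0 + t *\<^sub>R (y - y0)) has_derivative (\<lambda>s. s *\<^sub>R (y - y0))) (at t)"
      by (auto intro!: derivative_eq_intros)
    from has_derivative_compose[OF this Ck_on_has_derivative[OF f S[OF t]]]
    have "((\<lambda>t. f (y0 + t *\<^sub>R (y - y0))) has_derivative
        (\<lambda>s. ?D (y0 + t *\<^sub>R (y - y0)) (s *\<^sub>R (y - y0)))) (at t)" .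
    then show ?thesis
      unfolding has_vector_derivative_def
        linear_scale[OF has_derivative_linear[OF Ck_on_has_derivative[OF f S[OF t]]]]
      by (rule has_derivative_at_withinI)
  qed
  then have "((\<lambda>t. ?D (y0 + t *\<^sub>R (y - y0)) (y - y0)) has_integral
      f (y0 + 1 *\<^sub>R (y - y0)) - f (y0 + 0 *\<^sub>R (y - y0))) {0..1}"
    by (rule fundamental_theorem_of_calculus[OF zero_le_one])
  then have "f y = f y0 + integral {0..1} (\<lambda>t. ?D (y0 + t *\<^sub>R (y - y0)) (y - y0))"
    by (simp only: has_integral_iff scaleR_one scaleR_zero_left add_0_right add.commute[of y0] diff_add_cancel)
  also have "integral {0..1} (\<lambda>t. ?D (y0 + t *\<^sub>R (y - y0)) (y - y0)) =
      integral {0..1} (\<lambda>t. \<Sum>j\<in>Basis. ((y - y0) \<bullet> j) * ?D (y0 + t *\<^sub>R (y - y0)) j)"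
    by (intro integral_cong linear_eq_sum_Basis
        has_derivative_linear[OF Ck_on_has_derivative[OF f S]])
  also have "\<dots> = (\<Sum>j\<in>Basis. integral {0..1} (\<lambda>t. ((y - y0) \<bullet> j) * ?D (y0 + t *\<^sub>R (y - y0)) j))"
  proof (rule integral_sum)
    fix j :: 'b
    have "continuous_on S (\<lambda>x. ?D x j)" using D[of 0] by simp
    then have "continuous_on {0..1} (\<lambda>t. ?D (y0 + t *\<^sub>R (y - y0)) j)"
      by (rule continuous_on_compose2) (intro continuous_intros, use S in blast)
    then show "(\<lambda>t. ((y - y0) \<bullet> j) * ?D (y0 + t *\<^sub>R (y - y0)) j) integrable_on {0..1}"
      by (intro integrable_continuous_interval continuous_intros)
  qed simp
  finally show "f y = f y0 + (\<Sum>j\<in>Basis. ((y - y0) \<bullet> j) * ?g j y)"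
    by (simp only: power_0 mult_1_left integral_mult_right)
qed

lemma smooth_on_cong: "open S ==> smooth_on S f ==> (\<And>x. x \<in> S ==> f x = g x) ==> smooth_on S g"
  unfolding smooth_on_def using Ck_on_cong by blast

lemma smooth_on_subset: "smooth_on S f ==> T \<subseteq> S ==> smooth_on T f"
  unfolding smooth_on_def using Ck_on_subset by blast

lemma smooth_on_continuous: "smooth_on S f ==> continuous_on S f"
  unfolding smooth_on_def by (metis Ck_on.simps(1))

lemma smooth_on_compose:
  fixes f :: "'b::euclidean_space => real" and g :: "'c::euclidean_space => 'b"
  shows "open S ==> open T ==> g ` S \<subseteq> T ==> smooth_on S g ==> smooth_on T f ==> smooth_on S (\<lambda>x. f (g x))"
  unfolding smooth_on_def using Ck_on_compose by blast

lemma smooth_on_frechet_derivative: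
  "smooth_on S f ==> smooth_on S (\<lambda>x. frechet_derivative f (at x) v)"
  unfolding smooth_on_def by (metis Ck_on.simps(2))

lemma smooth_on_differentiable: "smooth_on S f ==> x \<in> S ==> f differentiable (at x)"
  unfolding smooth_on_def by (metis Ck_on.simps(2))

section \<open>Smooth functions on the manifold and their localisation\<close>

locale smooth_manifold =
  fixes A :: "('a::{t2_space,second_countable_topology}, 'b::euclidean_space) chart set"
  assumes atlas: "smooth_atlas A"
begin

abbreviation R where "R \<equiv> smooth_funs A"

lemma chart:
  assumes "(U, \<phi>) \<in> A"
  shows "open U" "open (\<phi> ` U)" "inj_on \<phi> U" "continuous_on U \<phi>"
    "continuous_on (\<phi> ` U) (inv_into U \<phi>)"
proof -
  obtain \<psi> where h: "open U" "open (\<phi> ` U)" "homeomorphism U (\<phi> ` U) \<phi> \<psi>"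
    using bspec[OF conjunct1[OF conjunct2[OF atlas[unfolded smooth_atlas_def]]] assms] by auto
  then show "open U" "open (\<phi> ` U)" "continuous_on U \<phi>"
    using homeomorphism_cont1 by blast+
  show inj: "inj_on \<phi> U"
    by (rule inj_on_inverseI[of U \<psi>]) (rule homeomorphism_apply1[OF h(3)])
  have "\<psi> y = inv_into U \<phi> y" if y: "y \<in> \<phi> ` U" for y
  proof -
    obtain x where x: "x \<in> U" "y = \<phi> x" using y by blast
    show ?thesis
      unfolding x(2) homeomorphism_apply1[OF h(3) x(1)] inv_into_f_f[OF inj x(1)] ..
  qed
  then show "continuous_on (\<phi> ` U) (inv_into U \<phi>)"
    by (rule continuous_on_eq[OF homeomorphism_cont2[OF h(3)]])
qed

lemma chart_at: obtains U \<phi> where "(U, \<phi>) \<in> A" "p \<in> U"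
proof -
  have "p \<in> (\<Union>(U, \<phi>)\<in>A. U)"
    using conjunct1[OF atlas[unfolded smooth_atlas_def]] by simp
  then show ?thesis using that by auto
qed

lemma transition: "(U, \<phi>) \<in> A ==> (V, \<psi>) \<in> A ==> smooth_on (\<phi> ` (U \<inter> V)) (\<psi> \<circ> inv_into U \<phi>)"
  using bspec[OF bspec[OF conjunct2[OF conjunct2[OF atlas[unfolded smooth_atlas_def]]], of "(U, \<phi>)", unfolded prod.case],
      of "(V, \<psi>)"] by simp

text \<open>One chart around \<open>p\<close> is enough, since \<open>smooth_nearD\<close> transfers
  the property to any other. Membership in \<open>R\<close> thereby becomes a local
  condition.\<close>

definition smooth_near :: "'a => ('a => real) => bool" where
  "smooth_near p f \<longleftrightarrow> (\<exists>(U, \<phi>)\<in>A. \<exists>W. p \<in> U \<and> open W \<and> \<phi> p \<in> W \<and> W \<subseteq> \<phi> ` U \<and>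
      smooth_on W (f \<circ> inv_into U \<phi>))"

lemma smooth_nearI:
  assumes "(U, \<phi>) \<in> A" "p \<in> U" "open W" "\<phi> p \<in> W" "W \<subseteq> \<phi> ` U" "smooth_on W (f \<circ> inv_into U \<phi>)"
  shows "smooth_near p f"
  unfolding smooth_near_def using assms(2-) by (intro bexI[OF _ assms(1)] case_prodI exI[of _ W] conjI)

text \<open>In the chart \<psi> the function is its expression in the chart \<phi> composed with the
  transition map; \<open>T\<close> is cut down so that this map lands in \<open>W\<close>.\<close>

lemma smooth_nearD:
  assumes "smooth_near p f" "(V, \<psi>) \<in> A" "p \<in> V"
  obtains T where "open T" "\<psi> p \<in> T" "T \<subseteq> \<psi> ` V" "smooth_on T (f \<circ> inv_into V \<psi>)"
proof -
  obtain U \<phi> W where U: "(U, \<phi>) \<in> A" "p \<in> U" "open W" "\<phi> p \<in> W" "W \<subseteq> \<phi> ` U"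
      "smooth_on W (f \<circ> inv_into U \<phi>)"
    using assms(1) unfolding smooth_near_def by blast
  note cU = chart[OF U(1)] and cV = chart[OF assms(2)]
  define Q where "Q = U \<inter> \<phi> -` W"
  have Q: "open Q"
    unfolding Q_def using continuous_open_preimage[OF cU(4,1) U(3)] .
  define T where "T = \<psi> ` V \<inter> inv_into V \<psi> -` Q"
  have T: "open T"
    unfolding T_def using continuous_open_preimage[OF cV(5,2) Q] .
  have pT: "\<psi> p \<in> T"
    using assms(3) U cV(3) by (auto simp: T_def Q_def)
  have TV: "T \<subseteq> \<psi> ` (V \<inter> U)"
    using cV(3) by (auto simp: T_def Q_def)
  have "smooth_on T (\<lambda>y. (f \<circ> inv_into U \<phi>) ((\<phi> \<circ> inv_into V \<psi>) y))"
    by (rule smooth_on_compose[OF T U(3) _ smooth_on_subset[OF transition[OF assms(2) U(1)] TV] U(6)])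
      (auto simp: T_def Q_def)
  then have "smooth_on T (f \<circ> inv_into V \<psi>)"
    by (rule smooth_on_cong[OF T]) (auto simp: T_def Q_def cU(3))
  then show ?thesis
    using that T pT by (auto simp: T_def)
qed

lemma smooth_funs_iff: "f \<in> R \<longleftrightarrow> (\<forall>p. smooth_near p f)"
proof
  assume f: "f \<in> R"
  show "\<forall>p. smooth_near p f"
  proof
    fix p
    obtain U \<phi> where U: "(U, \<phi>) \<in> A" "p \<in> U" by (rule chart_at)
    then have "smooth_on (\<phi> ` U) (f \<circ> inv_into U \<phi>)"
      using bspec[OF CollectD[OF f[unfolded smooth_funs_def]], of "(U, \<phi>)"] by simp
    then show "smooth_near p f"
      using U chart(2)[OF U(1)] by (intro smooth_nearI[OF U]) auto
  qed
next
  assume f: "\<forall>p. smooth_near p f"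
  show "f \<in> R"
    unfolding smooth_funs_def
  proof (rule CollectI, rule ballI)
    fix c assume c: "c \<in> A"
    obtain U \<phi> where Uc: "c = (U, \<phi>)" by (cases c)
    with c have U: "(U, \<phi>) \<in> A" by simp
    have "Ck_on k (\<phi> ` U) (f \<circ> inv_into U \<phi>)" for k
    proof (rule Ck_on_UnI)
      fix x assume "x \<in> \<phi> ` U"
      then obtain p where p: "p \<in> U" "x = \<phi> p" by blast
      show "\<exists>T. open T \<and> x \<in> T \<and> Ck_on k T (f \<circ> inv_into U \<phi>)"
        unfolding p(2)
        by (rule smooth_nearD[OF spec[OF f] U p(1)]) (auto simp only: smooth_on_def)
    qed
    then show "case c of (U, \<phi>) => smooth_on (\<phi> ` U) (f \<circ> inv_into U \<phi>)"
      unfolding Uc smooth_on_def by simp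
  qed
qed

lemma smooth_near_cong:
  assumes "smooth_near p f" "open Q" "p \<in> Q" "\<And>q. q \<in> Q ==> f q = g q"
  shows "smooth_near p g"
proof -
  obtain U \<phi> where U: "(U, \<phi>) \<in> A" "p \<in> U" by (rule chart_at)
  note c = chart[OF U(1)]
  obtain T where T: "open T" "\<phi> p \<in> T" "T \<subseteq> \<phi> ` U" "smooth_on T (f \<circ> inv_into U \<phi>)"
    using smooth_nearD[OF assms(1) U] by blast
  have Q: "open (\<phi> ` U \<inter> inv_into U \<phi> -` Q)"
    using continuous_open_preimage[OF c(5,2) assms(2)] .
  let ?T = "T \<inter> (\<phi> ` U \<inter> inv_into U \<phi> -` Q)"
  have oT: "open ?T" using T(1) Q by (rule open_Int)
  have "smooth_on ?T (g \<circ> inv_into U \<phi>)"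
    by (rule smooth_on_cong[OF oT smooth_on_subset[OF T(4)]]) (auto simp: assms(4))
  moreover have "\<phi> p \<in> ?T" using U T assms(3) c(3) by auto
  ultimately show ?thesis
    using T(3) by (intro smooth_nearI[OF U oT]) auto
qed

lemma smooth_near_ev:
  assumes "smooth_near p f" "(U, \<phi>) \<in> A" "p \<in> U"
  shows "\<exists>T. open T \<and> \<phi> p \<in> T \<and> T \<subseteq> \<phi> ` U \<and> (\<forall>k. Ck_on k T (f \<circ> inv_into U \<phi>))"
  using smooth_nearD[OF assms] by (metis smooth_on_def)

lemma smooth_near_lift2:
  assumes "smooth_near p f" "smooth_near p g"
    and "\<And>T k (a :: 'b => real) b. open T ==> Ck_on k T a ==> Ck_on k T b ==> Ck_on k T (\<lambda>y. F (a y) (b y))"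
  shows "smooth_near p (\<lambda>q. F (f q) (g q))"
proof -
  obtain U \<phi> where U: "(U, \<phi>) \<in> A" "p \<in> U" by (rule chart_at)
  obtain T where T: "open T" "\<phi> p \<in> T" "T \<subseteq> \<phi> ` U" "\<And>k. Ck_on k T (f \<circ> inv_into U \<phi>)"
    using smooth_near_ev[OF assms(1) U] by blast
  obtain T' where T': "open T'" "\<phi> p \<in> T'" "\<And>k. Ck_on k T' (g \<circ> inv_into U \<phi>)"
    using smooth_near_ev[OF assms(2) U] by blast
  have o: "open (T \<inter> T')" using T T' by blast
  have "Ck_on k (T \<inter> T') (\<lambda>y. F ((f \<circ> inv_into U \<phi>) y) ((g \<circ> inv_into U \<phi>) y))" for k
    by (intro assms(3) o Ck_on_subset[OF T(4)] Ck_on_subset[OF T'(3)]) auto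
  then have "smooth_on (T \<inter> T') ((\<lambda>q. F (f q) (g q)) \<circ> inv_into U \<phi>)"
    by (simp add: smooth_on_def comp_def)
  then show ?thesis
    using T T' by (intro smooth_nearI[OF U o]) auto
qed

lemma smooth_near_const: "smooth_near p (\<lambda>q. c)"
proof -
  obtain U \<phi> where U: "(U, \<phi>) \<in> A" "p \<in> U" by (rule chart_at)
  have "smooth_on (\<phi> ` U) ((\<lambda>q. c) \<circ> inv_into U \<phi>)"
    by (simp add: smooth_on_def comp_def Ck_on_const)
  then show ?thesis
    using U chart(2)[OF U(1)] by (intro smooth_nearI[OF U]) auto
qed

lemma smooth_near_add: "smooth_near p f ==> smooth_near p g ==> smooth_near p (\<lambda>q. f q + g q)"
  and smooth_near_mult: "smooth_near p f ==> smooth_near p g ==> smooth_near p (\<lambda>q. f q * g q)"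
  by (rule smooth_near_lift2; blast intro: Ck_on_add Ck_on_mult)+

lemma smooth_near_continuous:
  assumes "smooth_near p f"
  shows "isCont f p"
proof -
  obtain U \<phi> where U: "(U, \<phi>) \<in> A" "p \<in> U" by (rule chart_at)
  note c = chart[OF U(1)]
  obtain T where T: "open T" "\<phi> p \<in> T" "T \<subseteq> \<phi> ` U" "smooth_on T (f \<circ> inv_into U \<phi>)"
    using smooth_nearD[OF assms(1) U] by blast
  let ?Q = "U \<inter> \<phi> -` T"
  have Q: "open ?Q" using continuous_open_preimage[OF c(4,1) T(1)] .
  have "continuous_on ?Q (\<lambda>q. (f \<circ> inv_into U \<phi>) (\<phi> q))"
    by (rule continuous_on_compose2[OF smooth_on_continuous[OF T(4)] continuous_on_subset[OF c(4)]]) auto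
  then have "continuous_on ?Q f"
    by (rule continuous_on_eq) (use c(3) in auto)
  then show ?thesis
    using Q U T(2) by (auto simp: continuous_on_eq_continuous_at)
qed

lemma smooth_near_inverse:
  assumes "smooth_near p f" "f p \<noteq> 0"
  shows "smooth_near p (\<lambda>q. inverse (f q))"
proof -
  obtain U \<phi> where U: "(U, \<phi>) \<in> A" "p \<in> U" by (rule chart_at)
  note c = chart[OF U(1)]
  obtain T where T: "open T" "\<phi> p \<in> T" "T \<subseteq> \<phi> ` U" "smooth_on T (f \<circ> inv_into U \<phi>)"
    using smooth_nearD[OF assms(1) U] by blast
  let ?T = "T \<inter> (f \<circ> inv_into U \<phi>) -` (- {0})"
  have o: "open ?T"
    using continuous_open_preimage[OF smooth_on_continuous[OF T(4)] T(1)] by blast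
  have "smooth_on ?T ((\<lambda>q. inverse (f q)) \<circ> inv_into U \<phi>)"
    using Ck_on_inverse[OF o Ck_on_subset[OF T(4)[unfolded smooth_on_def, rule_format]]]
    by (auto simp: smooth_on_def comp_def)
  then show ?thesis
    using U T assms(2) c(3) by (intro smooth_nearI[OF U o]) auto
qed

lemma R_const [simp, intro]: "(\<lambda>p. c) \<in> R"
  and R_add [intro]: "f \<in> R ==> g \<in> R ==> (\<lambda>p. f p + g p) \<in> R"
  and R_mult [intro]: "f \<in> R ==> g \<in> R ==> (\<lambda>p. f p * g p) \<in> R"
  by (auto simp: smooth_funs_iff smooth_near_const smooth_near_add smooth_near_mult)

lemma R_uminus [intro]: "f \<in> R ==> (\<lambda>p. - f p) \<in> R"
  using R_mult[OF R_const[of "-1"]] by simp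

lemma R_diff [intro]: "f \<in> R ==> g \<in> R ==> (\<lambda>p. f p - g p) \<in> R"
  using R_add[OF _ R_uminus] by simp

lemma R_sum [intro]: "(\<And>i. i \<in> I ==> f i \<in> R) ==> (\<lambda>p. \<Sum>i\<in>I. f i p) \<in> R"
  by (induction I rule: infinite_finite_induct) auto

lemma R_prod [intro]: "(\<And>i. i \<in> I ==> f i \<in> R) ==> (\<lambda>p. \<Prod>i\<in>I. f i p) \<in> R"
  by (induction I rule: infinite_finite_induct) auto

lemma R_local:
  assumes "\<And>p. \<exists>Q g. open Q \<and> p \<in> Q \<and> g \<in> R \<and> (\<forall>q\<in>Q. f q = g q)"
  shows "f \<in> R"
  unfolding smooth_funs_iff
proof
  fix p
  obtain Q g where "open Q" "p \<in> Q" "g \<in> R" "\<forall>q\<in>Q. f q = g q"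
    using assms[of p] by (elim exE conjE)
  then show "smooth_near p f"
    using smooth_funs_iff[of g] by (intro smooth_near_cong[of p g Q f]) simp_all
qed

lemma R_continuous: "f \<in> R ==> isCont f p"
  by (simp add: smooth_funs_iff smooth_near_continuous)

text \<open>Extension by zero is smooth because the support lies in the compact set
  \<open>K\<close>, which is closed as the space is Hausdorff. Vanishing on a neighbourhood of each
  outer point is recorded separately: it allows products with functions that are defined in the
  chart only.\<close>

lemma bump_in_chart:
  assumes U: "(U, \<phi>) \<in> A" "p \<in> U" and W: "open W" "\<phi> p \<in> W" "W \<subseteq> \<phi> ` U"
  obtains b where "b \<in> R" "\<And>q. q \<notin> U \<inter> \<phi> -` W ==> b q = 0"
    "\<And>q. q \<notin> U \<inter> \<phi> -` W ==> \<exists>Q. open Q \<and> q \<in> Q \<and> (\<forall>x\<in>Q. b x = 0)"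
    "\<exists>Q. open Q \<and> p \<in> Q \<and> Q \<subseteq> U \<inter> \<phi> -` W \<and> (\<forall>q\<in>Q. b q = 1)"
proof -
  note c = chart[OF U(1)]
  obtain r where r: "r > 0" "cball (\<phi> p) r \<subseteq> W"
    using W open_contains_cball by metis
  define r2 where "r2 = r / 2"
  have r2: "r2 > 0" "2 * r2 = r" using r by (auto simp: r2_def)
  obtain B :: "'b => real" where B: "\<And>k. Ck_on k UNIV B" "\<And>x. dist (\<phi> p) x \<le> r2 ==> B x = 1"
      "\<And>x. dist (\<phi> p) x \<ge> r ==> B x = 0"
    using Ck_on_bump_exists[OF r2(1), of "\<phi> p"] r2(2) by metis
  define b where "b = (\<lambda>q. if q \<in> U then B (\<phi> q) else 0)"
  define K where "K = inv_into U \<phi> ` cball (\<phi> p) r"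
  have "compact K"
    unfolding K_def using r W(3)
    by (intro compact_continuous_image continuous_on_subset[OF c(5)] compact_cball) auto
  then have K: "open (- K)" using compact_imp_closed by auto
  have bK: "b q = 0" if "q \<notin> K" for q
  proof (cases "q \<in> U")
    case True
    then have "\<not> dist (\<phi> p) (\<phi> q) \<le> r"
      using that c(3) by (force simp: K_def)
    then show ?thesis using True B(3) by (auto simp: b_def)
  qed (simp add: b_def)
  have KW: "K \<subseteq> U \<inter> \<phi> -` W"
  proof
    fix q assume "q \<in> K"
    then obtain y where y: "y \<in> cball (\<phi> p) r" "q = inv_into U \<phi> y" by (auto simp: K_def)
    then have "y \<in> W" "y \<in> \<phi> ` U" using r W by auto
    then show "q \<in> U \<inter> \<phi> -` W" using y by (auto simp: inv_into_into f_inv_into_f)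
  qed
  have "b \<in> R"
    unfolding smooth_funs_iff
  proof
    fix q
    show "smooth_near q b"
    proof (cases "q \<in> U")
      case True
      have "smooth_on (\<phi> ` U) (b \<circ> inv_into U \<phi>)"
        by (rule smooth_on_cong[OF c(2), of B])
          (auto simp: smooth_on_def b_def c(3) inv_into_into intro: Ck_on_subset[OF B(1)])
      then show ?thesis
        using c True by (intro smooth_nearI[OF U(1) True]) auto
    next
      case False
      then have "q \<in> - K" using KW by auto
      then show ?thesis
        using bK by (intro smooth_near_cong[OF smooth_near_const[of q 0] K]) auto
    qed
  qed
  moreover have "b q = 0" if "q \<notin> U \<inter> \<phi> -` W" for q
    using that KW bK by blast
  moreover have "\<exists>Q. open Q \<and> q \<in> Q \<and> (\<forall>x\<in>Q. b x = 0)" if "q \<notin> U \<inter> \<phi> -` W" for q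
    using that KW bK K by (intro exI[of _ "- K"]) auto
  moreover have "\<exists>Q. open Q \<and> p \<in> Q \<and> Q \<subseteq> U \<inter> \<phi> -` W \<and> (\<forall>q\<in>Q. b q = 1)"
  proof (intro exI[of _ "U \<inter> \<phi> -` ball (\<phi> p) r2"] conjI)
    show "open (U \<inter> \<phi> -` ball (\<phi> p) r2)"
      using continuous_open_preimage[OF c(4,1)] by blast
    have "ball (\<phi> p) r2 \<subseteq> W" using r r2 by (auto simp: subset_eq)
    then show "U \<inter> \<phi> -` ball (\<phi> p) r2 \<subseteq> U \<inter> \<phi> -` W" by blast
  qed (use U r2 B(2) in \<open>auto simp: b_def\<close>)
  ultimately show ?thesis using that by blast
qed

lemma bump:
  assumes "open S" "p \<in> S"
  obtains b Q where "b \<in> R" "\<And>q. q \<notin> S ==> b q = 0" 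
    "\<And>q. q \<notin> S ==> \<exists>V. open V \<and> q \<in> V \<and> (\<forall>x\<in>V. b x = 0)"
    "open Q" "p \<in> Q" "Q \<subseteq> S" "\<And>q. q \<in> Q ==> b q = 1"
proof -
  obtain U \<phi> where U: "(U, \<phi>) \<in> A" "p \<in> U" by (rule chart_at)
  note c = chart[OF U(1)]
  let ?W = "\<phi> ` U \<inter> inv_into U \<phi> -` S"
  have W: "open ?W" using continuous_open_preimage[OF c(5,2) assms(1)] .
  have S: "U \<inter> \<phi> -` ?W \<subseteq> S"
  proof
    fix q assume q: "q \<in> U \<inter> \<phi> -` ?W"
    then have "inv_into U \<phi> (\<phi> q) \<in> S" by simp
    then show "q \<in> S" using inv_into_f_f[OF c(3), of q] q by simp
  qed
  have pW: "\<phi> p \<in> ?W" using U assms c(3) by auto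
  show ?thesis
  proof (rule bump_in_chart[OF U W pW Int_lower1])
    fix b assume b: "b \<in> R" "\<And>q. q \<notin> U \<inter> \<phi> -` ?W ==> b q = 0"
      "\<And>q. q \<notin> U \<inter> \<phi> -` ?W ==> \<exists>Q. open Q \<and> q \<in> Q \<and> (\<forall>x\<in>Q. b x = 0)"
      "\<exists>Q. open Q \<and> p \<in> Q \<and> Q \<subseteq> U \<inter> \<phi> -` ?W \<and> (\<forall>q\<in>Q. b q = 1)"
    from b(4) obtain Q where Q: "open Q" "p \<in> Q" "Q \<subseteq> U \<inter> \<phi> -` ?W" "\<forall>q\<in>Q. b q = 1"
      by (elim exE conjE)
    show ?thesis
    proof (rule that[of b Q])
      fix q assume "q \<notin> S"
      then have q: "q \<notin> U \<inter> \<phi> -` ?W" using S by (rule contra_subsetD[rotated])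
      show "b q = 0" by (rule b(2)[OF q])
      show "\<exists>V. open V \<and> q \<in> V \<and> (\<forall>x\<in>V. b x = 0)" by (rule b(3)[OF q])
    next
      show "Q \<subseteq> S" using Q(3) S by (rule subset_trans)
    qed (use b(1) Q in simp_all)
  qed
qed

end

section \<open>Tangent vectors and frames\<close>

lemma tvec_vector_space: "vector_space (\<lambda>(c::real) (v::'a tvec) f. c * v f)"
  by unfold_locales (auto simp: algebra_simps)

interpretation tv: vector_space "\<lambda>(c::real) (v::'a tvec) f. c * v f"
  by (rule tvec_vector_space)

lemma sum_fun_apply: "sum f I x = (\<Sum>i\<in>I. f i x)"
  by (induction I rule: infinite_finite_induct) auto

definition smul :: "('a => real) => 'a vfield => 'a vfield" where
  "smul h X = (\<lambda>f p. h p * X f p)"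

lemma smul_apply [simp]: "smul h X f p = h p * X f p"
  by (simp add: smul_def)

lemma vec_at_apply: "vec_at X p f = X f p"
  by (simp add: vec_at_def)

lemma vec_at_simps [simp]:
  "vec_at (X + Y) p = vec_at X p + vec_at Y p"
  "vec_at (X - Y) p = vec_at X p - vec_at Y p"
  "vec_at (- X) p = - vec_at X p"
  "vec_at 0 p = 0"
  "vec_at (smul h X) p = (\<lambda>f. h p * vec_at X p f)"
  "vec_at (sum F I) p = (\<Sum>i\<in>I. vec_at (F i) p)"
  by (auto simp: vec_at_def sum_fun_apply fun_eq_iff)

lemma vfield_eqI: "(\<And>p. vec_at X p = vec_at Y p) ==> X = Y"
  by (simp add: vec_at_def fun_eq_iff)

context smooth_manifold begin

abbreviation T where "T p \<equiv> carrier (tangent_space A p)"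
abbreviation VF where "VF \<equiv> carrier (vfields A)"

lemma tangentI:
  assumes "\<And>f g. f \<in> R ==> g \<in> R ==> v (\<lambda>x. f x + g x) = v f + v g"
    "\<And>f g. f \<in> R ==> g \<in> R ==> v (\<lambda>x. f x * g x) = f p * v g + g p * v f"
    "\<And>c f. f \<in> R ==> v (\<lambda>x. c * f x) = c * v f"
    "\<And>f. f \<notin> R ==> v f = 0"
  shows "v \<in> T p"
  using assms by (simp add: tangent_space_def)

lemma bump_ex:
  assumes "open S" "p \<in> S"
  shows "\<exists>b Q. b \<in> R \<and> (\<forall>q. q \<notin> S \<longrightarrow> b q = 0) \<and>
    (\<forall>q. q \<notin> S \<longrightarrow> (\<exists>V. open V \<and> q \<in> V \<and> (\<forall>x\<in>V. b x = 0))) \<and>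
    open Q \<and> p \<in> Q \<and> Q \<subseteq> S \<and> (\<forall>q\<in>Q. b q = 1)"
proof (rule bump[OF assms])
  fix b Q assume "b \<in> R" "\<And>q. q \<notin> S ==> b q = 0" "\<And>q. q \<notin> S ==> \<exists>V. open V \<and> q \<in> V \<and> (\<forall>x\<in>V. b x = 0)"
    "open Q" "p \<in> Q" "Q \<subseteq> S" "\<And>q. q \<in> Q ==> b q = 1"
  then show ?thesis
    by (intro exI[of _ b] exI[of _ Q] conjI) simp_all
qed

context
  fixes v p assumes v: "v \<in> T p"
begin

lemma T_add: "f \<in> R ==> g \<in> R ==> v (\<lambda>x. f x + g x) = v f + v g"
  and T_mult: "f \<in> R ==> g \<in> R ==> v (\<lambda>x. f x * g x) = f p * v g + g p * v f"
  and T_scale: "f \<in> R ==> v (\<lambda>x. c * f x) = c * v f"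
  and T_out: "f \<notin> R ==> v f = 0"
  using v unfolding tangent_space_def partial_object.select_convs by blast+

lemma T_zero: "v (\<lambda>x. 0) = 0"
  using T_scale[of "\<lambda>x. 0" 0] by simp

lemma T_const: "v (\<lambda>x. c) = 0"
proof -
  have "v (\<lambda>x. 1) = 0"
    using T_mult[of "\<lambda>x. 1" "\<lambda>x. 1"] by simp
  then show ?thesis
    using T_scale[of "\<lambda>x. 1" c] by simp
qed

lemma T_uminus: "f \<in> R ==> v (\<lambda>x. - f x) = - v f"
  using T_scale[of f "-1"] by simp

lemma T_diff: "f \<in> R ==> g \<in> R ==> v (\<lambda>x. f x - g x) = v f - v g"
  using T_add[of f "\<lambda>x. - g x"] T_uminus[of g] by (simp add: R_uminus)

lemma T_sum: "(\<And>i. i \<in> I ==> f i \<in> R) ==> v (\<lambda>x. \<Sum>i\<in>I. f i x) = (\<Sum>i\<in>I. v (f i))"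
proof (induction I rule: infinite_finite_induct)
  case (insert i I)
  then show ?case
    using T_add[of "f i" "\<lambda>x. \<Sum>i\<in>I. f i x"] R_sum[of I f] by simp
qed (simp_all add: T_zero)

text \<open>A bump function \<open>b\<close> with b(p) = 1 annihilates f - g, and the Leibniz rule
  for the product b (f - g) = 0 gives v(f - g) = 0.\<close>

lemma T_local:
  assumes "f \<in> R" "g \<in> R" "open Q" "p \<in> Q" "\<And>q. q \<in> Q ==> f q = g q"
  shows "v f = v g"
proof -
  from bump_ex[OF assms(3,4)] obtain b Q' where b: "b \<in> R" "\<forall>q. q \<notin> Q \<longrightarrow> b q = 0" "p \<in> Q'" "\<forall>q\<in>Q'. b q = 1"
    by (elim exE conjE)
  have d: "(\<lambda>x. f x - g x) \<in> R" using assms by (intro R_diff)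
  have "(\<lambda>x. b x * (f x - g x)) = (\<lambda>x. 0)"
  proof
    fix x show "b x * (f x - g x) = 0"
      using b(2) assms(5)[of x] by (cases "x \<in> Q") simp_all
  qed
  then have "v (\<lambda>x. f x - g x) = 0"
    using T_mult[OF b(1) d] T_zero b(3,4) assms(4,5) by simp
  then show ?thesis
    using T_diff[OF assms(1,2)] by simp
qed

end

lemma T_zero_in [simp]: "0 \<in> T p"
  by (rule tangentI) simp_all

lemma T_plus:
  assumes u: "u \<in> T p" and v: "v \<in> T p"
  shows "u + v \<in> T p"
proof (rule tangentI)
  show "(u + v) (\<lambda>x. k * f x) = k * (u + v) f" if "f \<in> R" for k f
    using T_scale[OF u that] T_scale[OF v that] by (simp add: algebra_simps)
qed (simp_all add: T_add[OF u] T_add[OF v] T_mult[OF u] T_mult[OF v] T_out[OF u] T_out[OF v] algebra_simps)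

lemma T_cmult:
  assumes u: "u \<in> T p"
  shows "(\<lambda>f. c * u f) \<in> T p"
proof (rule tangentI)
  show "c * u (\<lambda>x. k * f x) = k * (c * u f)" if "f \<in> R" for k f
    using T_scale[OF u that] by simp
qed (simp_all add: T_add[OF u] T_mult[OF u] T_out[OF u] algebra_simps)

lemma tv_subspace_T: "tv.subspace (T p)"
  by (rule tv.subspaceI) (simp_all add: T_plus T_cmult)

lemma VF_I: "(\<And>p. vec_at X p \<in> T p) ==> (\<And>f. f \<in> R ==> X f \<in> R) ==> X \<in> VF"
  by (simp add: vfields_def)

lemma VF_T: "X \<in> VF ==> vec_at X p \<in> T p"
  and VF_R: "X \<in> VF ==> f \<in> R ==> X f \<in> R"
  by (simp_all add: vfields_def)

lemma VF_out: "X \<in> VF ==> f \<notin> R ==> X f = (\<lambda>p. 0)"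
  using T_out[OF VF_T] by (fastforce simp: vec_at_def)

lemma VF_add: "X \<in> VF ==> f \<in> R ==> g \<in> R ==> X (\<lambda>x. f x + g x) = (\<lambda>p. X f p + X g p)"
  and VF_diff: "X \<in> VF ==> f \<in> R ==> g \<in> R ==> X (\<lambda>x. f x - g x) = (\<lambda>p. X f p - X g p)"
  and VF_mult: "X \<in> VF ==> f \<in> R ==> g \<in> R ==> X (\<lambda>x. f x * g x) = (\<lambda>p. f p * X g p + g p * X f p)"
  and VF_const: "X \<in> VF ==> X (\<lambda>x. c) = (\<lambda>p. 0)"
  using T_add[OF VF_T] T_diff[OF VF_T] T_mult[OF VF_T] T_const[OF VF_T]
  by (auto simp: vec_at_def fun_eq_iff)

lemma VF_local:
  assumes "X \<in> VF" "f \<in> R" "g \<in> R" "open Q" "p \<in> Q" "\<And>q. q \<in> Q ==> f q = g q"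
  shows "X f p = X g p"
  using T_local[OF VF_T[OF assms(1)] assms(2-)] by (simp add: vec_at_def)

lemma VF_plus [intro]:
  assumes "X \<in> VF" "Y \<in> VF"
  shows "X + Y \<in> VF"
proof (rule VF_I)
  show "vec_at (X + Y) p \<in> T p" for p
    using assms by (simp add: T_plus VF_T)
  show "(X + Y) f \<in> R" if "f \<in> R" for f
    using R_add[OF VF_R[OF assms(1) that] VF_R[OF assms(2) that]] by (simp add: plus_fun_def)
qed

lemma VF_smul [intro]:
  assumes "h \<in> R" "X \<in> VF"
  shows "smul h X \<in> VF"
proof (rule VF_I)
  show "vec_at (smul h X) p \<in> T p" for p
    using T_cmult[OF VF_T[OF assms(2)]] by simp
  show "smul h X f \<in> R" if "f \<in> R" for f
    using R_mult[OF assms(1) VF_R[OF assms(2) that]] by (simp add: smul_def)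
qed

lemma VF_zero [simp, intro]: "0 \<in> VF"
proof (rule VF_I)
  show "(0 :: 'a vfield) f \<in> R" for f
    using R_const[of 0] by (simp add: zero_fun_def)
qed simp

lemma VF_uminus [intro]: "X \<in> VF ==> - X \<in> VF"
  using VF_smul[of "\<lambda>p. -1" X] by (simp add: smul_def fun_Compl_def)

lemma VF_minus [intro]: "X \<in> VF ==> Y \<in> VF ==> X - Y \<in> VF"
  using VF_plus[of X "- Y"] VF_uminus[of Y] by simp

lemma VF_sum [intro]: "(\<And>i. i \<in> I ==> F i \<in> VF) ==> sum F I \<in> VF"
  by (induction I rule: infinite_finite_induct) auto

lemma VF_glue:
  assumes "\<And>p. \<exists>Q X. open Q \<and> p \<in> Q \<and> X \<in> VF \<and> (\<forall>q\<in>Q. v q = vec_at X q)"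
  shows "(\<lambda>f p. v p f) \<in> VF"
proof (rule VF_I)
  fix p
  from assms[of p] obtain Q X where "p \<in> Q" "X \<in> VF" "\<forall>q\<in>Q. v q = vec_at X q"
    by (elim exE conjE)
  then show "vec_at (\<lambda>f p. v p f) p \<in> T p"
    using VF_T[of X p] by (simp add: vec_at_def)
next
  fix f assume f: "f \<in> R"
  show "(\<lambda>p. v p f) \<in> R"
  proof (rule R_local)
    fix p
    from assms[of p] obtain Q X where *: "open Q" "p \<in> Q" "X \<in> VF" "\<forall>q\<in>Q. v q = vec_at X q"
      by (elim exE conjE)
    show "\<exists>Q g. open Q \<and> p \<in> Q \<and> g \<in> R \<and> (\<forall>q\<in>Q. v q f = g q)"
      using * VF_R[OF *(3) f] by (intro exI[of _ Q] exI[of _ "X f"]) (simp add: vec_at_def)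
  qed
qed

text \<open>Tangent vectors act on globally smooth functions. Through this extension by zero,
  coordinates, derivatives and Hadamard coefficients, which live in a chart, become available to
  them.\<close>

lemma cutoff_smooth:
  assumes U: "(U, \<phi>) \<in> A" and W: "open W" "W \<subseteq> \<phi> ` U" and b: "b \<in> R"
    "\<And>q. q \<notin> U \<inter> \<phi> -` W ==> \<exists>Q. open Q \<and> q \<in> Q \<and> (\<forall>x\<in>Q. b x = 0)"
    and g: "smooth_on W g"
  shows "(\<lambda>q. if q \<in> U \<inter> \<phi> -` W then b q * g (\<phi> q) else 0) \<in> R" (is "?F \<in> R")
  unfolding smooth_funs_iff
proof
  note c = chart[OF U]
  fix q
  show "smooth_near q ?F"
  proof (cases "q \<in> U \<inter> \<phi> -` W")
    case True
    have bs: "smooth_on (\<phi> ` U) (b \<circ> inv_into U \<phi>)"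
      using bspec[OF CollectD[OF b(1)[unfolded smooth_funs_def]] U] by simp
    have "smooth_on W (\<lambda>y. (b \<circ> inv_into U \<phi>) y * g y)"
      unfolding smooth_on_def
    proof (rule allI, rule Ck_on_mult[OF W(1)])
      fix k
      show "Ck_on k W (b \<circ> inv_into U \<phi>)"
        using smooth_on_subset[OF bs W(2)] by (simp add: smooth_on_def)
      show "Ck_on k W g" using g by (simp add: smooth_on_def)
    qed
    then have "smooth_on W (?F \<circ> inv_into U \<phi>)"
    proof (rule smooth_on_cong[OF W(1)])
      fix y assume "y \<in> W"
      then have "y \<in> \<phi> ` U" using W by blast
      then have "inv_into U \<phi> y \<in> U" "\<phi> (inv_into U \<phi> y) = y"
        by (simp_all add: inv_into_into f_inv_into_f)
      then show "(b \<circ> inv_into U \<phi>) y * g y = (?F \<circ> inv_into U \<phi>) y"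
        using \<open>y \<in> W\<close> by simp
    qed
    then show ?thesis
      using True W by (intro smooth_nearI[OF U _ W(1)]) auto
  next
    case False
    from b(2)[OF False] obtain Q where Q: "open Q" "q \<in> Q" "\<forall>x\<in>Q. b x = 0" by (elim exE conjE)
    show ?thesis
      by (rule smooth_near_cong[OF smooth_near_const[of q 0] Q(1,2)]) (simp add: Q(3))
  qed
qed

text \<open>The coordinate field in direction \<open>w\<close>, cut off by \<open>b\<close>. The
  value 0 for functions outside \<open>R\<close> is the convention of
  \<open>tangent_space\<close>.\<close>

lemma chart_derivative_vfield:
  assumes U: "(U, \<phi>) \<in> A" and b: "b \<in> R"
    "\<And>q. q \<notin> U ==> \<exists>Q. open Q \<and> q \<in> Q \<and> (\<forall>x\<in>Q. b x = 0)"
  shows "(\<lambda>f q. if f \<in> R \<and> q \<in> U then b q * frechet_derivative (f \<circ> inv_into U \<phi>) (at (\<phi> q)) w else 0) \<in> VF"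
    (is "?X \<in> VF")
proof (rule VF_I)
  note c = chart[OF U]
  have sm: "smooth_on (\<phi> ` U) (f \<circ> inv_into U \<phi>)" if "f \<in> R" for f
    using bspec[OF CollectD[OF that[unfolded smooth_funs_def]] U] by simp
  fix p
  have D: "((f \<circ> inv_into U \<phi>) has_derivative frechet_derivative (f \<circ> inv_into U \<phi>) (at (\<phi> p))) (at (\<phi> p))"
    if "f \<in> R" "p \<in> U" for f
    using smooth_on_differentiable[OF sm[OF that(1)], of "\<phi> p"] that by (simp add: frechet_derivative_works)
  show "vec_at ?X p \<in> T p"
  proof (rule tangentI)
    fix f g assume f: "f \<in> R" and g: "g \<in> R"
    show "vec_at ?X p (\<lambda>x. f x + g x) = vec_at ?X p f + vec_at ?X p g"
    proof (cases "p \<in> U")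
      case True
      have "frechet_derivative ((\<lambda>x. f x + g x) \<circ> inv_into U \<phi>) (at (\<phi> p)) =
          (\<lambda>w. frechet_derivative (f \<circ> inv_into U \<phi>) (at (\<phi> p)) w + frechet_derivative (g \<circ> inv_into U \<phi>) (at (\<phi> p)) w)"
        using frechet_derivative_at[OF has_derivative_add[OF D[OF f True] D[OF g True]]] by (simp add: comp_def)
      then show ?thesis using True f g R_add[OF f g] by (simp add: vec_at_def algebra_simps)
    qed (simp add: vec_at_def)
    show "vec_at ?X p (\<lambda>x. f x * g x) = f p * vec_at ?X p g + g p * vec_at ?X p f"
    proof (cases "p \<in> U")
      case True
      have "frechet_derivative ((\<lambda>x. f x * g x) \<circ> inv_into U \<phi>) (at (\<phi> p)) =
          (\<lambda>w. f p * frechet_derivative (g \<circ> inv_into U \<phi>) (at (\<phi> p)) w + frechet_derivative (f \<circ> inv_into U \<phi>) (at (\<phi> p)) w * g p)"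
        using frechet_derivative_at[OF has_derivative_mult[OF D[OF f True] D[OF g True]]]
          inv_into_f_f[OF c(3) True] by (simp add: comp_def)
      then show ?thesis using True f g R_mult[OF f g] by (simp add: vec_at_def algebra_simps)
    qed (simp add: vec_at_def)
    fix k :: real
    show "vec_at ?X p (\<lambda>x. k * f x) = k * vec_at ?X p f"
    proof (cases "p \<in> U")
      case True
      have "frechet_derivative ((\<lambda>x. k * f x) \<circ> inv_into U \<phi>) (at (\<phi> p)) =
          (\<lambda>w. k * frechet_derivative (f \<circ> inv_into U \<phi>) (at (\<phi> p)) w)"
        using frechet_derivative_at[OF has_derivative_mult_right[OF D[OF f True], of k]] by (simp add: comp_def)
      then show ?thesis using True f R_mult[OF R_const f, of k] by (simp add: vec_at_def)
    qed (simp add: vec_at_def)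
  qed (simp add: vec_at_def)
next
  note c = chart[OF U]
  fix f assume f: "f \<in> R"
  have sm: "smooth_on (\<phi> ` U) (f \<circ> inv_into U \<phi>)"
    using bspec[OF CollectD[OF f[unfolded smooth_funs_def]] U] by simp
  have UU: "U \<inter> \<phi> -` (\<phi> ` U) = U" by blast
  show "?X f \<in> R"
    using cutoff_smooth[OF U c(2) subset_refl b(1), unfolded UU, OF b(2) smooth_on_frechet_derivative[OF sm, of w]] f
    by simp
qed

text \<open>The functions and fields are global and restrict near \<open>p\<close> to coordinates
  and coordinate fields. In Hadamard's expansion of f around q a derivation at q retains only the
  terms v(x_j) G_j(q).\<close>

lemma coordinate_frame:
  obtains Q :: "'a set" and x :: "'b => 'a => real" and V :: "'b => 'a vfield"
  where "open Q" "p \<in> Q" "\<And>j. x j \<in> R" "\<And>j. V j \<in> VF"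
    "\<And>i j q. q \<in> Q ==> i \<in> Basis ==> j \<in> Basis ==> V i (x j) q = (if i = j then 1 else 0)"
    "\<And>q v f. q \<in> Q ==> v \<in> T q ==> v f = (\<Sum>j\<in>Basis. v (x j) * V j f q)"
proof -
  obtain U \<phi> where U: "(U, \<phi>) \<in> A" "p \<in> U" by (rule chart_at)
  note c = chart[OF U(1)]
  have UU: "U \<inter> \<phi> -` (\<phi> ` U) = U" by blast
  show ?thesis
  proof (rule bump_in_chart[OF U c(2) imageI[OF U(2)] subset_refl, unfolded UU])
    fix b assume b: "b \<in> R" "\<And>q. q \<notin> U ==> b q = 0"
      "\<And>q. q \<notin> U ==> \<exists>Q. open Q \<and> q \<in> Q \<and> (\<forall>x\<in>Q. b x = 0)"
      "\<exists>Q. open Q \<and> p \<in> Q \<and> Q \<subseteq> U \<and> (\<forall>q\<in>Q. b q = 1)"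
    from b(4) obtain Q where Q: "open Q" "p \<in> Q" "Q \<subseteq> U" "\<forall>q\<in>Q. b q = 1" by (elim exE conjE)
    define x where "x = (\<lambda>j q. if q \<in> U then b q * (\<phi> q \<bullet> j) else 0)"
    define V where "V = (\<lambda>w f q. if f \<in> R \<and> q \<in> U
      then b q * frechet_derivative (f \<circ> inv_into U \<phi>) (at (\<phi> q)) w else 0)"
    have xR: "x j \<in> R" for j
    proof -
      have "smooth_on (\<phi> ` U) (\<lambda>y. y \<bullet> j)"
        unfolding smooth_on_def by (rule allI, rule Ck_on_linear[OF bounded_linear_inner_left c(2)])
      from cutoff_smooth[OF U(1) c(2) subset_refl b(1), unfolded UU, OF b(3) this]
      show ?thesis by (simp add: x_def)
    qed
    have VV: "V j \<in> VF" for j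
      unfolding V_def by (rule chart_derivative_vfield[OF U(1) b(1) b(3)])
    define T' where "T' = \<phi> ` U \<inter> inv_into U \<phi> -` Q"
    have T': "open T'"
      unfolding T'_def using continuous_open_preimage[OF c(5,2) Q(1)] .
    have qT': "\<phi> q \<in> T'" if "q \<in> Q" for q
      using that Q(3) inv_into_f_f[OF c(3), of q] by (auto simp: T'_def)
    have T'E: "\<phi> (inv_into U \<phi> y) = y \<and> inv_into U \<phi> y \<in> U \<and> inv_into U \<phi> y \<in> Q" if "y \<in> T'" for y
      using that by (auto simp: T'_def f_inv_into_f inv_into_into)
    have Vx: "V i (x j) q = (if i = j then 1 else 0)" if "q \<in> Q" "i \<in> Basis" "j \<in> Basis" for i j q
    proof -
      have "frechet_derivative (x j \<circ> inv_into U \<phi>) (at (\<phi> q)) = frechet_derivative (\<lambda>y. y \<bullet> j) (at (\<phi> q))"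
        by (rule frechet_derivative_local(1)[OF T' qT'[OF that(1)]]) (use T'E Q(4) in \<open>simp add: x_def\<close>)
      also have "\<dots> = (\<lambda>w. w \<bullet> j)"
        by (rule frechet_derivative_at[symmetric]) (intro bounded_linear_imp_has_derivative bounded_linear_inner_left)
      finally show ?thesis
        using that Q(3,4) xR by (auto simp: V_def inner_Basis)
    qed
    \<comment> \<open>The coefficients depend on \<open>f\<close> and \<open>q\<close> but not on
      the tangent vector, so they can afterwards be identified by inserting the coordinate
      fields.\<close>
    have key: "\<exists>G. \<forall>v\<in>T q. v f = (\<Sum>j\<in>Basis. v (x j) * G j)" if q: "q \<in> Q" and f: "f \<in> R" for q f
    proof -
      obtain r where r: "r > 0" "ball (\<phi> q) r \<subseteq> T'"
        using openE[OF T' qT'[OF q]] .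
      let ?B = "ball (\<phi> q) r"
      have BU: "?B \<subseteq> \<phi> ` U" using r by (auto simp: T'_def)
      have sm: "smooth_on ?B (f \<circ> inv_into U \<phi>)"
        using bspec[OF CollectD[OF f[unfolded smooth_funs_def]] U(1)] BU by (auto intro: smooth_on_subset)
      have qU: "q \<in> U" and qB: "\<phi> q \<in> ?B" using q Q(3) r by auto
      obtain g where g: "\<And>j. smooth_on ?B (g j)"
        "\<And>y. y \<in> ?B ==> (f \<circ> inv_into U \<phi>) y = (f \<circ> inv_into U \<phi>) (\<phi> q) + (\<Sum>j\<in>Basis. ((y - \<phi> q) \<bullet> j) * g j y)"
        by (rule Hadamard[OF open_ball convex_ball qB sm]) (rule that)
      show ?thesis
      proof (rule bump_in_chart[OF U(1) qU open_ball qB BU])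
        fix d assume d: "d \<in> R" "\<And>x. x \<notin> U \<inter> \<phi> -` ?B ==> d x = 0"
          "\<And>x. x \<notin> U \<inter> \<phi> -` ?B ==> \<exists>Q. open Q \<and> x \<in> Q \<and> (\<forall>x\<in>Q. d x = 0)"
          "\<exists>Q. open Q \<and> q \<in> Q \<and> Q \<subseteq> U \<inter> \<phi> -` ?B \<and> (\<forall>q\<in>Q. d q = 1)"
        from d(4) obtain N where N: "open N" "q \<in> N" "N \<subseteq> U \<inter> \<phi> -` ?B" "\<forall>q\<in>N. d q = 1" by (elim exE conjE)
        define G where "G = (\<lambda>j z. if z \<in> U \<inter> \<phi> -` ?B then d z * g j (\<phi> z) else 0)"
        have GR: "G j \<in> R" for j
          unfolding G_def by (rule cutoff_smooth[OF U(1) open_ball BU d(1) d(3) g(1)])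
        define F where "F = (\<lambda>z. f q + (\<Sum>j\<in>Basis. (x j z - x j q) * G j z))"
        have FR: "(\<lambda>z. (x j z - x j q) * G j z) \<in> R" for j
          by (intro R_mult R_diff xR GR R_const)
        have SR: "(\<lambda>z. \<Sum>j\<in>Basis. (x j z - x j q) * G j z) \<in> R"
          by (intro R_sum FR)
        have ff: "f z = F z" if z: "z \<in> N \<inter> Q" for z
        proof -
          have zU: "z \<in> U" "\<phi> z \<in> ?B" "d z = 1" "b z = 1" "b q = 1" using z N Q q by auto
          show ?thesis
            using g(2)[OF zU(2)] zU qU inv_into_f_f[OF c(3), of z] inv_into_f_f[OF c(3), of q]
            by (simp add: F_def G_def x_def inner_diff_left)
        qed
        have vf: "v f = v F" if "v \<in> T q" for v
        proof (rule T_local[OF that f])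
          show "F \<in> R" unfolding F_def by (rule R_add[OF R_const SR])
          show "f z = F z" if "z \<in> N \<inter> Q" for z by (rule ff[OF that])
          show "open (N \<inter> Q)" "q \<in> N \<inter> Q" using N q Q by auto
        qed
        have "v F = (\<Sum>j\<in>Basis. v (x j) * G j q)" if v: "v \<in> T q" for v
        proof -
          have "v F = (\<Sum>j\<in>Basis. v (\<lambda>z. (x j z - x j q) * G j z))"
            unfolding F_def T_add[OF v R_const SR] T_const[OF v] T_sum[OF v FR] by simp
          moreover have "v (\<lambda>z. (x j z - x j q) * G j z) = v (x j) * G j q" for j
            using T_mult[OF v R_diff[OF xR R_const] GR, of j "x j q" j] T_diff[OF v xR R_const, of j "x j q"] T_const[OF v, of "x j q"]
            by simp
          ultimately show ?thesis by simp
        qed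
        then show ?thesis using vf by (intro exI[of _ "\<lambda>j. G j q"]) simp
      qed
    qed
    have fin: "v f = (\<Sum>j\<in>Basis. v (x j) * V j f q)" if q: "q \<in> Q" and v: "v \<in> T q" for q v f
    proof (cases "f \<in> R")
      case True
      from key[OF q True] obtain G where "\<forall>v\<in>T q. v f = (\<Sum>j\<in>Basis. v (x j) * G j)" ..
      then have G: "v f = (\<Sum>j\<in>Basis. v (x j) * G j)" if "v \<in> T q" for v
        using that by (rule bspec)
      have "V i f q = G i" if i: "i \<in> Basis" for i
      proof -
        have "V i f q = (\<Sum>j\<in>Basis. V i (x j) q * G j)"
          using G[OF VF_T[OF VV[of i], of q]] by (simp add: vec_at_def)
        also have "\<dots> = (\<Sum>j\<in>Basis. if j = i then G j else 0)"
          by (rule sum.cong) (auto simp: Vx[OF q i])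
        finally show ?thesis using i by simp
      qed
      then show ?thesis using G[OF v] by simp
    next
      case False
      then show ?thesis using T_out[OF v] by (simp add: V_def)
    qed
    show ?thesis
      by (rule that[OF Q(1,2) xR VV Vx fin])
  qed
qed

end

section \<open>Linear algebra in tangent spaces and smooth coframes\<close>

lemma independent_family:
  fixes g :: "'i => 'a tvec"
  assumes I: "finite I" and c: "\<forall>c. (\<forall>f. (\<Sum>i\<in>I. c i * g i f) = 0) \<longrightarrow> (\<forall>i\<in>I. c i = 0)"
  shows "inj_on g I" "tv.independent (g ` I)"
proof -
  show inj: "inj_on g I"
  proof (rule inj_onI, rule ccontr)
    fix i j assume ij: "i \<in> I" "j \<in> I" "g i = g j" "i \<noteq> j"
    let ?c = "\<lambda>k. (if k = i then 1 else 0) - (if k = j then 1 else (0::real))"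
    have "(\<Sum>k\<in>I. ?c k * g k f) = 0" for f
    proof -
      have "(\<Sum>k\<in>I. ?c k * g k f) = (\<Sum>k\<in>I. (if k = i then g k f else 0) - (if k = j then g k f else 0))"
        by (rule sum.cong) auto
      then show ?thesis using I ij by (simp add: sum_subtractf)
    qed
    with spec[OF c, of ?c] have "\<forall>k\<in>I. ?c k = 0" by blast
    with ij show False by auto
  qed
  show "tv.independent (g ` I)"
  proof
    assume "tv.dependent (g ` I)"
    then obtain u where u: "\<exists>v\<in>g ` I. u v \<noteq> 0" "(\<Sum>v\<in>g ` I. (\<lambda>f. u v * v f)) = 0"
      using tv.dependent_finite[of "g ` I"] I by auto
    have "(\<Sum>i\<in>I. u (g i) * g i f) = 0" for f
      using fun_cong[OF u(2), of f] by (simp add: sum.reindex[OF inj] sum_fun_apply)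
    with spec[OF c, of "\<lambda>i. u (g i)"] u(1) show False by blast
  qed
qed

lemma span_familyE:
  fixes g :: "'i => 'a tvec"
  assumes "finite I" "v \<in> tv.span (g ` I)"
  obtains c where "v = (\<lambda>f. \<Sum>i\<in>I. c i * g i f)"
proof -
  let ?S = "{v. \<exists>c. v = (\<lambda>f. \<Sum>i\<in>I. c i * g i f)}"
  have "tv.subspace ?S"
  proof (rule tv.subspaceI)
    show "0 \<in> ?S" by (rule CollectI, rule exI[of _ "\<lambda>i. 0"]) auto
  next
    fix x y assume "x \<in> ?S" "y \<in> ?S"
    then obtain c d where "x = (\<lambda>f. \<Sum>i\<in>I. c i * g i f)" "y = (\<lambda>f. \<Sum>i\<in>I. d i * g i f)" by blast
    then have "x + y = (\<lambda>f. \<Sum>i\<in>I. (c i + d i) * g i f)"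
      by (simp add: fun_eq_iff sum.distrib distrib_right)
    then show "x + y \<in> ?S" by (intro CollectI exI[of _ "\<lambda>i. c i + d i"])
  next
    fix k x assume "x \<in> ?S"
    then obtain c where "x = (\<lambda>f. \<Sum>i\<in>I. c i * g i f)" by blast
    then have "(\<lambda>f. k * x f) = (\<lambda>f. \<Sum>i\<in>I. (k * c i) * g i f)"
      by (simp add: fun_eq_iff sum_distrib_left mult.assoc)
    then show "(\<lambda>f. k * x f) \<in> ?S" by (intro CollectI exI[of _ "\<lambda>i. k * c i"])
  qed
  moreover have "g ` I \<subseteq> ?S"
  proof clarify
    fix i assume i: "i \<in> I"
    have "g i f = (\<Sum>j\<in>I. (if j = i then 1 else 0) * g j f)" for f
    proof -
      have "(\<Sum>j\<in>I. (if j = i then 1 else 0) * g j f) = (\<Sum>j\<in>I. if j = i then g j f else 0)"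
        by (rule sum.cong) auto
      then show ?thesis using i assms(1) by simp
    qed
    then have "g i = (\<lambda>f. \<Sum>j\<in>I. (if j = i then 1 else 0) * g j f)" by (rule ext)
    then show "\<exists>c. g i = (\<lambda>f. \<Sum>j\<in>I. c j * g j f)" by (rule exI[of _ "\<lambda>j. if j = i then 1 else 0"])
  qed
  ultimately have "tv.span (g ` I) \<subseteq> ?S"
    by (intro tv.span_minimal)
  then show ?thesis using assms(2) that by blast
qed

lemma span_familyI:
  fixes g :: "'i => 'a tvec"
  shows "(\<lambda>f. \<Sum>i\<in>I. c i * g i f) \<in> tv.span (g ` I)"
proof -
  have "(\<Sum>i\<in>I. (\<lambda>f. c i * g i f)) \<in> tv.span (g ` I)"
    by (rule tv.span_sum, rule tv.span_scale, rule tv.span_base) simp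
  moreover have "(\<Sum>i\<in>I. (\<lambda>f. c i * g i f)) = (\<lambda>f. \<Sum>i\<in>I. c i * g i f)"
    by (simp add: fun_eq_iff sum_fun_apply)
  ultimately show ?thesis by simp
qed

text \<open>A basis chosen among the \<open>k\<close> spanning vectors has \<open>k\<close>
  elements, so it contains all of them and the indexing is injective.\<close>

lemma frame_independent:
  fixes g :: "nat => 'a tvec"
  assumes D: "D = tv.span (g ` {..<k})" "tv.dim D = k" and c: "\<And>f. (\<Sum>i<k. c i * g i f) = 0" and i: "i < k"
  shows "c i = 0"
proof -
  obtain B where B: "B \<subseteq> g ` {..<k}" "tv.independent B" "g ` {..<k} \<subseteq> tv.span B"
    using tv.maximal_independent_subset by blast
  have "tv.span B = D"
    unfolding D(1) by (intro equalityI tv.span_mono B(1) tv.span_minimal B(3)) simp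
  then have "card B = k"
    using tv.dim_span_eq_card_independent[OF B(2)] D(2) by simp
  moreover have le: "card (g ` {..<k}) \<le> k"
    using card_image_le[of "{..<k}" g] by simp
  moreover have "card B \<le> card (g ` {..<k})"
    using card_mono[OF _ B(1)] by simp
  ultimately have "B = g ` {..<k}" "card (g ` {..<k}) = card {..<k}"
    using card_subset_eq[OF _ B(1)] by simp_all
  then have ind: "tv.independent (g ` {..<k})" and inj: "inj_on g {..<k}"
    using B(2) by (simp_all add: eq_card_imp_inj_on)
  let ?u = "\<lambda>v. c (inv_into {..<k} g v)"
  have "(\<Sum>v\<in>g ` {..<k}. (\<lambda>f. ?u v * v f)) f = (\<Sum>i<k. c i * g i f)" for f
    by (simp add: sum.reindex[OF inj] sum_fun_apply inv_into_f_f[OF inj])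
  then have "(\<Sum>v\<in>g ` {..<k}. (\<lambda>f. ?u v * v f)) = 0"
    by (simp add: fun_eq_iff c)
  then have "?u (g i) = 0"
    using tv.independentD[OF ind, of "g ` {..<k}" ?u "g i"] i by simp
  then show ?thesis
    using inv_into_f_f[OF inj, of i] i by simp
qed

text \<open>Linearity is demanded on the whole type, so no membership in a tangent space has to be
  carried through the computations.\<close>

definition tlin :: "('a tvec => real) => bool" where
  "tlin \<alpha> \<longleftrightarrow> (\<forall>u v. \<alpha> (u + v) = \<alpha> u + \<alpha> v) \<and> (\<forall>c u. \<alpha> (\<lambda>f. c * u f) = c * \<alpha> u)"

lemma tlin_add: "tlin \<alpha> ==> \<alpha> (u + v) = \<alpha> u + \<alpha> v"
  and tlin_scale: "tlin \<alpha> ==> \<alpha> (\<lambda>f. c * u f) = c * \<alpha> u"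
  by (simp_all add: tlin_def)

lemma tlin_zero: "tlin \<alpha> ==> \<alpha> 0 = 0"
  using tlin_scale[of \<alpha> 0 0] by (simp add: zero_fun_def)

lemma tlin_uminus: "tlin \<alpha> ==> \<alpha> (- u) = - \<alpha> u"
  using tlin_scale[of \<alpha> "-1" u] by (simp add: fun_Compl_def)

lemma tlin_diff: "tlin \<alpha> ==> \<alpha> (u - v) = \<alpha> u - \<alpha> v"
  using tlin_add[of \<alpha> u "- v"] by (simp add: tlin_uminus)

context smooth_manifold begin

text \<open>The reciprocal is smooth where \<open>f\<close> does not vanish; multiplied by a bump
  function supported there, it becomes an element of \<open>R\<close>.\<close>

lemma R_local_inverse:
  assumes f: "f \<in> R" "f p \<noteq> 0"
  shows "\<exists>g Q. g \<in> R \<and> open Q \<and> p \<in> Q \<and> (\<forall>q\<in>Q. f q \<noteq> 0 \<and> g q * f q = 1)"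
proof -
  have cont: "continuous_on UNIV f"
    using R_continuous[OF f(1)] by (simp add: continuous_at_imp_continuous_on)
  let ?S = "f -` (- {0})"
  have S: "open ?S" "p \<in> ?S"
    using open_vimage[OF _ cont, of "- {0}"] f(2) by auto
  from bump_ex[OF S] obtain b Q where b: "b \<in> R" "\<forall>q. q \<notin> ?S \<longrightarrow> b q = 0"
    "\<forall>q. q \<notin> ?S \<longrightarrow> (\<exists>V. open V \<and> q \<in> V \<and> (\<forall>x\<in>V. b x = 0))"
    "open Q" "p \<in> Q" "Q \<subseteq> ?S" "\<forall>q\<in>Q. b q = 1"
    by (elim exE conjE)
  have "(\<lambda>q. b q * inverse (f q)) \<in> R"
    unfolding smooth_funs_iff
  proof
    fix q
    show "smooth_near q (\<lambda>q. b q * inverse (f q))"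
    proof (cases "q \<in> ?S")
      case True
      then show ?thesis
        using f(1) b(1) by (intro smooth_near_mult smooth_near_inverse) (simp_all add: smooth_funs_iff)
    next
      case False
      with b(3) obtain V where V: "open V" "q \<in> V" "\<forall>x\<in>V. b x = 0" by blast
      show ?thesis
        by (rule smooth_near_cong[OF smooth_near_const[of q 0] V(1,2)]) (simp add: V(3))
    qed
  qed
  moreover have "f q \<noteq> 0 \<and> b q * inverse (f q) * f q = 1" if "q \<in> Q" for q
  proof -
    have "f q \<noteq> 0" using that b(6) by auto
    then show ?thesis using that b(7) by simp
  qed
  ultimately show ?thesis
    using b(4,5) by (intro exI[of _ "\<lambda>q. b q * inverse (f q)"] exI[of _ Q]) simp
qed

lemma R_det:
  assumes "\<And>i j. M i j \<in> R"
  shows "(\<lambda>q. Determinant.det (Matrix.mat m m (\<lambda>(i, j). M i j q))) \<in> R"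
proof -
  have "Determinant.det (Matrix.mat m m (\<lambda>(i, j). M i j q)) =
      (\<Sum>p\<in>{p. p permutes {0..<m}}. signof p * (\<Prod>i = 0..<m. M i (p i) q))" for q
  proof -
    have "Determinant.det (Matrix.mat m m (\<lambda>(i, j). M i j q)) =
      (\<Sum>p\<in>{p. p permutes {0..<m}}. signof p * (\<Prod>i = 0..<m. Matrix.mat m m (\<lambda>(i, j). M i j q) $$ (i, p i)))"
      by (rule det_def') simp
    also have "\<dots> = (\<Sum>p\<in>{p. p permutes {0..<m}}. signof p * (\<Prod>i = 0..<m. M i (p i) q))"
    proof (intro sum.cong refl arg_cong2[where f = "(*)"] prod.cong)
      fix p i assume "p \<in> {p. p permutes {0..<m}}" "i \<in> {0..<m}"
      then have "i < m" "p i < m" using permutes_in_image[of p "{0..<m}" i] by auto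
      then show "Matrix.mat m m (\<lambda>(i, j). M i j q) $$ (i, p i) = M i (p i) q" by simp
    qed
    finally show ?thesis .
  qed
  then show ?thesis
    using assms by (simp only:) (intro R_sum R_mult R_prod R_const)
qed

text \<open>Cramer's rule: cofactors are polynomials in the entries, and the determinant, nonzero at
  \<open>p\<close>, has a smooth inverse near \<open>p\<close> by
  \<open>R_local_inverse\<close>.\<close>

lemma smooth_matrix_inverse:
  assumes M: "\<And>i j. M i j \<in> R"
    and ns: "\<forall>c :: nat => real. (\<forall>i<m. (\<Sum>j<m. M i j p * c j) = 0) \<longrightarrow> (\<forall>j<m. c j = 0)"
  shows "\<exists>N Q. (\<forall>i j. N i j \<in> R) \<and> open Q \<and> p \<in> Q \<and>
    (\<forall>q\<in>Q. \<forall>i<m. \<forall>k<m. (\<Sum>j<m. N i j q * M j k q) = (if i = k then 1 else 0) \<and>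
       (\<Sum>j<m. M i j q * N j k q) = (if i = k then 1 else 0))"
proof -
  let ?M = "\<lambda>q. Matrix.mat m m (\<lambda>(i, j). M i j q)"
  have MC: "?M q \<in> carrier_mat m m" for q by simp
  let ?D = "\<lambda>q. Determinant.det (?M q)"
  have D: "?D \<in> R" by (rule R_det[OF M])
  have "?D p \<noteq> 0"
  proof
    assume "?D p = 0"
    then obtain v where v: "v \<in> carrier_vec m" "v \<noteq> 0\<^sub>v m" "?M p *\<^sub>v v = 0\<^sub>v m"
      using det_0_iff_vec_prod_zero_field[OF MC] by blast
    have "(\<Sum>j<m. M i j p * Matrix.vec_index v j) = 0" if "i < m" for i
    proof -
      have "Matrix.vec_index (?M p *\<^sub>v v) i = (\<Sum>j<m. M i j p * Matrix.vec_index v j)"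
        using that v(1) by (simp add: scalar_prod_def lessThan_atLeast0)
      then show ?thesis using v(3) that by simp
    qed
    then have "\<forall>j<m. Matrix.vec_index v j = 0" using spec[OF ns, of "Matrix.vec_index v"] by blast
    then have "v = 0\<^sub>v m"
      using v(1) by (intro eq_vecI) auto
    then show False using v(2) by simp
  qed
  from R_local_inverse[OF D this] obtain g Q where g: "g \<in> R" "open Q" "p \<in> Q"
      "\<forall>q\<in>Q. ?D q \<noteq> 0 \<and> g q * ?D q = 1" by (elim exE conjE)
  define C where "C = (\<lambda>i j q. cofactor (?M q) j i)"
  have C: "C i j \<in> R" for i j
  proof -
    have "mat_delete (?M q) j i = Matrix.mat (m - 1) (m - 1) (\<lambda>(i', j').
        M (if i' < j then i' else Suc i') (if j' < i then j' else Suc j') q)" for q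
      unfolding mat_delete_def by (rule eq_matI) auto
    then have "C i j = (\<lambda>q. (-1) ^ (j + i) * Determinant.det (Matrix.mat (m - 1) (m - 1) (\<lambda>(i', j').
        M (if i' < j then i' else Suc i') (if j' < i then j' else Suc j') q)))"
      unfolding C_def cofactor_def by simp
    then show ?thesis
      by (simp only:) (intro R_mult R_const R_det[where M = "\<lambda>i' j'. M (if i' < j then i' else Suc i') (if j' < i then j' else Suc j')"] M)
  qed
  have adj: "(\<Sum>j<m. M i j q * C j k q) = (if i = k then ?D q else 0)"
    "(\<Sum>j<m. C i j q * M j k q) = (if i = k then ?D q else 0)" if "i < m" "k < m" for i k q
  proof -
    have A: "adj_mat (?M q) = Matrix.mat m m (\<lambda>(i, j). C i j q)"
      unfolding adj_mat_def C_def by simp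
    have "(?M q * adj_mat (?M q)) $$ (i, k) = (\<Sum>j<m. M i j q * C j k q)"
      using that unfolding A by (simp add: scalar_prod_def lessThan_atLeast0)
    then show "(\<Sum>j<m. M i j q * C j k q) = (if i = k then ?D q else 0)"
      using adj_mat(2)[OF MC] that by (cases "i = k") simp_all
    have "(adj_mat (?M q) * ?M q) $$ (i, k) = (\<Sum>j<m. C i j q * M j k q)"
      using that unfolding A by (simp add: scalar_prod_def lessThan_atLeast0)
    then show "(\<Sum>j<m. C i j q * M j k q) = (if i = k then ?D q else 0)"
      using adj_mat(3)[OF MC] that by (cases "i = k") simp_all
  qed
  show ?thesis
  proof (intro exI[of _ "\<lambda>i j q. g q * C i j q"] exI[of _ Q] conjI allI ballI impI)
    show "(\<lambda>q. g q * C i j q) \<in> R" for i j by (intro R_mult g(1) C)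
    fix q i k assume q: "q \<in> Q" and ik: "i < m" "k < m"
    have "(\<Sum>j<m. g q * C i j q * M j k q) = g q * (\<Sum>j<m. C i j q * M j k q)"
      by (simp add: sum_distrib_left mult.assoc)
    then show "(\<Sum>j<m. g q * C i j q * M j k q) = (if i = k then 1 else 0)"
      using adj(2)[OF ik] g(4) q by simp
    have "(\<Sum>j<m. M i j q * (g q * C j k q)) = g q * (\<Sum>j<m. M i j q * C j k q)"
      by (simp add: sum_distrib_left mult_ac)
    then show "(\<Sum>j<m. M i j q * (g q * C j k q)) = (if i = k then 1 else 0)"
      using adj(1)[OF ik] g(4) q by simp
  qed (use g in simp_all)
qed

text \<open>The dual coframe of a frame is the inverse of its coordinate matrix, which is smooth by
  \<open>smooth_matrix_inverse\<close>.\<close>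

lemma coframe:
  fixes X :: "nat => 'a vfield"
  assumes X: "\<And>i. X i \<in> VF"
    and ind: "\<forall>c :: nat => real. (\<forall>f. (\<Sum>i<DIM('b). c i * X i f p) = 0) \<longrightarrow> (\<forall>i<DIM('b). c i = 0)"
  shows "\<exists>Q \<alpha>. open Q \<and> p \<in> Q \<and> (\<forall>i q. tlin (\<alpha> i q)) \<and>
    (\<forall>i. \<forall>W\<in>VF. (\<lambda>q. \<alpha> i q (vec_at W q)) \<in> R) \<and>
    (\<forall>q\<in>Q. \<forall>v\<in>T q. \<forall>f. v f = (\<Sum>i<DIM('b). \<alpha> i q v * X i f q)) \<and>
    (\<forall>q\<in>Q. \<forall>i<DIM('b). \<forall>k<DIM('b). \<alpha> i q (vec_at (X k) q) = (if i = k then 1 else 0))"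
proof (rule coordinate_frame[of p])
  fix Q :: "'a set" and x :: "'b => 'a => real" and V :: "'b => 'a vfield"
  assume Q: "open Q" "p \<in> Q" and x: "\<And>j. x j \<in> R" and V: "\<And>j. V j \<in> VF"
    and Vx: "\<And>i j q. q \<in> Q ==> i \<in> Basis ==> j \<in> Basis ==> V i (x j) q = (if i = j then 1 else 0)"
    and exp: "\<And>q v f. q \<in> Q ==> v \<in> T q ==> v f = (\<Sum>j\<in>Basis. v (x j) * V j f q)"
  let ?n = "DIM('b)"
  obtain e where e: "bij_betw e {0..<?n} (Basis :: 'b set)"
    using ex_bij_betw_nat_finite[OF finite_Basis] by blast
  have exp': "v f = (\<Sum>j<?n. v (x (e j)) * V (e j) f q)" if "q \<in> Q" "v \<in> T q" for q v f
    using exp[OF that, of f] sum.reindex_bij_betw[OF e, of "\<lambda>j. v (x j) * V j f q"]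
    by (simp add: lessThan_atLeast0)
  have eB: "e i \<in> Basis" if "i < ?n" for i
    using e that by (auto simp: bij_betw_def)
  \<comment> \<open>The columns are the coordinates of the frame fields; the rows of the inverse
    matrix are the coefficients of the coframe.\<close>
  define M where "M = (\<lambda>j i. X i (x (e j)))"
  have MR: "M i j \<in> R" for i j unfolding M_def by (rule VF_R[OF X x])
  have ns: "\<forall>c :: nat => real. (\<forall>i<?n. (\<Sum>j<?n. M i j p * c j) = 0) \<longrightarrow> (\<forall>j<?n. c j = 0)"
  proof (intro allI impI)
    fix c :: "nat => real" and k assume c: "\<forall>i<?n. (\<Sum>j<?n. M i j p * c j) = 0"
    assume k: "k < ?n"
    have z: "(\<Sum>i<?n. c i * X i f p) = 0" for f
    proof -
    have "(\<Sum>i<?n. c i * X i f p) = (\<Sum>i<?n. c i * (\<Sum>j<?n. M j i p * V (e j) f p))"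
    proof (rule sum.cong[OF refl])
      fix i
      show "c i * X i f p = c i * (\<Sum>j<?n. M j i p * V (e j) f p)"
        using exp'[OF Q(2) VF_T[OF X], of i f] by (simp add: vec_at_def M_def)
    qed
    also have "\<dots> = (\<Sum>j<?n. (\<Sum>i<?n. M j i p * c i) * V (e j) f p)"
    proof -
      have "(\<Sum>i<?n. c i * (\<Sum>j<?n. M j i p * V (e j) f p)) = (\<Sum>i<?n. \<Sum>j<?n. M j i p * c i * V (e j) f p)"
        by (simp only: sum_distrib_left mult_ac)
      also have "\<dots> = (\<Sum>j<?n. \<Sum>i<?n. M j i p * c i * V (e j) f p)" by (rule sum.swap)
      finally show ?thesis by (simp only: sum_distrib_right)
    qed
    also have "\<dots> = 0" using c by simp
    finally show ?thesis .
    qed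
    have "\<forall>i<?n. c i = 0" by (rule mp[OF spec[OF ind]], rule allI, rule z)
    then show "c k = 0" using k by simp
  qed
  from smooth_matrix_inverse[OF MR ns] obtain N Q' where N: "\<forall>i j. N i j \<in> R" "open Q'" "p \<in> Q'"
    "\<forall>q\<in>Q'. \<forall>i<?n. \<forall>k<?n. (\<Sum>j<?n. N i j q * M j k q) = (if i = k then 1 else 0) \<and>
       (\<Sum>j<?n. M i j q * N j k q) = (if i = k then 1 else 0)" by (elim exE conjE)
  define \<alpha> where "\<alpha> = (\<lambda>i q (v :: 'a tvec). \<Sum>j<?n. N i j q * v (x (e j)))"
  show ?thesis
  proof (intro exI[of _ "Q \<inter> Q'"] exI[of _ \<alpha>] conjI allI ballI impI)
    show "open (Q \<inter> Q')" "p \<in> Q \<inter> Q'" using Q N by auto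
    show "tlin (\<alpha> i q)" for i q
      unfolding tlin_def \<alpha>_def
      by (intro conjI allI) (simp_all add: distrib_left sum.distrib sum_distrib_left mult.left_commute)
    show "(\<lambda>q. \<alpha> i q (vec_at W q)) \<in> R" if "W \<in> VF" for i W
      unfolding \<alpha>_def vec_at_def using N(1) by (intro R_sum R_mult VF_R[OF that x]) simp
  next
    fix q v f assume q: "q \<in> Q \<inter> Q'" and v: "v \<in> T q"
    have 1: "v (x (e k)) = (\<Sum>i<?n. \<alpha> i q v * M k i q)" if k: "k < ?n" for k
    proof -
      have "(\<Sum>i<?n. \<alpha> i q v * M k i q) = (\<Sum>j<?n. (\<Sum>i<?n. M k i q * N i j q) * v (x (e j)))"
      proof -
        have "(\<Sum>i<?n. \<alpha> i q v * M k i q) = (\<Sum>i<?n. \<Sum>j<?n. M k i q * N i j q * v (x (e j)))"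
          unfolding \<alpha>_def by (simp only: sum_distrib_left sum_distrib_right mult_ac)
        also have "\<dots> = (\<Sum>j<?n. \<Sum>i<?n. M k i q * N i j q * v (x (e j)))" by (rule sum.swap)
        finally show ?thesis by (simp only: sum_distrib_right)
      qed
      also have "\<dots> = (\<Sum>j<?n. if j = k then v (x (e j)) else 0)"
      proof (rule sum.cong[OF refl])
        fix j assume "j \<in> {..<?n}"
        then have j: "j < ?n" by simp
        have "(\<Sum>i<?n. M k i q * N i j q) = (if k = j then 1 else 0)"
          using N(4) q k j by simp
        then show "(\<Sum>i<?n. M k i q * N i j q) * v (x (e j)) = (if j = k then v (x (e j)) else 0)" by simp
      qed
      finally show ?thesis using k by simp
    qed
    have "v f = (\<Sum>k<?n. v (x (e k)) * V (e k) f q)"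
      by (rule exp'[OF _ v]) (use q in simp)
    also have "\<dots> = (\<Sum>k<?n. \<Sum>i<?n. \<alpha> i q v * (M k i q * V (e k) f q))"
    proof (rule sum.cong[OF refl])
      fix k assume "k \<in> {..<?n}"
      then have "k < ?n" by simp
      show "v (x (e k)) * V (e k) f q = (\<Sum>i<?n. \<alpha> i q v * (M k i q * V (e k) f q))"
        unfolding 1[OF \<open>k < ?n\<close>] by (simp only: sum_distrib_right mult.assoc)
    qed
    also have "\<dots> = (\<Sum>i<?n. \<alpha> i q v * (\<Sum>k<?n. M k i q * V (e k) f q))"
      by (subst sum.swap) (simp add: sum_distrib_left)
    also have "\<dots> = (\<Sum>i<?n. \<alpha> i q v * X i f q)"
    proof (rule sum.cong[OF refl])
      fix i
      show "\<alpha> i q v * (\<Sum>k<?n. M k i q * V (e k) f q) = \<alpha> i q v * X i f q"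
        using exp'[OF _ VF_T[OF X], of q i f] q by (simp add: vec_at_def M_def)
    qed
    finally show "v f = (\<Sum>i<?n. \<alpha> i q v * X i f q)" .
  next
    fix q i k assume "q \<in> Q \<inter> Q'" "i < ?n" "k < ?n"
    then show "\<alpha> i q (vec_at (X k) q) = (if i = k then 1 else 0)"
      using N(4) by (auto simp: \<alpha>_def vec_at_def M_def)
  qed
qed

text \<open>Otherwise the independent coordinate vectors at \<open>p\<close>, which are
  \<open>DIM('b)\<close> many, would lie in a span of \<open>k\<close> vectors.\<close>

lemma exists_vfield_not_in_span:
  assumes "k < DIM('b)"
  shows "\<exists>Z\<in>VF. vec_at Z p \<notin> tv.span (g ` {..<k::nat})"
proof (rule coordinate_frame[of p], rule ccontr)
  fix Q :: "'a set" and x :: "'b => 'a => real" and V :: "'b => 'a vfield"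
  assume Q: "open Q" "p \<in> Q" and V: "\<And>j. V j \<in> VF"
    and Vx: "\<And>i j q. q \<in> Q ==> i \<in> Basis ==> j \<in> Basis ==> V i (x j) q = (if i = j then 1 else 0)"
    and n: "\<not> (\<exists>Z\<in>VF. vec_at Z p \<notin> tv.span (g ` {..<k}))"
  let ?v = "\<lambda>j. vec_at (V j) p"
  have ind: "\<forall>c :: 'b => real. (\<forall>f. (\<Sum>i\<in>Basis. c i * ?v i f) = 0) \<longrightarrow> (\<forall>i\<in>Basis. c i = 0)"
  proof (intro allI impI ballI)
    fix c :: "'b => real" and j :: 'b assume c: "\<forall>f. (\<Sum>i\<in>Basis. c i * ?v i f) = 0" and j: "j \<in> Basis"
    have "(\<Sum>i\<in>Basis. c i * ?v i (x j)) = (\<Sum>i\<in>Basis. if i = j then c i else 0)"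
      by (rule sum.cong) (use Vx[OF Q(2) _ j] in \<open>auto simp: vec_at_def\<close>)
    then show "c j = 0" using c[rule_format, of "x j"] j by simp
  qed
  note ind = independent_family[OF finite_Basis ind]
  have "?v ` Basis \<subseteq> tv.span (g ` {..<k})"
    using n V by blast
  then have "card (?v ` Basis) \<le> card (g ` {..<k})"
    using tv.independent_span_bound[OF _ ind(2), of "g ` {..<k}"] by simp
  also have "\<dots> \<le> k" using card_image_le[of "{..<k}" g] by simp
  finally show False
    using card_image[OF ind(1)] assms by simp
qed

end

lemma tlin_sum:
  assumes "tlin \<alpha>"
  shows "\<alpha> (\<lambda>f. \<Sum>i\<in>I. c i * g i f) = (\<Sum>i\<in>I. c i * \<alpha> (g i))"
proof (induction I rule: infinite_finite_induct)
  case (insert x I)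
  have "(\<lambda>f. \<Sum>i\<in>insert x I. c i * g i f) = (\<lambda>f. c x * g x f) + (\<lambda>f. \<Sum>i\<in>I. c i * g i f)"
    using insert by (simp add: fun_eq_iff)
  then show ?case
    using insert by (simp add: tlin_add[OF assms] tlin_scale[OF assms])
qed (use tlin_zero[OF assms] in \<open>simp_all add: zero_fun_def\<close>)

lemma tlin_sum':
  assumes "tlin \<alpha>"
  shows "\<alpha> (sum g I) = (\<Sum>i\<in>I. \<alpha> (g i))"
proof (induction I rule: infinite_finite_induct)
  case (insert x I)
  show ?case
    unfolding sum.insert[OF insert(1,2)] tlin_add[OF assms] insert(3) ..
qed (simp_all only: sum.infinite sum.empty tlin_zero[OF assms] not_False_eq_True)

lemma tv_scale_neg1: "(\<lambda>f. (-1) * u f) = - (u :: 'a tvec)"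
  by (simp add: fun_eq_iff)

section \<open>Lie brackets and sections of distributions\<close>

context smooth_manifold begin

lemma vfield_eqI_R:
  assumes "X \<in> VF" "Y \<in> VF" "\<And>f p. f \<in> R ==> X f p = Y f p"
  shows "X = Y"
proof (intro ext)
  fix f p show "X f p = Y f p"
    using assms(3) VF_out[OF assms(1)] VF_out[OF assms(2)] by (cases "f \<in> R") simp_all
qed

lemma lie_VF [intro]:
  assumes X: "X \<in> VF" and Y: "Y \<in> VF"
  shows "lie X Y \<in> VF"
proof (rule VF_I)
  fix p
  show "vec_at (lie X Y) p \<in> T p"
  proof (rule tangentI)
    fix f g assume f: "f \<in> R" and g: "g \<in> R"
    note fg = VF_R[OF X f] VF_R[OF X g] VF_R[OF Y f] VF_R[OF Y g]
    show "vec_at (lie X Y) p (\<lambda>x. f x + g x) = vec_at (lie X Y) p f + vec_at (lie X Y) p g"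
      by (simp add: vec_at_def lie_def VF_add[OF X] VF_add[OF Y] f g fg)
    show "vec_at (lie X Y) p (\<lambda>x. f x * g x) = f p * vec_at (lie X Y) p g + g p * vec_at (lie X Y) p f"
      by (simp add: vec_at_def lie_def VF_add[OF X] VF_add[OF Y] VF_mult[OF X] VF_mult[OF Y] R_mult f g fg algebra_simps)
  next
    fix c f assume f: "f \<in> R"
    note fg = VF_R[OF X f] VF_R[OF Y f]
    show "vec_at (lie X Y) p (\<lambda>x. c * f x) = c * vec_at (lie X Y) p f"
      by (simp add: vec_at_def lie_def VF_mult[OF X] VF_mult[OF Y] VF_const[OF X] VF_const[OF Y] f fg algebra_simps)
  next
    fix f assume "f \<notin> R"
    then show "vec_at (lie X Y) p f = 0"
      by (simp add: vec_at_def lie_def VF_out[OF X] VF_out[OF Y] VF_const[OF X] VF_const[OF Y])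
  qed
next
  fix f assume f: "f \<in> R"
  have "lie X Y f = (\<lambda>p. X (Y f) p - Y (X f) p)"
    by (simp add: lie_def)
  then show "lie X Y f \<in> R"
    by (simp only: R_diff[OF VF_R[OF X VF_R[OF Y f]] VF_R[OF Y VF_R[OF X f]]])
qed

lemma lie_add_right:
  assumes "X \<in> VF" "Y \<in> VF" "Z \<in> VF"
  shows "lie X (Y + Z) = lie X Y + lie X Z"
proof (rule vfield_eqI_R)
  fix f p assume f: "f \<in> R"
  have "(Y + Z) f = (\<lambda>p. Y f p + Z f p)" by (simp add: fun_eq_iff)
  then show "lie X (Y + Z) f p = (lie X Y + lie X Z) f p"
    using assms f by (simp add: lie_def VF_add VF_R)
qed (intro lie_VF VF_plus assms)+

lemma lie_antisym: "lie X Y = - lie Y X"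
  by (simp add: lie_def fun_eq_iff)

lemma lie_self [simp]: "lie X X = 0"
  by (simp add: lie_def fun_eq_iff)

lemma lie_add_left:
  assumes "X \<in> VF" "Y \<in> VF" "Z \<in> VF"
  shows "lie (X + Y) Z = lie X Z + lie Y Z"
  using lie_add_right[OF assms(3,1,2)] lie_antisym[of "X + Y" Z] lie_antisym[of X Z] lie_antisym[of Y Z]
  by simp

lemma lie_smul_right:
  assumes "h \<in> R" "X \<in> VF" "Y \<in> VF"
  shows "lie X (smul h Y) = smul h (lie X Y) + smul (X h) Y"
proof (rule vfield_eqI_R)
  fix f p assume f: "f \<in> R"
  have "smul h Y f = (\<lambda>p. h p * Y f p)" by (simp add: smul_def)
  then show "lie X (smul h Y) f p = (smul h (lie X Y) + smul (X h) Y) f p"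
    using assms f by (simp add: lie_def VF_mult VF_R algebra_simps)
qed (intro lie_VF VF_plus VF_smul assms VF_R[OF assms(2,1)])+

lemma lie_smul_left:
  assumes "h \<in> R" "X \<in> VF" "Y \<in> VF"
  shows "lie (smul h X) Y = smul h (lie X Y) - smul (Y h) X"
proof -
  have "lie (smul h X) Y = - (smul h (lie Y X) + smul (Y h) X)"
    using lie_smul_right[OF assms(1,3,2)] lie_antisym by metis
  also have "\<dots> = smul h (lie X Y) - smul (Y h) X"
    by (subst lie_antisym[of X Y]) (simp add: fun_eq_iff)
  finally show ?thesis .
qed

lemma jacobi:
  assumes "X \<in> VF" "Y \<in> VF" "Z \<in> VF"
  shows "lie X (lie Y Z) = lie (lie X Y) Z + lie Y (lie X Z)"
proof (rule vfield_eqI_R)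
  fix f p assume f: "f \<in> R"
  have l: "lie X Y g = (\<lambda>p. X (Y g) p - Y (X g) p)" for X Y :: "'a vfield" and g by (simp add: lie_def)
  show "lie X (lie Y Z) f p = (lie (lie X Y) Z + lie Y (lie X Z)) f p"
    using assms f by (simp add: l VF_diff VF_R)
qed (intro lie_VF VF_plus assms)+

lemma lie_zero_right [simp]: "X \<in> VF ==> lie X 0 = 0"
  using lie_add_right[of X 0 0] by simp

lemma lie_zero_left [simp]: "X \<in> VF ==> lie 0 X = 0"
  using lie_antisym[of 0 X] by simp

lemma lie_uminus_right: "X \<in> VF ==> Y \<in> VF ==> lie X (- Y) = - lie X Y"
  using lie_add_right[of X Y "- Y"] VF_uminus[of Y] by (simp add: eq_neg_iff_add_eq_0 add.commute)

lemma lie_diff_right: "X \<in> VF ==> Y \<in> VF ==> Z \<in> VF ==> lie X (Y - Z) = lie X Y - lie X Z"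
  using lie_add_right[of X Y "- Z"] VF_uminus[of Z] by (simp add: lie_uminus_right)

lemma lie_uminus_left: "X \<in> VF ==> Y \<in> VF ==> lie (- X) Y = - lie X Y"
  using lie_uminus_right[of Y X] lie_antisym[of "- X" Y] lie_antisym[of X Y] by simp

lemma lie_diff_left: "X \<in> VF ==> Y \<in> VF ==> Z \<in> VF ==> lie (X - Y) Z = lie X Z - lie Y Z"
  using lie_add_left[of X "- Y" Z] VF_uminus[of Y] by (simp add: lie_uminus_left)

lemma lie_sum_left:
  "(\<And>i. i \<in> I ==> F i \<in> VF) ==> Y \<in> VF ==> lie (sum F I) Y = (\<Sum>i\<in>I. lie (F i) Y)"
  by (induction I rule: infinite_finite_induct) (simp_all add: lie_add_left VF_sum)

lemma lie_sum_right:
  "(\<And>i. i \<in> I ==> F i \<in> VF) ==> Y \<in> VF ==> lie Y (sum F I) = (\<Sum>i\<in>I. lie Y (F i))"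
  by (induction I rule: infinite_finite_induct) (simp_all add: lie_add_right VF_sum)

lemma lie_local_right:
  assumes "X \<in> VF" "Y \<in> VF" "Y' \<in> VF" "open Q" "\<And>q. q \<in> Q ==> vec_at Y q = vec_at Y' q" "q \<in> Q"
  shows "vec_at (lie X Y) q = vec_at (lie X Y') q"
proof
  fix f
  have e: "Y g q = Y' g q" if "q \<in> Q" for g q
    using assms(5)[OF that] by (metis vec_at_apply)
  show "vec_at (lie X Y) q f = vec_at (lie X Y') q f"
  proof (cases "f \<in> R")
    case True
    have "X (Y f) q = X (Y' f) q"
      by (rule VF_local[OF assms(1) VF_R[OF assms(2) True] VF_R[OF assms(3) True] assms(4,6)]) (rule e)
    then show ?thesis using e[OF assms(6)] by (simp add: vec_at_def lie_def)
  next
    case False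
    then show ?thesis
      using T_out[OF VF_T[OF lie_VF[OF assms(1,2)]] False] T_out[OF VF_T[OF lie_VF[OF assms(1,3)]] False] by simp
  qed
qed

lemma lie_local_left:
  assumes "X \<in> VF" "Y \<in> VF" "Y' \<in> VF" "open Q" "\<And>q. q \<in> Q ==> vec_at Y q = vec_at Y' q" "q \<in> Q"
  shows "vec_at (lie Y X) q = vec_at (lie Y' X) q"
  using lie_local_right[OF assms] lie_antisym[of Y X] lie_antisym[of Y' X] by simp

definition sub_dist :: "'a distribution => bool" where
  "sub_dist D \<longleftrightarrow> (\<forall>p. tv.subspace (D p) \<and> D p \<subseteq> T p)"

text \<open>Sections over \<open>U\<close> remain globally defined fields; only the condition on
  their values is restricted to \<open>U\<close>.\<close>

definition secs :: "'a distribution => 'a set => 'a vfield set" where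
  "secs D U = {X \<in> VF. \<forall>q\<in>U. vec_at X q \<in> D q}"

abbreviation Gam :: "'a distribution => 'a vfield set" where
  "Gam D \<equiv> secs D UNIV"

lemma carrier_dist_sections: "carrier (dist_sections A D) = Gam D"
  by (simp add: dist_sections_def submod_def secs_def)

lemma secs_VF: "X \<in> secs D U ==> X \<in> VF"
  and secs_at: "X \<in> secs D U ==> q \<in> U ==> vec_at X q \<in> D q"
  and secs_mono: "X \<in> secs D U ==> V \<subseteq> U ==> X \<in> secs D V"
  by (auto simp: secs_def)

lemma secsI: "X \<in> VF ==> (\<And>q. q \<in> U ==> vec_at X q \<in> D q) ==> X \<in> secs D U"
  by (simp add: secs_def)

lemma sub_dist_zero: "sub_dist D ==> 0 \<in> D p"
  and sub_dist_add: "sub_dist D ==> u \<in> D p ==> v \<in> D p ==> u + v \<in> D p"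
  and sub_dist_scale: "sub_dist D ==> u \<in> D p ==> (\<lambda>f. c * u f) \<in> D p"
  and sub_dist_T: "sub_dist D ==> u \<in> D p ==> u \<in> T p"
  unfolding sub_dist_def using tv.subspace_0 tv.subspace_add tv.subspace_scale by blast+

lemma sub_dist_uminus: "sub_dist D ==> u \<in> D p ==> - u \<in> D p"
  using sub_dist_scale[of D u p "-1"] by (simp only: tv_scale_neg1)

lemma sub_dist_diff: "sub_dist D ==> u \<in> D p ==> v \<in> D p ==> u - v \<in> D p"
  using sub_dist_add[of D u p "- v"] sub_dist_uminus[of D v p] by simp

lemma sub_dist_sum: "sub_dist D ==> (\<And>i. i \<in> I ==> u i \<in> D p) ==> sum u I \<in> D p"
  by (induction I rule: infinite_finite_induct) (simp_all add: sub_dist_zero sub_dist_add)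

lemma secs_add: "sub_dist D ==> X \<in> secs D U ==> Y \<in> secs D U ==> X + Y \<in> secs D U"
  and secs_diff: "sub_dist D ==> X \<in> secs D U ==> Y \<in> secs D U ==> X - Y \<in> secs D U"
  and secs_uminus: "sub_dist D ==> X \<in> secs D U ==> - X \<in> secs D U"
  and secs_zero: "sub_dist D ==> 0 \<in> secs D U"
  and secs_smul: "sub_dist D ==> h \<in> R ==> X \<in> secs D U ==> smul h X \<in> secs D U"
  by (auto simp: secs_def sub_dist_add sub_dist_diff sub_dist_uminus sub_dist_zero sub_dist_scale)

lemma secs_sum: "sub_dist D ==> (\<And>i. i \<in> I ==> F i \<in> secs D U) ==> sum F I \<in> secs D U"
  by (induction I rule: infinite_finite_induct) (simp_all add: secs_zero secs_add)

lemma secs_cut: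
  assumes D: "sub_dist D" and U: "open U" "p \<in> U" and X: "X \<in> secs D U"
  shows "\<exists>X' Q. X' \<in> Gam D \<and> open Q \<and> p \<in> Q \<and> Q \<subseteq> U \<and> (\<forall>q\<in>Q. vec_at X' q = vec_at X q)"
proof -
  from bump_ex[OF U] obtain b Q where b: "b \<in> R" "\<forall>q. q \<notin> U \<longrightarrow> b q = 0"
    "open Q" "p \<in> Q" "Q \<subseteq> U" "\<forall>q\<in>Q. b q = 1" by (elim exE conjE)
  have "vec_at (smul b X) q \<in> D q" for q
  proof (cases "q \<in> U")
    case True
    then show ?thesis using sub_dist_scale[OF D secs_at[OF X]] by simp
  next
    case False
    then have "b q = 0" using b(2) by blast
    then show ?thesis using sub_dist_zero[OF D, of q] by (simp add: zero_fun_def)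
  qed
  then have "smul b X \<in> Gam D"
    using VF_smul[OF b(1) secs_VF[OF X]] by (intro secsI)
  moreover have "vec_at (smul b X) q = vec_at X q" if "q \<in> Q" for q
    using that b(6) by (simp add: fun_eq_iff)
  ultimately show ?thesis
    using b(3-5) by (intro exI[of _ "smul b X"] exI[of _ Q]) simp
qed

text \<open>The condition over all open sets makes the bracket with \<open>X\<close> act on classes
  modulo \<open>D\<close> by means of local lifts.\<close>

definition preserves :: "'a distribution => 'a vfield => bool" where
  "preserves D X \<longleftrightarrow> X \<in> VF \<and> (\<forall>U N. open U \<longrightarrow> N \<in> secs D U \<longrightarrow> lie X N \<in> secs D U)"

lemma subbundle_sub_dist:
  assumes "subbundle A k D"
  shows "sub_dist D"
  unfolding sub_dist_def
proof
  fix p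
  from assms obtain U and X :: "nat => 'a vfield" where X: "p \<in> U" "\<forall>i<k. X i \<in> VF"
    "\<forall>q\<in>U. D q = tv.span ((\<lambda>i. vec_at (X i) q) ` {..<k}) \<and> tv.dim (D q) = k"
    unfolding subbundle_def by blast
  then have "D p = tv.span ((\<lambda>i. vec_at (X i) p) ` {..<k})" by blast
  moreover have "tv.span ((\<lambda>i. vec_at (X i) p) ` {..<k}) \<subseteq> T p"
    by (rule tv.span_minimal[OF _ tv_subspace_T]) (use X(2) VF_T in auto)
  ultimately show "tv.subspace (D p) \<and> D p \<subseteq> T p"
    by simp
qed

lemma subbundleE:
  assumes "subbundle A k D"
  obtains U and X :: "nat => 'a vfield" where "open U" "p \<in> U" "\<forall>i<k. X i \<in> VF"
    "\<forall>q\<in>U. D q = tv.span ((\<lambda>i. vec_at (X i) q) ` {..<k}) \<and> tv.dim (D q) = k"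
  using assms[unfolded subbundle_def, THEN spec, of p] by (elim exE conjE) (rule that)

text \<open>The frame fields in \<open>subbundle\<close> are global but take values in the
  distribution only near \<open>p\<close>; a bump function turns them into sections.\<close>

lemma subbundle_global_frame:
  assumes D: "subbundle A k D"
  shows "\<exists>Q Y. open Q \<and> p \<in> Q \<and> (\<forall>i. Y i \<in> Gam D) \<and>
    (\<forall>q\<in>Q. D q = tv.span ((\<lambda>i. vec_at (Y i) q) ` {..<k}) \<and> tv.dim (D q) = k)"
proof -
  obtain U and X :: "nat => 'a vfield" where X: "open U" "p \<in> U" "\<forall>i<k. X i \<in> VF"
    "\<forall>q\<in>U. D q = tv.span ((\<lambda>i. vec_at (X i) q) ` {..<k}) \<and> tv.dim (D q) = k"
    by (rule subbundleE[OF D, of p])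
  note sub = subbundle_sub_dist[OF D]
  from bump_ex[OF X(1,2)] obtain b Q where b: "b \<in> R" "\<forall>q. q \<notin> U \<longrightarrow> b q = 0"
    "open Q" "p \<in> Q" "Q \<subseteq> U" "\<forall>q\<in>Q. b q = 1" by (elim exE conjE)
  define Y where "Y = (\<lambda>i. if i < k then smul b (X i) else 0)"
  have 1: "Y i \<in> Gam D" for i
  proof (cases "i < k")
    case True
    have "vec_at (smul b (X i)) q \<in> D q" for q
    proof (cases "q \<in> U")
      case qU: True
      then have "vec_at (X i) q \<in> D q"
        using X(4) True by (auto intro: tv.span_base)
      then show ?thesis using sub_dist_scale[OF sub] by simp
    next
      case False
      then have "b q = 0" using b(2) by blast
      then show ?thesis using sub_dist_zero[OF sub, of q] by (simp add: zero_fun_def)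
    qed
    then show ?thesis using True X(3) b(1) by (simp add: Y_def secsI VF_smul)
  qed (simp add: Y_def secs_zero[OF sub])
  have 2: "D q = tv.span ((\<lambda>i. vec_at (Y i) q) ` {..<k}) \<and> tv.dim (D q) = k" if q: "q \<in> Q" for q
  proof -
    have "(\<lambda>i. vec_at (Y i) q) ` {..<k} = (\<lambda>i. vec_at (X i) q) ` {..<k}"
      using q b(6) by (intro image_cong) (simp_all add: Y_def)
    note e = this
    have "q \<in> U" using q b(5) by (rule subsetD[rotated])
    from bspec[OF X(4) this] show ?thesis unfolding e .
  qed
  show ?thesis
    by (rule exI[of _ Q], rule exI[of _ Y],
      intro conjI allI ballI b(3,4) 1 2[THEN conjunct1] 2[THEN conjunct2])
qed

end

section \<open>The distribution \<xi> and the tensoriality of its curvature\<close>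

locale pre_contact_manifold = smooth_manifold A
  for A :: "('a::{t2_space,second_countable_topology}, 'b::euclidean_space) chart set" +
  fixes \<xi> :: "'a distribution"
  assumes pre_contact: "pre_contact A \<xi>"
begin

abbreviation F where "F \<equiv> char_dist A \<xi>"

definition rk where "rk = DIM('b) - 1"

lemma DIM_eq: "DIM('b) = Suc rk"
  using DIM_positive[where 'a = 'b] by (simp add: rk_def)

lemma xi_subbundle: "subbundle A rk \<xi>"
  using pre_contact by (simp add: pre_contact_def rk_def)

lemma xi_sub: "sub_dist \<xi>"
  by (rule subbundle_sub_dist[OF xi_subbundle])

text \<open>A frame of \<xi> is completed by a transversal field \<open>Z\<close>. The dual
  coordinate \<open>c\<close> of \<open>Z\<close> has kernel \<xi>, so it is a local trivialisation
  of \<ell>.\<close>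

lemma xi_frame:
  "\<exists>Q Y Z a c. open Q \<and> p \<in> Q \<and> (\<forall>i::nat. Y i \<in> Gam \<xi>) \<and> Z \<in> VF \<and>
    (\<forall>i q. tlin (a i q)) \<and> (\<forall>i. \<forall>W\<in>VF. (\<lambda>q. a i q (vec_at W q)) \<in> R) \<and>
    (\<forall>q. tlin (c q)) \<and> (\<forall>W\<in>VF. (\<lambda>q. c q (vec_at W q)) \<in> R) \<and>
    (\<forall>q\<in>Q. \<forall>v\<in>T q. \<forall>f. v f = (\<Sum>i<rk. a i q v * Y i f q) + c q v * Z f q) \<and>
    (\<forall>q\<in>Q. \<forall>v\<in>T q. v \<in> \<xi> q \<longleftrightarrow> c q v = 0) \<and> (\<forall>q\<in>Q. c q (vec_at Z q) = 1)"
proof -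
  let ?n = "DIM('b)" and ?k = rk
  note n = DIM_eq
  from subbundle_global_frame[OF xi_subbundle, of p] obtain Q Y where Q: "open Q" "p \<in> Q"
    and Y: "\<forall>i. Y i \<in> Gam \<xi>"
    and fr: "\<forall>q\<in>Q. \<xi> q = tv.span ((\<lambda>i. vec_at (Y i) q) ` {..<?k}) \<and> tv.dim (\<xi> q) = ?k"
    by (elim exE conjE)
  obtain Z where Z: "Z \<in> VF" "vec_at Z p \<notin> tv.span ((\<lambda>i. vec_at (Y i) p) ` {..<?k})"
    using exists_vfield_not_in_span[of ?k p "\<lambda>i. vec_at (Y i) p"] n by auto
  \<comment> \<open>The transversal field takes the last index \<open>rk\<close>.\<close>
  define X where "X = (\<lambda>i. if i < ?k then Y i else Z)"
  have X: "X i \<in> VF" for i using Y Z(1) secs_VF by (auto simp: X_def)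
  have ind: "\<forall>c :: nat => real. (\<forall>f. (\<Sum>i<?n. c i * X i f p) = 0) \<longrightarrow> (\<forall>i<?n. c i = 0)"
  proof (intro allI impI)
    fix c :: "nat => real" and j assume c: "\<forall>f. (\<Sum>i<?n. c i * X i f p) = 0" and j: "j < ?n"
    have c': "(\<Sum>i<?k. c i * vec_at (Y i) p f) + c ?k * Z f p = 0" for f
      using spec[OF c, of f] unfolding n by (simp add: X_def vec_at_def)
    have ck: "c ?k = 0"
    proof (rule ccontr)
      assume ck: "c ?k \<noteq> 0"
      have "vec_at Z p = (\<lambda>f. \<Sum>i<?k. (- c i / c ?k) * vec_at (Y i) p f)"
      proof
        fix f
        have "(\<Sum>i<?k. (- c i / c ?k) * vec_at (Y i) p f) = - (\<Sum>i<?k. c i * vec_at (Y i) p f) / c ?k"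
          by (simp add: sum_divide_distrib sum_negf)
        also have "(\<Sum>i<?k. c i * vec_at (Y i) p f) = - c ?k * Z f p" using c'[of f] by simp
        finally show "vec_at Z p f = (\<Sum>i<?k. (- c i / c ?k) * vec_at (Y i) p f)"
          using ck by (simp add: vec_at_def)
      qed
      then show False using Z(2) span_familyI[of "\<lambda>i. - c i / c ?k" "\<lambda>i. vec_at (Y i) p" "{..<?k}"] by simp
    qed
    have "c i = 0" if "i < ?k" for i
    proof (rule frame_independent[of "\<xi> p" "\<lambda>i. vec_at (Y i) p" rk c, OF _ _ _ that])
      show "(\<Sum>i<rk. c i * vec_at (Y i) p f) = 0" for f using c'[of f] ck by simp
    qed (use bspec[OF fr Q(2)] in \<open>auto simp only:\<close>)
    then show "c j = 0" using ck j n less_Suc_eq[of j ?k] by auto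
  qed
  from coframe[OF X ind] obtain Q' \<alpha> where Q': "open Q'" "p \<in> Q'" and tl: "\<forall>i q. tlin (\<alpha> i q)"
    and sm: "\<forall>i. \<forall>W\<in>VF. (\<lambda>q. \<alpha> i q (vec_at W q)) \<in> R"
    and ex: "\<forall>q\<in>Q'. \<forall>v\<in>T q. \<forall>f. v f = (\<Sum>i<?n. \<alpha> i q v * X i f q)"
    and dl: "\<forall>q\<in>Q'. \<forall>i<?n. \<forall>k<?n. \<alpha> i q (vec_at (X k) q) = (if i = k then 1 else 0)"
    by (elim exE conjE)
  have ex': "v f = (\<Sum>i<?k. \<alpha> i q v * Y i f q) + \<alpha> ?k q v * Z f q" if "q \<in> Q \<inter> Q'" "v \<in> T q" for q v f
  proof -
    have "v f = (\<Sum>i<Suc ?k. \<alpha> i q v * X i f q)"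
      using ex that n by auto
    then show ?thesis by (simp add: X_def)
  qed
  have c0: "v \<in> \<xi> q \<longleftrightarrow> \<alpha> ?k q v = 0" if q: "q \<in> Q \<inter> Q'" and v: "v \<in> T q" for q v
  proof
    assume "v \<in> \<xi> q"
    then have "v \<in> tv.span ((\<lambda>i. vec_at (Y i) q) ` {..<?k})" using fr q by auto
    then obtain d where d: "v = (\<lambda>f. \<Sum>i<?k. d i * vec_at (Y i) q f)"
      by (rule span_familyE[OF finite_lessThan])
    have "\<alpha> ?k q (vec_at (Y i) q) = 0" if "i < ?k" for i
    proof -
      have "\<alpha> ?k q (vec_at (X i) q) = 0" using dl q that n by simp
      then show ?thesis using that by (simp add: X_def)
    qed
    then show "\<alpha> ?k q v = 0"
      unfolding d tlin_sum[OF tl[rule_format]] by simp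
  next
    assume "\<alpha> ?k q v = 0"
    then have "v = (\<lambda>f. \<Sum>i<?k. \<alpha> i q v * vec_at (Y i) q f)"
      using ex'[OF q v] by (simp add: fun_eq_iff vec_at_def)
    then have "v \<in> tv.span ((\<lambda>i. vec_at (Y i) q) ` {..<?k})"
      using span_familyI[of "\<lambda>i. \<alpha> i q v" "\<lambda>i. vec_at (Y i) q" "{..<?k}"] by simp
    then show "v \<in> \<xi> q" using fr q by auto
  qed
  have "\<alpha> ?k q (vec_at Z q) = 1" if "q \<in> Q \<inter> Q'" for q
  proof -
    have "\<alpha> ?k q (vec_at (X ?k) q) = 1" using dl that n by simp
    then show ?thesis by (simp add: X_def)
  qed
  then show ?thesis
    using Q Q' Y Z(1) tl sm ex' c0
    by (intro exI[of _ "Q \<inter> Q'"] exI[of _ Y] exI[of _ Z] exI[of _ \<alpha>] exI[of _ "\<alpha> ?k"]) (simp add: open_Int)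
qed

text \<open>Near \<open>p\<close> the field is X = \<Sum> h_i E_i with a frame E_i of \<xi> and
  h_i(p) = 0. At \<open>p\<close> the bracket [X,Y] reduces to the sum of the terms -Y(h_i) E_i,
  which lies in \<xi>.\<close>

lemma lie_xi_tensor:
  assumes X: "X \<in> Gam \<xi>" and Y: "Y \<in> Gam \<xi>" and z: "vec_at X p = 0"
  shows "vec_at (lie X Y) p \<in> \<xi> p"
proof -
  let ?k = rk
  from xi_frame[of p] obtain Q E Z a c where Q: "open Q" "p \<in> Q" and E: "\<forall>i::nat. E i \<in> Gam \<xi>"
    and tl: "\<forall>i q. tlin (a i q)" and a: "\<forall>i. \<forall>W\<in>VF. (\<lambda>q. a i q (vec_at W q)) \<in> R"
    and ex: "\<forall>q\<in>Q. \<forall>v\<in>T q. \<forall>f. v f = (\<Sum>i<?k. a i q v * E i f q) + c q v * Z f q"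
    and c: "\<forall>q\<in>Q. \<forall>v\<in>T q. v \<in> \<xi> q \<longleftrightarrow> c q v = 0"
    by (elim exE conjE)
  note XV = secs_VF[OF X] and YV = secs_VF[OF Y]
  have EV: "E i \<in> VF" for i using E secs_VF by blast
  define h where "h = (\<lambda>i q. a i q (vec_at X q))"
  have h: "h i \<in> R" for i unfolding h_def using a XV by blast
  have SV: "smul (h i) (E i) \<in> VF" for i by (intro VF_smul h EV)
  let ?X = "\<Sum>i<?k. smul (h i) (E i)"
  have "vec_at X q = vec_at ?X q" if q: "q \<in> Q" for q
  proof
    fix f
    have "c q (vec_at X q) = 0"
      using c q VF_T[OF XV] secs_at[OF X] by blast
    then show "vec_at X q f = vec_at ?X q f"
      using bspec[OF bspec[OF ex q] VF_T[OF XV], THEN spec, of f] by (simp add: sum_fun_apply h_def vec_at_def)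
  qed
  then have "vec_at (lie X Y) p = vec_at (lie ?X Y) p"
    by (intro lie_local_left[OF YV XV _ Q(1) _ Q(2)] VF_sum SV)
  also have "\<dots> = (\<Sum>i<?k. vec_at (smul (h i) (lie (E i) Y) - smul (Y (h i)) (E i)) p)"
    by (simp only: lie_sum_left[OF SV YV] vec_at_simps lie_smul_left[OF h EV YV])
  also have "\<dots> \<in> \<xi> p"
  proof (rule sub_dist_sum[OF xi_sub])
    fix i
    have "h i p = 0" unfolding h_def z using tl by (simp add: tlin_zero)
    then have e: "vec_at (smul (h i) (lie (E i) Y) - smul (Y (h i)) (E i)) p = (\<lambda>f. (- Y (h i) p) * vec_at (E i) p f)"
      by (simp add: fun_eq_iff)
    show "vec_at (smul (h i) (lie (E i) Y) - smul (Y (h i)) (E i)) p \<in> \<xi> p"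
      unfolding e by (rule sub_dist_scale[OF xi_sub secs_at[OF E[rule_format] UNIV_I]])
  qed
  finally show ?thesis .
qed

end

section \<open>Linear coset representatives and the characteristic distribution\<close>

interpretation tvp: vector_space_pair "\<lambda>(c::real) (v::'a tvec) f. c * v f" "\<lambda>(c::real) (v::'a tvec) f. c * v f"
  by unfold_locales

definition tvec_lin :: "('a tvec => 'a tvec) => bool" where
  "tvec_lin \<pi> \<longleftrightarrow> (\<forall>u v. \<pi> (u + v) = \<pi> u + \<pi> v) \<and> (\<forall>c u. \<pi> (\<lambda>f. c * u f) = (\<lambda>f. c * \<pi> u f))"

text \<open>Such a map selects coset representatives linearly, so that coset arithmetic becomes
  addition of functions. It comes from extending a basis of \<open>D\<close> and sending that basis
  to 0.\<close>

lemma subspace_projection: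
  fixes D :: "'a tvec set"
  assumes D: "tv.subspace D"
  shows "\<exists>\<pi>. tvec_lin \<pi> \<and> (\<forall>v. \<pi> v = 0 \<longleftrightarrow> v \<in> D) \<and> (\<forall>v. v - \<pi> v \<in> D)"
proof -
  obtain B where B: "B \<subseteq> D" "tv.independent B" "D \<subseteq> tv.span B"
    by (rule tv.maximal_independent_subset)
  obtain B' where B': "B \<subseteq> B'" "B' \<subseteq> UNIV" "tv.independent B'" "UNIV \<subseteq> tv.span B'"
    by (rule tv.maximal_independent_subset_extend[OF subset_UNIV B(2)])
  define \<pi> where "\<pi> = tvp.construct B' (\<lambda>b. if b \<in> B then 0 else b)"
  have lin: "Vector_Spaces.linear (\<lambda>c v f. c * v f) (\<lambda>c v f. c * v f) \<pi>"
    unfolding \<pi>_def by (rule tvp.linear_construct[OF B'(3)])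
  have l: "tvec_lin \<pi>"
    unfolding tvec_lin_def using tvp.linear_add[OF lin] tvp.linear_scale[OF lin] by blast
  have d: "\<pi> (u - v) = \<pi> u - \<pi> v" for u v
    by (rule tvp.linear_diff[OF lin])
  have base: "\<pi> b = (if b \<in> B then 0 else b)" if "b \<in> B'" for b
    unfolding \<pi>_def by (rule tvp.construct_basis[OF B'(3) that])
  have S: "tv.subspace {v. v - \<pi> v \<in> D}"
  proof (rule tv.subspaceI)
    show "0 \<in> {v. v - \<pi> v \<in> D}"
      using tvp.linear_0[OF lin] tv.subspace_0[OF D] by simp
    fix x y assume "x \<in> {v. v - \<pi> v \<in> D}" "y \<in> {v. v - \<pi> v \<in> D}"
    then have "(x - \<pi> x) + (y - \<pi> y) \<in> D" using tv.subspace_add[OF D] by blast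
    moreover have "(x - \<pi> x) + (y - \<pi> y) = (x + y) - \<pi> (x + y)"
      using tvp.linear_add[OF lin, of x y] by simp
    ultimately show "x + y \<in> {v. v - \<pi> v \<in> D}" by simp
  next
    fix c x assume "x \<in> {v. v - \<pi> v \<in> D}"
    then have "(\<lambda>f. c * (x - \<pi> x) f) \<in> D" using tv.subspace_scale[OF D] by blast
    moreover have "(\<lambda>f. c * (x - \<pi> x) f) = (\<lambda>f. c * x f) - \<pi> (\<lambda>f. c * x f)"
      using tvp.linear_scale[OF lin, of c x] by (simp add: fun_eq_iff right_diff_distrib)
    ultimately show "(\<lambda>f. c * x f) \<in> {v. v - \<pi> v \<in> D}" by simp
  qed
  have "B' \<subseteq> {v. v - \<pi> v \<in> D}"
    using base B(1) tv.subspace_0[OF D] by auto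
  then have "tv.span B' \<subseteq> {v. v - \<pi> v \<in> D}"
    using S by (rule tv.span_minimal)
  then have vD: "v - \<pi> v \<in> D" for v
    using B'(4) by blast
  have "\<pi> v = 0" if v: "v \<in> D" for v
  proof (rule tvp.linear_eq_0_on_span[OF lin])
    show "v \<in> tv.span B" using v B(3) by blast
    show "\<pi> b = 0" if "b \<in> B" for b using base[of b] that B'(1) by auto
  qed
  moreover have "v \<in> D" if "\<pi> v = 0" for v
    using vD[of v] that by simp
  ultimately show ?thesis
    using l vD by blast
qed

text \<open>The choice is made at each point separately and need not vary smoothly: smoothness of a
  family of classes is always expressed by vector fields that lift it.\<close>

definition dist_proj :: "'a distribution => 'a => 'a tvec => 'a tvec" where
  "dist_proj D p = (SOME \<pi>. tvec_lin \<pi> \<and> (\<forall>v. \<pi> v = 0 \<longleftrightarrow> v \<in> D p) \<and> (\<forall>v. v - \<pi> v \<in> D p))"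

lemma image_plus_eq_iff:
  assumes D: "tv.subspace D"
  shows "(\<lambda>h. h + u) ` D = (\<lambda>h. h + v) ` D \<longleftrightarrow> u - v \<in> D"
proof
  assume "(\<lambda>h. h + u) ` D = (\<lambda>h. h + v) ` D"
  moreover have "u \<in> (\<lambda>h. h + u) ` D" using tv.subspace_0[OF D] by force
  ultimately obtain h where "h \<in> D" "u = h + v" by blast
  then show "u - v \<in> D" by simp
next
  assume uv: "u - v \<in> D"
  have "h + u \<in> (\<lambda>h. h + v) ` D" if "h \<in> D" for h
    using tv.subspace_add[OF D that uv] by (rule rev_image_eqI) simp
  moreover have "h + v \<in> (\<lambda>h. h + u) ` D" if "h \<in> D" for h
    using tv.subspace_diff[OF D that uv] by (rule rev_image_eqI) simp
  ultimately show "(\<lambda>h. h + u) ` D = (\<lambda>h. h + v) ` D" by blast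
qed

context smooth_manifold begin

lemma coset_eq: "D +>\<^bsub>tangent_space A p\<^esub> v = (\<lambda>h. h + v) ` D"
  by (auto simp: a_r_coset_def r_coset_def tangent_space_def plus_fun_def)

lemma quot_proj_apply: "quot_proj A D X p = (\<lambda>h. h + vec_at X p) ` D p"
  by (simp add: quot_proj_def coset_eq)

lemma zero_quot_fibre: "\<zero>\<^bsub>quot_fibre A D p\<^esub> = (\<lambda>h. h + 0) ` D p"
  by (simp add: quot_fibre_def quot_module_def)

end

context pre_contact_manifold begin

lemma curvature_zero_iff: "curvature A \<xi> X Y p = \<zero>\<^bsub>quot_fibre A \<xi> p\<^esub> \<longleftrightarrow> vec_at (lie X Y) p \<in> \<xi> p"
proof -
  have "tv.subspace (\<xi> p)" using xi_sub by (simp add: sub_dist_def)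
  from image_plus_eq_iff[OF this, of "vec_at (lie X Y) p" 0] show ?thesis
    by (simp only: curvature_def quot_proj_apply zero_quot_fibre diff_zero)
qed

lemma F_iff: "v \<in> F p \<longleftrightarrow> (\<exists>X\<in>Gam \<xi>. v = vec_at X p \<and> (\<forall>Y\<in>Gam \<xi>. vec_at (lie X Y) p \<in> \<xi> p))"
  unfolding char_dist_def carrier_dist_sections curvature_zero_iff by blast

lemma F_I: "X \<in> Gam \<xi> ==> (\<And>Y. Y \<in> Gam \<xi> ==> vec_at (lie X Y) p \<in> \<xi> p) ==> vec_at X p \<in> F p"
  unfolding F_iff by blast

text \<open>The extension in the definition of \<open>char_dist\<close> can be replaced by
  \<open>X\<close>, since their difference vanishes at \<open>p\<close> and
  \<open>lie_xi_tensor\<close> applies.\<close>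

lemma F_lie:
  assumes X: "X \<in> Gam \<xi>" and Xp: "vec_at X p \<in> F p" and Y: "Y \<in> Gam \<xi>"
  shows "vec_at (lie X Y) p \<in> \<xi> p"
proof -
  from Xp obtain X' where X': "X' \<in> Gam \<xi>" "vec_at X p = vec_at X' p" "vec_at (lie X' Y) p \<in> \<xi> p"
    unfolding F_iff using Y by blast
  have "vec_at (lie (X - X') Y) p \<in> \<xi> p"
    by (rule lie_xi_tensor[OF secs_diff[OF xi_sub X X'(1)] Y]) (simp add: X'(2))
  then have "vec_at (lie X Y) p - vec_at (lie X' Y) p \<in> \<xi> p"
    by (simp add: lie_diff_left[OF secs_VF[OF X] secs_VF[OF X'(1)] secs_VF[OF Y]])
  from sub_dist_add[OF xi_sub this X'(3)] show ?thesis by simp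
qed

lemma F_xi: "v \<in> F p ==> v \<in> \<xi> p"
  unfolding F_iff using secs_at by blast

lemma F_sub: "sub_dist F"
  unfolding sub_dist_def
proof
  fix p
  have "tv.subspace (F p)"
  proof (rule tv.subspaceI)
    show "0 \<in> F p"
    proof -
      have z: "0 \<in> Gam \<xi>" by (rule secs_zero[OF xi_sub])
      have "vec_at 0 p \<in> F p"
        by (rule F_I[OF z]) (simp add: secs_VF sub_dist_zero[OF xi_sub])
      then show ?thesis by simp
    qed
  next
    fix u v assume "u \<in> F p" "v \<in> F p"
    then obtain X Y where X: "X \<in> Gam \<xi>" "u = vec_at X p" "\<forall>Z\<in>Gam \<xi>. vec_at (lie X Z) p \<in> \<xi> p"
      and Y: "Y \<in> Gam \<xi>" "v = vec_at Y p" "\<forall>Z\<in>Gam \<xi>. vec_at (lie Y Z) p \<in> \<xi> p"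
      unfolding F_iff by blast
    have "vec_at (X + Y) p \<in> F p"
    proof (rule F_I[OF secs_add[OF xi_sub X(1) Y(1)]])
      fix Z assume Z: "Z \<in> Gam \<xi>"
      show "vec_at (lie (X + Y) Z) p \<in> \<xi> p"
        using sub_dist_add[OF xi_sub bspec[OF X(3) Z] bspec[OF Y(3) Z]]
        by (simp add: lie_add_left[OF secs_VF[OF X(1)] secs_VF[OF Y(1)] secs_VF[OF Z]])
    qed
    then show "u + v \<in> F p" using X Y by simp
  next
    fix c u assume "u \<in> F p"
    then obtain X where X: "X \<in> Gam \<xi>" "u = vec_at X p" "\<forall>Z\<in>Gam \<xi>. vec_at (lie X Z) p \<in> \<xi> p"
      unfolding F_iff by blast
    have "vec_at (smul (\<lambda>p. c) X) p \<in> F p"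
    proof (rule F_I[OF secs_smul[OF xi_sub R_const X(1)]])
      fix Z assume Z: "Z \<in> Gam \<xi>"
      have "vec_at (lie (smul (\<lambda>p. c) X) Z) p = (\<lambda>f. c * vec_at (lie X Z) p f)"
        by (simp add: lie_smul_left[OF R_const secs_VF[OF X(1)] secs_VF[OF Z]] VF_const[OF secs_VF[OF Z]] fun_eq_iff)
      then show "vec_at (lie (smul (\<lambda>p. c) X) Z) p \<in> \<xi> p"
        using sub_dist_scale[OF xi_sub bspec[OF X(3) Z]] by simp
    qed
    then show "(\<lambda>f. c * u f) \<in> F p" using X by simp
  qed
  then show "tv.subspace (F p) \<and> F p \<subseteq> T p"
    using F_xi sub_dist_T[OF xi_sub] by blast
qed

lemma secs_F_xi: "X \<in> secs F U ==> X \<in> secs \<xi> U"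
  using F_xi by (auto simp: secs_def)

text \<open>\<open>char_dist\<close> is defined by global sections of \<xi>. Cut-offs that agree
  near q with the given local sections have the same bracket there.\<close>

lemma lie_cut:
  assumes X: "X \<in> secs D U" "sub_dist D" and Y: "Y \<in> secs E U" "sub_dist E" and U: "open U" "q \<in> U"
  shows "\<exists>X' Y'. X' \<in> Gam D \<and> Y' \<in> Gam E \<and> vec_at (lie X Y) q = vec_at (lie X' Y') q \<and>
    vec_at X' q = vec_at X q \<and> vec_at Y' q = vec_at Y q"
proof -
  from secs_cut[OF X(2) U X(1)] obtain X' Q where X': "X' \<in> Gam D" "open Q" "q \<in> Q" "Q \<subseteq> U"
    "\<forall>q\<in>Q. vec_at X' q = vec_at X q" by (elim exE conjE)
  from secs_cut[OF Y(2) U Y(1)] obtain Y' Q' where Y': "Y' \<in> Gam E" "open Q'" "q \<in> Q'" "Q' \<subseteq> U"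
    "\<forall>q\<in>Q'. vec_at Y' q = vec_at Y q" by (elim exE conjE)
  have "vec_at (lie X Y) q = vec_at (lie X' Y) q"
    by (rule lie_local_left[OF secs_VF[OF Y(1)] secs_VF[OF X(1)] secs_VF[OF X'(1)] X'(2) _ X'(3)]) (simp add: X'(5))
  also have "\<dots> = vec_at (lie X' Y') q"
    by (rule lie_local_right[OF secs_VF[OF X'(1)] secs_VF[OF Y(1)] secs_VF[OF Y'(1)] Y'(2) _ Y'(3)]) (simp add: Y'(5))
  finally show ?thesis using X' Y' by blast
qed

lemma lie_F_xi:
  assumes "X \<in> secs F U" "Y \<in> secs \<xi> U" "open U"
  shows "lie X Y \<in> secs \<xi> U"
proof (rule secsI)
  show "lie X Y \<in> VF" using assms secs_VF by blast
  fix q assume q: "q \<in> U"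
  from lie_cut[OF assms(1) F_sub assms(2) xi_sub assms(3) q] obtain X' Y' where
    "X' \<in> Gam F" "Y' \<in> Gam \<xi>" "vec_at (lie X Y) q = vec_at (lie X' Y') q" by blast
  then show "vec_at (lie X Y) q \<in> \<xi> q"
    using F_lie[OF secs_F_xi secs_at[of X' F UNIV q]] by simp
qed

text \<open>Involutivity follows from the Jacobi identity, because brackets of T\<F> with \<xi> stay
  in \<xi>.\<close>

lemma lie_F_F:
  assumes "X \<in> secs F U" "Y \<in> secs F U" "open U"
  shows "lie X Y \<in> secs F U"
proof (rule secsI)
  show "lie X Y \<in> VF" using assms secs_VF by blast
  fix q assume q: "q \<in> U"
  from lie_cut[OF assms(1) F_sub assms(2) F_sub assms(3) q] obtain X' Y' where
    X: "X' \<in> Gam F" and Y: "Y' \<in> Gam F" and e: "vec_at (lie X Y) q = vec_at (lie X' Y') q" by blast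
  have "vec_at (lie X' Y') q \<in> F q"
  proof (rule F_I[OF lie_F_xi[OF X secs_F_xi[OF Y] open_UNIV]])
    fix Z assume Z: "Z \<in> Gam \<xi>"
    have "lie (lie X' Y') Z = lie X' (lie Y' Z) - lie Y' (lie X' Z)"
      using jacobi[OF secs_VF[OF X] secs_VF[OF Y] secs_VF[OF Z]] by simp
    moreover have "lie X' (lie Y' Z) \<in> Gam \<xi>" "lie Y' (lie X' Z) \<in> Gam \<xi>"
      by (intro lie_F_xi X Y Z open_UNIV)+
    ultimately show "vec_at (lie (lie X' Y') Z) q \<in> \<xi> q"
      using secs_at[OF secs_diff[OF xi_sub]] by (metis UNIV_I)
  qed
  then show "vec_at (lie X Y) q \<in> F q" using e by simp
qed

lemma preserves_xi: "X \<in> Gam F ==> preserves \<xi> X"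
  and preserves_F: "X \<in> Gam F ==> preserves F X"
  by (simp_all add: preserves_def secs_VF lie_F_xi[OF secs_mono[OF _ subset_UNIV]] lie_F_F[OF secs_mono[OF _ subset_UNIV]])

end

section \<open>A complement G and its intersection with \<xi>\<close>

locale pre_contact_complement = pre_contact_manifold A \<xi>
  for A :: "('a::{t2_space,second_countable_topology}, 'b::euclidean_space) chart set" and \<xi> +
  fixes G :: "'a distribution"
  assumes complement: "complementary A F G"
begin

lemma G_subbundle: obtains k where "subbundle A k G"
  using complement unfolding complementary_def by (elim conjE exE) (rule that)

lemma G_sub: "sub_dist G"
  by (rule G_subbundle) (rule subbundle_sub_dist)

lemma FG_zero: "v \<in> F p ==> v \<in> G p ==> v = 0"
proof -
  assume v: "v \<in> F p" "v \<in> G p"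
  have "F p \<inter> G p = {\<zero>\<^bsub>tangent_space A p\<^esub>}"
    using complement unfolding complementary_def by blast
  then have "v = \<zero>\<^bsub>tangent_space A p\<^esub>" using v by blast
  then show "v = 0" by (simp add: tangent_space_def zero_fun_def)
qed

lemma FG_decomp:
  assumes "v \<in> T p"
  obtains f g where "f \<in> F p" "g \<in> G p" "v = f + g"
proof -
  have "F p <+>\<^bsub>tangent_space A p\<^esub> G p = T p"
    using complement unfolding complementary_def by blast
  then have "v \<in> F p <+>\<^bsub>tangent_space A p\<^esub> G p" using assms by simp
  then show ?thesis
    using that by (auto simp: set_add_def set_mult_def tangent_space_def plus_fun_def)
qed

definition xG :: "'a distribution" where "xG p = \<xi> p \<inter> G p"

lemma xG_sub: "sub_dist xG"
  using xi_sub G_sub tv.subspace_inter unfolding sub_dist_def xG_def by blast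

lemma xG_xi: "X \<in> secs xG U ==> X \<in> secs \<xi> U"
  and xG_G: "X \<in> secs xG U ==> X \<in> secs G U"
  by (auto simp: secs_def xG_def)

text \<open>At \<open>p\<close> a section of \<xi> splits into a part in T\<F> and a part in \<xi>
  \<inter> G. The first brackets with \<open>D\<close> into \<xi> by the definition of T\<F>, so it
  is enough to test vectors that span \<xi> \<inter> G.\<close>

lemma F_I_xG:
  assumes D: "D \<in> Gam \<xi>" and y: "\<And>i::nat. y i \<in> Gam xG"
    and sp: "\<And>v. v \<in> xG p ==> \<exists>d. v = (\<lambda>f. \<Sum>i<m. d i * y i f p)"
    and l: "\<And>i. i < m ==> vec_at (lie D (y i)) p \<in> \<xi> p"
  shows "vec_at D p \<in> F p"
proof (rule F_I[OF D])
  fix Y assume Y: "Y \<in> Gam \<xi>"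
  obtain f g where fg: "f \<in> F p" "g \<in> G p" "vec_at Y p = f + g"
    by (rule FG_decomp[OF VF_T[OF secs_VF[OF Y]]])
  from fg(1) obtain X where X: "X \<in> Gam \<xi>" "f = vec_at X p" "vec_at (lie X D) p \<in> \<xi> p"
    unfolding F_iff using D by blast
  have "g = vec_at Y p - f" using fg(3) by simp
  then have "g \<in> \<xi> p"
    using sub_dist_diff[OF xi_sub secs_at[OF Y] F_xi[OF fg(1)]] by simp
  then have "g \<in> xG p" using fg(2) by (simp add: xG_def)
  from sp[OF this] obtain d where d: "g = (\<lambda>f. \<Sum>i<m. d i * y i f p)" ..
  have yx: "y i \<in> Gam \<xi>" for i by (rule xG_xi[OF y])
  let ?S = "\<Sum>i<m. smul (\<lambda>p. d i) (y i)"
  have S: "?S \<in> Gam \<xi>" by (intro secs_sum[OF xi_sub] secs_smul[OF xi_sub] R_const yx)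
  have "vec_at ?S p = g" by (simp add: d fun_eq_iff sum_fun_apply vec_at_def)
  \<comment> \<open>\<open>Y\<close> agrees at \<open>p\<close> with a section of known bracket
    behaviour, and by tensoriality only the value at \<open>p\<close> matters.\<close>
  then have z: "vec_at (Y - (X + ?S)) p = 0" using fg(3) X(2) by (simp del: vec_at_simps(6))
  have "vec_at (lie (Y - (X + ?S)) D) p \<in> \<xi> p"
    by (rule lie_xi_tensor[OF _ D z]) (intro secs_diff[OF xi_sub Y] secs_add[OF xi_sub X(1)] S)
  then have 1: "vec_at (lie Y D) p - (vec_at (lie X D) p + vec_at (lie ?S D) p) \<in> \<xi> p"
    using secs_VF[OF Y] secs_VF[OF X(1)] secs_VF[OF S] secs_VF[OF D] VF_plus
    by (simp only: lie_diff_left lie_add_left vec_at_simps)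
  have "lie ?S D = (\<Sum>i<m. lie (smul (\<lambda>p. d i) (y i)) D)"
    by (rule lie_sum_left) (use VF_smul[OF R_const secs_VF[OF yx]] secs_VF[OF D] in simp_all)
  then have "vec_at (lie ?S D) p = (\<Sum>i<m. vec_at (lie (smul (\<lambda>p. d i) (y i)) D) p)"
    by simp
  moreover have "vec_at (lie (smul (\<lambda>p. d i) (y i)) D) p \<in> \<xi> p" if "i < m" for i
  proof -
    have "vec_at (lie (smul (\<lambda>p. d i) (y i)) D) p = (\<lambda>f. (- d i) * vec_at (lie D (y i)) p f)"
      by (simp add: lie_smul_left[OF R_const secs_VF[OF yx] secs_VF[OF D]] VF_const[OF secs_VF[OF D]]
        lie_antisym[of "y i" D] fun_eq_iff)
    then show ?thesis using sub_dist_scale[OF xi_sub l[OF that], of "- d i"] by simp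
  qed
  ultimately have "vec_at (lie ?S D) p \<in> \<xi> p"
    using sub_dist_sum[OF xi_sub, of "{..<m}"] by (simp only: lessThan_iff)
  from sub_dist_add[OF xi_sub 1 sub_dist_add[OF xi_sub X(3) this]]
  have "vec_at (lie Y D) p \<in> \<xi> p" unfolding diff_add_cancel .
  from sub_dist_uminus[OF xi_sub this] show "vec_at (lie D Y) p \<in> \<xi> p"
    by (simp add: lie_antisym[of D Y])
qed

end

section \<open>Lifting sections through a complement\<close>

definition smulsec :: "('a => real) => ('a => 'a tvec) => ('a => 'a tvec)" where
  "smulsec h m = (\<lambda>p f. h p * m p f)"

context smooth_manifold begin

text \<open>Classes modulo \<open>D\<close> are encoded without cosets: \<open>dist_proj D p\<close> is a chosen linear map with
  kernel \<open>D p\<close>.\<close>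

definition cls :: "'a distribution => 'a vfield => 'a => 'a tvec" where
  "cls D X p = dist_proj D p (vec_at X p)"

definition lsec :: "'a distribution => ('a => 'a tvec) set" where
  "lsec D = {m. \<forall>p. \<exists>Q N. open Q \<and> p \<in> Q \<and> N \<in> VF \<and> (\<forall>q\<in>Q. m q = cls D N q)}"

context
  fixes D assumes D: "sub_dist D"
begin

lemma dist_proj_props:
  "tvec_lin (dist_proj D p)" "dist_proj D p v = 0 \<longleftrightarrow> v \<in> D p" "v - dist_proj D p v \<in> D p"
proof -
  have "tv.subspace (D p)" using D by (simp add: sub_dist_def)
  from someI_ex[OF subspace_projection[OF this]]
  show "tvec_lin (dist_proj D p)" "dist_proj D p v = 0 \<longleftrightarrow> v \<in> D p" "v - dist_proj D p v \<in> D p"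
    unfolding dist_proj_def by blast+
qed

lemma dist_proj_add: "dist_proj D p (u + v) = dist_proj D p u + dist_proj D p v"
  and dist_proj_scale: "dist_proj D p (\<lambda>f. c * u f) = (\<lambda>f. c * dist_proj D p u f)"
  using dist_proj_props(1)[of p] unfolding tvec_lin_def by blast+

lemma dist_proj_uminus: "dist_proj D p (- u) = - dist_proj D p u"
  using dist_proj_scale[of p "-1" u] by (simp add: fun_eq_iff fun_Compl_def)

lemma dist_proj_diff: "dist_proj D p (u - v) = dist_proj D p u - dist_proj D p v"
  using dist_proj_add[of p u "- v"] by (simp add: dist_proj_uminus)

lemma cls_add: "cls D (X + Y) p = cls D X p + cls D Y p"
  and cls_diff: "cls D (X - Y) p = cls D X p - cls D Y p"
  and cls_uminus: "cls D (- X) p = - cls D X p"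
  and cls_smul: "cls D (smul h X) p = (\<lambda>f. h p * cls D X p f)"
  by (simp_all add: cls_def dist_proj_add dist_proj_diff dist_proj_uminus dist_proj_scale)

lemma cls_zero_iff: "cls D X p = 0 \<longleftrightarrow> vec_at X p \<in> D p"
  by (simp add: cls_def dist_proj_props)

lemma cls_zero: "cls D 0 p = 0"
  by (simp add: cls_zero_iff sub_dist_zero[OF D])

lemma cls_eq_iff: "cls D X p = cls D Y p \<longleftrightarrow> vec_at X p - vec_at Y p \<in> D p"
  using cls_zero_iff[of "X - Y" p] by (simp add: cls_diff)

lemma cls_sum: "cls D (sum X I) p = (\<Sum>i\<in>I. cls D (X i) p)"
proof (induction I rule: infinite_finite_induct)
  case (insert x I)
  show ?case
    unfolding sum.insert[OF insert(1,2)] cls_add insert(3) ..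
qed (simp_all only: sum.infinite sum.empty cls_zero not_False_eq_True)

lemma lsecI: "(\<And>p. \<exists>Q N. open Q \<and> p \<in> Q \<and> N \<in> VF \<and> (\<forall>q\<in>Q. m q = cls D N q)) ==> m \<in> lsec D"
  by (simp add: lsec_def)

lemma lsecE:
  assumes "m \<in> lsec D"
  obtains Q N where "open Q" "p \<in> Q" "N \<in> VF" "\<And>q. q \<in> Q ==> m q = cls D N q"
  using assms[unfolded lsec_def, THEN CollectD, THEN spec, of p] by (elim exE conjE) (rule that, auto)

lemma cls_lsec: "X \<in> VF ==> cls D X \<in> lsec D"
  by (rule lsecI) (intro exI[of _ UNIV] exI[of _ X], simp)

lemma lsec_add:
  assumes "m \<in> lsec D" "n \<in> lsec D"
  shows "m + n \<in> lsec D"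
proof (rule lsecI)
  fix p
  obtain Q N where N: "open Q" "p \<in> Q" "N \<in> VF" "\<And>q. q \<in> Q ==> m q = cls D N q"
    by (rule lsecE[OF assms(1), of p]) (rule that)
  obtain Q' N' where N': "open Q'" "p \<in> Q'" "N' \<in> VF" "\<And>q. q \<in> Q' ==> n q = cls D N' q"
    by (rule lsecE[OF assms(2), of p]) (rule that)
  show "\<exists>Q N. open Q \<and> p \<in> Q \<and> N \<in> VF \<and> (\<forall>q\<in>Q. (m + n) q = cls D N q)"
    using N N' VF_plus[OF N(3) N'(3)]
    by (intro exI[of _ "Q \<inter> Q'"] exI[of _ "N + N'"]) (simp add: cls_add open_Int)
qed

lemma lsec_smul:
  assumes "h \<in> R" "m \<in> lsec D"
  shows "smulsec h m \<in> lsec D"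
proof (rule lsecI)
  fix p
  obtain Q N where N: "open Q" "p \<in> Q" "N \<in> VF" "\<And>q. q \<in> Q ==> m q = cls D N q"
    by (rule lsecE[OF assms(2), of p]) (rule that)
  show "\<exists>Q N. open Q \<and> p \<in> Q \<and> N \<in> VF \<and> (\<forall>q\<in>Q. smulsec h m q = cls D N q)"
    using N VF_smul[OF assms(1) N(3)]
    by (intro exI[of _ Q] exI[of _ "smul h N"]) (simp add: cls_smul smulsec_def)
qed

lemma lsec_zero: "0 \<in> lsec D"
proof -
  have "cls D 0 = 0" by (rule ext) (simp add: cls_zero)
  then show ?thesis using cls_lsec[OF VF_zero] by simp
qed

lemma smulsec_neg1: "smulsec (\<lambda>p. -1) m = - m"
  by (simp add: smulsec_def fun_eq_iff)

lemma lsec_uminus: "m \<in> lsec D ==> - m \<in> lsec D"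
  using lsec_smul[OF R_const[of "-1"]] by (simp add: smulsec_neg1)

lemma lsec_diff: "m \<in> lsec D ==> n \<in> lsec D ==> m - n \<in> lsec D"
  using lsec_add[OF _ lsec_uminus] by fastforce

end

end

context pre_contact_manifold begin

lemma xi_triv:
  obtains Q Z c where "open Q" "p \<in> Q" "Z \<in> VF" "\<And>q. tlin (c q)"
    "\<And>W. W \<in> VF ==> (\<lambda>q. c q (vec_at W q)) \<in> R"
    "\<And>q v. q \<in> Q ==> v \<in> T q ==> v \<in> \<xi> q \<longleftrightarrow> c q v = 0" "\<And>q. q \<in> Q ==> c q (vec_at Z q) = 1"
  using xi_frame[of p] by (elim exE conjE) (rule that, assumption, assumption, assumption, (drule spec; assumption)?, auto)

end

context pre_contact_complement begin

text \<open>\<open>Z\<close> trivialises \<ell> inside G, the \<open>y j\<close> span \<xi> \<inter>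
  G, and the \<open>w j\<close> are dual to them under the curvature. The duals exist because the
  curvature is nondegenerate on \<xi> \<inter> G, which meets T\<F> in 0.\<close>

lemma solve_frame:
  "\<exists>Q Z m y w c. open Q \<and> p \<in> Q \<and> Z \<in> Gam G \<and> (\<forall>j::nat. y j \<in> Gam xG) \<and> (\<forall>j::nat. w j \<in> Gam xG) \<and>
    (\<forall>q. tlin (c q)) \<and> (\<forall>W\<in>VF. (\<lambda>q. c q (vec_at W q)) \<in> R) \<and>
    (\<forall>q\<in>Q. \<forall>v\<in>T q. v \<in> \<xi> q \<longleftrightarrow> c q v = 0) \<and> (\<forall>q\<in>Q. c q (vec_at Z q) = 1) \<and>
    (\<forall>q\<in>Q. \<forall>j<m. \<forall>k<m. c q (vec_at (lie (w j) (y k)) q) = (if j = k then 1 else 0)) \<and>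
    (\<forall>q\<in>Q. \<forall>v\<in>xG q. \<exists>d. v = (\<lambda>f. \<Sum>k<m. d k * y k f q))"
proof -
  obtain r where r: "subbundle A r G" by (rule G_subbundle)
  from subbundle_global_frame[OF r, of p] obtain Q0 g0 where Q0: "open Q0" "p \<in> Q0"
    and g0: "\<forall>i. g0 i \<in> Gam G"
    and fr0: "\<forall>q\<in>Q0. G q = tv.span ((\<lambda>i. vec_at (g0 i) q) ` {..<r}) \<and> tv.dim (G q) = r"
    by (elim exE conjE)
  obtain Q1 Z1 c where Q1: "open Q1" "p \<in> Q1" and Z1: "Z1 \<in> VF" and tl: "\<And>q. tlin (c q)"
    and cR: "\<And>W. W \<in> VF ==> (\<lambda>q. c q (vec_at W q)) \<in> R"
    and cx: "\<And>q v. q \<in> Q1 ==> v \<in> T q ==> v \<in> \<xi> q \<longleftrightarrow> c q v = 0" and cZ1: "\<And>q. q \<in> Q1 ==> c q (vec_at Z1 q) = 1"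
    by (rule xi_triv[of p]) (rule that)
  have g0G: "vec_at (g0 i) q \<in> G q" for i q using secs_at g0 by blast
  have g0V: "g0 i \<in> VF" for i using secs_VF g0 by blast
  \<comment> \<open>G is transversal to \<xi>: otherwise \<open>c p\<close> would vanish on T\<F>
    and on G, hence everywhere, although it is 1 on \<open>Z1\<close>.\<close>
  obtain i0 where i0: "i0 < r" "c p (vec_at (g0 i0) p) \<noteq> 0"
  proof (rule ccontr)
    assume "\<not> thesis"
    then have n: "\<forall>i<r. c p (vec_at (g0 i) p) = 0" using that by blast
    obtain f g where fg: "f \<in> F p" "g \<in> G p" "vec_at Z1 p = f + g"
      by (rule FG_decomp[OF VF_T[OF Z1]])
    have "g \<in> tv.span ((\<lambda>i. vec_at (g0 i) p) ` {..<r})" using fg(2) fr0 Q0(2) by blast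
    then obtain d where d: "g = (\<lambda>f. \<Sum>i<r. d i * vec_at (g0 i) p f)"
      by (rule span_familyE[OF finite_lessThan])
    have "c p g = 0" unfolding d tlin_sum[OF tl] using n by simp
    moreover have "c p f = 0"
      using cx[OF Q1(2) sub_dist_T[OF F_sub fg(1)]] F_xi[OF fg(1)] by simp
    ultimately show False using cZ1[OF Q1(2)] fg(3) by (simp add: tlin_add[OF tl])
  qed
  \<comment> \<open>The transversal frame vector is exchanged into the last place \<open>m\<close>.
    The \<open>m\<close> remaining ones, corrected by multiples of \<open>Z\<close>, span \<xi>
    \<inter> G.\<close>
  define m where "m = r - 1"
  have rm: "r = Suc m" using i0 by (simp add: m_def)
  define g where "g = (\<lambda>i. g0 (Transposition.transpose i0 m i))"
  have gG: "vec_at (g i) q \<in> G q" for i q by (simp add: g_def g0G)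
  have gV: "g i \<in> VF" for i by (simp add: g_def g0V)
  have gGam: "g i \<in> Gam G" for i using g0 by (simp add: g_def)
  have im: "(\<lambda>i. vec_at (g i) q) ` {..<r} = (\<lambda>i. vec_at (g0 i) q) ` {..<r}" for q
  proof -
    have t: "Transposition.transpose i0 m ` {..<r} = {..<r}"
      using i0 rm by (intro transpose_image_eq) auto
    have "(\<lambda>i. vec_at (g i) q) ` {..<r} = (\<lambda>i. vec_at (g0 i) q) ` Transposition.transpose i0 m ` {..<r}"
      by (simp add: g_def image_image)
    then show ?thesis unfolding t .
  qed
  have frG: "G q = tv.span ((\<lambda>i. vec_at (g i) q) ` {..<Suc m})" if "q \<in> Q0" for q
    using bspec[OF fr0 that, THEN conjunct1] im[of q] rm by simp
  have frD: "tv.dim (G q) = Suc m" if "q \<in> Q0" for q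
    using bspec[OF fr0 that, THEN conjunct2] rm by simp
  have cgm: "c p (vec_at (g m) p) \<noteq> 0" using i0 by (simp add: g_def)
  from R_local_inverse[OF cR[OF gV] cgm] obtain h Q2 where h: "h \<in> R" "open Q2" "p \<in> Q2"
    "\<forall>q\<in>Q2. c q (vec_at (g m) q) \<noteq> 0 \<and> h q * c q (vec_at (g m) q) = 1" by (elim exE conjE)
  define Z where "Z = smul h (g m)"
  have ZG: "Z \<in> Gam G" unfolding Z_def by (rule secs_smul[OF G_sub h(1) gGam])
  have ZV: "Z \<in> VF" by (rule secs_VF[OF ZG])
  have cZ: "c q (vec_at Z q) = 1" if "q \<in> Q2" for q
    using h(4) that by (simp add: Z_def tlin_scale[OF tl])
  define S where "S = Q0 \<inter> Q1 \<inter> Q2"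
  have S: "open S" "p \<in> S" using Q0 Q1 h by (auto simp: S_def)
  \<comment> \<open>The correction puts the fields into \<xi> only where \<open>c\<close> describes
    \<xi>; the bump function makes them global sections of \<xi> \<inter> G.\<close>
  from bump_ex[OF S] obtain b Q3 where b: "b \<in> R" "\<forall>q. q \<notin> S \<longrightarrow> b q = 0"
    "open Q3" "p \<in> Q3" "Q3 \<subseteq> S" "\<forall>q\<in>Q3. b q = 1" by (elim exE conjE)
  define u where "u = (\<lambda>j q. c q (vec_at (g j) q))"
  have uR: "u j \<in> R" for j unfolding u_def by (rule cR[OF gV])
  define y where "y = (\<lambda>j. smul b (g j - smul (u j) Z))"
  have yV: "y j \<in> VF" for j
    unfolding y_def by (intro VF_smul b(1) VF_minus gV uR ZV)
  have yG: "y j \<in> Gam xG" for j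
  proof (rule secsI[OF yV])
    fix q
    have G: "vec_at (y j) q \<in> G q"
      unfolding y_def by (rule secs_at[OF _ UNIV_I]) (intro secs_smul[OF G_sub] b(1) secs_diff[OF G_sub] gGam uR ZG)
    moreover have "vec_at (y j) q \<in> \<xi> q"
    proof (cases "q \<in> S")
      case True
      then have "q \<in> Q2" by (simp add: S_def)
      have "c q (vec_at (y j) q) = b q * (u j q - u j q * c q (vec_at Z q))"
        by (simp only: y_def vec_at_simps tlin_scale[OF tl] tlin_diff[OF tl] u_def)
      then have "c q (vec_at (y j) q) = 0"
        using cZ[OF \<open>q \<in> Q2\<close>] by simp
      then show ?thesis using cx[OF _ VF_T[OF yV]] True by (auto simp: S_def)
    next
      case False
      then have "b q = 0" using b(2) by blast
      then show ?thesis using sub_dist_zero[OF xi_sub, of q] by (simp add: y_def zero_fun_def)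
    qed
    ultimately show "vec_at (y j) q \<in> xG q" by (simp add: xG_def)
  qed
  have yat: "vec_at (y j) q f = vec_at (g j) q f - u j q * (h q * vec_at (g m) q f)" if "q \<in> Q3" for j q f
    using b(6) that by (simp add: y_def Z_def)
  have sp: "\<exists>d. v = (\<lambda>f. \<Sum>k<m. d k * y k f q)" if q: "q \<in> Q3" and v: "v \<in> xG q" for q v
  proof -
    have qS: "q \<in> Q0" "q \<in> Q1" "q \<in> Q2" using q b(5) by (auto simp: S_def)
    have "v \<in> tv.span ((\<lambda>i. vec_at (g i) q) ` {..<Suc m})" using v frG[OF qS(1)] by (simp add: xG_def)
    then obtain d where d: "v = (\<lambda>f. \<Sum>i<Suc m. d i * vec_at (g i) q f)"
      by (rule span_familyE[OF finite_lessThan])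
    have "c q v = (\<Sum>i<Suc m. d i * u i q)"
      unfolding d tlin_sum[OF tl] u_def ..
    moreover have "c q v = 0"
      using cx[OF qS(2), of v] v sub_dist_T[OF xi_sub] by (simp add: xG_def)
    ultimately have "d m * u m q = - (\<Sum>i<m. d i * u i q)" by simp
    then have "d m * u m q * h q = - (\<Sum>i<m. d i * u i q) * h q" by simp
    moreover have "u m q * h q = 1" using h(4) qS(3) by (simp add: u_def mult.commute)
    ultimately have dm: "d m = - (\<Sum>i<m. d i * u i q) * h q" by (simp add: mult.assoc)
    have "v f = (\<Sum>k<m. d k * y k f q)" for f
    proof -
      have "(\<Sum>k<m. d k * y k f q) = (\<Sum>k<m. d k * vec_at (g k) q f - d k * u k q * h q * vec_at (g m) q f)"
        by (intro sum.cong refl)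
          (simp only: vec_at_apply[of "y _" q, symmetric] yat[OF q] right_diff_distrib mult.assoc)
      also have "\<dots> = (\<Sum>k<m. d k * vec_at (g k) q f) + d m * vec_at (g m) q f"
        by (simp add: sum_subtractf dm sum_distrib_right)
      finally show ?thesis by (simp add: d)
    qed
    then show ?thesis by blast
  qed
  have ind: "d j = 0" if d: "\<And>f. (\<Sum>k<m. d k * y k f p) = 0" and j: "j < m" for d :: "nat => real" and j
  proof -
    let ?d = "\<lambda>i. if i < m then d i else - (\<Sum>k<m. d k * u k p) * h p"
    have "(\<Sum>i<Suc m. ?d i * vec_at (g i) p f) = 0" for f
    proof -
      have "(\<Sum>k<m. d k * y k f p) = (\<Sum>k<m. d k * vec_at (g k) p f - d k * u k p * h p * vec_at (g m) p f)"
        by (intro sum.cong refl)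
          (simp only: vec_at_apply[of "y _" p, symmetric] yat[OF b(4)] right_diff_distrib mult.assoc)
      also have "\<dots> = (\<Sum>i<Suc m. ?d i * vec_at (g i) p f)"
        by (simp add: sum_subtractf sum_distrib_right)
      finally show ?thesis using d by simp
    qed
    from frame_independent[of "G p" "\<lambda>i. vec_at (g i) p" "Suc m" ?d, OF frG[OF Q0(2)] frD[OF Q0(2)] this, of j] j
    show ?thesis by simp
  qed
  define M where "M = (\<lambda>i j q. c q (vec_at (lie (y j) (y i)) q))"
  have MR: "M i j \<in> R" for i j unfolding M_def by (rule cR[OF lie_VF[OF yV yV]])
  have xiV: "y j \<in> Gam \<xi>" for j by (rule xG_xi[OF yG])
  have csm: "c q (vec_at (lie (\<Sum>j<m. smul (e j) (y j)) (y k)) q) = (\<Sum>j<m. e j q * M k j q)"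
    if q: "q \<in> Q1" and e: "\<And>j. e j \<in> R" for e k q
  proof -
    have "lie (\<Sum>j<m. smul (e j) (y j)) (y k) = (\<Sum>j<m. smul (e j) (lie (y j) (y k)) - smul (y k (e j)) (y j))"
      using lie_sum_left[of "{..<m}" "\<lambda>j. smul (e j) (y j)" "y k"] VF_smul[OF e yV] yV
      by (simp add: lie_smul_left[OF e yV yV])
    moreover have "c q (vec_at (y j) q) = 0" for j
      using cx[OF q VF_T[OF yV]] secs_at[OF xiV UNIV_I] by blast
    ultimately show ?thesis
      by (simp add: tlin_sum'[OF tl] tlin_diff[OF tl] tlin_scale[OF tl] M_def)
  qed
  \<comment> \<open>A vector in the kernel of the curvature matrix at \<open>p\<close> yields a
    section of \<xi> \<inter> G whose value at \<open>p\<close> lies in T\<F>, hence is 0.\<close>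
  have ns: "\<forall>d :: nat => real. (\<forall>i<m. (\<Sum>j<m. M i j p * d j) = 0) \<longrightarrow> (\<forall>j<m. d j = 0)"
  proof (intro allI impI)
    fix d :: "nat => real" and j assume d: "\<forall>i<m. (\<Sum>j<m. M i j p * d j) = 0" and j: "j < m"
    let ?D = "\<Sum>j<m. smul (\<lambda>p. d j) (y j)"
    have D: "?D \<in> Gam xG" by (intro secs_sum[OF xG_sub] secs_smul[OF xG_sub] R_const yG)
    have "vec_at ?D p \<in> F p"
    proof (rule F_I_xG[OF xG_xi[OF D] yG sp[OF b(4)]])
      fix i assume i: "i < m"
      have "c p (vec_at (lie ?D (y i)) p) = (\<Sum>j<m. d j * M i j p)"
        by (rule csm[OF Q1(2) R_const])
      also have "\<dots> = (\<Sum>j<m. M i j p * d j)" by (simp add: mult.commute)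
      finally have "c p (vec_at (lie ?D (y i)) p) = 0" using d i by simp
      then show "vec_at (lie ?D (y i)) p \<in> \<xi> p"
        using cx[OF Q1(2) VF_T[OF lie_VF[OF secs_VF[OF D] yV]]] by blast
    qed
    then have z: "vec_at ?D p = 0"
      by (rule FG_zero) (rule secs_at[OF xG_G[OF D] UNIV_I])
    have "(\<Sum>k<m. d k * y k f p) = 0" for f
    proof -
      have "(\<Sum>k<m. d k * y k f p) = vec_at ?D p f"
        by (simp add: sum_fun_apply vec_at_def)
      also have "\<dots> = 0" by (simp only: z zero_fun_apply)
      finally show ?thesis .
    qed
    from ind[OF this j] show "d j = 0" .
  qed
  from smooth_matrix_inverse[OF MR ns] obtain N Q4 where N: "\<forall>i j. N i j \<in> R" "open Q4" "p \<in> Q4"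
    "\<forall>q\<in>Q4. \<forall>i<m. \<forall>k<m. (\<Sum>j<m. N i j q * M j k q) = (if i = k then 1 else 0) \<and>
       (\<Sum>j<m. M i j q * N j k q) = (if i = k then 1 else 0)" by (elim exE conjE)
  \<comment> \<open>The pairing of \<open>w j\<close> with \<open>y k\<close> is then the entry (k,
    j) of the product of \<open>M\<close> and its inverse.\<close>
  define w where "w = (\<lambda>j. \<Sum>l<m. smul (N l j) (y l))"
  have w: "w j \<in> Gam xG" for j
    unfolding w_def by (intro secs_sum[OF xG_sub] secs_smul[OF xG_sub] N(1)[rule_format] yG)
  have wy: "c q (vec_at (lie (w j) (y k)) q) = (if j = k then 1 else 0)" if "q \<in> Q3 \<inter> Q4" "j < m" "k < m" for q j k
  proof -
    have q1: "q \<in> Q1" using that(1) b(5) by (auto simp: S_def)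
    have "c q (vec_at (lie (w j) (y k)) q) = (\<Sum>l<m. N l j q * M k l q)"
      unfolding w_def by (rule csm[OF q1]) (rule N(1)[rule_format])
    also have "\<dots> = (\<Sum>l<m. M k l q * N l j q)" by (simp add: mult.commute)
    also have "\<dots> = (if k = j then 1 else 0)" using N(4) that by simp
    finally show ?thesis by auto
  qed
  have sub: "q \<in> Q1 \<and> q \<in> Q2" if "q \<in> Q3 \<inter> Q4" for q using that b(5) by (auto simp: S_def)
  show ?thesis
    apply (rule exI[of _ "Q3 \<inter> Q4"], rule exI[of _ Z], rule exI[of _ m], rule exI[of _ y], rule exI[of _ w], rule exI[of _ c])
    apply (intro conjI allI ballI impI)
    subgoal using b(3) N(2) by (rule open_Int)
    subgoal using b(4) N(3) by simp
    subgoal by (rule ZG)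
    subgoal by (rule yG)
    subgoal by (rule w)
    subgoal by (rule tl)
    subgoal by (rule cR)
    subgoal using sub cx by blast
    subgoal using sub cZ by blast
    subgoal by (rule wy)
    subgoal by (rule sp) simp_all
    done
qed

end

section \<open>Operators on sections of a quotient bundle, defined by local lifts\<close>

context smooth_manifold begin

text \<open>The rule \<open>r\<close> acts on vector fields and is evaluated on some lift of
  \<open>m\<close> near \<open>p\<close>. For a \<open>local_rule\<close> the choice of the lift
  does not matter, by \<open>lop_eq\<close>.\<close>

definition lop :: "'a distribution => ('a vfield => 'a => 'a tvec) => ('a => 'a tvec) => 'a => 'a tvec" where
  "lop D r m = (\<lambda>p. r (SOME N. N \<in> VF \<and> (\<exists>Q. open Q \<and> p \<in> Q \<and> (\<forall>q\<in>Q. m q = cls D N q))) p)"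

definition local_rule :: "'a distribution => ('a vfield => 'a => 'a tvec) => bool" where
  "local_rule D r \<longleftrightarrow> (\<forall>N\<in>VF. r N \<in> lsec D) \<and> (\<forall>N\<in>VF. \<forall>N'\<in>VF. r (N + N') = r N + r N') \<and>
    (\<forall>U N. open U \<longrightarrow> N \<in> secs D U \<longrightarrow> (\<forall>q\<in>U. r N q = 0))"

lemma local_ruleD:
  assumes "local_rule D r"
  shows "N \<in> VF ==> r N \<in> lsec D"
    and "N \<in> VF ==> N' \<in> VF ==> r (N + N') = r N + r N'"
    and "open U ==> N \<in> secs D U ==> q \<in> U ==> r N q = 0"
  using assms[unfolded local_rule_def, THEN conjunct1, rule_format]
    assms[unfolded local_rule_def, THEN conjunct2, THEN conjunct1, rule_format]
    assms[unfolded local_rule_def, THEN conjunct2, THEN conjunct2, rule_format]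
  by simp_all

text \<open>Two lifts of the same section differ near \<open>p\<close> by a section of
  \<open>D\<close>, which the third clause of \<open>local_rule\<close> sends to 0.\<close>

lemma lop_eq:
  assumes D: "sub_dist D" and r: "local_rule D r" and N: "N \<in> VF" and Q: "open Q" "p \<in> Q"
    and m: "\<And>q. q \<in> Q ==> m q = cls D N q"
  shows "lop D r m p = r N p"
proof -
  let ?P = "\<lambda>N. N \<in> VF \<and> (\<exists>Q. open Q \<and> p \<in> Q \<and> (\<forall>q\<in>Q. m q = cls D N q))"
  have "?P N" using N Q m by blast
  then have "?P (SOME N. ?P N)" by (rule someI[of ?P])
  then obtain Q' where N': "(SOME N. ?P N) \<in> VF" and Q': "open Q'" "p \<in> Q'" "\<forall>q\<in>Q'. m q = cls D (SOME N. ?P N) q"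
    by (elim conjE exE)
  define N' where "N' = (SOME N. ?P N)"
  have N'V: "N' \<in> VF" using N' by (simp add: N'_def)
  have d: "N' - N \<in> VF" by (rule VF_minus[OF N'V N])
  have "N' - N \<in> secs D (Q \<inter> Q')"
  proof (rule secsI[OF d])
    fix q assume q: "q \<in> Q \<inter> Q'"
    have "cls D N' q = cls D N q"
      using bspec[OF Q'(3), of q] m[of q] q unfolding N'_def by simp
    then show "vec_at (N' - N) q \<in> D q" using cls_eq_iff[OF D] by simp
  qed
  then have "r (N' - N) p = 0"
    using local_ruleD(3)[OF r open_Int[OF Q(1) Q'(1)]] Q Q' by blast
  moreover have "r N' = r N + r (N' - N)"
    using local_ruleD(2)[OF r N d] by simp
  ultimately have "r N' p = r N p" by simp
  then show ?thesis by (simp add: lop_def N'_def)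
qed

lemma lop_lsec:
  assumes D: "sub_dist D" and r: "local_rule D r" and m: "m \<in> lsec D"
  shows "lop D r m \<in> lsec D"
proof (rule lsecI[OF D])
  fix p
  obtain Q N where N: "open Q" "p \<in> Q" "N \<in> VF" "\<And>q. q \<in> Q ==> m q = cls D N q"
    by (rule lsecE[OF D m, of p]) (rule that)
  obtain Q' N' where N': "open Q'" "p \<in> Q'" "N' \<in> VF" "\<And>q. q \<in> Q' ==> r N q = cls D N' q"
    by (rule lsecE[OF D local_ruleD(1)[OF r N(3)], of p]) (rule that)
  have "lop D r m q = cls D N' q" if "q \<in> Q \<inter> Q'" for q
    using lop_eq[OF D r N(3,1) _ N(4), of q] N'(4)[of q] that by simp
  then show "\<exists>Q N. open Q \<and> p \<in> Q \<and> N \<in> VF \<and> (\<forall>q\<in>Q. lop D r m q = cls D N q)"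
    using N N' by (intro exI[of _ "Q \<inter> Q'"] exI[of _ N']) (simp add: open_Int)
qed

lemma lop_cls:
  assumes D: "sub_dist D" and r: "local_rule D r" and N: "N \<in> VF"
  shows "lop D r (cls D N) = r N"
  by (rule ext) (rule lop_eq[OF D r N open_UNIV], simp_all)

lemma lop_add:
  assumes D: "sub_dist D" and r: "local_rule D r" and m: "m \<in> lsec D" "n \<in> lsec D"
  shows "lop D r (m + n) = lop D r m + lop D r n"
proof
  fix p
  obtain Q N where N: "open Q" "p \<in> Q" "N \<in> VF" "\<And>q. q \<in> Q ==> m q = cls D N q"
    by (rule lsecE[OF D m(1), of p]) (rule that)
  obtain Q' N' where N': "open Q'" "p \<in> Q'" "N' \<in> VF" "\<And>q. q \<in> Q' ==> n q = cls D N' q"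
    by (rule lsecE[OF D m(2), of p]) (rule that)
  have "lop D r (m + n) p = r (N + N') p"
    by (rule lop_eq[OF D r VF_plus[OF N(3) N'(3)] open_Int[OF N(1) N'(1)]]) (use N N' in \<open>simp_all add: cls_add[OF D]\<close>)
  also have "\<dots> = r N p + r N' p" by (simp add: local_ruleD(2)[OF r N(3) N'(3)])
  also have "r N p = lop D r m p" by (rule lop_eq[OF D r N(3,1,2,4), symmetric])
  also have "r N' p = lop D r n p" by (rule lop_eq[OF D r N'(3,1,2,4), symmetric])
  finally show "lop D r (m + n) p = (lop D r m + lop D r n) p" unfolding plus_fun_apply .
qed

lemma lop_smul:
  assumes D: "sub_dist D" and r: "local_rule D r" and h: "h \<in> R" and m: "m \<in> lsec D"
    and s: "\<And>N. N \<in> VF ==> r (smul h N) = smulsec h (r N) + smulsec k (cls D N)"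
  shows "lop D r (smulsec h m) = smulsec h (lop D r m) + smulsec k m"
proof
  fix p
  obtain Q N where N: "open Q" "p \<in> Q" "N \<in> VF" "\<And>q. q \<in> Q ==> m q = cls D N q"
    by (rule lsecE[OF D m, of p]) (rule that)
  have "lop D r (smulsec h m) p = r (smul h N) p"
    by (rule lop_eq[OF D r VF_smul[OF h N(3)] N(1,2)]) (simp add: cls_smul[OF D] smulsec_def N(4))
  also have "\<dots> = smulsec h (r N) p + smulsec k (cls D N) p" by (simp add: s[OF N(3)])
  also have "\<dots> = smulsec h (lop D r m) p + smulsec k m p"
    using lop_eq[OF D r N(3,1,2,4)] N(4)[OF N(2)] by (simp add: smulsec_def)
  finally show "lop D r (smulsec h m) p = (smulsec h (lop D r m) + smulsec k m) p" by simp
qed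

lemma smulsec_add: "smulsec h (m + n) = smulsec h m + smulsec h n"
  and smulsec_zero: "smulsec h 0 = 0"
  by (simp_all add: smulsec_def fun_eq_iff algebra_simps)

lemma cls_add': "sub_dist D ==> cls D (X + Y) = cls D X + cls D Y"
  and cls_diff': "sub_dist D ==> cls D (X - Y) = cls D X - cls D Y"
  and cls_uminus': "sub_dist D ==> cls D (- X) = - cls D X"
  and cls_zero': "sub_dist D ==> cls D 0 = 0"
  and cls_smul': "sub_dist D ==> cls D (smul h X) = smulsec h (cls D X)"
  by (rule ext, simp only: cls_add cls_diff cls_uminus cls_zero cls_smul smulsec_def plus_fun_apply minus_apply uminus_apply zero_fun_apply)+

lemma cls_zero_secs: "sub_dist D ==> X \<in> VF ==> cls D X = 0 \<longleftrightarrow> X \<in> Gam D"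
  by (simp add: fun_eq_iff[of "cls D X"] cls_zero_iff secs_def)

end

context pre_contact_manifold begin

lemma cls_xi_zero: "X \<in> Gam \<xi> ==> cls \<xi> X = 0"
  using cls_zero_secs[OF xi_sub secs_VF] by blast

lemma cls_lie_smul_right:
  assumes "h \<in> R" "N \<in> VF" "Y \<in> Gam \<xi>"
  shows "cls \<xi> (lie N (smul h Y)) = smulsec h (cls \<xi> (lie N Y))"
  by (simp only: lie_smul_right[OF assms(1,2) secs_VF[OF assms(3)]] cls_add'[OF xi_sub] cls_smul'[OF xi_sub]
    cls_xi_zero[OF assms(3)] smulsec_zero add_0_right)

lemma cls_lie_smul_left:
  assumes "h \<in> R" "N \<in> VF" "Y \<in> VF"
  shows "cls \<xi> (lie (smul h N) Y) = smulsec h (cls \<xi> (lie N Y)) - smulsec (Y h) (cls \<xi> N)"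
  by (simp only: lie_smul_left[OF assms] cls_diff'[OF xi_sub] cls_smul'[OF xi_sub])

lemma xi_tensor_right:
  assumes "N \<in> Gam \<xi>" "Y \<in> Gam \<xi>" "Y' \<in> Gam \<xi>" "vec_at Y q = vec_at Y' q"
  shows "cls \<xi> (lie N Y) q = cls \<xi> (lie N Y') q"
proof -
  have "vec_at (lie (Y - Y') N) q \<in> \<xi> q"
    by (rule lie_xi_tensor[OF secs_diff[OF xi_sub assms(2,3)] assms(1)]) (simp add: assms(4))
  then have "- vec_at (lie (Y - Y') N) q \<in> \<xi> q" by (rule sub_dist_uminus[OF xi_sub])
  moreover have "lie N Y - lie N Y' = - lie (Y - Y') N"
    using assms secs_VF by (simp add: lie_antisym[of "Y - Y'" N] lie_diff_right)
  then have "vec_at (lie N Y) q - vec_at (lie N Y') q = - vec_at (lie (Y - Y') N) q"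
    by (metis vec_at_simps(2,3))
  ultimately show ?thesis using cls_eq_iff[OF xi_sub] by simp
qed

end

section \<open>Sections of G with prescribed class and prescribed brackets\<close>

context pre_contact_complement begin

lemma F_I_xG_cls:
  assumes D: "D \<in> VF" and U: "open U" "p \<in> U" and c: "\<And>q. q \<in> U ==> vec_at D q \<in> \<xi> q"
    and l: "\<And>Y. Y \<in> Gam xG ==> vec_at (lie D Y) p \<in> \<xi> p"
  shows "vec_at D p \<in> F p"
proof -
  from solve_frame[of p] obtain Q Z' m y w' c' where Q: "p \<in> Q" and y: "\<forall>j::nat. y j \<in> Gam xG"
    and sp: "\<forall>q\<in>Q. \<forall>v\<in>xG q. \<exists>d. v = (\<lambda>f. \<Sum>k<m. d k * y k f q)" by (elim exE conjE)
  have DU: "D \<in> secs \<xi> U" by (rule secsI[OF D c])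
  from secs_cut[OF xi_sub U DU] obtain D' V where D': "D' \<in> Gam \<xi>" "open V" "p \<in> V" "\<forall>q\<in>V. vec_at D' q = vec_at D q"
    by (elim exE conjE)
  have "vec_at D' p \<in> F p"
  proof (rule F_I_xG[OF D'(1) y[rule_format], where p = p and m = m])
    show "\<exists>d. v = (\<lambda>f. \<Sum>k<m. d k * y k f p)" if "v \<in> xG p" for v
      using bspec[OF bspec[OF sp Q] that] .
    fix i
    have "vec_at (lie D' (y i)) p = vec_at (lie D (y i)) p"
      by (rule lie_local_left[OF secs_VF[OF y[rule_format]] secs_VF[OF D'(1)] D D'(2) _ D'(3)]) (simp add: D'(4))
    then show "vec_at (lie D' (y i)) p \<in> \<xi> p" using l[OF y[rule_format, of i]] by simp
  qed
  then show ?thesis using D'(3,4) by simp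
qed

text \<open>The difference of two solutions lies in \<xi> near \<open>p\<close> and brackets with
  \<xi> \<inter> G into \<xi> at \<open>p\<close>, so its value there is in T\<F>; being in G as
  well, it vanishes.\<close>

lemma solve_unique:
  assumes N: "N \<in> Gam G" "N' \<in> Gam G" and U: "open U" "p \<in> U"
    and c: "\<And>q. q \<in> U ==> cls \<xi> N q = cls \<xi> N' q"
    and l: "\<And>Y. Y \<in> Gam xG ==> cls \<xi> (lie N Y) p = cls \<xi> (lie N' Y) p"
  shows "vec_at N p = vec_at N' p"
proof -
  have NV: "N \<in> VF" "N' \<in> VF" using N secs_VF by blast+
  have "vec_at (N - N') p \<in> F p"
  proof (rule F_I_xG_cls[OF VF_minus[OF NV] U])
    show "vec_at (N - N') q \<in> \<xi> q" if "q \<in> U" for q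
      using c[OF that] cls_eq_iff[OF xi_sub] by simp
    fix Y assume Y: "Y \<in> Gam xG"
    show "vec_at (lie (N - N') Y) p \<in> \<xi> p"
      using l[OF Y] cls_eq_iff[OF xi_sub] by (simp add: lie_diff_left[OF NV secs_VF[OF Y]])
  qed
  moreover have "vec_at (N - N') p \<in> G p"
    by (rule secs_at[OF secs_diff[OF G_sub N] UNIV_I])
  ultimately have "vec_at (N - N') p = 0" by (rule FG_zero)
  then show ?thesis by simp
qed

text \<open>The sections of the bundle of linear maps from \<xi> \<inter> G to \<ell>.\<close>

definition xG_linear :: "('a vfield => 'a => 'a tvec) => bool" where
  "xG_linear \<mu> \<longleftrightarrow> (\<forall>Y\<in>Gam xG. \<mu> Y \<in> lsec \<xi>) \<and> (\<forall>Y\<in>Gam xG. \<forall>Y'\<in>Gam xG. \<mu> (Y + Y') = \<mu> Y + \<mu> Y') \<and>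
    (\<forall>Y\<in>Gam xG. \<forall>h\<in>R. \<mu> (smul h Y) = smulsec h (\<mu> Y))"

lemma xG_linearD:
  assumes "xG_linear \<mu>"
  shows "Y \<in> Gam xG ==> \<mu> Y \<in> lsec \<xi>" "Y \<in> Gam xG ==> Y' \<in> Gam xG ==> \<mu> (Y + Y') = \<mu> Y + \<mu> Y'"
    "Y \<in> Gam xG ==> h \<in> R ==> \<mu> (smul h Y) = smulsec h (\<mu> Y)"
  using assms unfolding xG_linear_def by blast+

lemma xG_linear_zero: "xG_linear \<mu> ==> \<mu> 0 = 0"
  using xG_linearD(2)[of \<mu> 0 0] secs_zero[OF xG_sub] by simp

lemma xG_linear_sum:
  assumes \<mu>: "xG_linear \<mu>" and Y: "\<And>i. i \<in> I ==> Y i \<in> Gam xG"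
  shows "\<mu> (sum Y I) = (\<Sum>i\<in>I. \<mu> (Y i))"
  using Y
proof (induction I rule: infinite_finite_induct)
  case (insert x I)
  have "\<mu> (Y x + sum Y I) = \<mu> (Y x) + \<mu> (sum Y I)"
    by (rule xG_linearD(2)[OF \<mu>]) (use insert.prems in \<open>simp_all add: secs_sum[OF xG_sub]\<close>)
  moreover have "\<mu> (sum Y I) = (\<Sum>i\<in>I. \<mu> (Y i))" by (rule insert.IH) (use insert.prems in simp)
  ultimately show ?case unfolding sum.insert[OF insert(1,2)] by argo
qed (simp_all only: sum.infinite sum.empty xG_linear_zero[OF \<mu>] not_False_eq_True)

lemma xG_linear_local:
  assumes \<mu>: "xG_linear \<mu>" and Y: "Y \<in> Gam xG" "Y' \<in> Gam xG" and U: "open U" "p \<in> U"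
    and e: "\<And>q. q \<in> U ==> vec_at Y q = vec_at Y' q"
  shows "\<mu> Y p = \<mu> Y' p"
proof -
  from bump_ex[OF U] obtain b V where b: "b \<in> R" "\<forall>q. q \<notin> U \<longrightarrow> b q = 0"
    "p \<in> V" "\<forall>q\<in>V. b q = 1" by (elim exE conjE)
  have "smul b Y = smul b Y'"
  proof (rule vfield_eqI)
    fix q show "vec_at (smul b Y) q = vec_at (smul b Y') q"
      using e[of q] b(2) by (cases "q \<in> U") simp_all
  qed
  then have "smulsec b (\<mu> Y) p = smulsec b (\<mu> Y') p"
    using xG_linearD(3)[OF \<mu> Y(1) b(1)] xG_linearD(3)[OF \<mu> Y(2) b(1)] by simp
  then show ?thesis using b(3,4) by (simp add: smulsec_def)
qed

text \<open>The solution is a Z + \<Sum> t_j w_j in the frame of \<open>solve_frame\<close>: the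
  function \<open>a\<close> is fixed by the class, and \<open>t k\<close> is the amount by which
  \<theta>[a Z, y_k] misses the prescribed value, since the \<open>w j\<close> are dual to the
  \<open>y k\<close>.\<close>

lemma solve_local:
  assumes m: "m \<in> lsec \<xi>" and \<mu>: "xG_linear \<mu>"
  shows "\<exists>U N. open U \<and> p \<in> U \<and> N \<in> Gam G \<and> (\<forall>q\<in>U. cls \<xi> N q = m q) \<and>
    (\<forall>Y\<in>Gam xG. \<forall>q\<in>U. cls \<xi> (lie N Y) q = \<mu> Y q)"
proof -
  from solve_frame[of p] obtain Q Z n y w c where Q: "open Q" "p \<in> Q" and Z: "Z \<in> Gam G"
    and y: "\<forall>j::nat. y j \<in> Gam xG" and w: "\<forall>j::nat. w j \<in> Gam xG"
    and tl: "\<forall>q. tlin (c q)" and cR: "\<forall>W\<in>VF. (\<lambda>q. c q (vec_at W q)) \<in> R"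
    and cx: "\<forall>q\<in>Q. \<forall>v\<in>T q. v \<in> \<xi> q \<longleftrightarrow> c q v = 0" and cZ: "\<forall>q\<in>Q. c q (vec_at Z q) = 1"
    and wy: "\<forall>q\<in>Q. \<forall>j<n. \<forall>k<n. c q (vec_at (lie (w j) (y k)) q) = (if j = k then 1 else 0)"
    and sp: "\<forall>q\<in>Q. \<forall>v\<in>xG q. \<exists>d. v = (\<lambda>f. \<Sum>k<n. d k * y k f q)" by (elim exE conjE)
  note tl = tl[rule_format]
  have yV: "y j \<in> VF" and wV: "w j \<in> VF" and yx: "y j \<in> Gam \<xi>" and wx: "w j \<in> Gam \<xi>" for j
    using y w secs_VF xG_xi by blast+
  have ZV: "Z \<in> VF" by (rule secs_VF[OF Z])
  have cc: "cls \<xi> X q = cls \<xi> Y q \<longleftrightarrow> c q (vec_at X q) = c q (vec_at Y q)" if "q \<in> Q" "X \<in> VF" "Y \<in> VF" for X Y q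
  proof -
    have "cls \<xi> X q = cls \<xi> Y q \<longleftrightarrow> vec_at (X - Y) q \<in> \<xi> q" using cls_eq_iff[OF xi_sub] by simp
    also have "\<dots> \<longleftrightarrow> c q (vec_at (X - Y) q) = 0" using cx that VF_T[OF VF_minus[OF that(2,3)]] by blast
    finally show ?thesis by (simp only: vec_at_simps tlin_diff[OF tl] right_minus_eq)
  qed
  have cxi: "c q (vec_at X q) = 0" if "q \<in> Q" "X \<in> Gam \<xi>" for X q
    using cx that VF_T[OF secs_VF[OF that(2)]] secs_at[OF that(2) UNIV_I] by blast
  obtain Qm M where M: "open Qm" "p \<in> Qm" "M \<in> VF" "\<And>q. q \<in> Qm ==> m q = cls \<xi> M q"
    by (rule lsecE[OF xi_sub m, of p]) (rule that)
  have "\<exists>L Q. L \<in> VF \<and> open Q \<and> p \<in> Q \<and> (\<forall>q\<in>Q. \<mu> (y k) q = cls \<xi> L q)" for k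
    by (rule lsecE[OF xi_sub xG_linearD(1)[OF \<mu> y[rule_format]], of p k]) blast
  then obtain L QL where L: "\<And>k. L k \<in> VF" "\<And>k. open (QL k)" "\<And>k. p \<in> QL k"
    "\<And>k q. q \<in> QL k ==> \<mu> (y k) q = cls \<xi> (L k) q" by metis
  define U where "U = Q \<inter> Qm \<inter> (\<Inter>k<n. QL k)"
  have U: "open U" "p \<in> U"
    unfolding U_def using Q M(1,2) L(2,3) by (auto intro!: open_Int open_INT)
  have UQ: "q \<in> Q" "q \<in> Qm" "\<And>k. k < n ==> q \<in> QL k" if "q \<in> U" for q using that by (auto simp: U_def)
  define a where "a = (\<lambda>q. c q (vec_at M q))"
  have aR: "a \<in> R" unfolding a_def using cR M(3) by blast
  define N0 where "N0 = smul a Z"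
  have N0: "N0 \<in> Gam G" unfolding N0_def by (rule secs_smul[OF G_sub aR Z])
  have N0V: "N0 \<in> VF" by (rule secs_VF[OF N0])
  define t where "t = (\<lambda>k q. c q (vec_at (L k) q) - c q (vec_at (lie N0 (y k)) q))"
  have tR: "t k \<in> R" for k
    unfolding t_def using cR L(1) lie_VF[OF N0V yV] by (intro R_diff) blast+
  define W where "W = (\<Sum>j<n. smul (t j) (w j))"
  have W: "W \<in> Gam xG" unfolding W_def by (intro secs_sum[OF xG_sub] secs_smul[OF xG_sub] tR w[rule_format])
  have WV: "W \<in> VF" by (rule secs_VF[OF W])
  define N where "N = N0 + W"
  have N: "N \<in> Gam G" unfolding N_def by (rule secs_add[OF G_sub N0 xG_G[OF W]])
  have NV: "N \<in> VF" by (rule secs_VF[OF N])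
  have 1: "cls \<xi> N q = m q" if q: "q \<in> U" for q
  proof -
    have "c q (vec_at N q) = a q * c q (vec_at Z q) + c q (vec_at W q)"
      by (simp only: N_def N0_def vec_at_simps tlin_add[OF tl] tlin_scale[OF tl])
    also have "\<dots> = c q (vec_at M q)"
      using cZ cxi[OF UQ(1)[OF q] xG_xi[OF W]] UQ(1)[OF q] by (simp add: a_def)
    finally show ?thesis using cc[OF UQ(1)[OF q] NV M(3)] M(4)[OF UQ(2)[OF q]] by simp
  qed
  have 2: "cls \<xi> (lie N (y k)) q = \<mu> (y k) q" if q: "q \<in> U" and k: "k < n" for q k
  proof -
    have qQ: "q \<in> Q" by (rule UQ(1)[OF q])
    have "lie W (y k) = (\<Sum>j<n. smul (t j) (lie (w j) (y k)) - smul (y k (t j)) (w j))"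
      unfolding W_def using lie_sum_left[of "{..<n}" "\<lambda>j. smul (t j) (w j)" "y k"] VF_smul[OF tR wV] yV
      by (simp add: lie_smul_left[OF tR wV yV])
    then have "c q (vec_at (lie W (y k)) q) = (\<Sum>j<n. t j q * c q (vec_at (lie (w j) (y k)) q) - y k (t j) q * c q (vec_at (w j) q))"
      by (simp only: vec_at_simps tlin_sum'[OF tl] tlin_diff[OF tl] tlin_scale[OF tl])
    also have "\<dots> = (\<Sum>j<n. if j = k then t j q else 0)"
      using wy qQ k cxi[OF qQ wx] by (intro sum.cong refl) simp
    also have "\<dots> = t k q" using k by simp
    finally have "c q (vec_at (lie N (y k)) q) = c q (vec_at (L k) q)"
      by (simp only: N_def lie_add_left[OF N0V WV yV] vec_at_simps tlin_add[OF tl]) (simp add: t_def)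
    then show ?thesis
      using cc[OF qQ lie_VF[OF NV yV] L(1)] L(4)[OF UQ(3)[OF q k]] by simp
  qed
  have 3: "cls \<xi> (lie N Y) q = \<mu> Y q" if Y: "Y \<in> Gam xG" and q: "q \<in> U" for Y q
  proof -
    have YV: "Y \<in> VF" by (rule secs_VF[OF Y])
    \<comment> \<open>An arbitrary section of \<xi> \<inter> G is expanded in the
      \<open>y k\<close>; its coefficients are read off by pairing with the dual fields
      \<open>w k\<close>.\<close>
    define e where "e = (\<lambda>k q. c q (vec_at (lie (w k) Y) q))"
    have eR: "e k \<in> R" for k unfolding e_def using cR lie_VF[OF wV YV] by blast
    define S where "S = (\<Sum>k<n. smul (e k) (y k))"
    have syG: "smul (e k) (y k) \<in> Gam xG" for k by (intro secs_smul[OF xG_sub] eR y[rule_format])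
    have S: "S \<in> Gam xG" unfolding S_def by (intro secs_sum[OF xG_sub] syG)
    have SV: "S \<in> VF" by (rule secs_VF[OF S])
    have YS: "vec_at Y x = vec_at S x" if x: "x \<in> Q" for x
    proof -
      have YSd: "Y - S \<in> Gam xG" by (rule secs_diff[OF xG_sub Y S])
      from bspec[OF bspec[OF sp x] secs_at[OF YSd UNIV_I]] obtain d
        where d: "vec_at (Y - S) x = (\<lambda>f. \<Sum>k<n. d k * y k f x)" ..
      define E where "E = (\<Sum>k<n. smul (\<lambda>p. d k) (y k))"
      have E: "E \<in> Gam xG" unfolding E_def by (intro secs_sum[OF xG_sub] secs_smul[OF xG_sub] R_const y[rule_format])
      have Ex: "vec_at (Y - S) x = vec_at E x"
        unfolding d E_def by (simp add: fun_eq_iff sum_fun_apply vec_at_def)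
      have lsum: "c x (vec_at (lie (w j) (\<Sum>k<n. smul (g k) (y k))) x) = g j x" if j: "j < n" and g: "\<And>k. g k \<in> R" for j g
      proof -
        have "lie (w j) (\<Sum>k<n. smul (g k) (y k)) = (\<Sum>k<n. smul (g k) (lie (w j) (y k)) + smul (w j (g k)) (y k))"
          using lie_sum_right[of "{..<n}" "\<lambda>k. smul (g k) (y k)" "w j"] VF_smul[OF g yV] wV
          by (simp add: lie_smul_right[OF g wV yV])
        then have "c x (vec_at (lie (w j) (\<Sum>k<n. smul (g k) (y k))) x) =
            (\<Sum>k<n. g k x * c x (vec_at (lie (w j) (y k)) x) + w j (g k) x * c x (vec_at (y k) x))"
          by (simp only: vec_at_simps tlin_sum'[OF tl] tlin_add[OF tl] tlin_scale[OF tl])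
        also have "\<dots> = (\<Sum>k<n. if k = j then g k x else 0)"
          using wy x j cxi[OF x yx] by (intro sum.cong refl) simp
        finally show ?thesis using j by simp
      qed
      have "d j = 0" if j: "j < n" for j
      proof -
        have "d j = c x (vec_at (lie (w j) E) x)"
          unfolding E_def using lsum[OF j, of "\<lambda>k p. d k"] by simp
        also have "\<dots> = c x (vec_at (lie (w j) (Y - S)) x)"
          using xi_tensor_right[OF wx xG_xi[OF E] xG_xi[OF YSd] Ex[symmetric], of j]
            cc[OF x lie_VF[OF wV secs_VF[OF E]] lie_VF[OF wV secs_VF[OF YSd]]] by simp
        also have "\<dots> = e j x - c x (vec_at (lie (w j) S) x)"
          by (simp only: lie_diff_right[OF wV YV SV] vec_at_simps tlin_diff[OF tl] e_def)
        also have "c x (vec_at (lie (w j) S) x) = e j x"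
          unfolding S_def by (rule lsum[OF j eR])
        finally show ?thesis by simp
      qed
      \<comment> \<open>The difference has an expansion at \<open>x\<close> whose coefficients are
        its pairings with the \<open>w j\<close>, and these are 0.\<close>
      then have "vec_at (Y - S) x = 0" unfolding d by (simp add: fun_eq_iff)
      then show ?thesis by simp
    qed
    have "\<mu> Y q = \<mu> S q"
      by (rule xG_linear_local[OF \<mu> Y S Q(1) UQ(1)[OF q] YS])
    also have "\<mu> S = (\<Sum>k<n. smulsec (e k) (\<mu> (y k)))"
      unfolding S_def using xG_linear_sum[OF \<mu>, of "{..<n}" "\<lambda>k. smul (e k) (y k)"] syG
      by (simp add: xG_linearD(3)[OF \<mu> y[rule_format] eR])
    also have "\<dots> q = (\<Sum>k<n. smulsec (e k) (\<mu> (y k)) q)" by (rule sum_fun_apply)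
    also have "\<dots> = (\<Sum>k<n. smulsec (e k) (cls \<xi> (lie N (y k))) q)"
      by (rule sum.cong[OF refl]) (simp add: smulsec_def 2[OF q])
    also have "\<dots> = cls \<xi> (lie N S) q"
    proof -
      have "lie N S = (\<Sum>k<n. lie N (smul (e k) (y k)))"
        unfolding S_def using lie_sum_right[of "{..<n}" "\<lambda>k. smul (e k) (y k)" N] VF_smul[OF eR yV] NV by simp
      then show ?thesis
        by (simp only: cls_sum[OF xi_sub] cls_lie_smul_right[OF eR NV yx])
    qed
    also have "\<dots> = cls \<xi> (lie N Y) q"
    proof -
      have "vec_at (lie N S) q = vec_at (lie N Y) q"
        by (rule lie_local_right[OF NV SV YV Q(1) _ UQ(1)[OF q]]) (simp add: YS)
      then show ?thesis by (simp add: cls_def)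
    qed
    finally show ?thesis by simp
  qed
  show ?thesis
    using U N 1 3 by (intro exI[of _ U] exI[of _ N]) blast
qed

text \<open>Local solutions coincide on overlaps by \<open>solve_unique\<close>, so their values at
  the points form one smooth field.\<close>

lemma solve:
  assumes m: "m \<in> lsec \<xi>" and \<mu>: "xG_linear \<mu>"
  shows "\<exists>N\<in>Gam G. cls \<xi> N = m \<and> (\<forall>Y\<in>Gam xG. cls \<xi> (lie N Y) = \<mu> Y)"
proof -
  have "\<exists>N U. open U \<and> p \<in> U \<and> N \<in> Gam G \<and> (\<forall>q\<in>U. cls \<xi> N q = m q) \<and>
    (\<forall>Y\<in>Gam xG. \<forall>q\<in>U. cls \<xi> (lie N Y) q = \<mu> Y q)" for p
    using solve_local[OF m \<mu>, of p] by (elim exE) (intro exI)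
  then obtain N U where NU: "\<And>p. open (U p) \<and> p \<in> U p \<and> N p \<in> Gam G \<and> (\<forall>q\<in>U p. cls \<xi> (N p) q = m q) \<and>
    (\<forall>Y\<in>Gam xG. \<forall>q\<in>U p. cls \<xi> (lie (N p) Y) q = \<mu> Y q)" by metis
  have U: "open (U p)" "p \<in> U p" and N: "N p \<in> Gam G" and Nm: "q \<in> U p ==> cls \<xi> (N p) q = m q"
    and N\<mu>: "Y \<in> Gam xG ==> q \<in> U p ==> cls \<xi> (lie (N p) Y) q = \<mu> Y q" for p q Y
    using NU[of p] by simp_all
  define v where "v = (\<lambda>q. vec_at (N q) q)"
  have v: "v q = vec_at (N p) q" if q: "q \<in> U p" for p q
    unfolding v_def
    by (rule solve_unique[OF N N open_Int[OF U(1)[of p] U(1)[of q]]]) (use q U(2)[of q] Nm N\<mu> in simp_all)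
  define K where "K = (\<lambda>f p. v p f)"
  have KV: "K \<in> VF"
    unfolding K_def
  proof (rule VF_glue)
    fix p show "\<exists>Q X. open Q \<and> p \<in> Q \<and> X \<in> VF \<and> (\<forall>q\<in>Q. v q = vec_at X q)"
      using U[of p] secs_VF[OF N[of p]] v by (intro exI[of _ "U p"] exI[of _ "N p"]) simp
  qed
  have Kv: "vec_at K q = v q" for q by (simp add: K_def vec_at_def)
  have KG: "K \<in> Gam G"
    by (rule secsI[OF KV]) (simp only: Kv v_def secs_at[OF N])
  have "cls \<xi> K p = m p" for p
    using Nm[OF U(2), of p] by (simp add: cls_def Kv v_def)
  moreover have "cls \<xi> (lie K Y) p = \<mu> Y p" if Y: "Y \<in> Gam xG" for Y p
  proof -
    have "vec_at (lie K Y) p = vec_at (lie (N p) Y) p"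
      by (rule lie_local_left[OF secs_VF[OF Y] KV secs_VF[OF N] U(1)[of p] _ U(2)]) (simp only: Kv v)
    then show ?thesis using N\<mu>[OF Y U(2), of p] by (simp add: cls_def)
  qed
  ultimately show ?thesis using KG by (intro bexI[of _ K]) auto
qed

end

section \<open>The partial connections on \<ell> and N\<F>\<close>

context smooth_manifold begin

text \<open>The connection \<open>bott\<close> in the encoding by \<open>cls\<close>; the two are
  identified in \<open>bott_eq\<close>.\<close>

definition nabD :: "'a distribution => 'a vfield => ('a => 'a tvec) => 'a => 'a tvec" where
  "nabD D x = lop D (\<lambda>N. cls D (lie x N))"

lemma preserves_local_rule:
  assumes "sub_dist D" "preserves D x"
  shows "local_rule D (\<lambda>N. cls D (lie x N))"
  unfolding local_rule_def
proof (intro conjI ballI allI impI)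
  have x: "x \<in> VF" using assms(2) by (simp add: preserves_def)
  show "cls D (lie x N) \<in> lsec D" if "N \<in> VF" for N
    by (rule cls_lsec[OF assms(1) lie_VF[OF x that]])
  show "cls D (lie x (N + N')) = cls D (lie x N) + cls D (lie x N')" if "N \<in> VF" "N' \<in> VF" for N N'
    unfolding lie_add_right[OF x that] by (rule cls_add'[OF assms(1)])
  show "cls D (lie x N) q = 0" if "open U" "N \<in> secs D U" "q \<in> U" for U N q
    using assms(2) that secs_at[of "lie x N" D U q] unfolding cls_zero_iff[OF assms(1)] preserves_def by blast
qed

lemma smul_minus: "smul h (- X) = - smul h X"
  by (simp add: fun_eq_iff)

lemma smul_add: "smul h (X + Y) = smul h X + smul h Y"
  and smul_diff: "smul h (X - Y) = smul h X - smul h Y"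
  by (simp_all add: fun_eq_iff algebra_simps)

text \<open>Assumption \<open>tens\<close> says that \<open>E\<close> is contained in
  \<open>D\<close>. It makes the connection linear over functions in its direction: the extra term
  in [s x, N] is a multiple of x, whose class is 0.\<close>

lemma bracket_module_sections:
  assumes D: "sub_dist D" and E: "sub_dist E" and pr: "\<And>x. x \<in> Gam E ==> preserves D x"
    and tens: "\<And>x N. x \<in> Gam E ==> cls D x = 0" and inv: "\<And>x y. x \<in> Gam E ==> y \<in> Gam E ==> lie x y \<in> Gam E"
  shows "bracket_module (Gam E) (lsec D) lie (nabD D) R smul smulsec (\<lambda>x h. x h)"
proof -
  note EV = secs_VF[of _ E UNIV]
  note lr = preserves_local_rule[OF D pr]
  have nab: "nabD D x m p = cls D (lie x N) p"
    if "x \<in> Gam E" "N \<in> VF" "open Q" "p \<in> Q" "\<And>q. q \<in> Q ==> m q = cls D N q" for x N Q p m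
    unfolding nabD_def by (rule lop_eq[OF D lr[OF that(1)] that(2-5)])
  show ?thesis
  proof unfold_locales
    fix x y m assume x: "x \<in> Gam E" and y: "y \<in> Gam E" and m: "m \<in> lsec D"
    show "nabD D (x + y) m = nabD D x m + nabD D y m"
    proof
      fix p
      obtain Q N where N: "open Q" "p \<in> Q" "N \<in> VF" "\<And>q. q \<in> Q ==> m q = cls D N q"
        by (rule lsecE[OF D m, of p]) (rule that)
      show "nabD D (x + y) m p = (nabD D x m + nabD D y m) p"
        using nab[OF secs_add[OF E x y] N(3,1,2,4)] nab[OF x N(3,1,2,4)] nab[OF y N(3,1,2,4)]
        by (simp only: plus_fun_apply lie_add_left[OF EV[OF x] EV[OF y] N(3)] cls_add[OF D])
    qed
  next
    fix s x m assume s: "s \<in> R" and x: "x \<in> Gam E" and m: "m \<in> lsec D"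
    show "nabD D (smul s x) m = smulsec s (nabD D x m)"
    proof
      fix p
      obtain Q N where N: "open Q" "p \<in> Q" "N \<in> VF" "\<And>q. q \<in> Q ==> m q = cls D N q"
        by (rule lsecE[OF D m, of p]) (rule that)
      have "cls D (smul (N s) x) p = 0"
        using tens[OF x] by (simp add: cls_smul[OF D] fun_eq_iff zero_fun_def)
      then show "nabD D (smul s x) m p = smulsec s (nabD D x m) p"
        using nab[OF secs_smul[OF E s x] N(3,1,2,4)] nab[OF x N(3,1,2,4)]
        by (simp only: lie_smul_left[OF s EV[OF x] N(3)] cls_diff[OF D] cls_smul[OF D, of s] smulsec_def diff_zero)
    qed
    show "nabD D x (smulsec s m) = smulsec s (nabD D x m) + smulsec (x s) m"
      unfolding nabD_def
    proof (rule lop_smul[OF D lr[OF x] s m])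
      fix N assume N: "N \<in> VF"
      show "cls D (lie x (smul s N)) = smulsec s (cls D (lie x N)) + smulsec (x s) (cls D N)"
        by (simp only: lie_smul_right[OF s EV[OF x] N] cls_add'[OF D] cls_smul'[OF D])
    qed
  next
    fix x m n assume x: "x \<in> Gam E" and m: "m \<in> lsec D" "n \<in> lsec D"
    show "nabD D x (m + n) = nabD D x m + nabD D x n"
      unfolding nabD_def by (rule lop_add[OF D lr[OF x] m])
  next
    fix x m assume x: "x \<in> Gam E" and m: "m \<in> lsec D"
    show "nabD D x m \<in> lsec D"
      unfolding nabD_def by (rule lop_lsec[OF D lr[OF x] m])
  next
    fix x y z assume "x \<in> Gam E" "y \<in> Gam E" "z \<in> Gam E"
    then show "lie (x + y) z = lie x z + lie y z" "lie z (x + y) = lie z x + lie z y"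
      by (simp_all only: lie_add_left lie_add_right EV)
  next
    fix s x y assume "s \<in> R" "x \<in> Gam E" "y \<in> Gam E"
    then show "lie x (smul s y) = smul s (lie x y) + smul (x s) y"
      by (simp only: lie_smul_right EV)
  next
    fix x s assume "x \<in> Gam E" "s \<in> R"
    then show "x s \<in> R" using VF_R EV by blast
  qed (simp_all add: secs_zero[OF E] secs_add[OF E] secs_uminus[OF E] secs_smul[OF E] inv lie_self
      lsec_zero[OF D] lsec_add[OF D] lsec_uminus[OF D] lsec_smul[OF D] smul_minus smulsec_add)
qed

end

context pre_contact_manifold begin

sublocale xi: bracket_module "Gam F" "lsec \<xi>" lie "nabD \<xi>" R smul smulsec "\<lambda>x h. x h"
  by (rule bracket_module_sections[OF xi_sub F_sub preserves_xi cls_xi_zero[OF secs_F_xi] lie_F_F[OF _ _ open_UNIV]])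

lemma cls_F_zero: "X \<in> Gam F ==> cls F X = 0"
  using cls_zero_secs[OF F_sub secs_VF] by blast

sublocale nf: bracket_module "Gam F" "lsec F" lie "nabD F" R smul smulsec "\<lambda>x h. x h"
  by (rule bracket_module_sections[OF F_sub F_sub preserves_F cls_F_zero lie_F_F[OF _ _ open_UNIV]])

lemma nab_xi_cls: "x \<in> Gam F ==> N \<in> VF ==> nabD \<xi> x (cls \<xi> N) = cls \<xi> (lie x N)"
  unfolding nabD_def by (rule lop_cls[OF xi_sub preserves_local_rule[OF xi_sub preserves_xi]])

lemma nab_F_cls: "x \<in> Gam F ==> N \<in> VF ==> nabD F x (cls F N) = cls F (lie x N)"
  unfolding nabD_def by (rule lop_cls[OF F_sub preserves_local_rule[OF F_sub preserves_F]])

end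

section \<open>The projections along the splitting, and the cochain map\<close>

context pre_contact_complement begin

text \<open>The projection to G along T\<F>. Obtaining it from \<open>solve\<close> makes it a
  smooth field at once; the remainder lies in T\<F> because \<theta> and all brackets with \<xi>
  \<inter> G agree.\<close>

definition QG :: "'a vfield => 'a vfield" where
  "QG X = (SOME N. N \<in> Gam G \<and> cls \<xi> N = cls \<xi> X \<and> (\<forall>Y\<in>Gam xG. cls \<xi> (lie N Y) = cls \<xi> (lie X Y)))"

definition PF :: "'a vfield => 'a vfield" where
  "PF X = X - QG X"

lemma QG_spec:
  assumes X: "X \<in> VF"
  shows "QG X \<in> Gam G" "PF X \<in> Gam F"
proof -
  have "xG_linear (\<lambda>Y. cls \<xi> (lie X Y))"
    unfolding xG_linear_def
    by (intro conjI ballI cls_lsec[OF xi_sub] lie_VF X)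
      (simp_all only: secs_VF lie_add_right[OF X] cls_add'[OF xi_sub] cls_lie_smul_right[OF _ X xG_xi])
  from solve[OF cls_lsec[OF xi_sub X] this]
  have "\<exists>N. N \<in> Gam G \<and> cls \<xi> N = cls \<xi> X \<and> (\<forall>Y\<in>Gam xG. cls \<xi> (lie N Y) = cls \<xi> (lie X Y))" by blast
  from someI_ex[OF this] have Q: "QG X \<in> Gam G" "cls \<xi> (QG X) = cls \<xi> X"
    "\<And>Y. Y \<in> Gam xG ==> cls \<xi> (lie (QG X) Y) = cls \<xi> (lie X Y)"
    unfolding QG_def by blast+
  note QV = secs_VF[OF Q(1)]
  show "QG X \<in> Gam G" by (rule Q(1))
  have PV: "PF X \<in> VF" unfolding PF_def by (rule VF_minus[OF X QV])
  show "PF X \<in> Gam F"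
  proof (rule secsI[OF PV])
    fix p
    show "vec_at (PF X) p \<in> F p"
    proof (rule F_I_xG_cls[OF PV open_UNIV UNIV_I])
      fix q show "vec_at (PF X) q \<in> \<xi> q"
        using Q(2) cls_eq_iff[OF xi_sub, of X q "QG X"] by (simp add: PF_def)
    next
      fix Y assume Y: "Y \<in> Gam xG"
      show "vec_at (lie (PF X) Y) p \<in> \<xi> p"
        using Q(3)[OF Y] cls_eq_iff[OF xi_sub, of "lie X Y" p "lie (QG X) Y"]
        by (simp add: PF_def lie_diff_left[OF X QV secs_VF[OF Y]])
    qed
  qed
qed

lemma QG_VF: "X \<in> VF ==> QG X \<in> VF" and PF_VF: "X \<in> VF ==> PF X \<in> VF"
  using QG_spec secs_VF by blast+

lemma FG_sections_zero:
  assumes "X \<in> Gam F" "X \<in> Gam G"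
  shows "X = 0"
proof (rule vfield_eqI)
  fix p
  have "vec_at X p = 0" by (rule FG_zero[OF secs_at[OF assms(1) UNIV_I] secs_at[OF assms(2) UNIV_I]])
  then show "vec_at X p = vec_at 0 p" by (simp only: vec_at_simps)
qed

lemma QG_unique:
  assumes "X \<in> VF" "N \<in> Gam G" "X - N \<in> Gam F"
  shows "QG X = N" "PF X = X - N"
proof -
  have "PF X - (X - N) \<in> Gam F" by (rule secs_diff[OF F_sub QG_spec(2)[OF assms(1)] assms(3)])
  moreover have "PF X - (X - N) = N - QG X" by (simp add: PF_def)
  ultimately have "N - QG X = 0"
    using FG_sections_zero secs_diff[OF G_sub assms(2) QG_spec(1)[OF assms(1)]] by metis
  then show "QG X = N" "PF X = X - N" by (simp_all add: PF_def)
qed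

lemma QG_add: "X \<in> VF ==> Y \<in> VF ==> QG (X + Y) = QG X + QG Y"
proof (rule QG_unique(1))
  assume X: "X \<in> VF" and Y: "Y \<in> VF"
  show "QG X + QG Y \<in> Gam G" by (intro secs_add[OF G_sub] QG_spec X Y)
  have "X + Y - (QG X + QG Y) = PF X + PF Y" by (simp add: PF_def)
  then show "X + Y - (QG X + QG Y) \<in> Gam F" using secs_add[OF F_sub QG_spec(2)[OF X] QG_spec(2)[OF Y]] by simp
qed (rule VF_plus)

lemma QG_smul: "h \<in> R ==> X \<in> VF ==> QG (smul h X) = smul h (QG X)"
proof (rule QG_unique(1))
  assume h: "h \<in> R" and X: "X \<in> VF"
  show "smul h (QG X) \<in> Gam G" by (intro secs_smul[OF G_sub] QG_spec h X)
  have "smul h X - smul h (QG X) = smul h (PF X)" by (simp add: PF_def smul_diff)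
  then show "smul h X - smul h (QG X) \<in> Gam F" using secs_smul[OF F_sub h QG_spec(2)[OF X]] by simp
qed (rule VF_smul)

lemma QG_G: "X \<in> Gam G ==> QG X = X"
  by (rule QG_unique(1)) (simp_all add: secs_VF secs_zero[OF F_sub])

lemma QG_F: "X \<in> Gam F ==> QG X = 0"
  by (rule QG_unique(1)) (simp_all add: secs_VF secs_zero[OF G_sub])

lemma PF_G: "X \<in> Gam G ==> PF X = 0" and PF_F: "X \<in> Gam F ==> PF X = X"
  by (simp_all add: PF_def QG_G QG_F)

lemma PF_add: "X \<in> VF ==> Y \<in> VF ==> PF (X + Y) = PF X + PF Y"
  by (simp add: PF_def QG_add)

lemma PF_uminus: "X \<in> VF ==> PF (- X) = - PF X"
  using PF_add[of X "- X"] VF_uminus[of X] PF_F[OF secs_zero[OF F_sub]]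
  by (simp add: eq_neg_iff_add_eq_0 add.commute)

lemma PF_diff: "X \<in> VF ==> Y \<in> VF ==> PF (X - Y) = PF X - PF Y"
  using PF_add[of X "- Y"] VF_uminus[of Y] by (simp add: PF_uminus)

lemma PF_smul: "h \<in> R ==> X \<in> VF ==> PF (smul h X) = smul h (PF X)"
  by (simp add: PF_def QG_smul smul_diff)

lemma QG_xG: "X \<in> Gam \<xi> ==> QG X \<in> Gam xG"
proof (rule secsI)
  assume X: "X \<in> Gam \<xi>"
  note XV = secs_VF[OF X]
  show "QG X \<in> VF" by (rule QG_VF[OF XV])
  fix q
  have "vec_at X q - vec_at (PF X) q \<in> \<xi> q"
    by (rule sub_dist_diff[OF xi_sub secs_at[OF X UNIV_I] F_xi[OF secs_at[OF QG_spec(2)[OF XV] UNIV_I]]])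
  then show "vec_at (QG X) q \<in> xG q"
    using secs_at[OF QG_spec(1)[OF XV] UNIV_I] by (simp add: PF_def xG_def)
qed

lemma cls_F_eq: "X \<in> VF ==> Y \<in> VF ==> cls F X = cls F Y \<longleftrightarrow> X - Y \<in> Gam F"
  using cls_zero_secs[OF F_sub VF_minus, of X Y] by (simp add: cls_diff'[OF F_sub])

lemma cls_F_QG: "X \<in> VF ==> cls F (QG X) = cls F X"
  using QG_spec(2)[of X] cls_F_eq[of X "QG X"] QG_VF[of X] by (simp add: PF_def)

lemma G_lift_unique: "X \<in> Gam G ==> Y \<in> Gam G ==> cls F X = cls F Y ==> X = Y"
  using cls_F_eq[OF secs_VF secs_VF] FG_sections_zero[OF _ secs_diff[OF G_sub]] by fastforce

text \<open>Local lifts are first projected to G, where a lift is unique; hence they glue.\<close>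

lemma G_lift:
  assumes m: "m \<in> lsec F"
  shows "\<exists>N\<in>Gam G. cls F N = m"
proof -
  have "\<exists>Q N. open Q \<and> p \<in> Q \<and> N \<in> Gam G \<and> (\<forall>q\<in>Q. m q = cls F N q)" for p
  proof -
    obtain Q N where N: "open Q" "p \<in> Q" "N \<in> VF" "\<And>q. q \<in> Q ==> m q = cls F N q"
      by (rule lsecE[OF F_sub m, of p]) (rule that)
    then show ?thesis
      using QG_spec(1)[OF N(3)] cls_F_QG[OF N(3)] by (intro exI[of _ Q] exI[of _ "QG N"]) simp
  qed
  then obtain U N where UN: "\<And>p. open (U p) \<and> p \<in> U p \<and> N p \<in> Gam G \<and> (\<forall>q\<in>U p. m q = cls F (N p) q)"
    by metis
  have v: "vec_at (N q) q = vec_at (N p) q" if q: "q \<in> U p" for p q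
  proof -
    have "cls F (N q) q = cls F (N p) q" using UN[of q] UN[of p] q by metis
    then have "vec_at (N q - N p) q \<in> F q" using cls_eq_iff[OF F_sub] by simp
    moreover have "vec_at (N q - N p) q \<in> G q"
      using UN by (intro secs_at[OF secs_diff[OF G_sub] UNIV_I]) blast+
    ultimately have "vec_at (N q - N p) q = 0" by (rule FG_zero)
    then show ?thesis by simp
  qed
  define K where "K = (\<lambda>f p. vec_at (N p) p f)"
  have KV: "K \<in> VF"
    unfolding K_def
  proof (rule VF_glue)
    fix p show "\<exists>Q X. open Q \<and> p \<in> Q \<and> X \<in> VF \<and> (\<forall>q\<in>Q. vec_at (N q) q = vec_at X q)"
      using UN[of p] secs_VF[of "N p" G UNIV] v by (intro exI[of _ "U p"] exI[of _ "N p"]) simp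
  qed
  have Kv: "vec_at K q = vec_at (N q) q" for q by (simp add: K_def vec_at_def)
  have "K \<in> Gam G"
    using UN secs_at by (intro secsI[OF KV]) (simp only: Kv, blast)
  moreover have "cls F K = m"
  proof
    fix q
    have "m q = cls F (N q) q" using UN[of q] by blast
    then show "cls F K q = m q" by (simp only: cls_def Kv)
  qed
  ultimately show ?thesis by blast
qed

text \<open>The isomorphism from sections of N\<F> to sections of G, so that a class modulo T\<F>
  can be studied by the data \<theta> N and \<theta>[N,.] of its lift.\<close>

definition repG :: "('a => 'a tvec) => 'a vfield" where
  "repG m = (THE N. N \<in> Gam G \<and> cls F N = m)"

lemma repG_cls:
  assumes "X \<in> VF"
  shows "repG (cls F X) = QG X"
  unfolding repG_def
  by (rule the_equality) (use QG_spec(1)[OF assms] cls_F_QG[OF assms] G_lift_unique in auto)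

lemma repG: "m \<in> lsec F ==> repG m \<in> Gam G" and cls_repG: "m \<in> lsec F ==> cls F (repG m) = m"
  using G_lift[of m] repG_cls secs_VF QG_G by auto

lemma repG_VF: "m \<in> lsec F ==> repG m \<in> VF"
  by (rule secs_VF[OF repG])

lemma repG_add:
  assumes "m \<in> lsec F" "n \<in> lsec F"
  shows "repG (m + n) = repG m + repG n"
proof -
  have "repG (m + n) = repG (cls F (repG m + repG n))"
    by (simp only: cls_add'[OF F_sub] cls_repG assms)
  also have "\<dots> = repG m + repG n"
    by (simp only: repG_cls VF_plus repG_VF assms QG_G secs_add[OF G_sub] repG)
  finally show ?thesis .
qed

lemma repG_zero: "repG 0 = 0"
  using repG_cls[OF VF_zero] cls_zero'[OF F_sub] QG_F[OF secs_zero[OF F_sub]] by simp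

lemma cls_lie_QG:
  assumes "X \<in> VF" "Y \<in> Gam \<xi>"
  shows "cls \<xi> (lie (QG X) Y) = cls \<xi> (lie X Y)"
proof -
  have "lie X Y = lie (QG X) Y + lie (PF X) Y"
    using lie_add_left[OF QG_VF PF_VF secs_VF, OF assms(1) assms(1) assms(2)] by (simp add: PF_def)
  moreover have "cls \<xi> (lie (PF X) Y) = 0"
    by (rule cls_xi_zero[OF lie_F_xi[OF QG_spec(2)[OF assms(1)] assms(2) open_UNIV]])
  ultimately show ?thesis by (simp add: cls_add'[OF xi_sub])
qed

lemma cls_QG:
  assumes "X \<in> VF"
  shows "cls \<xi> (QG X) = cls \<xi> X"
proof -
  have "cls \<xi> (PF X) = 0" by (rule cls_xi_zero[OF secs_F_xi[OF QG_spec(2)[OF assms]]])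
  then show ?thesis by (simp add: PF_def cls_diff'[OF xi_sub])
qed

lemma solve_unique_global:
  assumes "N \<in> Gam G" "N' \<in> Gam G" "cls \<xi> N = cls \<xi> N'" "\<And>Y. Y \<in> Gam xG ==> cls \<xi> (lie N Y) = cls \<xi> (lie N' Y)"
  shows "N = N'"
  by (rule vfield_eqI) (rule solve_unique[OF assms(1,2) open_UNIV UNIV_I], simp_all add: assms(3,4))

definition AY :: "'a vfield => 'a vfield => 'a vfield" where
  "AY Y x = PF (lie x Y)"

lemma AY_F: "Y \<in> VF ==> x \<in> VF ==> AY Y x \<in> Gam F"
  unfolding AY_def by (rule QG_spec(2)[OF lie_VF])

lemma AY_add: "Y \<in> VF ==> x \<in> VF ==> y \<in> VF ==> AY Y (x + y) = AY Y x + AY Y y"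
  by (simp add: AY_def lie_add_left PF_add lie_VF)

lemma AY_smul:
  assumes "h \<in> R" "Y \<in> VF" "x \<in> Gam F"
  shows "AY Y (smul h x) = smul h (AY Y x) + smul (\<lambda>p. - Y h p) x"
proof -
  have xV: "x \<in> VF" by (rule secs_VF[OF assms(3)])
  have yx: "smul (Y h) x \<in> Gam F" by (rule secs_smul[OF F_sub VF_R[OF assms(2,1)] assms(3)])
  have "smul (\<lambda>p. - Y h p) x = - smul (Y h) x" by (simp add: fun_eq_iff)
  then show ?thesis
    using PF_diff[OF VF_smul[OF assms(1) lie_VF[OF xV assms(2)]] secs_VF[OF yx]]
    by (simp add: AY_def lie_smul_left[OF assms(1) xV assms(2)] PF_smul[OF assms(1) lie_VF[OF xV assms(2)]] PF_F[OF yx])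
qed

definition is_form :: "nat => ('a vfield list => 'a => 'a tvec) => bool" where
  "is_form n \<omega> \<longleftrightarrow> xi.aalt n \<omega> \<and> xi.hom n \<omega>"

abbreviation dm where "dm n \<equiv> xi.dom n"

text \<open>When Y is multiplied by a function s, the bracket [x,Y] acquires the extra term x(s) Y.
  It lies in G and is annihilated by the projection to T\<F>.\<close>

lemma ins_AY_linear:
  assumes \<omega>: "is_form n \<omega>" and xs: "xs \<in> dm n"
  shows "xG_linear (\<lambda>Y. ins (AY Y) \<omega> xs)"
  unfolding xG_linear_def
proof (intro conjI ballI)
  have a: "xi.aalt n \<omega>" and h: "xi.hom n \<omega>" using \<omega> by (simp_all add: is_form_def)
  note len = xi.domD(2)[OF xs]
  have xV: "x \<in> VF" if "x \<in> Gam F" for x using secs_VF that by blast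
  show "ins (AY Y) \<omega> xs \<in> lsec \<xi>" if "Y \<in> Gam xG" for Y
    by (rule xi.ins_M[OF a _ xs]) (rule AY_F[OF secs_VF[OF that] xV])
  show "ins (AY (Y + Y')) \<omega> xs = ins (AY Y) \<omega> xs + ins (AY Y') \<omega> xs" if Y: "Y \<in> Gam xG" "Y' \<in> Gam xG" for Y Y'
    by (rule xi.ins_op_add[OF a _ _ _ xs])
      (simp_all add: AY_F secs_VF[OF Y(1)] secs_VF[OF Y(2)] xV, simp add: AY_def lie_add_right PF_add lie_VF secs_VF[OF Y(1)] secs_VF[OF Y(2)] xV)
  show "ins (AY (smul s Y)) \<omega> xs = smulsec s (ins (AY Y) \<omega> xs)" if Y: "Y \<in> Gam xG" and s: "s \<in> R" for Y s
    unfolding ins_def xi.sm_sum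
  proof (rule sum.cong[OF refl])
    fix k assume "k \<in> {..<length xs}"
    then have k: "k < n" using len by simp
    let ?x = "xs ! k"
    have xk: "?x \<in> Gam F" by (rule xi.dom_nth[OF xs k])
    note xkV = secs_VF[OF xk] and YV = secs_VF[OF Y]
    have g: "smul (?x s) Y \<in> Gam G" by (rule secs_smul[OF G_sub VF_R[OF xkV s] xG_G[OF Y]])
    have "AY (smul s Y) ?x = smul s (AY Y ?x)"
      using PF_add[OF VF_smul[OF s lie_VF[OF xkV YV]] secs_VF[OF g]]
      by (simp add: AY_def lie_smul_right[OF s xkV YV] PF_smul[OF s lie_VF[OF xkV YV]] PF_G[OF g])
    then show "\<omega> (xs[k := AY (smul s Y) ?x]) = smulsec s (\<omega> (xs[k := AY Y ?x]))"
      using xi.homD[OF h xs k s AY_F[OF YV xkV]] by simp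
  qed
qed

definition Nu :: "('a vfield list => 'a => 'a tvec) => 'a vfield list => 'a vfield" where
  "Nu \<omega> xs = (SOME N. N \<in> Gam G \<and> cls \<xi> N = \<omega> xs \<and> (\<forall>Y\<in>Gam xG. cls \<xi> (lie N Y) = ins (AY Y) \<omega> xs))"

lemma Nu:
  assumes \<omega>: "is_form n \<omega>" and xs: "xs \<in> dm n"
  shows "Nu \<omega> xs \<in> Gam G" "cls \<xi> (Nu \<omega> xs) = \<omega> xs" "Y \<in> Gam xG ==> cls \<xi> (lie (Nu \<omega> xs) Y) = ins (AY Y) \<omega> xs"
proof -
  have "\<omega> xs \<in> lsec \<xi>" using xi.aalt_M[OF _ xs] \<omega> by (simp add: is_form_def)
  from solve[OF this ins_AY_linear[OF assms]]
  have "\<exists>N. N \<in> Gam G \<and> cls \<xi> N = \<omega> xs \<and> (\<forall>Y\<in>Gam xG. cls \<xi> (lie N Y) = ins (AY Y) \<omega> xs)" by blast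
  from someI_ex[OF this] show "Nu \<omega> xs \<in> Gam G" "cls \<xi> (Nu \<omega> xs) = \<omega> xs"
    "Y \<in> Gam xG ==> cls \<xi> (lie (Nu \<omega> xs) Y) = ins (AY Y) \<omega> xs" unfolding Nu_def by blast+
qed

text \<open>All algebraic properties of the cochain map are obtained in this way: they hold for the
  data and pass to the solution.\<close>

lemma Nu_unique:
  assumes "is_form n \<omega>" "xs \<in> dm n" "N \<in> Gam G" "cls \<xi> N = \<omega> xs"
    "\<And>Y. Y \<in> Gam xG ==> cls \<xi> (lie N Y) = ins (AY Y) \<omega> xs"
  shows "Nu \<omega> xs = N"
  by (rule solve_unique_global[OF Nu(1)[OF assms(1,2)] assms(3)]) (simp_all add: assms Nu[OF assms(1,2)])

lemma is_form_d: "is_form n \<omega> ==> is_form (Suc n) (xi.d \<omega>)"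
  by (simp add: is_form_def xi.aalt_kz xi.hom_kz)

lemma is_form_ins:
  assumes "is_form n \<omega>" "Y \<in> VF"
  shows "xi.aalt n (ins (AY Y) \<omega>)"
  by (rule xi.aalt_ins) (use assms secs_VF in \<open>auto simp: is_form_def AY_F AY_add\<close>)

text \<open>The cochain map up to the sign \<open>(-1)\<^sup>n\<close>, with values in classes modulo \<open>T\<F>\<close>.\<close>

definition NuF :: "('a vfield list => 'a => 'a tvec) => 'a vfield list => 'a => 'a tvec" where
  "NuF \<omega> xs = cls F (Nu \<omega> xs)"

lemma repG_NuF: "is_form n \<omega> ==> xs \<in> dm n ==> repG (NuF \<omega> xs) = Nu \<omega> xs"
  using Nu(1)[of n \<omega> xs] repG_cls[OF secs_VF[of "Nu \<omega> xs" G UNIV]] by (simp add: NuF_def QG_G)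

lemma NuF_lsec: "is_form n \<omega> ==> xs \<in> dm n ==> NuF \<omega> xs \<in> lsec F"
  unfolding NuF_def by (rule cls_lsec[OF F_sub secs_VF[OF Nu(1)]])

lemma NuF_aalt:
  assumes \<omega>: "is_form n \<omega>"
  shows "nf.aalt n (NuF \<omega>)"
  unfolding nf.aalt_def
proof (intro ballI conjI allI impI)
  fix xs assume xs: "xs \<in> dm n"
  have a: "xi.aalt n \<omega>" and h: "xi.hom n \<omega>" using \<omega> by (simp_all add: is_form_def)
  note ia = is_form_ins[OF \<omega> secs_VF]
  show "NuF \<omega> xs \<in> lsec F" by (rule NuF_lsec[OF assms xs])
  show "NuF \<omega> (xs[i := x + y]) = NuF \<omega> (xs[i := x]) + NuF \<omega> (xs[i := y])"
    if i: "i < n" and x: "x \<in> Gam F" and y: "y \<in> Gam F" for i x y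
  proof -
    note dx = xi.dom_update[OF xs x, of i] and dy = xi.dom_update[OF xs y, of i]
      and dxy = xi.dom_update[OF xs xi.L_add[OF x y], of i]
    have "Nu \<omega> (xs[i := x + y]) = Nu \<omega> (xs[i := x]) + Nu \<omega> (xs[i := y])"
    proof (rule Nu_unique[OF \<omega> dxy])
      show "Nu \<omega> (xs[i := x]) + Nu \<omega> (xs[i := y]) \<in> Gam G"
        by (intro secs_add[OF G_sub] Nu(1)[OF \<omega>] dx dy)
      show "cls \<xi> (Nu \<omega> (xs[i := x]) + Nu \<omega> (xs[i := y])) = \<omega> (xs[i := x + y])"
        by (simp only: cls_add'[OF xi_sub] Nu(2)[OF \<omega>] dx dy xi.aalt_add[OF a xs i x y])
      fix Y assume Y: "Y \<in> Gam xG"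
      show "cls \<xi> (lie (Nu \<omega> (xs[i := x]) + Nu \<omega> (xs[i := y])) Y) = ins (AY Y) \<omega> (xs[i := x + y])"
        by (simp only: lie_add_left[OF secs_VF[OF Nu(1)[OF \<omega> dx]] secs_VF[OF Nu(1)[OF \<omega> dy]] secs_VF[OF Y]]
          cls_add'[OF xi_sub] Nu(3)[OF \<omega> dx Y] Nu(3)[OF \<omega> dy Y] xi.aalt_add[OF ia[OF Y] xs i x y])
    qed
    then show ?thesis by (simp only: NuF_def cls_add'[OF F_sub])
  qed
  show "NuF \<omega> xs = 0" if ij: "i < n" "j < n" "i \<noteq> j \<and> xs ! i = xs ! j" for i j
  proof -
    have e: "i \<noteq> j" "xs ! i = xs ! j" using ij(3) by simp_all
    have "Nu \<omega> xs = 0"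
    proof (rule Nu_unique[OF \<omega> xs])
      show "cls \<xi> 0 = \<omega> xs"
        by (simp only: cls_zero'[OF xi_sub] xi.aalt_alt[OF a xs ij(1,2) e])
      fix Y assume Y: "Y \<in> Gam xG"
      show "cls \<xi> (lie 0 Y) = ins (AY Y) \<omega> xs"
        by (simp only: lie_zero_left[OF secs_VF[OF Y]] cls_zero'[OF xi_sub] xi.aalt_alt[OF ia[OF Y] xs ij(1,2) e])
    qed (rule secs_zero[OF G_sub])
    then show ?thesis by (simp only: NuF_def cls_zero'[OF F_sub])
  qed
qed

text \<open>The data are not linear over functions separately: \<theta>[s N, Y] contains -Y(s)
  \<theta> N, and the insertion contains the same term because P[s x, Y] has the summand -Y(s)
  x.\<close>

lemma NuF_hom:
  assumes \<omega>: "is_form n \<omega>"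
  shows "nf.hom n (NuF \<omega>)"
  unfolding nf.hom_def
proof (intro ballI allI impI)
  fix xs i s x assume xs: "xs \<in> dm n" and i: "i < n" and s: "s \<in> R" and x: "x \<in> Gam F"
  have a: "xi.aalt n \<omega>" and h: "xi.hom n \<omega>" using \<omega> by (simp_all add: is_form_def)
  note dx = xi.dom_update[OF xs x, of i] and dsx = xi.dom_update[OF xs xi.sx_L[OF s x], of i]
  note NG = Nu(1)[OF \<omega> dx]
  have "Nu \<omega> (xs[i := smul s x]) = smul s (Nu \<omega> (xs[i := x]))"
  proof (rule Nu_unique[OF \<omega> dsx])
    show "smul s (Nu \<omega> (xs[i := x])) \<in> Gam G" by (rule secs_smul[OF G_sub s NG])
    show "cls \<xi> (smul s (Nu \<omega> (xs[i := x]))) = \<omega> (xs[i := smul s x])"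
      by (simp only: cls_smul'[OF xi_sub] Nu(2)[OF \<omega> dx] xi.homD[OF h xs i s x])
    fix Y assume Y: "Y \<in> Gam xG"
    note YV = secs_VF[OF Y]
    have "ins (AY Y) \<omega> (xs[i := smul s x]) = smulsec s (ins (AY Y) \<omega> (xs[i := x])) + smulsec (\<lambda>p. - Y s p) (\<omega> (xs[i := x]))"
      by (rule xi.ins_hom[OF a h xs i s _ x AY_F[OF YV secs_VF] AY_smul[OF s YV x]]) (rule R_uminus[OF VF_R[OF YV s]])
    also have "smulsec (\<lambda>p. - Y s p) (\<omega> (xs[i := x])) = - smulsec (Y s) (\<omega> (xs[i := x]))"
      by (simp add: smulsec_def fun_eq_iff)
    finally show "cls \<xi> (lie (smul s (Nu \<omega> (xs[i := x]))) Y) = ins (AY Y) \<omega> (xs[i := smul s x])"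
      by (simp only: cls_lie_smul_left[OF s secs_VF[OF NG] YV] Nu(2)[OF \<omega> dx] Nu(3)[OF \<omega> dx Y] diff_conv_add_uminus)
  qed
  then show "NuF \<omega> (xs[i := smul s x]) = smulsec s (NuF \<omega> (xs[i := x]))"
    by (simp only: NuF_def cls_smul'[OF F_sub])
qed

text \<open>The second equation is the Jacobi identity. The projection \<open>QG\<close> may be
  dropped under \<theta>, since T\<F> lies in \<xi> and brackets \<xi> into \<xi>.\<close>

lemma pairing_nab:
  assumes x: "x \<in> Gam F" and m: "m \<in> lsec F" and Y: "Y \<in> Gam \<xi>"
  shows "cls \<xi> (repG (nabD F x m)) = nabD \<xi> x (cls \<xi> (repG m))"
    and "cls \<xi> (lie (repG (nabD F x m)) Y) = nabD \<xi> x (cls \<xi> (lie (repG m) Y)) - cls \<xi> (lie (repG m) (lie x Y))"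
proof -
  note xV = secs_VF[OF x] and mV = repG_VF[OF m] and YV = secs_VF[OF Y]
  have r: "repG (nabD F x m) = QG (lie x (repG m))"
    using nab_F_cls[OF x mV] repG_cls[OF lie_VF[OF xV mV]] by (simp add: cls_repG[OF m])
  show "cls \<xi> (repG (nabD F x m)) = nabD \<xi> x (cls \<xi> (repG m))"
    unfolding r cls_QG[OF lie_VF[OF xV mV]] nab_xi_cls[OF x mV] ..
  have "lie (lie x (repG m)) Y = lie x (lie (repG m) Y) - lie (repG m) (lie x Y)"
    using jacobi[OF xV mV YV] by simp
  then show "cls \<xi> (lie (repG (nabD F x m)) Y) = nabD \<xi> x (cls \<xi> (lie (repG m) Y)) - cls \<xi> (lie (repG m) (lie x Y))"
    unfolding r cls_lie_QG[OF lie_VF[OF xV mV] Y] nab_xi_cls[OF x lie_VF[OF mV YV]]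
    by (simp only: cls_diff'[OF xi_sub])
qed

text \<open>Of the two data of a lift only the bracket with Y picks up a correction under the
  differential, because only it involves a field that the connection moves.\<close>

lemma pairing_d:
  assumes xs: "xs \<in> dm (Suc n)" and \<nu>: "\<And>ys. ys \<in> dm n ==> \<nu> ys \<in> lsec F" and Y: "Y \<in> Gam \<xi>"
  shows "cls \<xi> (repG (nf.d \<nu> xs)) = xi.d (\<lambda>ys. cls \<xi> (repG (\<nu> ys))) xs"
    and "cls \<xi> (lie (repG (nf.d \<nu> xs)) Y) = xi.d (\<lambda>ys. cls \<xi> (lie (repG (\<nu> ys)) Y)) xs
      - asum (\<lambda>x zs. cls \<xi> (lie (repG (\<nu> zs)) (lie x Y))) xs"
proof -
  have \<nu>': "\<nu> ys \<in> lsec F" if "set ys \<subseteq> Gam F" "length ys = n" for ys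
    using \<nu> that by (simp add: xi.dom_def)
  note YV = secs_VF[OF Y]
  have "cls \<xi> (repG (nf.d \<nu> xs)) = xi.d (\<lambda>ys. cls \<xi> (repG (\<nu> ys))) xs - asum (\<lambda>x zs. 0) xs"
  proof (rule kz_pairing[OF xi.domD[OF xs] \<nu>' xi.br_L _ nf.M_zero nf.M_add nf.M_uminus nf.nab_M, where b = "\<lambda>m. cls \<xi> (repG m)" and b' = "\<lambda>x m. 0"])
    show "cls \<xi> (repG 0) = 0" by (simp only: repG_zero cls_zero'[OF xi_sub])
    show "cls \<xi> (repG (m + n)) = cls \<xi> (repG m) + cls \<xi> (repG n)" if "m \<in> lsec F" "n \<in> lsec F" for m n
      by (simp only: repG_add[OF that] cls_add'[OF xi_sub])
    show "cls \<xi> (repG (nabD F x m)) = nabD \<xi> x (cls \<xi> (repG m)) - 0" if "x \<in> Gam F" "m \<in> lsec F" for x m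
      using pairing_nab(1)[OF that Y] by simp
  qed
  then show "cls \<xi> (repG (nf.d \<nu> xs)) = xi.d (\<lambda>ys. cls \<xi> (repG (\<nu> ys))) xs"
    by (simp add: asum_def)
  show "cls \<xi> (lie (repG (nf.d \<nu> xs)) Y) = xi.d (\<lambda>ys. cls \<xi> (lie (repG (\<nu> ys)) Y)) xs
      - asum (\<lambda>x zs. cls \<xi> (lie (repG (\<nu> zs)) (lie x Y))) xs"
  proof (rule kz_pairing[OF xi.domD[OF xs] \<nu>' xi.br_L _ nf.M_zero nf.M_add nf.M_uminus nf.nab_M, where b = "\<lambda>m. cls \<xi> (lie (repG m) Y)" and b' = "\<lambda>x m. cls \<xi> (lie (repG m) (lie x Y))"])
    show "cls \<xi> (lie (repG 0) Y) = 0" by (simp only: repG_zero lie_zero_left[OF YV] cls_zero'[OF xi_sub])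
    show "cls \<xi> (lie (repG (m + n)) Y) = cls \<xi> (lie (repG m) Y) + cls \<xi> (lie (repG n) Y)" if "m \<in> lsec F" "n \<in> lsec F" for m n
      by (simp only: repG_add[OF that] lie_add_left[OF repG_VF repG_VF YV] that cls_add'[OF xi_sub])
    show "cls \<xi> (lie (repG (nabD F x m)) Y) = nabD \<xi> x (cls \<xi> (lie (repG m) Y)) - cls \<xi> (lie (repG m) (lie x Y))"
      if "x \<in> Gam F" "m \<in> lsec F" for x m
      by (rule pairing_nab(2)[OF that Y])
  qed
qed

text \<open>The data of both sides are compared. For the bracket with Y, \<open>pairing_d\<close>
  leaves the terms \<theta>[N,[x,Y]]. The T\<F>-part of [x,Y] gives a covariant derivative of the
  form and the rest another insertion, which together are the right-hand side of
  \<open>ins_kz\<close>.\<close>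

lemma NuF_chain:
  assumes \<omega>: "is_form n \<omega>" and xs: "xs \<in> dm (Suc n)"
  shows "NuF (xi.d \<omega>) xs = nf.d (NuF \<omega>) xs"
proof -
  have a: "xi.aalt n \<omega>" and h: "xi.hom n \<omega>" using \<omega> by (simp_all add: is_form_def)
  have nl: "NuF \<omega> ys \<in> lsec F" if "ys \<in> dm n" for ys by (rule NuF_lsec[OF \<omega> that])
  have dl: "nf.d (NuF \<omega>) xs \<in> lsec F"
    by (rule nf.aalt_M[OF nf.aalt_kz[OF NuF_aalt[OF \<omega>]]]) (rule xs)
  have rep: "cls \<xi> (repG (NuF \<omega> ys)) = \<omega> ys"
    "Y \<in> Gam xG ==> cls \<xi> (lie (repG (NuF \<omega> ys)) Y) = ins (AY Y) \<omega> ys" if "ys \<in> dm n" for ys Y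
    using Nu(2,3)[OF \<omega> that] repG_NuF[OF \<omega> that] by simp_all
  have "Nu (xi.d \<omega>) xs = repG (nf.d (NuF \<omega>) xs)"
  proof (rule Nu_unique[OF is_form_d[OF \<omega>] xs repG[OF dl]])
    have "cls \<xi> (repG (nf.d (NuF \<omega>) xs)) = xi.d (\<lambda>ys. cls \<xi> (repG (NuF \<omega> ys))) xs"
      by (rule pairing_d(1)[OF xs nl secs_zero[OF xi_sub]])
    also have "\<dots> = xi.d \<omega> xs" by (rule xi.kz_cong[OF _ xs]) (rule rep(1))
    finally show "cls \<xi> (repG (nf.d (NuF \<omega>) xs)) = xi.d \<omega> xs" .
    fix Y assume Y: "Y \<in> Gam xG"
    note YV = secs_VF[OF Y] and Yx = xG_xi[OF Y]
    \<comment> \<open>\<open>QG (lie x Y)\<close> is again a section of \<xi> \<inter> G, so the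
      defining equation of \<open>Nu\<close> applies to it as well.\<close>
    let ?A = "AY Y" and ?A' = "\<lambda>x. AY (QG (lie x Y))"
    have lY: "lie x Y \<in> Gam \<xi>" if "x \<in> Gam F" for x by (rule lie_F_xi[OF that Yx open_UNIV])
    have A: "?A x \<in> Gam F" if "x \<in> Gam F" for x by (rule AY_F[OF YV secs_VF[OF that]])
    have QV: "QG (lie x Y) \<in> VF" if "x \<in> Gam F" for x by (rule QG_VF[OF secs_VF[OF lY[OF that]]])
    have A': "?A' x y \<in> Gam F" if "x \<in> Gam F" "y \<in> Gam F" for x y
      by (rule AY_F[OF QV[OF that(1)] secs_VF[OF that(2)]])
    \<comment> \<open>The T\<F>-component of the Jacobi identity for x, y, Y, with Q[x,Y] = [x,Y] -
      P[x,Y]; brackets of two sections of T\<F> are fixed by P.\<close>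
    have AA': "lie x (?A y) + lie (?A x) y - ?A (lie x y) = ?A' x y - ?A' y x" if x: "x \<in> Gam F" and y: "y \<in> Gam F" for x y
    proof -
      note xV = secs_VF[OF x] and yV = secs_VF[OF y]
      have q: "QG (lie z Y) = lie z Y - ?A z" for z by (simp add: AY_def PF_def)
      have e: "?A' u v = PF (lie v (lie u Y)) - lie v (?A u)" if u: "u \<in> Gam F" and v: "v \<in> Gam F" for u v
      proof -
        note uV = secs_VF[OF u] and vV = secs_VF[OF v]
        have "?A' u v = PF (lie v (lie u Y) - lie v (?A u))"
          by (simp only: AY_def[of "lie u Y - AY Y u"] q lie_diff_right[OF vV lie_VF[OF uV YV] secs_VF[OF A[OF u]]])
        also have "\<dots> = PF (lie v (lie u Y)) - PF (lie v (?A u))"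
          by (rule PF_diff) (intro lie_VF uV vV YV secs_VF[OF A[OF u]])+
        also have "PF (lie v (?A u)) = lie v (?A u)" by (rule PF_F[OF lie_F_F[OF v A[OF u] open_UNIV]])
        finally show ?thesis .
      qed
      have "?A (lie x y) = PF (lie x (lie y Y) - lie y (lie x Y))"
        using jacobi[OF xV yV YV] by (simp add: AY_def)
      also have "\<dots> = PF (lie x (lie y Y)) - PF (lie y (lie x Y))"
        by (rule PF_diff) (intro lie_VF xV yV YV)+
      finally have j: "?A (lie x y) = \<dots>" .
      show ?thesis
        unfolding e[OF x y] e[OF y x] j lie_antisym[of "?A x" y] by simp
    qed
    have "cls \<xi> (lie (repG (nf.d (NuF \<omega>) xs)) Y) = xi.d (\<lambda>ys. cls \<xi> (lie (repG (NuF \<omega> ys)) Y)) xs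
      - asum (\<lambda>x zs. cls \<xi> (lie (repG (NuF \<omega> zs)) (lie x Y))) xs"
      by (rule pairing_d(2)[OF xs nl Yx])
    also have "xi.d (\<lambda>ys. cls \<xi> (lie (repG (NuF \<omega> ys)) Y)) xs = xi.d (ins ?A \<omega>) xs"
      by (rule xi.kz_cong[OF _ xs]) (rule rep(2)[OF _ Y])
    also have "asum (\<lambda>x zs. cls \<xi> (lie (repG (NuF \<omega> zs)) (lie x Y))) xs =
        - asum (\<lambda>x zs. nabD \<xi> (?A x) (\<omega> zs) - ins (?A' x) \<omega> zs) xs"
      unfolding asum_def sum_negf[symmetric]
    proof (rule sum.cong[OF refl])
      fix i assume "i \<in> {..<length xs}"
      then have i: "i < Suc n" using xi.domD(2)[OF xs] by simp
      let ?x = "xs ! i" and ?z = "nths xs (- {i})"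
      have x: "?x \<in> Gam F" and z: "?z \<in> dm n" by (rule xi.dom_nth[OF xs i], rule xi.dom_nths[OF xs i])
      let ?N = "repG (NuF \<omega> ?z)"
      have NV: "?N \<in> VF" by (rule repG_VF[OF nl[OF z]])
      have "lie ?x Y = ?A ?x + QG (lie ?x Y)" by (simp add: AY_def PF_def)
      then have "cls \<xi> (lie ?N (lie ?x Y)) = cls \<xi> (lie ?N (?A ?x)) + cls \<xi> (lie ?N (QG (lie ?x Y)))"
        using lie_add_right[OF NV secs_VF[OF A[OF x]] QV[OF x]] by (simp add: cls_add'[OF xi_sub])
      also have "cls \<xi> (lie ?N (?A ?x)) = - nabD \<xi> (?A ?x) (\<omega> ?z)"
        using nab_xi_cls[OF A[OF x] NV] rep(1)[OF z] lie_antisym[of ?N "?A ?x"] by (simp add: cls_uminus'[OF xi_sub])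
      also have "cls \<xi> (lie ?N (QG (lie ?x Y))) = ins (?A' ?x) \<omega> ?z"
        by (rule rep(2)[OF z QG_xG[OF lY[OF x]]])
      finally have e: "cls \<xi> (lie ?N (lie ?x Y)) = - (nabD \<xi> (?A ?x) (\<omega> ?z) - ins (?A' ?x) \<omega> ?z)"
        by (simp only: minus_diff_eq add.commute[of "- _"] diff_conv_add_uminus[symmetric])
      show "sg i (cls \<xi> (lie ?N (lie ?x Y))) = - sg i (nabD \<xi> (?A ?x) (\<omega> ?z) - ins (?A' ?x) \<omega> ?z)"
        unfolding e by (simp only: sg_simps)
    qed
    also have "xi.d (ins ?A \<omega>) xs - - asum (\<lambda>x zs. nabD \<xi> (?A x) (\<omega> zs) - ins (?A' x) \<omega> zs) xs = ins ?A (xi.d \<omega>) xs"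
    proof -
      have "ins ?A (xi.d \<omega>) xs - xi.d (ins ?A \<omega>) xs = asum (\<lambda>x zs. nabD \<xi> (?A x) (\<omega> zs) - ins (?A' x) \<omega> zs) xs"
        by (rule xi.ins_kz[OF a xs A _ A' AA']) (simp_all add: AY_add[OF YV] secs_VF)
      then show ?thesis by (simp add: diff_eq_eq add.commute)
    qed
    finally show "cls \<xi> (lie (repG (nf.d (NuF \<omega>) xs)) Y) = ins ?A (xi.d \<omega>) xs" .
  qed
  then show ?thesis by (simp add: NuF_def cls_repG[OF dl])
qed

end

context pre_contact_complement begin

lemma nf_eqI:
  assumes "m \<in> lsec F" "n \<in> lsec F" "cls \<xi> (repG m) = cls \<xi> (repG n)"
    "\<And>Y. Y \<in> Gam xG ==> cls \<xi> (lie (repG m) Y) = cls \<xi> (lie (repG n) Y)"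
  shows "m = n"
proof -
  have "repG m = repG n" by (rule solve_unique_global[OF repG[OF assms(1)] repG[OF assms(2)] assms(3,4)])
  then have "cls F (repG m) = cls F (repG n)" by simp
  then show ?thesis by (simp only: cls_repG assms(1,2))
qed

lemma repG_smul:
  assumes "s \<in> R" "m \<in> lsec F"
  shows "repG (smulsec s m) = smul s (repG m)"
proof -
  have "repG (smulsec s m) = repG (cls F (smul s (repG m)))"
    by (simp only: cls_smul'[OF F_sub] cls_repG assms)
  also have "\<dots> = smul s (repG m)"
    by (simp only: repG_cls VF_smul repG_VF assms QG_G secs_smul[OF G_sub] repG)
  finally show ?thesis .
qed

end

section \<open>Independence of the complement\<close>

locale two_complements = pre_contact_complement +
  fixes G' assumes G': "pre_contact_complement A \<xi> G'"
begin

interpretation c2: pre_contact_complement A \<xi> G' by (rule G')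

definition shift :: "'a vfield => 'a vfield" where
  "shift X = c2.PF X - PF X"

lemma shift_F: "X \<in> VF ==> shift X \<in> Gam F"
  unfolding shift_def by (rule secs_diff[OF F_sub c2.QG_spec(2) QG_spec(2)])

lemma shift_add: "X \<in> VF ==> Y \<in> VF ==> shift (X + Y) = shift X + shift Y"
  by (simp add: shift_def PF_add c2.PF_add)

lemma shift_smul: "h \<in> R ==> X \<in> VF ==> shift (smul h X) = smul h (shift X)"
  by (simp add: shift_def PF_smul c2.PF_smul smul_diff)

lemma shift_QG:
  assumes "X \<in> VF"
  shows "shift (QG X) = shift X"
proof -
  have "shift (PF X) = 0" using QG_spec(2)[OF assms] by (simp add: shift_def PF_F c2.PF_F)
  then show ?thesis using shift_add[OF QG_VF[OF assms] PF_VF[OF assms]] by (simp add: PF_def)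
qed

text \<open>Since P Y = 0, the field splits as Y = t + Q'Y with t = P'Y, the shift of Y, and Q'Y in
  \<xi> \<inter> G', where the data of the other solution are prescribed. Moreover P'[x,Q'Y] =
  P[x,Y] + (P' - P)[x,Y] + [t,x]; the terms with t combine to a Lie derivative.\<close>

lemma Nu_change:
  assumes \<omega>: "is_form n \<omega>" and xs: "xs \<in> dm n" and Y: "Y \<in> Gam xG"
  shows "cls \<xi> (lie (QG (c2.Nu \<omega> xs)) Y) =
    ins (AY Y) \<omega> xs + ins (\<lambda>x. shift (lie x Y)) \<omega> xs - xi.lieop (shift Y) \<omega> xs"
proof -
  have a: "xi.aalt n \<omega>" using \<omega> by (simp add: is_form_def)
  note YV = secs_VF[OF Y] and Yx = xG_xi[OF Y]
  let ?t = "shift Y" and ?N = "c2.Nu \<omega> xs"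
  have aux2: "u - - w = v + (u - v + w)" for u v w :: "'a vfield" by (simp add: algebra_simps)
  have NV: "?N \<in> VF" by (rule secs_VF[OF c2.Nu(1)[OF \<omega> xs]])
  have t: "?t \<in> Gam F" by (rule shift_F[OF YV])
  note tV = secs_VF[OF t]
  have "PF Y = 0" by (rule PF_G[OF xG_G[OF Y]])
  then have Q: "c2.QG Y = Y - ?t" by (simp add: shift_def c2.PF_def)
  have QV: "c2.QG Y \<in> VF" by (rule c2.QG_VF[OF YV])
  have "Y = ?t + c2.QG Y" by (simp add: Q)
  then have "cls \<xi> (lie ?N Y) = cls \<xi> (lie ?N ?t) + cls \<xi> (lie ?N (c2.QG Y))"
    using lie_add_right[OF NV tV QV] by (simp add: cls_add'[OF xi_sub])
  also have "cls \<xi> (lie ?N ?t) = - nabD \<xi> ?t (\<omega> xs)"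
    using nab_xi_cls[OF t NV] c2.Nu(2)[OF \<omega> xs] lie_antisym[of ?N ?t] by (simp add: cls_uminus'[OF xi_sub])
  also have "cls \<xi> (lie ?N (c2.QG Y)) = ins (c2.AY (c2.QG Y)) \<omega> xs"
    by (rule c2.Nu(3)[OF \<omega> xs c2.QG_xG[OF Yx]])
  also have "\<dots> = ins (AY Y) \<omega> xs + ins (\<lambda>x. shift (lie x Y) + lie ?t x) \<omega> xs"
  proof (rule xi.ins_op_add[OF a _ _ _ xs])
    fix x assume x: "x \<in> Gam F"
    note xV = secs_VF[OF x]
    have xt: "lie x ?t \<in> Gam F" by (rule lie_F_F[OF x t open_UNIV])
    show "AY Y x \<in> Gam F" by (rule AY_F[OF YV xV])
    show "shift (lie x Y) + lie ?t x \<in> Gam F"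
      by (rule secs_add[OF F_sub shift_F[OF lie_VF[OF xV YV]] lie_F_F[OF t x open_UNIV]])
    have "c2.AY (c2.QG Y) x = c2.PF (lie x Y) - c2.PF (lie x ?t)"
      unfolding c2.AY_def Q lie_diff_right[OF xV YV tV] by (rule c2.PF_diff[OF lie_VF[OF xV YV] secs_VF[OF xt]])
    also have "c2.PF (lie x ?t) = - lie ?t x"
      using c2.PF_F[OF xt] lie_antisym[of x ?t] by simp
    finally have "c2.AY (c2.QG Y) x = c2.PF (lie x Y) - - lie ?t x" .
    also have "\<dots> = AY Y x + (shift (lie x Y) + lie ?t x)"
      unfolding AY_def shift_def[of "lie x Y"] by (rule aux2)
    finally show "c2.AY (c2.QG Y) x = AY Y x + (shift (lie x Y) + lie ?t x)" .
  qed
  also have "ins (\<lambda>x. shift (lie x Y) + lie ?t x) \<omega> xs = ins (\<lambda>x. shift (lie x Y)) \<omega> xs + ins (lie ?t) \<omega> xs"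
    by (rule xi.ins_op_add[OF a _ _ _ xs]) (simp_all add: shift_F lie_VF secs_VF YV lie_F_F[OF t _ open_UNIV])
  finally have e: "cls \<xi> (lie ?N Y) = - nabD \<xi> ?t (\<omega> xs) +
    (ins (AY Y) \<omega> xs + (ins (\<lambda>x. shift (lie x Y)) \<omega> xs + ins (lie ?t) \<omega> xs))" .
  have aux: "- a + (b + (c + d)) = b + c - (a - d)" for a b c d :: "'a => 'a tvec" by (simp add: algebra_simps)
  show ?thesis unfolding cls_lie_QG[OF NV Yx] e xi.lieop_def by (rule aux)
qed

definition psi :: "('a vfield list => 'a => 'a tvec) => 'a vfield list => 'a => 'a tvec" where
  "psi \<omega> xs = cls F (SOME N. N \<in> Gam G \<and> cls \<xi> N = 0 \<and> (\<forall>Y\<in>Gam xG. cls \<xi> (lie N Y) = \<omega> (shift Y # xs)))"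

text \<open>The bracket equation, imposed on \<xi> \<inter> G, extends to \<xi> because both sides
  vanish on T\<F>: P and P' agree there, and \<theta>[N,X] is minus the covariant derivative of
  \<theta> N = 0.\<close>

lemma psi:
  assumes \<omega>: "is_form (Suc n) \<omega>" and xs: "xs \<in> dm n"
  shows "psi \<omega> xs \<in> lsec F" "cls \<xi> (repG (psi \<omega> xs)) = 0"
    "Y \<in> Gam \<xi> ==> cls \<xi> (lie (repG (psi \<omega> xs)) Y) = \<omega> (shift Y # xs)"
proof -
  have a: "xi.aalt (Suc n) \<omega>" and h: "xi.hom (Suc n) \<omega>" using \<omega> by (simp_all add: is_form_def)
  have sF: "shift Y \<in> Gam F" if "Y \<in> Gam xG" for Y by (rule shift_F[OF secs_VF[OF that]])
  have "xG_linear (\<lambda>Y. \<omega> (shift Y # xs))"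
    unfolding xG_linear_def
  proof (intro conjI ballI)
    show "\<omega> (shift Y # xs) \<in> lsec \<xi>" if "Y \<in> Gam xG" for Y
      by (rule xi.aalt_M[OF a]) (simp add: xi.dom_Cons sF that xs)
    show "\<omega> (shift (Y + Y') # xs) = \<omega> (shift Y # xs) + \<omega> (shift Y' # xs)" if "Y \<in> Gam xG" "Y' \<in> Gam xG" for Y Y'
      unfolding shift_add[OF secs_VF secs_VF, OF that] by (rule xi.aalt_hd_add[OF a xs sF sF, OF that])
    show "\<omega> (shift (smul s Y) # xs) = smulsec s (\<omega> (shift Y # xs))" if "Y \<in> Gam xG" "s \<in> R" for Y s
      unfolding shift_smul[OF that(2) secs_VF[OF that(1)]] by (rule xi.hom_hd[OF h xs that(2) sF[OF that(1)]])
  qed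
  from solve[OF lsec_zero[OF xi_sub] this]
  have "\<exists>N. N \<in> Gam G \<and> cls \<xi> N = 0 \<and> (\<forall>Y\<in>Gam xG. cls \<xi> (lie N Y) = \<omega> (shift Y # xs))" by blast
  from someI_ex[OF this] obtain N where N: "N \<in> Gam G" "cls \<xi> N = 0"
    "\<And>Y. Y \<in> Gam xG ==> cls \<xi> (lie N Y) = \<omega> (shift Y # xs)" and p: "psi \<omega> xs = cls F N" unfolding psi_def by blast
  have NV: "N \<in> VF" by (rule secs_VF[OF N(1)])
  have r: "repG (psi \<omega> xs) = N" unfolding p using repG_cls[OF NV] QG_G[OF N(1)] by simp
  show "psi \<omega> xs \<in> lsec F" unfolding p by (rule cls_lsec[OF F_sub NV])
  show "cls \<xi> (repG (psi \<omega> xs)) = 0" unfolding r by (rule N(2))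
  show "cls \<xi> (lie (repG (psi \<omega> xs)) Y) = \<omega> (shift Y # xs)" if Y: "Y \<in> Gam \<xi>"
  proof -
    note YV = secs_VF[OF Y]
    have PF: "PF Y \<in> Gam F" by (rule QG_spec(2)[OF YV])
    have "lie N Y = lie N (PF Y) + lie N (QG Y)"
      using lie_add_right[OF NV PF_VF[OF YV] QG_VF[OF YV]] by (simp add: PF_def)
    moreover have "cls \<xi> (lie N (PF Y)) = 0"
      using nab_xi_cls[OF PF NV] N(2) xi.nab_zero[OF PF] lie_antisym[of N "PF Y"] by (simp add: cls_uminus'[OF xi_sub])
    ultimately show ?thesis
      unfolding r using N(3)[OF QG_xG[OF Y]] shift_QG[OF YV] by (simp add: cls_add'[OF xi_sub])
  qed
qed

lemma psi_eqI:
  assumes "is_form (Suc n) \<omega>" "xs \<in> dm n" "m \<in> lsec F" "cls \<xi> (repG m) = 0"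
    "\<And>Y. Y \<in> Gam xG ==> cls \<xi> (lie (repG m) Y) = \<omega> (shift Y # xs)"
  shows "psi \<omega> xs = m"
  by (rule nf_eqI[OF psi(1)[OF assms(1,2)] assms(3)]) (simp_all add: psi[OF assms(1,2)] assms(4,5) xG_xi)

lemma psi_form:
  assumes \<omega>: "is_form (Suc n) \<omega>"
  shows "nf.aalt n (psi \<omega>)" "nf.hom n (psi \<omega>)"
proof -
  have a: "xi.aalt (Suc n) \<omega>" and h: "xi.hom (Suc n) \<omega>" using \<omega> by (simp_all add: is_form_def)
  have sF: "shift Y \<in> Gam F" if "Y \<in> Gam xG" for Y by (rule shift_F[OF secs_VF[OF that]])
  have ai: "xi.aalt n (\<lambda>ys. \<omega> (shift Y # ys))" and hi: "xi.hom n (\<lambda>ys. \<omega> (shift Y # ys))" if "Y \<in> Gam xG" for Y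
    by (rule xi.aalt_iota[OF a sF[OF that]], rule xi.hom_iota[OF h sF[OF that]])
  show "nf.aalt n (psi \<omega>)"
    unfolding nf.aalt_def
  proof (intro ballI conjI allI impI)
    fix xs assume xs: "xs \<in> dm n"
    show "psi \<omega> xs \<in> lsec F" by (rule psi(1)[OF \<omega> xs])
    show "psi \<omega> (xs[i := x + y]) = psi \<omega> (xs[i := x]) + psi \<omega> (xs[i := y])"
      if i: "i < n" and x: "x \<in> Gam F" and y: "y \<in> Gam F" for i x y
    proof -
      note dx = xi.dom_update[OF xs x, of i] and dy = xi.dom_update[OF xs y, of i]
        and dxy = xi.dom_update[OF xs xi.L_add[OF x y], of i]
      note px = psi[OF \<omega> dx] and py = psi[OF \<omega> dy]
      show ?thesis
      proof (rule psi_eqI[OF \<omega> dxy lsec_add[OF F_sub px(1) py(1)]])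
        show "cls \<xi> (repG (psi \<omega> (xs[i := x]) + psi \<omega> (xs[i := y]))) = 0"
          by (simp only: repG_add[OF px(1) py(1)] cls_add'[OF xi_sub] px(2) py(2) add_0)
        show "cls \<xi> (lie (repG (psi \<omega> (xs[i := x]) + psi \<omega> (xs[i := y]))) Y) = \<omega> (shift Y # xs[i := x + y])"
          if Y: "Y \<in> Gam xG" for Y
          by (simp only: repG_add[OF px(1) py(1)] lie_add_left[OF repG_VF[OF px(1)] repG_VF[OF py(1)] secs_VF[OF Y]]
            cls_add'[OF xi_sub] px(3)[OF xG_xi[OF Y]] py(3)[OF xG_xi[OF Y]] xi.aalt_add[OF ai[OF Y] xs i x y])
      qed
    qed
    show "psi \<omega> xs = 0" if ij: "i < n" "j < n" "i \<noteq> j \<and> xs ! i = xs ! j" for i j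
    proof (rule psi_eqI[OF \<omega> xs lsec_zero[OF F_sub]])
      show "cls \<xi> (repG 0) = 0" by (simp only: repG_zero cls_zero'[OF xi_sub])
      show "cls \<xi> (lie (repG 0) Y) = \<omega> (shift Y # xs)" if Y: "Y \<in> Gam xG" for Y
        unfolding xi.aalt_alt[OF ai[OF Y] xs ij(1,2) conjunct1[OF ij(3)] conjunct2[OF ij(3)]]
        by (simp only: repG_zero lie_zero_left[OF secs_VF[OF Y]] cls_zero'[OF xi_sub])
    qed
  qed
  show "nf.hom n (psi \<omega>)"
    unfolding nf.hom_def
  proof (intro ballI allI impI)
    fix xs i s x assume xs: "xs \<in> dm n" and i: "i < n" and s: "s \<in> R" and x: "x \<in> Gam F"
    note dx = xi.dom_update[OF xs x, of i] and dsx = xi.dom_update[OF xs xi.sx_L[OF s x], of i]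
    note px = psi[OF \<omega> dx]
    have z: "smulsec s' 0 = 0" for s' :: "'a => real" by (simp add: smulsec_def fun_eq_iff)
    show "psi \<omega> (xs[i := smul s x]) = smulsec s (psi \<omega> (xs[i := x]))"
    proof (rule psi_eqI[OF \<omega> dsx lsec_smul[OF F_sub s px(1)]])
      show "cls \<xi> (repG (smulsec s (psi \<omega> (xs[i := x])))) = 0"
        by (simp only: repG_smul[OF s px(1)] cls_smul'[OF xi_sub] px(2) z)
      show "cls \<xi> (lie (repG (smulsec s (psi \<omega> (xs[i := x])))) Y) = \<omega> (shift Y # xs[i := smul s x])"
        if Y: "Y \<in> Gam xG" for Y
        by (simp only: repG_smul[OF s px(1)] cls_lie_smul_left[OF s repG_VF[OF px(1)] secs_VF[OF Y]] px(2) z diff_zero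
          px(3)[OF xG_xi[OF Y]] xi.homD[OF hi[OF Y] xs i s x])
    qed
  qed
qed

text \<open>For a closed form Cartan's formula turns the Lie derivative in \<open>Nu_change\<close>
  into the differential of a contraction. What remains of the difference is then the bracket datum
  of \<open>d\<close> of \<open>psi\<close> as computed by \<open>pairing_d\<close>. In degree 0
  there is no \<open>psi\<close>, and the Lie derivative vanishes.\<close>

lemma NuF_change:
  assumes \<omega>: "is_form n \<omega>" and closed: "\<And>ys. ys \<in> dm (Suc n) ==> xi.d \<omega> ys = 0" and xs: "xs \<in> dm n"
  shows "c2.NuF \<omega> xs = NuF \<omega> xs - (case n of 0 => 0 | Suc k => nf.d (psi \<omega>) xs)"
proof (rule nf_eqI)
  have a: "xi.aalt n \<omega>" using \<omega> by (simp add: is_form_def)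
  let ?c = "case n of 0 => 0 | Suc k => nf.d (psi \<omega>) xs"
  have NV: "c2.Nu \<omega> xs \<in> VF" by (rule secs_VF[OF c2.Nu(1)[OF \<omega> xs]])
  have c: "?c \<in> lsec F"
  proof (cases n)
    case 0
    then show ?thesis by (simp add: lsec_zero[OF F_sub])
  next
    case (Suc k)
    have "nf.d (psi \<omega>) xs \<in> lsec F"
      by (rule nf.aalt_M[OF nf.aalt_kz[OF psi_form(1)[OF \<omega>[unfolded Suc]]] xs[unfolded Suc]])
    then show ?thesis by (simp add: Suc)
  qed
  have p: "cls \<xi> (repG ?c) = 0"
  proof (cases n)
    case 0
    then show ?thesis by (simp only: nat.case repG_zero cls_zero'[OF xi_sub])
  next
    case (Suc k)
    note \<omega>k = \<omega>[unfolded Suc] and xk = xs[unfolded Suc]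
    have "cls \<xi> (repG (nf.d (psi \<omega>) xs)) = xi.d (\<lambda>ys. cls \<xi> (repG (psi \<omega> ys))) xs"
      by (rule pairing_d(1)[OF xk psi(1)[OF \<omega>k] secs_zero[OF xi_sub]])
    also have "\<dots> = xi.d (\<lambda>ys. 0) xs" by (rule xi.kz_cong[OF _ xk]) (rule psi(2)[OF \<omega>k])
    also have "\<dots> = 0" by (rule xi.kz_zero[OF xk])
    finally show ?thesis by (simp add: Suc)
  qed
  have q: "cls \<xi> (lie (repG ?c) Y) = xi.lieop (shift Y) \<omega> xs - ins (\<lambda>x. shift (lie x Y)) \<omega> xs" if Y: "Y \<in> Gam xG" for Y
  proof -
    note YV = secs_VF[OF Y] and Yx = xG_xi[OF Y]
    have t: "shift Y \<in> Gam F" by (rule shift_F[OF YV])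
    \<comment> \<open>Cartan's formula with the left-hand side 0 by closedness.\<close>
    have L: "xi.lieop (shift Y) \<omega> xs = xi.d (\<lambda>ys. \<omega> (shift Y # ys)) xs"
      using xi.kz_Cons[OF a xs t] closed[of "shift Y # xs"] t xs by (simp add: xi.dom_Cons)
    show ?thesis
    proof (cases n)
      case 0
      then have "xs = []" using xs by (simp add: xi.dom_0)
      then show ?thesis
        unfolding L using 0 by (simp add: repG_zero lie_zero_left[OF YV] cls_zero'[OF xi_sub])
    next
      case (Suc k)
      note \<omega>k = \<omega>[unfolded Suc] and xk = xs[unfolded Suc]
      have lY: "lie x Y \<in> Gam \<xi>" if "x \<in> Gam F" for x by (rule lie_F_xi[OF that Yx open_UNIV])
      have "cls \<xi> (lie (repG (nf.d (psi \<omega>) xs)) Y) = xi.d (\<lambda>ys. cls \<xi> (lie (repG (psi \<omega> ys)) Y)) xs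
          - asum (\<lambda>x zs. cls \<xi> (lie (repG (psi \<omega> zs)) (lie x Y))) xs"
        by (rule pairing_d(2)[OF xk psi(1)[OF \<omega>k] Yx])
      also have "xi.d (\<lambda>ys. cls \<xi> (lie (repG (psi \<omega> ys)) Y)) xs = xi.d (\<lambda>ys. \<omega> (shift Y # ys)) xs"
        by (rule xi.kz_cong[OF _ xk]) (rule psi(3)[OF \<omega>k _ Yx])
      also have "asum (\<lambda>x zs. cls \<xi> (lie (repG (psi \<omega> zs)) (lie x Y))) xs = ins (\<lambda>x. shift (lie x Y)) \<omega> xs"
        unfolding asum_def ins_def
      proof (rule sum.cong[OF refl])
        fix i assume "i \<in> {..<length xs}"
        then have i: "i < Suc k" using xi.domD(2)[OF xk] by simp
        note xF = xi.dom_nth[OF xk i]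
        have "cls \<xi> (lie (repG (psi \<omega> (nths xs (- {i})))) (lie (xs ! i) Y)) = \<omega> (shift (lie (xs ! i) Y) # nths xs (- {i}))"
          by (rule psi(3)[OF \<omega>k xi.dom_nths[OF xk i] lY[OF xF]])
        also have "\<dots> = sg i (\<omega> (xs[i := shift (lie (xs ! i) Y)]))"
          by (rule xi.aalt_move[OF a xs shift_F[OF secs_VF[OF lY[OF xF]]]]) (simp add: Suc i)
        finally show "sg i (cls \<xi> (lie (repG (psi \<omega> (nths xs (- {i})))) (lie (xs ! i) Y))) = \<omega> (xs[i := shift (lie (xs ! i) Y)])"
          by (simp only: sg_sg)
      qed
      finally show ?thesis unfolding L by (simp only: Suc nat.case)
    qed
  qed
  show "c2.NuF \<omega> xs \<in> lsec F" by (rule c2.NuF_lsec[OF \<omega> xs])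
  show "NuF \<omega> xs - ?c \<in> lsec F" by (rule lsec_diff[OF F_sub NuF_lsec[OF \<omega> xs] c])
  have r: "repG (NuF \<omega> xs - ?c) = Nu \<omega> xs - repG ?c"
    using repG_add[OF lsec_diff[OF F_sub NuF_lsec[OF \<omega> xs] c] c] repG_NuF[OF \<omega> xs] by (simp add: eq_diff_eq)
  have r2: "repG (c2.NuF \<omega> xs) = QG (c2.Nu \<omega> xs)"
    unfolding c2.NuF_def by (rule repG_cls[OF NV])
  show "cls \<xi> (repG (c2.NuF \<omega> xs)) = cls \<xi> (repG (NuF \<omega> xs - ?c))"
    unfolding r r2 cls_QG[OF NV] cls_diff'[OF xi_sub] p by (simp only: c2.Nu(2)[OF \<omega> xs] Nu(2)[OF \<omega> xs] diff_zero)
  show "cls \<xi> (lie (repG (c2.NuF \<omega> xs)) Y) = cls \<xi> (lie (repG (NuF \<omega> xs - ?c)) Y)" if Y: "Y \<in> Gam xG" for Y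
  proof -
    have "lie (Nu \<omega> xs - repG ?c) Y = lie (Nu \<omega> xs) Y - lie (repG ?c) Y"
      by (rule lie_diff_left[OF secs_VF[OF Nu(1)[OF \<omega> xs]] repG_VF[OF c] secs_VF[OF Y]])
    then have e: "cls \<xi> (lie (Nu \<omega> xs - repG ?c) Y) =
        ins (AY Y) \<omega> xs - (xi.lieop (shift Y) \<omega> xs - ins (\<lambda>x. shift (lie x Y)) \<omega> xs)"
      by (simp only: cls_diff'[OF xi_sub] q[OF Y] Nu(3)[OF \<omega> xs Y])
    have aux: "a + b - c = a - (c - b)" for a b c :: "'a => 'a tvec" by (simp add: algebra_simps)
    show ?thesis unfolding r r2 e Nu_change[OF \<omega> xs Y] by (rule aux)
  qed
qed

end

section \<open>Modules of sections and forms\<close>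

text \<open>A module record is embedded into a type-class group. The group axioms of the record
  follow by injectivity, and its equations can be checked in the ambient group.\<close>

locale module_embedding =
  fixes M :: "('s, 'x) module" and J :: "'x => 'm::ab_group_add"
  assumes inj: "inj_on J (carrier M)"
    and zero_closed: "\<zero>\<^bsub>M\<^esub> \<in> carrier M" and J_zero: "J \<zero>\<^bsub>M\<^esub> = 0"
    and add_closed: "x \<in> carrier M ==> y \<in> carrier M ==> x \<oplus>\<^bsub>M\<^esub> y \<in> carrier M"
    and J_add: "x \<in> carrier M ==> y \<in> carrier M ==> J (x \<oplus>\<^bsub>M\<^esub> y) = J x + J y"
    and neg: "x \<in> carrier M ==> \<exists>y\<in>carrier M. J y = - J x"
begin

lemma J_eq: "x \<in> carrier M ==> y \<in> carrier M ==> J x = J y ==> x = y"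
  using inj by (simp add: inj_on_def)

lemma is_abelian_group: "abelian_group M"
proof (rule abelian_groupI)
  show "\<exists>y\<in>carrier M. y \<oplus>\<^bsub>M\<^esub> x = \<zero>\<^bsub>M\<^esub>" if x: "x \<in> carrier M" for x
  proof -
    obtain y where y: "y \<in> carrier M" "J y = - J x" using neg[OF x] by blast
    have "y \<oplus>\<^bsub>M\<^esub> x = \<zero>\<^bsub>M\<^esub>"
      by (rule J_eq) (simp_all add: add_closed zero_closed x y J_add J_zero)
    then show ?thesis using y by blast
  qed
qed (auto intro!: J_eq simp: add_closed zero_closed J_add J_zero add.assoc add.commute)

sublocale grp: abelian_group M by (rule is_abelian_group)

lemma J_uminus: "x \<in> carrier M ==> J (\<ominus>\<^bsub>M\<^esub> x) = - J x"
  using J_add[of x "\<ominus>\<^bsub>M\<^esub> x"] grp.r_neg[of x] by (simp add: J_zero eq_neg_iff_add_eq_0 add.commute)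

lemma J_minus: "x \<in> carrier M ==> y \<in> carrier M ==> J (x \<ominus>\<^bsub>M\<^esub> y) = J x - J y"
  by (simp add: a_minus_def J_add J_uminus)

lemma J_finsum: "finite I ==> f \<in> I \<rightarrow> carrier M ==> J (finsum M f I) = (\<Sum>i\<in>I. J (f i))"
  by (induction I rule: finite_induct) (simp_all add: J_zero J_add)

lemma J_alt_sign: "x \<in> carrier M ==> J (alt_sign M i x) = sg i (J x)"
  by (simp add: alt_sign_def sg_def J_uminus)

lemma alt_sign_closed: "x \<in> carrier M ==> alt_sign M i x \<in> carrier M"
  by (simp add: alt_sign_def)

text \<open>Membership of every summand is assumed because \<open>finsum\<close> behaves as a sum
  only for terms in the carrier.\<close>

lemma koszul_closed_J:
  assumes xs: "xs \<in> tuples L (Suc n)"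
    and 1: "\<And>i. i \<le> n ==> nab (xs ! i) (\<eta> (nths xs (- {i}))) \<in> carrier M"
    and 2: "\<And>i j. i < j ==> j \<le> n ==> \<eta> (br (xs ! i) (xs ! j) # nths xs (- {i, j})) \<in> carrier M"
  shows "koszul L M br nab n \<eta> xs \<in> carrier M"
    and "J (koszul L M br nab n \<eta> xs) =
      (\<Sum>i<Suc n. sg i (J (nab (xs ! i) (\<eta> (nths xs (- {i})))))) +
      (\<Sum>j<Suc n. \<Sum>i<j. sg (i + j) (J (\<eta> (br (xs ! i) (xs ! j) # nths xs (- {i, j})))))"
proof -
  let ?a = "\<lambda>i. alt_sign M i (nab (xs ! i) (\<eta> (nths xs (- {i}))))"
    and ?b = "\<lambda>j i. alt_sign M (i + j) (\<eta> (br (xs ! i) (xs ! j) # nths xs (- {i, j})))"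
  have a: "?a \<in> {..n} \<rightarrow> carrier M" using 1 by (auto intro!: alt_sign_closed)
  have b: "?b j \<in> {..<j} \<rightarrow> carrier M" if "j \<le> n" for j using 2 that by (auto intro!: alt_sign_closed)
  have B: "(\<lambda>j. finsum M (?b j) {..<j}) \<in> {..n} \<rightarrow> carrier M"
    using grp.finsum_closed[OF b] by auto
  have e: "koszul L M br nab n \<eta> xs = finsum M ?a {..n} \<oplus>\<^bsub>M\<^esub> (\<Oplus>\<^bsub>M\<^esub>j\<in>{..n}. finsum M (?b j) {..<j})"
    using xs by (simp add: koszul_def)
  show "koszul L M br nab n \<eta> xs \<in> carrier M"
    unfolding e by (intro add_closed grp.finsum_closed a B)
  have "J (finsum M ?a {..n}) = (\<Sum>i<Suc n. sg i (J (nab (xs ! i) (\<eta> (nths xs (- {i}))))))"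
    unfolding J_finsum[OF finite_atMost a] lessThan_Suc_atMost by (intro sum.cong refl) (simp add: J_alt_sign 1)
  moreover have "J (\<Oplus>\<^bsub>M\<^esub>j\<in>{..n}. finsum M (?b j) {..<j}) =
      (\<Sum>j<Suc n. \<Sum>i<j. sg (i + j) (J (\<eta> (br (xs ! i) (xs ! j) # nths xs (- {i, j})))))"
    unfolding J_finsum[OF finite_atMost B] lessThan_Suc_atMost
  proof (rule sum.cong[OF refl])
    fix j assume "j \<in> {..n}"
    then have j: "j \<le> n" by simp
    show "J (finsum M (?b j) {..<j}) = (\<Sum>i<j. sg (i + j) (J (\<eta> (br (xs ! i) (xs ! j) # nths xs (- {i, j})))))"
      unfolding J_finsum[OF finite_lessThan b[OF j]] by (intro sum.cong refl) (simp add: J_alt_sign 2 j)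
  qed
  ultimately show "J (koszul L M br nab n \<eta> xs) =
      (\<Sum>i<Suc n. sg i (J (nab (xs ! i) (\<eta> (nths xs (- {i})))))) +
      (\<Sum>j<Suc n. \<Sum>i<j. sg (i + j) (J (\<eta> (br (xs ! i) (xs ! j) # nths xs (- {i, j})))))"
    unfolding e J_add[OF grp.finsum_closed[OF a] grp.finsum_closed[OF B]] by simp
qed

end

context smooth_manifold begin

definition qs :: "'a distribution => ('a => 'a tvec) => 'a qsection" where
  "qs D m = (\<lambda>p. (\<lambda>h. h + m p) ` D p)"

text \<open>The inverse of \<open>qs\<close> on sections. The element picked from the coset is
  irrelevant, as \<open>dist_proj\<close> is constant on cosets.\<close>

definition js :: "'a distribution => 'a qsection => ('a => 'a tvec)" where
  "js D s = (\<lambda>p. dist_proj D p (SOME v. v \<in> s p))"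

context
  fixes D assumes D: "sub_dist D"
begin

lemma sub_dist_subspace: "tv.subspace (D p)"
  using D by (simp add: sub_dist_def)

lemma dist_proj_coset:
  assumes "S = (\<lambda>h. h + v) ` D p"
  shows "dist_proj D p (SOME u. u \<in> S) = dist_proj D p v"
proof -
  have "v \<in> S" using assms tv.subspace_0[OF sub_dist_subspace, of p] by force
  then have "(SOME u. u \<in> S) \<in> S" by (rule someI[of "\<lambda>u. u \<in> S"])
  then obtain h where h: "h \<in> D p" "(SOME u. u \<in> S) = h + v" unfolding assms by blast
  have "dist_proj D p h = 0" using h dist_proj_props(2)[OF D] by blast
  then show ?thesis unfolding h(2) dist_proj_add[OF D] by simp
qed

lemma quot_proj_qs: "quot_proj A D X = qs D (cls D X)"
proof
  fix p
  have "vec_at X p - cls D X p \<in> D p" unfolding cls_def by (rule dist_proj_props(3)[OF D])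
  then show "quot_proj A D X p = qs D (cls D X) p"
    unfolding quot_proj_apply qs_def image_plus_eq_iff[OF sub_dist_subspace] .
qed

lemma js_qs:
  assumes "m \<in> lsec D"
  shows "js D (qs D m) = m"
proof
  fix p
  obtain Q N where N: "open Q" "p \<in> Q" "N \<in> VF" "\<And>q. q \<in> Q ==> m q = cls D N q"
    by (rule lsecE[OF D assms, of p]) (rule that)
  have mp: "m p = dist_proj D p (vec_at N p)" using N by (simp add: cls_def)
  have "dist_proj D p (vec_at N p - m p) = 0"
    unfolding mp dist_proj_props(2)[OF D] by (rule dist_proj_props(3)[OF D])
  then have "dist_proj D p (m p) = m p" unfolding dist_proj_diff[OF D] mp by simp
  then show "js D (qs D m) p = m p"
    unfolding js_def by (subst dist_proj_coset[of _ "m p"]) (simp_all add: qs_def)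
qed

lemma js_quot_proj: "X \<in> VF ==> js D (quot_proj A D X) = cls D X"
  unfolding quot_proj_qs by (rule js_qs[OF cls_lsec[OF D]])

lemma js_local: "s p = quot_proj A D X p ==> js D s p = cls D X p"
  unfolding js_def cls_def by (rule dist_proj_coset) (simp add: quot_proj_apply)

lemma qsec_iff: "s \<in> carrier (quot_sections A D) \<longleftrightarrow>
    (\<forall>p. \<exists>U. open U \<and> p \<in> U \<and> (\<exists>X\<in>VF. \<forall>q\<in>U. s q = quot_proj A D X q))"
  by (simp add: quot_sections_def)

lemma js_lsec:
  assumes "s \<in> carrier (quot_sections A D)"
  shows "js D s \<in> lsec D" "qs D (js D s) = s"
proof -
  have loc: "\<exists>U N. open U \<and> p \<in> U \<and> N \<in> VF \<and> (\<forall>q\<in>U. s q = quot_proj A D N q)" for p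
    using assms[unfolded qsec_iff, THEN spec, of p] by (elim exE conjE bexE) (intro exI conjI)
  show "js D s \<in> lsec D"
  proof (rule lsecI[OF D])
    fix p
    obtain U N where N: "open U" "p \<in> U" "N \<in> VF" "\<forall>q\<in>U. s q = quot_proj A D N q"
      using loc[of p] by (elim exE conjE)
    show "\<exists>Q N. open Q \<and> p \<in> Q \<and> N \<in> VF \<and> (\<forall>q\<in>Q. js D s q = cls D N q)"
      by (intro exI[of _ U] exI[of _ N] conjI ballI N(1-3) js_local bspec[OF N(4)])
  qed
  show "qs D (js D s) = s"
  proof
    fix p
    obtain U N where N: "p \<in> U" "N \<in> VF" "\<forall>q\<in>U. s q = quot_proj A D N q" using loc[of p] by (elim exE conjE)
    then have "s p = quot_proj A D N p" by blast
    then show "qs D (js D s) p = s p" using js_local[of s p N] by (simp add: quot_proj_qs qs_def)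
  qed
qed

lemma qs_carrier:
  assumes "m \<in> lsec D"
  shows "qs D m \<in> carrier (quot_sections A D)"
  unfolding qsec_iff
proof
  fix p
  obtain Q N where N: "open Q" "p \<in> Q" "N \<in> VF" "\<And>q. q \<in> Q ==> m q = cls D N q"
    by (rule lsecE[OF D assms, of p]) (rule that)
  then show "\<exists>U. open U \<and> p \<in> U \<and> (\<exists>X\<in>VF. \<forall>q\<in>U. qs D m q = quot_proj A D X q)"
    by (intro exI[of _ Q] conjI bexI[of _ N]) (simp_all add: quot_proj_qs qs_def)
qed

lemma qs_add: "qs D m \<oplus>\<^bsub>quot_sections A D\<^esub> qs D n = qs D (m + n)"
proof
  fix p
  have "(qs D m \<oplus>\<^bsub>quot_sections A D\<^esub> qs D n) p = (\<Union>h\<in>D p. \<Union>k\<in>D p. {(h + m p) + (k + n p)})"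
    by (auto simp: quot_sections_def quot_fibre_def quot_module_def set_add_def set_mult_def tangent_space_def qs_def plus_fun_def)
  also have "\<dots> = (\<lambda>h. h + (m p + n p)) ` D p"
  proof (intro equalityI subsetI)
    fix v assume "v \<in> (\<Union>h\<in>D p. \<Union>k\<in>D p. {(h + m p) + (k + n p)})"
    then obtain h k where h: "h \<in> D p" "k \<in> D p" "v = (h + m p) + (k + n p)" by blast
    have "h + k \<in> D p" by (rule tv.subspace_add[OF sub_dist_subspace h(1,2)])
    moreover have "v = (h + k) + (m p + n p)" by (simp only: h(3) ac_simps)
    ultimately show "v \<in> (\<lambda>h. h + (m p + n p)) ` D p" by blast
  next
    fix v assume "v \<in> (\<lambda>h. h + (m p + n p)) ` D p"
    then obtain h where h: "h \<in> D p" "v = h + (m p + n p)" by blast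
    have "v = (h + m p) + (0 + n p)" unfolding h(2) by (simp only: add.assoc add_0)
    then show "v \<in> (\<Union>h\<in>D p. \<Union>k\<in>D p. {(h + m p) + (k + n p)})"
      using h(1) tv.subspace_0[OF sub_dist_subspace, of p] by blast
  qed
  finally show "(qs D m \<oplus>\<^bsub>quot_sections A D\<^esub> qs D n) p = qs D (m + n) p" by (simp only: qs_def plus_fun_apply)
qed

lemma qs_smul: "h \<odot>\<^bsub>quot_sections A D\<^esub> qs D m = qs D (smulsec h m)"
proof
  fix p
  have "(h \<odot>\<^bsub>quot_sections A D\<^esub> qs D m) p = (\<Union>x\<in>D p. (\<lambda>k. k + (\<lambda>f. h p * (x + m p) f)) ` D p)"
    by (auto simp: quot_sections_def quot_fibre_def quot_module_def coset_eq qs_def smulsec_def) (auto simp: tangent_space_def)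
  also have "\<dots> = (\<Union>x\<in>D p. (\<lambda>k. k + smulsec h m p) ` D p)"
  proof (rule SUP_cong[OF refl])
    fix x assume "x \<in> D p"
    then have "(\<lambda>f. h p * x f) \<in> D p" by (rule tv.subspace_scale[OF sub_dist_subspace])
    moreover have "(\<lambda>f. h p * x f) = (\<lambda>f. h p * (x + m p) f) - smulsec h m p"
      by (simp add: fun_eq_iff smulsec_def algebra_simps)
    ultimately show "(\<lambda>k. k + (\<lambda>f. h p * (x + m p) f)) ` D p = (\<lambda>k. k + smulsec h m p) ` D p"
      unfolding image_plus_eq_iff[OF sub_dist_subspace] by simp
  qed
  also have "\<dots> = qs D (smulsec h m) p"
    using tv.subspace_0[OF sub_dist_subspace, of p] by (auto simp: qs_def)
  finally show "(h \<odot>\<^bsub>quot_sections A D\<^esub> qs D m) p = qs D (smulsec h m) p" .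
qed

lemma qs_zero: "qs D 0 = \<zero>\<^bsub>quot_sections A D\<^esub>"
  by (simp add: quot_sections_def zero_quot_fibre qs_def)

lemma module_embedding_qsec: "module_embedding (quot_sections A D) (js D)"
proof
  show "inj_on (js D) (carrier (quot_sections A D))"
    by (rule inj_on_inverseI[of _ "qs D"]) (rule js_lsec(2))
  show "\<zero>\<^bsub>quot_sections A D\<^esub> \<in> carrier (quot_sections A D)"
    unfolding qs_zero[symmetric] by (rule qs_carrier[OF lsec_zero[OF D]])
  show "js D \<zero>\<^bsub>quot_sections A D\<^esub> = 0"
    unfolding qs_zero[symmetric] by (rule js_qs[OF lsec_zero[OF D]])
  fix s t assume s: "s \<in> carrier (quot_sections A D)"
  show "\<exists>t\<in>carrier (quot_sections A D). js D t = - js D s"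
    using qs_carrier js_qs lsec_uminus[OF D js_lsec(1)[OF s]] by blast
  assume t: "t \<in> carrier (quot_sections A D)"
  have e: "s \<oplus>\<^bsub>quot_sections A D\<^esub> t = qs D (js D s + js D t)"
    using qs_add[of "js D s" "js D t"] by (simp only: js_lsec(2) s t)
  have l: "js D s + js D t \<in> lsec D" by (intro lsec_add[OF D] js_lsec s t)
  show "s \<oplus>\<^bsub>quot_sections A D\<^esub> t \<in> carrier (quot_sections A D)" "js D (s \<oplus>\<^bsub>quot_sections A D\<^esub> t) = js D s + js D t"
    unfolding e by (rule qs_carrier[OF l], rule js_qs[OF l])
qed

lemma qsec_smul:
  assumes "h \<in> R" "s \<in> carrier (quot_sections A D)"
  shows "h \<odot>\<^bsub>quot_sections A D\<^esub> s \<in> carrier (quot_sections A D)"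
    and "js D (h \<odot>\<^bsub>quot_sections A D\<^esub> s) = smulsec h (js D s)"
proof -
  have e: "h \<odot>\<^bsub>quot_sections A D\<^esub> s = qs D (smulsec h (js D s))"
    using qs_smul[of h "js D s"] by (simp only: js_lsec(2) assms)
  have l: "smulsec h (js D s) \<in> lsec D" by (intro lsec_smul[OF D] js_lsec assms)
  show "h \<odot>\<^bsub>quot_sections A D\<^esub> s \<in> carrier (quot_sections A D)"
    "js D (h \<odot>\<^bsub>quot_sections A D\<^esub> s) = smulsec h (js D s)"
    unfolding e by (rule qs_carrier[OF l], rule js_qs[OF l])
qed

text \<open>Independence of the local lift, that is \<open>lop_eq\<close>, gives the existence
  required by \<open>THE\<close>; uniqueness holds because every point has a neighbourhood with a
  lift.\<close>

lemma bott_eq: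
  assumes x: "preserves D x" and s: "s \<in> carrier (quot_sections A D)"
  shows "bott A D x s = qs D (nabD D x (js D s))"
  unfolding bott_def
proof (rule the_equality)
  have xV: "x \<in> VF" using x by (simp add: preserves_def)
  have nl: "nabD D x (js D s) \<in> lsec D"
    unfolding nabD_def by (rule lop_lsec[OF D preserves_local_rule[OF D x] js_lsec(1)[OF s]])
  have nab: "nabD D x (js D s) q = cls D (lie x Y) q"
    if "open U" "Y \<in> VF" "\<forall>q\<in>U. s q = quot_proj A D Y q" "q \<in> U" for U Y q
    unfolding nabD_def
    by (rule lop_eq[OF D preserves_local_rule[OF D x] that(2,1,4)]) (intro js_local bspec[OF that(3)])
  show "qs D (nabD D x (js D s)) \<in> carrier (quot_sections A D) \<and>
    (\<forall>U. \<forall>Y\<in>VF. open U \<and> (\<forall>q\<in>U. s q = quot_proj A D Y q) \<longrightarrow>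
       (\<forall>q\<in>U. qs D (nabD D x (js D s)) q = quot_proj A D (lie x Y) q))"
  proof (intro conjI allI ballI impI)
    show "qs D (nabD D x (js D s)) \<in> carrier (quot_sections A D)" by (rule qs_carrier[OF nl])
    fix U Y q assume Y: "Y \<in> VF" "open U \<and> (\<forall>q\<in>U. s q = quot_proj A D Y q)" "q \<in> U"
    show "qs D (nabD D x (js D s)) q = quot_proj A D (lie x Y) q"
      unfolding quot_proj_qs qs_def nab[OF conjunct1[OF Y(2)] Y(1) conjunct2[OF Y(2)] Y(3)] ..
  qed
  fix t assume t: "t \<in> carrier (quot_sections A D) \<and>
    (\<forall>U. \<forall>Y\<in>VF. open U \<and> (\<forall>q\<in>U. s q = quot_proj A D Y q) \<longrightarrow>
       (\<forall>q\<in>U. t q = quot_proj A D (lie x Y) q))"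
  show "t = qs D (nabD D x (js D s))"
  proof
    fix p
    obtain U Y where U: "open U" "p \<in> U" "Y \<in> VF" "\<forall>q\<in>U. s q = quot_proj A D Y q"
      using s[unfolded qsec_iff, THEN spec, of p] by (elim exE conjE bexE)
    have "t p = quot_proj A D (lie x Y) p"
      by (rule t[THEN conjunct2, THEN spec, THEN bspec, OF U(3), THEN mp, THEN bspec, OF conjI[OF U(1,4)] U(2)])
    also have "\<dots> = qs D (nabD D x (js D s)) p" unfolding quot_proj_qs qs_def nab[OF U(1,3,4,2)] ..
    finally show "t p = qs D (nabD D x (js D s)) p" .
  qed
qed

end

end

text \<open>Treats both coefficient bundles at once: \<open>D\<close> is \<xi> for \<ell> and the
  characteristic distribution for N\<F>.\<close>

locale char_module = pre_contact_manifold +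
  fixes D assumes D_sub: "sub_dist D" and F_pres: "x \<in> Gam F ==> preserves D x" and F_D: "x \<in> Gam F ==> cls D x = 0"
begin

sublocale bm: bracket_module "Gam F" "lsec D" lie "nabD D" R smul smulsec "\<lambda>x h. x h"
  by (rule bracket_module_sections[OF D_sub F_sub F_pres F_D lie_F_F[OF _ _ open_UNIV]])

sublocale me: module_embedding "quot_sections A D" "js D"
  by (rule module_embedding_qsec[OF D_sub])

abbreviation Om where "Om \<equiv> forms R (TF A \<xi>) (quot_sections A D)"
abbreviation dK where "dK \<equiv> koszul (TF A \<xi>) (quot_sections A D) lie (bott A D)"

text \<open>The value 0 outside the domain, in place of \<open>undefined\<close>, makes the
  translation of sums, multiples and zero an equality of functions.\<close>

definition jf :: "nat => ('a vfield list => 'a qsection) => ('a vfield list => 'a => 'a tvec)" where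
  "jf n \<eta> = (\<lambda>xs. if xs \<in> bm.dom n then js D (\<eta> xs) else 0)"

definition qf :: "nat => ('a vfield list => 'a => 'a tvec) => ('a vfield list => 'a qsection)" where
  "qf n \<omega> = (\<lambda>xs\<in>bm.dom n. qs D (\<omega> xs))"

lemma tuples_TF: "tuples (TF A \<xi>) n = bm.dom n"
  by (simp add: tuples_def bm.dom_def carrier_dist_sections)

lemma TF_ops: "x \<oplus>\<^bsub>TF A \<xi>\<^esub> y = x + y" "h \<odot>\<^bsub>TF A \<xi>\<^esub> x = smul h x"
  by (simp_all add: dist_sections_def submod_def vfields_def smul_def plus_fun_def)

lemma form_closed: "\<eta> \<in> carrier (Om n) ==> xs \<in> bm.dom n ==> \<eta> xs \<in> carrier (quot_sections A D)"
  by (auto simp: forms_def tuples_TF)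

lemma js_form:
  assumes \<eta>: "\<eta> \<in> carrier (Om n)"
  shows "bm.aalt n (jf n \<eta>)" "bm.hom n (jf n \<eta>)"
proof -
  have lin: "linear_map R (TF A \<xi>) (quot_sections A D) (\<lambda>x. \<eta> (xs[i := x]))" if "xs \<in> bm.dom n" "i < n" for xs i
    using \<eta> that by (simp add: forms_def tuples_TF)
  have lin_add: "\<eta> (xs[i := x + y]) = \<eta> (xs[i := x]) \<oplus>\<^bsub>quot_sections A D\<^esub> \<eta> (xs[i := y])"
    if "xs \<in> bm.dom n" "i < n" "x \<in> Gam F" "y \<in> Gam F" for xs i x y
    using lin[OF that(1,2)] that(3,4) by (simp add: linear_map_def carrier_dist_sections TF_ops)
  have lin_smul: "\<eta> (xs[i := smul h x]) = h \<odot>\<^bsub>quot_sections A D\<^esub> \<eta> (xs[i := x])"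
    if "xs \<in> bm.dom n" "i < n" "x \<in> Gam F" "h \<in> R" for xs i x h
    using lin[OF that(1,2)] that(3,4) by (simp add: linear_map_def carrier_dist_sections TF_ops)
  have alt: "\<eta> xs = \<zero>\<^bsub>quot_sections A D\<^esub>" if "xs \<in> bm.dom n" "i < n" "j < n" "i \<noteq> j \<and> xs ! i = xs ! j" for xs i j
    using \<eta> that unfolding forms_def tuples_TF by auto
  show "bm.aalt n (jf n \<eta>)"
    unfolding bm.aalt_def
  proof (intro ballI conjI allI impI)
    fix xs assume xs: "xs \<in> bm.dom n"
    show "jf n \<eta> xs \<in> lsec D" using xs by (simp add: jf_def js_lsec[OF D_sub] form_closed[OF \<eta>])
    show "jf n \<eta> xs = 0" if "i < n" "j < n" "i \<noteq> j \<and> xs ! i = xs ! j" for i j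
      using alt[OF xs that] xs by (simp add: jf_def me.J_zero)
    fix i x y assume i: "i < n" and x: "x \<in> Gam F" and y: "y \<in> Gam F"
    show "jf n \<eta> (xs[i := x + y]) = jf n \<eta> (xs[i := x]) + jf n \<eta> (xs[i := y])"
      using xs x y i by (simp add: jf_def bm.dom_update bm.L_add lin_add me.J_add form_closed[OF \<eta>])
  qed
  show "bm.hom n (jf n \<eta>)"
    unfolding bm.hom_def
  proof (intro ballI allI impI)
    fix xs i s x assume "xs \<in> bm.dom n" "i < n" "s \<in> R" "x \<in> Gam F"
    then show "jf n \<eta> (xs[i := smul s x]) = smulsec s (jf n \<eta> (xs[i := x]))"
      by (simp add: jf_def bm.dom_update bm.sx_L lin_smul qsec_smul(2)[OF D_sub] form_closed[OF \<eta>])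
  qed
qed

lemma jf_ext:
  assumes "\<eta> \<in> carrier (Om n)" "\<zeta> \<in> carrier (Om n)" "\<And>xs. xs \<in> bm.dom n ==> jf n \<eta> xs = jf n \<zeta> xs"
  shows "\<eta> = \<zeta>"
proof (rule PiE_ext[of _ "bm.dom n" "\<lambda>_. carrier (quot_sections A D)"])
  show "\<eta> \<in> bm.dom n \<rightarrow>\<^sub>E carrier (quot_sections A D)" "\<zeta> \<in> bm.dom n \<rightarrow>\<^sub>E carrier (quot_sections A D)"
    using assms(1,2) by (simp_all add: forms_def tuples_TF)
  show "\<eta> xs = \<zeta> xs" if "xs \<in> bm.dom n" for xs
    using assms(3)[OF that] that by (intro me.J_eq form_closed[OF assms(1)] form_closed[OF assms(2)]) (simp_all add: jf_def)
qed

lemma qf_form: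
  assumes a: "bm.aalt n \<omega>" and h: "bm.hom n \<omega>"
  shows "qf n \<omega> \<in> carrier (Om n)" "xs \<in> bm.dom n ==> jf n (qf n \<omega>) xs = \<omega> xs"
proof -
  have c: "qs D (\<omega> xs) \<in> carrier (quot_sections A D)" if "xs \<in> bm.dom n" for xs
    by (rule qs_carrier[OF D_sub bm.aalt_M[OF a that]])
  show "jf n (qf n \<omega>) xs = \<omega> xs" if "xs \<in> bm.dom n" for xs
    using that by (simp add: jf_def qf_def js_qs[OF D_sub bm.aalt_M[OF a]])
  have "linear_map R (TF A \<xi>) (quot_sections A D) (\<lambda>x. qf n \<omega> (xs[i := x]))" if xs: "xs \<in> bm.dom n" and i: "i < n" for xs i
    unfolding linear_map_def carrier_dist_sections TF_ops
  proof (intro conjI ballI)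
    show "(\<lambda>x. qf n \<omega> (xs[i := x])) \<in> Gam F \<rightarrow> carrier (quot_sections A D)"
      using xs by (auto simp: qf_def bm.dom_update c)
    show "qf n \<omega> (xs[i := x + y]) = qf n \<omega> (xs[i := x]) \<oplus>\<^bsub>quot_sections A D\<^esub> qf n \<omega> (xs[i := y])"
      if "x \<in> Gam F" "y \<in> Gam F" for x y
      using that xs by (simp add: qf_def bm.dom_update bm.L_add qs_add[OF D_sub] bm.aalt_add[OF a xs i])
    show "qf n \<omega> (xs[i := smul s x]) = s \<odot>\<^bsub>quot_sections A D\<^esub> qf n \<omega> (xs[i := x])" if "s \<in> R" "x \<in> Gam F" for s x
      using that xs by (simp add: qf_def bm.dom_update bm.sx_L qs_smul[OF D_sub] bm.homD[OF h xs i])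
  qed
  moreover have "qf n \<omega> xs = \<zero>\<^bsub>quot_sections A D\<^esub>" if "xs \<in> bm.dom n" "i < n" "j < n" "i \<noteq> j \<and> xs ! i = xs ! j" for xs i j
  proof -
    have "\<omega> xs = 0" using that(4) by (intro bm.aalt_alt[OF a that(1-3)]) simp_all
    then show ?thesis using that(1) by (simp only: qf_def restrict_apply' qs_zero[OF D_sub])
  qed
  ultimately show "qf n \<omega> \<in> carrier (Om n)"
    unfolding forms_def tuples_TF using c by (auto simp: qf_def)
qed

lemma Om_ops:
  "\<zero>\<^bsub>Om n\<^esub> = (\<lambda>xs\<in>bm.dom n. \<zero>\<^bsub>quot_sections A D\<^esub>)"
  "\<eta> \<oplus>\<^bsub>Om n\<^esub> \<zeta> = (\<lambda>xs\<in>bm.dom n. \<eta> xs \<oplus>\<^bsub>quot_sections A D\<^esub> \<zeta> xs)"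
  "c \<odot>\<^bsub>Om n\<^esub> \<eta> = (\<lambda>xs\<in>bm.dom n. (\<lambda>p. c) \<odot>\<^bsub>quot_sections A D\<^esub> \<eta> xs)"
  by (simp_all add: forms_def tuples_TF)

lemma qs_js_form: "\<eta> \<in> carrier (Om n) ==> xs \<in> bm.dom n ==> qs D (jf n \<eta> xs) = \<eta> xs"
  by (simp add: jf_def js_lsec(2)[OF D_sub form_closed])

lemma qf_jf:
  assumes "\<eta> \<in> carrier (Om n)"
  shows "qf n (jf n \<eta>) = \<eta>"
  by (rule jf_ext[OF qf_form(1)[OF js_form[OF assms]] assms]) (rule qf_form(2)[OF js_form[OF assms]])

lemma Om_add: 
  assumes "\<eta> \<in> carrier (Om n)" "\<zeta> \<in> carrier (Om n)"
  shows "\<eta> \<oplus>\<^bsub>Om n\<^esub> \<zeta> \<in> carrier (Om n)" "jf n (\<eta> \<oplus>\<^bsub>Om n\<^esub> \<zeta>) = jf n \<eta> + jf n \<zeta>"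
proof -
  note \<eta> = js_form[OF assms(1)] and \<zeta> = js_form[OF assms(2)]
  have a: "bm.aalt n (\<lambda>xs. jf n \<eta> xs + jf n \<zeta> xs)" by (rule bm.aalt_plus[OF \<eta>(1) \<zeta>(1)])
  have h: "bm.hom n (\<lambda>xs. jf n \<eta> xs + jf n \<zeta> xs)" using \<eta>(2) \<zeta>(2) by (simp add: bm.hom_def bm.sm_add)
  have "\<eta> \<oplus>\<^bsub>Om n\<^esub> \<zeta> = qf n (\<lambda>xs. jf n \<eta> xs + jf n \<zeta> xs)"
    unfolding Om_ops qf_def
    by (rule restrict_ext) (simp only: qs_add[OF D_sub, symmetric] qs_js_form assms)
  then show "\<eta> \<oplus>\<^bsub>Om n\<^esub> \<zeta> \<in> carrier (Om n)" using qf_form(1)[OF a h] by simp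
  show "jf n (\<eta> \<oplus>\<^bsub>Om n\<^esub> \<zeta>) = jf n \<eta> + jf n \<zeta>"
    unfolding Om_ops
    by (rule ext) (simp add: jf_def me.J_add form_closed[OF assms(1)] form_closed[OF assms(2)])
qed

lemma Om_smul:
  assumes "\<eta> \<in> carrier (Om n)"
  shows "c \<odot>\<^bsub>Om n\<^esub> \<eta> \<in> carrier (Om n)" "jf n (c \<odot>\<^bsub>Om n\<^esub> \<eta>) = (\<lambda>xs. smulsec (\<lambda>p. c) (jf n \<eta> xs))"
proof -
  have R: "(\<lambda>p. c) \<in> R" by (rule R_const)
  note \<eta> = js_form[OF assms]
  have comm: "smulsec s (smulsec t m) = smulsec t (smulsec s m)" for s t and m :: "'a => 'a tvec"
    by (simp add: smulsec_def fun_eq_iff)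
  have z: "smulsec s 0 = 0" for s :: "'a => real" by (simp add: smulsec_def fun_eq_iff)
  have a: "bm.aalt n (\<lambda>xs. smulsec (\<lambda>p. c) (jf n \<eta> xs))"
    using \<eta>(1) unfolding bm.aalt_def by (auto simp: lsec_smul[OF D_sub R] smulsec_add z)
  have h: "bm.hom n (\<lambda>xs. smulsec (\<lambda>p. c) (jf n \<eta> xs))"
    using \<eta>(2) unfolding bm.hom_def by (simp add: comm[of "\<lambda>p. c"])
  have "c \<odot>\<^bsub>Om n\<^esub> \<eta> = qf n (\<lambda>xs. smulsec (\<lambda>p. c) (jf n \<eta> xs))"
    unfolding Om_ops qf_def
    by (rule restrict_ext) (simp only: qs_smul[OF D_sub, symmetric] qs_js_form assms)
  then show "c \<odot>\<^bsub>Om n\<^esub> \<eta> \<in> carrier (Om n)" using qf_form(1)[OF a h] by simp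
  show "jf n (c \<odot>\<^bsub>Om n\<^esub> \<eta>) = (\<lambda>xs. smulsec (\<lambda>p. c) (jf n \<eta> xs))"
    unfolding Om_ops
    by (rule ext) (simp add: jf_def qsec_smul(2)[OF D_sub R] form_closed[OF assms] z)
qed

lemma Om_zero: "\<zero>\<^bsub>Om n\<^esub> \<in> carrier (Om n)" "jf n \<zero>\<^bsub>Om n\<^esub> = 0"
proof -
  have h: "bm.hom n (\<lambda>xs. 0)" by (simp add: bm.hom_def bm.sm_zero)
  have "\<zero>\<^bsub>Om n\<^esub> = qf n (\<lambda>xs. 0)"
    unfolding Om_ops qf_def by (rule restrict_ext) (simp only: qs_zero[OF D_sub])
  then show "\<zero>\<^bsub>Om n\<^esub> \<in> carrier (Om n)" using qf_form(1)[OF bm.aalt_zero h] by simp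
  show "jf n \<zero>\<^bsub>Om n\<^esub> = 0" unfolding Om_ops by (rule ext) (simp add: jf_def me.J_zero)
qed

lemma module_embedding_Om: "module_embedding (Om n) (jf n)"
proof
  show "inj_on (jf n) (carrier (Om n))" by (rule inj_on_inverseI[of _ "qf n"]) (rule qf_jf)
  fix \<eta> assume \<eta>: "\<eta> \<in> carrier (Om n)"
  have n: "smulsec (\<lambda>p. - 1) m = - m" for m :: "'a => 'a tvec" by (simp add: smulsec_def fun_eq_iff)
  show "\<exists>\<zeta>\<in>carrier (Om n). jf n \<zeta> = - jf n \<eta>"
    using Om_smul[OF \<eta>, of "-1"] by (intro bexI[of _ "(-1) \<odot>\<^bsub>Om n\<^esub> \<eta>"]) (simp_all add: n fun_Compl_def)
qed (simp_all add: Om_zero Om_add)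

lemma dK_form:
  assumes \<eta>: "\<eta> \<in> carrier (Om n)"
  shows "dK n \<eta> \<in> carrier (Om (Suc n))" "xs \<in> bm.dom (Suc n) ==> jf (Suc n) (dK n \<eta>) xs = bm.d (jf n \<eta>) xs"
proof -
  have e: "dK n \<eta> xs = qs D (bm.d (jf n \<eta>) xs)" if xs: "xs \<in> bm.dom (Suc n)" for xs
  proof -
    have 1: "bott A D (xs ! i) (\<eta> (nths xs (- {i}))) \<in> carrier (quot_sections A D)"
      "js D (bott A D (xs ! i) (\<eta> (nths xs (- {i})))) = nabD D (xs ! i) (jf n \<eta> (nths xs (- {i})))" if i: "i \<le> n" for i
    proof -
      have x: "xs ! i \<in> Gam F" and d: "nths xs (- {i}) \<in> bm.dom n"
        using i by (auto intro!: bm.dom_nth[OF xs] bm.dom_nths[OF xs])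
      have c: "\<eta> (nths xs (- {i})) \<in> carrier (quot_sections A D)" by (rule form_closed[OF \<eta> d])
      have l: "nabD D (xs ! i) (js D (\<eta> (nths xs (- {i})))) \<in> lsec D"
        by (rule bm.nab_M[OF x js_lsec(1)[OF D_sub c]])
      show "bott A D (xs ! i) (\<eta> (nths xs (- {i}))) \<in> carrier (quot_sections A D)"
        "js D (bott A D (xs ! i) (\<eta> (nths xs (- {i})))) = nabD D (xs ! i) (jf n \<eta> (nths xs (- {i})))"
        unfolding bott_eq[OF D_sub F_pres[OF x] c] using d
        by (simp_all add: qs_carrier[OF D_sub l] js_qs[OF D_sub l] jf_def)
    qed
    have d2: "lie (xs ! i) (xs ! j) # nths xs (- {i, j}) \<in> bm.dom n" if ij: "i < j" "j \<le> n" for i j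
    proof -
      obtain m where m: "n = Suc m" using ij by (cases n) auto
      show ?thesis
        unfolding m bm.dom_Cons
        by (intro conjI bm.br_L bm.dom_nth[OF xs] bm.dom_nths2[OF xs[unfolded m]]) (use ij m in simp_all)
    qed
    have xs': "xs \<in> tuples (TF A \<xi>) (Suc n)" using xs by (simp add: tuples_TF)
    have k: "dK n \<eta> xs \<in> carrier (quot_sections A D)"
      "js D (dK n \<eta> xs) = (\<Sum>i<Suc n. sg i (js D (bott A D (xs ! i) (\<eta> (nths xs (- {i})))))) +
        (\<Sum>j<Suc n. \<Sum>i<j. sg (i + j) (js D (\<eta> (lie (xs ! i) (xs ! j) # nths xs (- {i, j})))))"
      by (rule me.koszul_closed_J[OF xs']; intro 1(1) form_closed[OF \<eta>] d2; assumption)+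
    have "js D (dK n \<eta> xs) = bm.d (jf n \<eta>) xs"
      unfolding k(2) kz_def bm.domD(2)[OF xs]
      by (intro arg_cong2[where f = "(+)"] sum.cong refl) (simp_all add: 1(2), simp add: jf_def d2)
    then show ?thesis using js_lsec(2)[OF D_sub k(1)] by simp
  qed
  note a = bm.aalt_kz[OF js_form(1)[OF \<eta>]] and h = bm.hom_kz[OF js_form[OF \<eta>]]
  have "dK n \<eta> = qf (Suc n) (bm.d (jf n \<eta>))"
  proof (rule ext)
    fix xs show "dK n \<eta> xs = qf (Suc n) (bm.d (jf n \<eta>)) xs"
      by (cases "xs \<in> bm.dom (Suc n)") (simp_all add: e qf_def, simp add: koszul_def tuples_TF)
  qed
  then show "dK n \<eta> \<in> carrier (Om (Suc n))" "xs \<in> bm.dom (Suc n) ==> jf (Suc n) (dK n \<eta>) xs = bm.d (jf n \<eta>) xs"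
    using qf_form[OF a h] by simp_all
qed

end

section \<open>The Atiyah algebroid\<close>

lemma nths_cong_length: "(\<And>i. i < length xs ==> i \<in> I \<longleftrightarrow> i \<in> J) ==> nths xs I = nths xs J"
  unfolding nths_def by (intro arg_cong[where f = "map fst"] filter_cong refl) (auto simp: set_zip)

text \<open>In the definition of \<Phi> the distinguished derivation stands in the last place of the
  argument list.\<close>

lemma nths_snoc:
  assumes "n = length xs"
  shows "i < n ==> nths (xs @ [a]) (- {i}) = nths xs (- {i}) @ [a]"
    and "nths (xs @ [a]) (- {n}) = xs"
    and "i < j ==> j < n ==> nths (xs @ [a]) (- {i, j}) = nths xs (- {i, j}) @ [a]"
    and "i < n ==> nths (xs @ [a]) (- {i, n}) = nths xs (- {i})"
proof -
  show "i < n ==> nths (xs @ [a]) (- {i}) = nths xs (- {i}) @ [a]"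
    "i < j ==> j < n ==> nths (xs @ [a]) (- {i, j}) = nths xs (- {i, j}) @ [a]"
    using assms by (simp_all add: nths_append)
  have "nths xs (- {n}) = nths xs UNIV" by (rule nths_cong_length) (simp add: assms)
  then have "nths xs (- {n}) = xs" by (simp add: nths_all)
  then show "nths (xs @ [a]) (- {n}) = xs" using assms by (simp add: nths_append)
  have "nths xs (- {i, n}) = nths xs (- {i})" by (rule nths_cong_length) (use assms in auto)
  then show "i < n ==> nths (xs @ [a]) (- {i, n}) = nths xs (- {i})" using assms by (simp add: nths_append)
qed

lemma (in bracket_action) aalt_zero_arg:
  assumes "aalt n \<eta>" "xs \<in> dom n" "i < n" "xs ! i = 0"
  shows "\<eta> xs = 0"
proof -
  have "xs[i := 0] = xs" using assms(4) by (metis list_update_id)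
  then show ?thesis using aalt_add[OF assms(1-3) L_zero L_zero] by simp
qed

section \<open>Derivations of \<ell>, their symbols and the form \<varpi>\<close>

context pre_contact_complement begin

interpretation cx: char_module A \<xi> \<xi>
  by unfold_locales (rule xi_sub preserves_xi cls_xi_zero secs_F_xi, assumption?)+

definition isder :: "(('a => 'a tvec) => ('a => 'a tvec)) => 'a vfield => bool" where
  "isder \<delta> X \<longleftrightarrow> X \<in> VF \<and> (\<forall>m\<in>lsec \<xi>. \<delta> m \<in> lsec \<xi>) \<and>
     (\<forall>m\<in>lsec \<xi>. \<forall>n\<in>lsec \<xi>. \<delta> (m + n) = \<delta> m + \<delta> n) \<and>
     (\<forall>h\<in>R. \<forall>m\<in>lsec \<xi>. \<delta> (smulsec h m) = smulsec (X h) m + smulsec h (\<delta> m))"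

lemma isderD:
  assumes "isder \<delta> X"
  shows "X \<in> VF" "m \<in> lsec \<xi> ==> \<delta> m \<in> lsec \<xi>" "m \<in> lsec \<xi> ==> n \<in> lsec \<xi> ==> \<delta> (m + n) = \<delta> m + \<delta> n"
    "h \<in> R ==> m \<in> lsec \<xi> ==> \<delta> (smulsec h m) = smulsec (X h) m + smulsec h (\<delta> m)"
  using assms unfolding isder_def by blast+

lemma isder_zero: "isder \<delta> X ==> \<delta> 0 = 0"
  using isderD(3)[of \<delta> X 0 0] lsec_zero[OF xi_sub] by simp

lemma isder_cong:
  assumes "isder \<delta> X" "\<And>m. m \<in> lsec \<xi> ==> \<delta>' m = \<delta> m"
  shows "isder \<delta>' X"
  using assms unfolding isder_def by (simp add: lsec_add[OF xi_sub] lsec_smul[OF xi_sub])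

text \<open>The Leibniz rule is evaluated on the class of a field transversal to \<xi>, which does
  not vanish at \<open>p\<close>.\<close>

lemma isder_symbol_unique:
  assumes "isder \<delta> X" "isder \<delta> X'"
  shows "X = X'"
proof (rule vfield_eqI_R)
  show X: "X \<in> VF" "X' \<in> VF" using assms isderD(1) by blast+
  fix f p assume f: "f \<in> R"
  obtain Q Z c where t: "open Q" "p \<in> Q" "Z \<in> VF" "\<And>q. tlin (c q)"
    "\<And>W. W \<in> VF ==> (\<lambda>q. c q (vec_at W q)) \<in> R"
    "\<And>q v. q \<in> Q ==> v \<in> T q ==> v \<in> \<xi> q \<longleftrightarrow> c q v = 0" "\<And>q. q \<in> Q ==> c q (vec_at Z q) = 1"
    by (rule xi_triv[of p]) (rule that)
  have "vec_at Z p \<notin> \<xi> p" using t(6)[OF t(2) VF_T[OF t(3)]] t(7)[OF t(2)] by simp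
  then have "cls \<xi> Z p \<noteq> 0" by (simp add: cls_zero_iff[OF xi_sub])
  then obtain g where g: "cls \<xi> Z p g \<noteq> 0" by (auto simp: fun_eq_iff)
  have m: "cls \<xi> Z \<in> lsec \<xi>" by (rule cls_lsec[OF xi_sub t(3)])
  have "smulsec (X f) (cls \<xi> Z) = smulsec (X' f) (cls \<xi> Z)"
    using isderD(4)[OF assms(1) f m] isderD(4)[OF assms(2) f m] by simp
  then have "smulsec (X f) (cls \<xi> Z) p g = smulsec (X' f) (cls \<xi> Z) p g" by simp
  then show "X f p = X' f p" using g by (simp add: smulsec_def)
qed

definition jd :: "'a deriv => ('a => 'a tvec) => ('a => 'a tvec)" where
  "jd \<Delta> m = (if m \<in> lsec \<xi> then js \<xi> (\<Delta> (qs \<xi> m)) else 0)"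

definition dq :: "(('a => 'a tvec) => ('a => 'a tvec)) => 'a deriv" where
  "dq \<delta> = (\<lambda>s\<in>carrier (ell A \<xi>). qs \<xi> (\<delta> (js \<xi> s)))"

lemma Dl_closed: "\<Delta> \<in> carrier (Dl A \<xi>) ==> s \<in> carrier (ell A \<xi>) ==> \<Delta> s \<in> carrier (ell A \<xi>)"
  by (auto simp: Dl_def)

lemma jd_js: "\<Delta> \<in> carrier (Dl A \<xi>) ==> s \<in> carrier (ell A \<xi>) ==> js \<xi> (\<Delta> s) = jd \<Delta> (js \<xi> s)"
  by (simp add: jd_def js_lsec[OF xi_sub])

lemma isder_jd_symbol:
  assumes \<Delta>: "\<Delta> \<in> carrier (Dl A \<xi>)" and X: "is_symbol A \<xi> \<Delta> X"
  shows "isder (jd \<Delta>) X"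
  unfolding isder_def
proof (intro conjI ballI)
  note q = qs_carrier[OF xi_sub] and D = Dl_closed[OF \<Delta>]
  show XV: "X \<in> VF" using X by (simp add: is_symbol_def)
  show "jd \<Delta> m \<in> lsec \<xi>" if "m \<in> lsec \<xi>" for m
    using that by (simp add: jd_def js_lsec[OF xi_sub] D q)
  show "jd \<Delta> (m + n) = jd \<Delta> m + jd \<Delta> n" if m: "m \<in> lsec \<xi>" and n: "n \<in> lsec \<xi>" for m n
  proof -
    have "\<Delta> (qs \<xi> m \<oplus>\<^bsub>ell A \<xi>\<^esub> qs \<xi> n) = \<Delta> (qs \<xi> m) \<oplus>\<^bsub>ell A \<xi>\<^esub> \<Delta> (qs \<xi> n)"
      using \<Delta> q[OF m] q[OF n] unfolding Dl_def linear_map_def by simp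
    then show ?thesis
      using m n by (simp add: jd_def lsec_add[OF xi_sub] qs_add[OF xi_sub] cx.me.J_add D q)
  qed
  show "jd \<Delta> (smulsec h m) = smulsec (X h) m + smulsec h (jd \<Delta> m)" if h: "h \<in> R" and m: "m \<in> lsec \<xi>" for h m
  proof -
    note Xh = VF_R[OF XV h]
    have "\<Delta> (h \<odot>\<^bsub>ell A \<xi>\<^esub> qs \<xi> m) = (X h \<odot>\<^bsub>ell A \<xi>\<^esub> qs \<xi> m) \<oplus>\<^bsub>ell A \<xi>\<^esub> (h \<odot>\<^bsub>ell A \<xi>\<^esub> \<Delta> (qs \<xi> m))"
      using X h q[OF m] unfolding is_symbol_def by blast
    then have "js \<xi> (\<Delta> (qs \<xi> (smulsec h m))) = js \<xi> (X h \<odot>\<^bsub>ell A \<xi>\<^esub> qs \<xi> m) + js \<xi> (h \<odot>\<^bsub>ell A \<xi>\<^esub> \<Delta> (qs \<xi> m))"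
      unfolding qs_smul[OF xi_sub]
      by (simp only: cx.me.J_add qsec_smul(1)[OF xi_sub] h D[OF q[OF m]] qs_carrier[OF xi_sub lsec_smul[OF xi_sub Xh m]])
    then show ?thesis
      using m h by (simp add: jd_def lsec_smul[OF xi_sub] qsec_smul(2)[OF xi_sub] Xh q D js_qs[OF xi_sub])
  qed
qed

lemma symb_Dl:
  assumes \<Delta>: "\<Delta> \<in> carrier (Dl A \<xi>)"
  shows "isder (jd \<Delta>) (symb A \<xi> \<Delta>)"
proof -
  obtain X where X: "is_symbol A \<xi> \<Delta> X" using \<Delta> unfolding Dl_def by auto
  have "symb A \<xi> \<Delta> = X"
    unfolding symb_def
    by (rule the_equality[of "is_symbol A \<xi> \<Delta>", OF X]) (rule isder_symbol_unique[OF isder_jd_symbol[OF \<Delta>] isder_jd_symbol[OF \<Delta> X]])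
  then show ?thesis using isder_jd_symbol[OF \<Delta> X] by simp
qed

lemma symb_eq: "\<Delta> \<in> carrier (Dl A \<xi>) ==> isder (jd \<Delta>) X ==> symb A \<xi> \<Delta> = X"
  by (rule isder_symbol_unique[OF symb_Dl])

lemma symb_VF: "\<Delta> \<in> carrier (Dl A \<xi>) ==> symb A \<xi> \<Delta> \<in> VF"
  by (rule isderD(1)[OF symb_Dl])

lemma dq:
  assumes \<delta>: "isder \<delta> X"
  shows "dq \<delta> \<in> carrier (Dl A \<xi>)" "m \<in> lsec \<xi> ==> jd (dq \<delta>) m = \<delta> m" "symb A \<xi> (dq \<delta>) = X"
proof -
  note l = isderD(2)[OF \<delta>] and j = js_lsec(1)[OF xi_sub]
  have sy: "is_symbol A \<xi> (dq \<delta>) X"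
    unfolding is_symbol_def
  proof (intro conjI ballI)
    show XV: "X \<in> VF" by (rule isderD(1)[OF \<delta>])
    fix f s assume f: "f \<in> R" and s: "s \<in> carrier (ell A \<xi>)"
    have "dq \<delta> (f \<odot>\<^bsub>ell A \<xi>\<^esub> s) = qs \<xi> (smulsec (X f) (js \<xi> s) + smulsec f (\<delta> (js \<xi> s)))"
      by (simp add: dq_def qsec_smul[OF xi_sub f s] isderD(4)[OF \<delta> f j[OF s]])
    also have "\<dots> = (X f \<odot>\<^bsub>ell A \<xi>\<^esub> qs \<xi> (js \<xi> s)) \<oplus>\<^bsub>ell A \<xi>\<^esub> (f \<odot>\<^bsub>ell A \<xi>\<^esub> qs \<xi> (\<delta> (js \<xi> s)))"
      by (simp only: qs_add[OF xi_sub, symmetric] qs_smul[OF xi_sub, symmetric])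
    finally show "dq \<delta> (f \<odot>\<^bsub>ell A \<xi>\<^esub> s) = (X f \<odot>\<^bsub>ell A \<xi>\<^esub> s) \<oplus>\<^bsub>ell A \<xi>\<^esub> (f \<odot>\<^bsub>ell A \<xi>\<^esub> dq \<delta> s)"
      using s by (simp add: dq_def js_lsec(2)[OF xi_sub])
  qed
  have const: "X (\<lambda>p. c) = 0" for c
  proof
    fix p
    have "X \<in> VF" by (rule isderD(1)[OF \<delta>])
    from VF_T[OF this, of p] show "X (\<lambda>p. c) p = 0 p"
      using T_const[of "vec_at X p" p c] by (simp add: vec_at_def)
  qed
  have lin: "linear_map (range (\<lambda>c p. c)) (ell A \<xi>) (ell A \<xi>) (dq \<delta>)"
    unfolding linear_map_def
  proof (intro conjI ballI)
    show "dq \<delta> \<in> carrier (ell A \<xi>) \<rightarrow> carrier (ell A \<xi>)"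
      by (auto simp: dq_def qs_carrier[OF xi_sub l[OF j]])
    show "dq \<delta> (s \<oplus>\<^bsub>ell A \<xi>\<^esub> t) = dq \<delta> s \<oplus>\<^bsub>ell A \<xi>\<^esub> dq \<delta> t"
      if s: "s \<in> carrier (ell A \<xi>)" and t: "t \<in> carrier (ell A \<xi>)" for s t
      using s t by (simp add: dq_def cx.me.add_closed cx.me.J_add isderD(3)[OF \<delta>] j qs_add[OF xi_sub])
    fix c s assume c: "c \<in> range (\<lambda>(c::real) (p::'a). c)" and s: "s \<in> carrier (ell A \<xi>)"
    then obtain c' where c': "c = (\<lambda>p. c')" by blast
    have z: "smulsec 0 m = 0" for m :: "'a => 'a tvec" by (simp add: smulsec_def fun_eq_iff)
    have "c \<in> R" unfolding c' by (rule R_const)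
    then show "dq \<delta> (c \<odot>\<^bsub>ell A \<xi>\<^esub> s) = c \<odot>\<^bsub>ell A \<xi>\<^esub> dq \<delta> s"
      using s const[of c'] unfolding c'[symmetric]
      by (simp add: dq_def qsec_smul[OF xi_sub] isderD(4)[OF \<delta>] j qs_smul[OF xi_sub] z)
  qed
  have "dq \<delta> \<in> carrier (ell A \<xi>) \<rightarrow>\<^sub>E carrier (ell A \<xi>)"
    by (auto simp: dq_def qs_carrier[OF xi_sub l[OF j]])
  then show D: "dq \<delta> \<in> carrier (Dl A \<xi>)" using lin sy unfolding Dl_def by auto
  show jd: "jd (dq \<delta>) m = \<delta> m" if "m \<in> lsec \<xi>" for m
    using that by (simp add: jd_def dq_def qs_carrier[OF xi_sub] js_qs[OF xi_sub] l)
  show "symb A \<xi> (dq \<delta>) = X"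
    by (rule symb_eq[OF D isder_cong[OF \<delta> jd]])
qed

lemma jd_inj:
  assumes "\<Delta> \<in> carrier (Dl A \<xi>)" "\<Delta>' \<in> carrier (Dl A \<xi>)" "\<And>m. m \<in> lsec \<xi> ==> jd \<Delta> m = jd \<Delta>' m"
  shows "\<Delta> = \<Delta>'"
proof (rule PiE_ext[of _ "carrier (ell A \<xi>)" "\<lambda>_. carrier (ell A \<xi>)"])
  show "\<Delta> \<in> carrier (ell A \<xi>) \<rightarrow>\<^sub>E carrier (ell A \<xi>)" "\<Delta>' \<in> carrier (ell A \<xi>) \<rightarrow>\<^sub>E carrier (ell A \<xi>)"
    using assms(1,2) by (simp_all add: Dl_def)
  show "\<Delta> s = \<Delta>' s" if s: "s \<in> carrier (ell A \<xi>)" for s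
    by (rule cx.me.J_eq[OF Dl_closed[OF assms(1) s] Dl_closed[OF assms(2) s]])
      (simp only: jd_js assms(1,2) s assms(3)[OF js_lsec(1)[OF xi_sub s]])
qed

lemma isder_add: "isder \<delta> X ==> isder \<delta>' X' ==> isder (\<lambda>m. \<delta> m + \<delta>' m) (X + X')"
  unfolding isder_def by (auto simp: lsec_add[OF xi_sub] smulsec_def fun_eq_iff algebra_simps)

lemma isder_uminus: "isder \<delta> X ==> isder (\<lambda>m. - \<delta> m) (- X)"
  unfolding isder_def by (auto simp: lsec_uminus[OF xi_sub] smulsec_def fun_eq_iff algebra_simps VF_uminus)

lemma isder_0: "isder (\<lambda>m. 0) 0"
  unfolding isder_def by (auto simp: lsec_zero[OF xi_sub] smulsec_def fun_eq_iff)

lemma Dl_add: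
  assumes "\<Delta> \<in> carrier (Dl A \<xi>)" "\<Delta>' \<in> carrier (Dl A \<xi>)"
  shows "\<Delta> \<oplus>\<^bsub>Dl A \<xi>\<^esub> \<Delta>' \<in> carrier (Dl A \<xi>)" "jd (\<Delta> \<oplus>\<^bsub>Dl A \<xi>\<^esub> \<Delta>') = jd \<Delta> + jd \<Delta>'"
proof -
  let ?s = "dq (\<lambda>m. jd \<Delta> m + jd \<Delta>' m)"
  note d = isder_add[OF symb_Dl[OF assms(1)] symb_Dl[OF assms(2)]]
  have e: "\<Delta> \<oplus>\<^bsub>Dl A \<xi>\<^esub> \<Delta>' = ?s"
    unfolding dq_def by (simp add: Dl_def)
      (rule restrict_ext, simp add: qs_add[OF xi_sub, symmetric] jd_js[symmetric] assms js_lsec(2)[OF xi_sub] Dl_closed)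
  show "\<Delta> \<oplus>\<^bsub>Dl A \<xi>\<^esub> \<Delta>' \<in> carrier (Dl A \<xi>)" unfolding e by (rule dq(1)[OF d])
  show "jd (\<Delta> \<oplus>\<^bsub>Dl A \<xi>\<^esub> \<Delta>') = jd \<Delta> + jd \<Delta>'"
  proof
    fix m show "jd (\<Delta> \<oplus>\<^bsub>Dl A \<xi>\<^esub> \<Delta>') m = (jd \<Delta> + jd \<Delta>') m"
      using dq(2)[OF d, of m] by (cases "m \<in> lsec \<xi>") (simp_all only: e plus_fun_apply, simp add: jd_def)
  qed
qed

lemma module_embedding_Dl: "module_embedding (Dl A \<xi>) jd"
proof
  show "inj_on jd (carrier (Dl A \<xi>))"
    by (rule inj_onI) (rule jd_inj, simp_all)
  have z: "\<zero>\<^bsub>Dl A \<xi>\<^esub> = dq (\<lambda>m. 0)"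
    unfolding dq_def by (simp add: Dl_def qs_zero[OF xi_sub])
  show "\<zero>\<^bsub>Dl A \<xi>\<^esub> \<in> carrier (Dl A \<xi>)" unfolding z by (rule dq(1)[OF isder_0])
  show "jd \<zero>\<^bsub>Dl A \<xi>\<^esub> = 0"
  proof
    fix m show "jd \<zero>\<^bsub>Dl A \<xi>\<^esub> m = 0 m"
      using dq(2)[OF isder_0, of m] by (cases "m \<in> lsec \<xi>") (simp_all add: z jd_def)
  qed
  fix \<Delta> assume \<Delta>: "\<Delta> \<in> carrier (Dl A \<xi>)"
  note d = isder_uminus[OF symb_Dl[OF \<Delta>]]
  show "\<exists>y\<in>carrier (Dl A \<xi>). jd y = - jd \<Delta>"
  proof (rule bexI[OF _ dq(1)[OF d]], rule ext)
    fix m show "jd (dq (\<lambda>m. - jd \<Delta> m)) m = (- jd \<Delta>) m"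
      using dq(2)[OF d, of m] by (cases "m \<in> lsec \<xi>") (simp_all only: uminus_apply, simp add: jd_def)
  qed
qed (rule Dl_add, assumption+)+

interpretation dl: module_embedding "Dl A \<xi>" jd by (rule module_embedding_Dl)

lemma symb_minus:
  assumes "\<Delta> \<in> carrier (Dl A \<xi>)" "\<Delta>' \<in> carrier (Dl A \<xi>)"
  shows "symb A \<xi> (\<Delta> \<ominus>\<^bsub>Dl A \<xi>\<^esub> \<Delta>') = symb A \<xi> \<Delta> - symb A \<xi> \<Delta>'"
proof (rule symb_eq)
  show "\<Delta> \<ominus>\<^bsub>Dl A \<xi>\<^esub> \<Delta>' \<in> carrier (Dl A \<xi>)" using assms by (rule dl.grp.minus_closed)
  have "isder (\<lambda>m. jd \<Delta> m + - jd \<Delta>' m) (symb A \<xi> \<Delta> + - symb A \<xi> \<Delta>')"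
    by (intro isder_add isder_uminus symb_Dl assms)
  then show "isder (jd (\<Delta> \<ominus>\<^bsub>Dl A \<xi>\<^esub> \<Delta>')) (symb A \<xi> \<Delta> - symb A \<xi> \<Delta>')"
    unfolding diff_conv_add_uminus
    by (rule isder_cong) (simp only: dl.J_minus assms minus_apply diff_conv_add_uminus[symmetric])
qed

lemma isder_commutator:
  assumes "isder \<delta> X" "isder \<delta>' X'"
  shows "isder (\<lambda>m. \<delta> (\<delta>' m) - \<delta>' (\<delta> m)) (lie X X')"
  unfolding isder_def
proof (intro conjI ballI)
  note d = isderD[OF assms(1)] and d' = isderD[OF assms(2)]
  show "lie X X' \<in> VF" by (rule lie_VF[OF d(1) d'(1)])
  show "\<delta> (\<delta>' m) - \<delta>' (\<delta> m) \<in> lsec \<xi>" if "m \<in> lsec \<xi>" for m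
    by (intro lsec_diff[OF xi_sub] d(2) d'(2) that)
  show "\<delta> (\<delta>' (m + n)) - \<delta>' (\<delta> (m + n)) = (\<delta> (\<delta>' m) - \<delta>' (\<delta> m)) + (\<delta> (\<delta>' n) - \<delta>' (\<delta> n))"
    if "m \<in> lsec \<xi>" "n \<in> lsec \<xi>" for m n
    using that by (simp add: d(2,3) d'(2,3))
  fix h m assume h: "h \<in> R" and m: "m \<in> lsec \<xi>"
  note Xh = VF_R[OF d(1) h] and X'h = VF_R[OF d'(1) h]
  have l: "smulsec g n \<in> lsec \<xi>" if "g \<in> R" "n \<in> lsec \<xi>" for g n by (rule lsec_smul[OF xi_sub that])
  have 1: "\<delta> (\<delta>' (smulsec h m)) = (smulsec (X (X' h)) m + smulsec (X' h) (\<delta> m)) + (smulsec (X h) (\<delta>' m) + smulsec h (\<delta> (\<delta>' m)))"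
    by (simp only: d'(4)[OF h m] d(3)[OF l[OF X'h m] l[OF h d'(2)[OF m]]] d(4)[OF X'h m] d(4)[OF h d'(2)[OF m]])
  have 2: "\<delta>' (\<delta> (smulsec h m)) = (smulsec (X' (X h)) m + smulsec (X h) (\<delta>' m)) + (smulsec (X' h) (\<delta> m) + smulsec h (\<delta>' (\<delta> m)))"
    by (simp only: d(4)[OF h m] d'(3)[OF l[OF Xh m] l[OF h d(2)[OF m]]] d'(4)[OF Xh m] d'(4)[OF h d(2)[OF m]])
  show "\<delta> (\<delta>' (smulsec h m)) - \<delta>' (\<delta> (smulsec h m)) = smulsec (lie X X' h) m + smulsec h (\<delta> (\<delta>' m) - \<delta>' (\<delta> m))"
    unfolding 1 2 by (simp add: smulsec_def lie_def fun_eq_iff algebra_simps)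
qed

lemma commutator_dq:
  assumes "\<Delta> \<in> carrier (Dl A \<xi>)" "\<Delta>' \<in> carrier (Dl A \<xi>)"
  shows "commutator A \<xi> \<Delta> \<Delta>' = dq (\<lambda>m. jd \<Delta> (jd \<Delta>' m) - jd \<Delta>' (jd \<Delta> m))"
  unfolding commutator_def dq_def
proof (rule restrict_ext)
  fix s assume s: "s \<in> carrier (ell A \<xi>)"
  note c = Dl_closed[OF assms(1)] Dl_closed[OF assms(2)]
  have d: "\<Delta> (\<Delta>' s) \<ominus>\<^bsub>ell A \<xi>\<^esub> \<Delta>' (\<Delta> s) \<in> carrier (ell A \<xi>)" by (intro cx.me.grp.minus_closed c s)
  have "js \<xi> (\<Delta> (\<Delta>' s) \<ominus>\<^bsub>ell A \<xi>\<^esub> \<Delta>' (\<Delta> s)) = jd \<Delta> (jd \<Delta>' (js \<xi> s)) - jd \<Delta>' (jd \<Delta> (js \<xi> s))"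
    by (simp only: cx.me.J_minus c s jd_js assms)
  then show "\<Delta> (\<Delta>' s) \<ominus>\<^bsub>ell A \<xi>\<^esub> \<Delta>' (\<Delta> s) = qs \<xi> (jd \<Delta> (jd \<Delta>' (js \<xi> s)) - jd \<Delta>' (jd \<Delta> (js \<xi> s)))"
    using js_lsec(2)[OF xi_sub d] by simp
qed

lemma commutator:
  assumes "\<Delta> \<in> carrier (Dl A \<xi>)" "\<Delta>' \<in> carrier (Dl A \<xi>)"
  shows "commutator A \<xi> \<Delta> \<Delta>' \<in> carrier (Dl A \<xi>)" "symb A \<xi> (commutator A \<xi> \<Delta> \<Delta>') = lie (symb A \<xi> \<Delta>) (symb A \<xi> \<Delta>')"
  unfolding commutator_dq[OF assms]
  by (rule dq[OF isder_commutator[OF symb_Dl[OF assms(1)] symb_Dl[OF assms(2)]]])+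

text \<open>The Koszul formula for a 1-form: two actions and one commutator, whose symbol is the
  bracket of the symbols.\<close>

lemma varpi:
  assumes \<Delta>: "\<Delta> \<in> carrier (Dl A \<xi>)" and \<Delta>': "\<Delta>' \<in> carrier (Dl A \<xi>)"
  shows "varpi A \<xi> [\<Delta>, \<Delta>'] \<in> carrier (ell A \<xi>)"
    "js \<xi> (varpi A \<xi> [\<Delta>, \<Delta>']) =
      jd \<Delta> (cls \<xi> (symb A \<xi> \<Delta>')) - jd \<Delta>' (cls \<xi> (symb A \<xi> \<Delta>)) - cls \<xi> (lie (symb A \<xi> \<Delta>) (symb A \<xi> \<Delta>'))"
proof -
  define \<alpha> where "\<alpha> = (\<lambda>\<Delta>s\<in>tuples (Dl A \<xi>) 1. quot_proj A \<xi> (symb A \<xi> (hd \<Delta>s)))"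
  have al: "\<alpha> [E] = quot_proj A \<xi> (symb A \<xi> E)" if "E \<in> carrier (Dl A \<xi>)" for E
    using that by (simp add: \<alpha>_def tuples_def)
  have q: "quot_proj A \<xi> X \<in> carrier (ell A \<xi>)" if "X \<in> VF" for X
    unfolding quot_proj_qs[OF xi_sub] by (rule qs_carrier[OF xi_sub cls_lsec[OF xi_sub that]])
  have jq: "js \<xi> (E (quot_proj A \<xi> X)) = jd E (cls \<xi> X)" if "E \<in> carrier (Dl A \<xi>)" "X \<in> VF" for E X
    by (simp only: jd_js that q js_quot_proj[OF xi_sub])
  note s = symb_VF[OF \<Delta>] symb_VF[OF \<Delta>']
  have n: "nths [\<Delta>, \<Delta>'] (- {0}) = [\<Delta>']" "nths [\<Delta>, \<Delta>'] (- {Suc 0}) = [\<Delta>]" "nths [\<Delta>, \<Delta>'] (- {0, Suc 0}) = []"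
    by (simp_all add: nths_Cons)
  have t: "[\<Delta>, \<Delta>'] \<in> tuples (Dl A \<xi>) (Suc 1)" using \<Delta> \<Delta>' by (simp add: tuples_def)
  have "\<And>i. i \<le> 1 ==> ([\<Delta>, \<Delta>'] ! i) (\<alpha> (nths [\<Delta>, \<Delta>'] (- {i}))) \<in> carrier (ell A \<xi>)"
    by (auto simp: le_Suc_eq n al \<Delta> \<Delta>' Dl_closed q s)
  moreover have "\<And>i j. i < j ==> j \<le> 1 ==>
      \<alpha> (commutator A \<xi> ([\<Delta>, \<Delta>'] ! i) ([\<Delta>, \<Delta>'] ! j) # nths [\<Delta>, \<Delta>'] (- {i, j})) \<in> carrier (ell A \<xi>)"
    by (auto simp: le_Suc_eq n al \<Delta> \<Delta>' commutator q lie_VF s)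
  ultimately have k0: "koszul (Dl A \<xi>) (ell A \<xi>) (commutator A \<xi>) (\<lambda>\<Delta>. \<Delta>) 1 \<alpha> [\<Delta>, \<Delta>'] \<in> carrier (ell A \<xi>)"
    "js \<xi> (koszul (Dl A \<xi>) (ell A \<xi>) (commutator A \<xi>) (\<lambda>\<Delta>. \<Delta>) 1 \<alpha> [\<Delta>, \<Delta>']) =
      (\<Sum>i<Suc 1. sg i (js \<xi> (([\<Delta>, \<Delta>'] ! i) (\<alpha> (nths [\<Delta>, \<Delta>'] (- {i})))))) +
      (\<Sum>j<Suc 1. \<Sum>i<j. sg (i + j) (js \<xi> (\<alpha> (commutator A \<xi> ([\<Delta>, \<Delta>'] ! i) ([\<Delta>, \<Delta>'] ! j) # nths [\<Delta>, \<Delta>'] (- {i, j})))))"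
    using cx.me.koszul_closed_J[OF t, where nab = "\<lambda>\<Delta>. \<Delta>" and br = "commutator A \<xi>" and \<eta> = \<alpha>] by blast+
  have k: "varpi A \<xi> [\<Delta>, \<Delta>'] \<in> carrier (ell A \<xi>)"
    "js \<xi> (varpi A \<xi> [\<Delta>, \<Delta>']) = (\<Sum>i<Suc 1. sg i (js \<xi> (([\<Delta>, \<Delta>'] ! i) (\<alpha> (nths [\<Delta>, \<Delta>'] (- {i})))))) +
      (\<Sum>j<Suc 1. \<Sum>i<j. sg (i + j) (js \<xi> (\<alpha> (commutator A \<xi> ([\<Delta>, \<Delta>'] ! i) ([\<Delta>, \<Delta>'] ! j) # nths [\<Delta>, \<Delta>'] (- {i, j})))))"
    unfolding varpi_def d_D_def \<alpha>_def[symmetric] by (rule k0)+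
  show "varpi A \<xi> [\<Delta>, \<Delta>'] \<in> carrier (ell A \<xi>)" by (rule k(1))
  show "js \<xi> (varpi A \<xi> [\<Delta>, \<Delta>']) =
      jd \<Delta> (cls \<xi> (symb A \<xi> \<Delta>')) - jd \<Delta>' (cls \<xi> (symb A \<xi> \<Delta>)) - cls \<xi> (lie (symb A \<xi> \<Delta>) (symb A \<xi> \<Delta>'))"
    unfolding k(2)
    by (simp add: n al \<Delta> \<Delta>' jq s commutator js_quot_proj[OF xi_sub] lie_VF)
qed

section \<open>Derivations with prescribed symbol and the kernel of \<varpi>\<close>

lemma xi_lift:
  assumes "m \<in> lsec \<xi>"
  shows "\<exists>N. N \<in> Gam G \<and> cls \<xi> N = m"
proof -
  have "xG_linear (\<lambda>Y. 0)"
    by (simp add: xG_linear_def lsec_zero[OF xi_sub]) (simp add: smulsec_def fun_eq_iff)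
  from solve[OF assms this] show ?thesis by blast
qed

definition der :: "('a vfield => ('a => 'a tvec)) => ('a => 'a tvec) => ('a => 'a tvec)" where
  "der r m = r (SOME N. N \<in> Gam G \<and> cls \<xi> N = m)"

text \<open>Every section of \<ell> has a global lift by \<open>xi_lift\<close>, so a rule on vector
  fields that annihilates \<xi> descends to \<ell>. The equation \<open>smul\<close> becomes the
  Leibniz rule.\<close>

lemma rule_der:
  assumes X: "X \<in> VF" and r: "\<And>N. N \<in> VF ==> r N \<in> lsec \<xi>"
    and add: "\<And>N N'. N \<in> VF ==> N' \<in> VF ==> r (N + N') = r N + r N'"
    and xi: "\<And>N. N \<in> Gam \<xi> ==> r N = 0"
    and smul: "\<And>s N. s \<in> R ==> N \<in> VF ==> r (smul s N) = smulsec (X s) (cls \<xi> N) + smulsec s (r N)"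
  shows "isder (der r) X" "N \<in> VF ==> der r (cls \<xi> N) = r N"
proof -
  have eq: "der r (cls \<xi> N) = r N" if N: "N \<in> VF" for N
  proof -
    from someI_ex[OF xi_lift[OF cls_lsec[OF xi_sub N]]]
    obtain N' where N': "N' \<in> Gam G" "cls \<xi> N' = cls \<xi> N" and e: "der r (cls \<xi> N) = r N'" unfolding der_def by blast
    note V' = secs_VF[OF N'(1)]
    have "cls \<xi> (N' - N) = 0" using N'(2) by (simp add: cls_diff'[OF xi_sub])
    then have "N' - N \<in> Gam \<xi>" using cls_zero_secs[OF xi_sub VF_minus[OF V' N]] by simp
    then have "r (N' - N) = 0" by (rule xi)
    moreover have "r (N' - N + N) = r (N' - N) + r N" by (rule add[OF VF_minus[OF V' N] N])
    ultimately show ?thesis unfolding e by simp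
  qed
  show "isder (der r) X"
    unfolding isder_def
  proof (intro conjI ballI X)
    fix m assume "m \<in> lsec \<xi>"
    then obtain N where "N \<in> Gam G" and m: "cls \<xi> N = m" using xi_lift by blast
    then have N: "N \<in> VF" using secs_VF by blast
    show "der r m \<in> lsec \<xi>" using r[OF N] eq[OF N] m by simp
    show "der r (smulsec h m) = smulsec (X h) m + smulsec h (der r m)" if h: "h \<in> R" for h
      using eq[OF VF_smul[OF h N]] eq[OF N] smul[OF h N] m by (simp add: cls_smul'[OF xi_sub])
    fix n assume "n \<in> lsec \<xi>"
    then obtain N' where "N' \<in> Gam G" and n: "cls \<xi> N' = n" using xi_lift by blast
    then have N': "N' \<in> VF" using secs_VF by blast
    show "der r (m + n) = der r m + der r n"
      using eq[OF VF_plus[OF N N']] eq[OF N] eq[OF N'] add[OF N N'] m n by (simp add: cls_add'[OF xi_sub])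
  qed
  show "N \<in> VF ==> der r (cls \<xi> N) = r N" by (rule eq)
qed

lemma isder_id: "isder (\<lambda>m. m) 0"
  unfolding isder_def by (auto simp: smulsec_def fun_eq_iff)

lemma isder_nab:
  assumes "X \<in> Gam F"
  shows "isder (nabD \<xi> X) X"
  unfolding isder_def
  using secs_VF[OF assms] xi.nab_M[OF assms] xi.nab_add_right[OF assms] xi.nab_sm[OF _ assms] by (simp add: add.commute)

lemma local_der:
  assumes Y: "Y \<in> VF"
  shows "\<exists>b \<delta>. b \<in> R \<and> b p = 1 \<and> isder \<delta> (smul b Y)"
proof -
  obtain Q Z c where t: "open Q" "p \<in> Q" "Z \<in> VF" "\<And>q. tlin (c q)"
    "\<And>W. W \<in> VF ==> (\<lambda>q. c q (vec_at W q)) \<in> R"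
    "\<And>q v. q \<in> Q ==> v \<in> T q ==> v \<in> \<xi> q \<longleftrightarrow> c q v = 0" "\<And>q. q \<in> Q ==> c q (vec_at Z q) = 1"
    by (rule xi_triv[of p]) (rule that)
  from bump_ex[OF t(1,2)] obtain b Q' where b: "b \<in> R"
    "\<forall>q. q \<notin> Q \<longrightarrow> b q = 0" "\<forall>q. q \<notin> Q \<longrightarrow> (\<exists>V. open V \<and> q \<in> V \<and> (\<forall>x\<in>V. b x = 0))"
    "p \<in> Q'" "\<forall>q\<in>Q'. b q = 1" by (elim exE conjE)
  let ?C = "\<lambda>N q. c q (vec_at N q)" and ?X = "smul b Y"
  note CR = t(5)
  have XV: "?X \<in> VF" by (rule VF_smul[OF b(1) Y])
  have CV: "smul (?C N) Z \<in> VF" if "N \<in> VF" for N by (rule VF_smul[OF CR[OF that] t(3)])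
  let ?r = "\<lambda>N. cls \<xi> (lie ?X (smul (?C N) Z))"
  have "isder (der ?r) ?X"
  proof (rule rule_der(1)[OF XV])
    show "?r N \<in> lsec \<xi>" if "N \<in> VF" for N
      by (rule cls_lsec[OF xi_sub lie_VF[OF XV CV[OF that]]])
    show "?r (N + N') = ?r N + ?r N'" if "N \<in> VF" "N' \<in> VF" for N N'
    proof -
      have "smul (?C (N + N')) Z = smul (?C N) Z + smul (?C N') Z"
        by (simp add: fun_eq_iff vec_at_simps tlin_add[OF t(4)] algebra_simps)
      then show ?thesis by (simp only: lie_add_right[OF XV CV CV, OF that] cls_add'[OF xi_sub])
    qed
    show "?r N = 0" if N: "N \<in> Gam \<xi>" for N
    proof
      fix q
      note NV = secs_VF[OF N]
      have "vec_at (lie ?X (smul (?C N) Z)) q = 0"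
      proof (cases "q \<in> Q")
        case True
        have "vec_at (lie ?X (smul (?C N) Z)) q = vec_at (lie ?X 0) q"
        proof (rule lie_local_right[OF XV CV[OF NV] VF_zero t(1) _ True])
          fix q assume q: "q \<in> Q"
          have "?C N q = 0" using t(6)[OF q VF_T[OF NV]] secs_at[OF N UNIV_I] by simp
          then show "vec_at (smul (?C N) Z) q = vec_at 0 q" by (simp add: vec_at_simps fun_eq_iff)
        qed
        then show ?thesis by (simp only: lie_zero_right[OF XV] vec_at_simps)
      next
        case False
        then obtain V where V: "open V" "q \<in> V" "\<forall>x\<in>V. b x = 0" using b(3) by blast
        have "vec_at (lie ?X (smul (?C N) Z)) q = vec_at (lie 0 (smul (?C N) Z)) q"
          by (rule lie_local_left[OF CV[OF NV] XV VF_zero V(1) _ V(2)]) (use V(3) in \<open>simp add: vec_at_simps fun_eq_iff\<close>)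
        then show ?thesis by (simp only: lie_zero_left[OF CV[OF NV]] vec_at_simps)
      qed
      then show "?r N q = 0 q"
        by (simp only: cls_zero_iff[OF xi_sub] zero_fun_apply sub_dist_zero[OF xi_sub])
    qed
    show "?r (smul s N) = smulsec (?X s) (cls \<xi> N) + smulsec s (?r N)" if s: "s \<in> R" and N: "N \<in> VF" for s N
    proof -
      have "smul (?C (smul s N)) Z = smul s (smul (?C N) Z)"
        by (simp add: fun_eq_iff vec_at_simps tlin_scale[OF t(4)])
      then have e: "?r (smul s N) = smulsec s (?r N) + smulsec (?X s) (cls \<xi> (smul (?C N) Z))"
        by (simp only: lie_smul_right[OF s XV CV[OF N]] cls_add'[OF xi_sub] cls_smul'[OF xi_sub])
      have "smulsec (?X s) (cls \<xi> (smul (?C N) Z)) = smulsec (?X s) (cls \<xi> N)"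
      proof (rule ext)
        fix q show "smulsec (?X s) (cls \<xi> (smul (?C N) Z)) q = smulsec (?X s) (cls \<xi> N) q"
        proof (cases "q \<in> Q")
          case True
          have "vec_at (smul (?C N) Z) q - vec_at N q \<in> T q"
            using VF_T[OF VF_minus[OF CV[OF N] N], of q] by (simp only: vec_at_simps)
          moreover have "c q (vec_at (smul (?C N) Z) q - vec_at N q) = 0"
            using t(7)[OF True] by (simp only: tlin_diff[OF t(4)] vec_at_simps tlin_scale[OF t(4)] mult_1_right diff_self)
          ultimately have "cls \<xi> (smul (?C N) Z) q = cls \<xi> N q"
            unfolding cls_eq_iff[OF xi_sub] using t(6)[OF True] by blast
          then show ?thesis by (simp only: smulsec_def)
        next
          case False
          then show ?thesis using b(2) by (simp add: smulsec_def)
        qed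
      qed
      then show ?thesis unfolding e by (simp only: add.commute)
    qed
  qed
  then show ?thesis using b by blast
qed

text \<open>The identity is a derivation with symbol 0, which lies in G, and testing with it gives
  \<theta> X = 0. Testing with a derivation of symbol b Y from \<open>local_der\<close> then gives
  the second claim at a point with b = 1, as the terms with X(b) cancel.\<close>

lemma kernel_test:
  assumes \<delta>: "isder \<delta> X"
    and V: "\<And>\<delta>' X'. isder \<delta>' X' ==> X' \<in> Gam G ==> \<delta> (cls \<xi> X') - \<delta>' (cls \<xi> X) - cls \<xi> (lie X X') = 0"
  shows "X \<in> Gam \<xi>" "Y \<in> Gam G ==> \<delta> (cls \<xi> Y) = cls \<xi> (lie X Y)"
proof -
  note XV = isderD(1)[OF \<delta>]
  have "\<delta> (cls \<xi> 0) - cls \<xi> X - cls \<xi> (lie X 0) = 0"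
    by (rule V[OF isder_id secs_zero[OF G_sub]])
  then have z: "cls \<xi> X = 0"
    by (simp only: cls_zero'[OF xi_sub] lie_zero_right[OF XV] isder_zero[OF \<delta>]) simp
  then show "X \<in> Gam \<xi>" using cls_zero_secs[OF xi_sub XV] by simp
  show "\<delta> (cls \<xi> Y) = cls \<xi> (lie X Y)" if Y: "Y \<in> Gam G"
  proof
    fix p
    note YV = secs_VF[OF Y]
    obtain b \<delta>' where b: "b \<in> R" "b p = 1" "isder \<delta>' (smul b Y)" using local_der[OF YV, of p] by blast
    have "\<delta> (cls \<xi> (smul b Y)) - \<delta>' (cls \<xi> X) - cls \<xi> (lie X (smul b Y)) = 0"
      by (rule V[OF b(3) secs_smul[OF G_sub b(1) Y]])
    then have "smulsec (X b) (cls \<xi> Y) + smulsec b (\<delta> (cls \<xi> Y)) - 0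
        - (smulsec b (cls \<xi> (lie X Y)) + smulsec (X b) (cls \<xi> Y)) = 0"
      by (simp only: z isder_zero[OF b(3)] cls_smul'[OF xi_sub] isderD(4)[OF \<delta> b(1) cls_lsec[OF xi_sub YV]]
        lie_smul_right[OF b(1) XV YV] cls_add'[OF xi_sub])
    then have "smulsec b (\<delta> (cls \<xi> Y)) = smulsec b (cls \<xi> (lie X Y))" by simp
    then have "smulsec b (\<delta> (cls \<xi> Y)) p = smulsec b (cls \<xi> (lie X Y)) p" by simp
    then show "\<delta> (cls \<xi> Y) p = cls \<xi> (lie X Y) p" using b(2) by (simp only: smulsec_def) simp
  qed
qed

lemma varpi_zero_iff:
  assumes "\<Delta> \<in> carrier (Dl A \<xi>)" "\<Delta>' \<in> carrier (Dl A \<xi>)"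
  shows "varpi A \<xi> [\<Delta>, \<Delta>'] = \<zero>\<^bsub>ell A \<xi>\<^esub> \<longleftrightarrow>
    jd \<Delta> (cls \<xi> (symb A \<xi> \<Delta>')) - jd \<Delta>' (cls \<xi> (symb A \<xi> \<Delta>)) - cls \<xi> (lie (symb A \<xi> \<Delta>) (symb A \<xi> \<Delta>')) = 0"
  using varpi[OF assms] cx.me.J_eq[OF _ cx.me.zero_closed] by (auto simp: cx.me.J_zero)

text \<open>Testing against symbols in G determines the kernel of \<varpi>. This serves both for the
  description of \<open>Ker\<close> and for the uniqueness of preimages in
  \<open>varpi_inv\<close>.\<close>

lemma test_varpi:
  assumes \<Delta>: "\<Delta> \<in> carrier (Dl A \<xi>)"
    and z: "\<And>\<Delta>'. \<Delta>' \<in> carrier (Dl A \<xi>) ==> symb A \<xi> \<Delta>' \<in> Gam G ==> varpi A \<xi> [\<Delta>, \<Delta>'] = \<zero>\<^bsub>ell A \<xi>\<^esub>"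
  shows "symb A \<xi> \<Delta> \<in> Gam F" "m \<in> lsec \<xi> ==> jd \<Delta> m = nabD \<xi> (symb A \<xi> \<Delta>) m"
proof -
  let ?X = "symb A \<xi> \<Delta>"
  note \<delta> = symb_Dl[OF \<Delta>]
  have V: "jd \<Delta> (cls \<xi> X') - \<delta>' (cls \<xi> ?X) - cls \<xi> (lie ?X X') = 0" if d: "isder \<delta>' X'" "X' \<in> Gam G" for \<delta>' X'
    using z[OF dq(1)[OF d(1)]] varpi_zero_iff[OF \<Delta> dq(1)[OF d(1)]] dq(3)[OF d(1)]
      dq(2)[OF d(1) cls_lsec[OF xi_sub isderD(1)[OF \<delta>]]] d(2) by simp
  have X: "?X \<in> Gam \<xi>" by (rule kernel_test(1)[OF \<delta>]) (rule V)
  have k: "jd \<Delta> (cls \<xi> Y) = cls \<xi> (lie ?X Y)" if "Y \<in> Gam G" for Y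
    by (rule kernel_test(2)[OF \<delta> _ that]) (rule V)
  note XV = secs_VF[OF X]
  have "cls \<xi> (lie ?X Y) = 0" if Y: "Y \<in> Gam \<xi>" for Y
  proof -
    note YV = secs_VF[OF Y]
    have PF: "PF Y \<in> Gam F" by (rule QG_spec(2)[OF YV])
    have "lie ?X Y = lie ?X (PF Y) + lie ?X (QG Y)"
      using lie_add_right[OF XV PF_VF[OF YV] QG_VF[OF YV]] by (simp add: PF_def)
    moreover have "cls \<xi> (lie ?X (PF Y)) = 0"
      using cls_xi_zero[OF lie_F_xi[OF PF X open_UNIV]] lie_antisym[of ?X "PF Y"] by (simp add: cls_uminus'[OF xi_sub])
    moreover have "cls \<xi> (lie ?X (QG Y)) = 0"
      using k[OF xG_G[OF QG_xG[OF Y]]] cls_xi_zero[OF xG_xi[OF QG_xG[OF Y]]] isder_zero[OF \<delta>] by simp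
    ultimately show ?thesis by (simp add: cls_add'[OF xi_sub])
  qed
  then have "vec_at (lie ?X Y) p \<in> \<xi> p" if "Y \<in> Gam \<xi>" for Y p
    using that cls_zero_iff[OF xi_sub, of "lie ?X Y" p] by simp
  then show F: "?X \<in> Gam F" by (intro secsI[OF XV] F_I[OF X])
  show "jd \<Delta> m = nabD \<xi> ?X m" if "m \<in> lsec \<xi>" for m
  proof -
    obtain N where N: "N \<in> Gam G" "cls \<xi> N = m" using xi_lift[OF \<open>m \<in> lsec \<xi>\<close>] by blast
    show ?thesis using k[OF N(1)] nab_xi_cls[OF F secs_VF[OF N(1)]] N(2) by simp
  qed
qed

lemma varpi_nab:
  assumes E: "E \<in> carrier (Dl A \<xi>)" and F: "symb A \<xi> E \<in> Gam F" and n: "\<And>m. m \<in> lsec \<xi> ==> jd E m = nabD \<xi> (symb A \<xi> E) m"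
    and \<Delta>': "\<Delta>' \<in> carrier (Dl A \<xi>)"
  shows "varpi A \<xi> [E, \<Delta>'] = \<zero>\<^bsub>ell A \<xi>\<^esub>"
  unfolding varpi_zero_iff[OF E \<Delta>']
  using n[OF cls_lsec[OF xi_sub symb_VF[OF \<Delta>']]] nab_xi_cls[OF F symb_VF[OF \<Delta>']] cls_xi_zero[OF secs_F_xi[OF F]]
    isder_zero[OF symb_Dl[OF \<Delta>']] by simp

text \<open>The kernel of \<varpi> consists of the covariant derivatives along T\<F>, so X \<mapsto>
  \<nabla>_X, called \<open>kerD\<close> below, inverts the symbol map on it.\<close>

lemma Ker_iff: "\<Delta> \<in> carrier (Ker A \<xi>) \<longleftrightarrow>
    \<Delta> \<in> carrier (Dl A \<xi>) \<and> symb A \<xi> \<Delta> \<in> Gam F \<and> (\<forall>m\<in>lsec \<xi>. jd \<Delta> m = nabD \<xi> (symb A \<xi> \<Delta>) m)"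
  using test_varpi[of \<Delta>] varpi_nab[of \<Delta>] unfolding Ker_def submod_def by auto

lemma carrier_G_tilde: "\<Delta> \<in> carrier (G_tilde A \<xi> G) \<longleftrightarrow> \<Delta> \<in> carrier (Dl A \<xi>) \<and> symb A \<xi> \<Delta> \<in> Gam G"
  by (simp add: G_tilde_def submod_def carrier_dist_sections)

abbreviation kerD where "kerD X \<equiv> dq (nabD \<xi> X)"

lemma kerD: "X \<in> Gam F ==> kerD X \<in> carrier (Ker A \<xi>)" "X \<in> Gam F ==> symb A \<xi> (kerD X) = X"
  using dq[OF isder_nab] by (simp_all add: Ker_iff)

lemma Ker_eq:
  assumes "\<Delta> \<in> carrier (Ker A \<xi>)" "\<Delta>' \<in> carrier (Ker A \<xi>)" "symb A \<xi> \<Delta> = symb A \<xi> \<Delta>'"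
  shows "\<Delta> = \<Delta>'"
  using assms by (intro jd_inj) (simp_all add: Ker_iff)

lemma pr_K:
  assumes \<Delta>: "\<Delta> \<in> carrier (Dl A \<xi>)"
  shows "symb A \<xi> (pr_K A \<xi> G \<Delta>) = PF (symb A \<xi> \<Delta>)"
proof -
  let ?X = "symb A \<xi> \<Delta>"
  note XV = symb_VF[OF \<Delta>]
  have F: "PF ?X \<in> Gam F" by (rule QG_spec(2)[OF XV])
  have "pr_K A \<xi> G \<Delta> = kerD (PF ?X)"
    unfolding pr_K_def
  proof (rule the_equality)
    have D: "kerD (PF ?X) \<in> carrier (Dl A \<xi>)" using kerD(1)[OF F] by (simp add: Ker_iff)
    have "?X - PF ?X \<in> Gam G" using QG_spec(1)[OF XV] by (simp add: PF_def)
    then show "kerD (PF ?X) \<in> carrier (Ker A \<xi>) \<and> \<Delta> \<ominus>\<^bsub>Dl A \<xi>\<^esub> kerD (PF ?X) \<in> carrier (G_tilde A \<xi> G)"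
      using kerD[OF F] dl.grp.minus_closed[OF \<Delta> D] by (simp add: carrier_G_tilde symb_minus[OF \<Delta> D])
    fix E assume "E \<in> carrier (Ker A \<xi>) \<and> \<Delta> \<ominus>\<^bsub>Dl A \<xi>\<^esub> E \<in> carrier (G_tilde A \<xi> G)"
    then have E: "E \<in> carrier (Ker A \<xi>)" "\<Delta> \<ominus>\<^bsub>Dl A \<xi>\<^esub> E \<in> carrier (G_tilde A \<xi> G)" by simp_all
    have ED: "E \<in> carrier (Dl A \<xi>)" and EF: "symb A \<xi> E \<in> Gam F" using E(1) by (simp_all add: Ker_iff)
    have "?X - symb A \<xi> E \<in> Gam G" using E(2) by (simp add: carrier_G_tilde symb_minus[OF \<Delta> ED])
    then have "PF ?X = ?X - (?X - symb A \<xi> E)"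
      by (intro QG_unique(2)[OF XV]) (simp_all add: EF)
    then have "symb A \<xi> E = symb A \<xi> (kerD (PF ?X))" using kerD(2)[OF F] by simp
    then show "E = kerD (PF ?X)" by (rule Ker_eq[OF E(1) kerD(1)[OF F]])
  qed
  then show ?thesis by (simp add: kerD(2)[OF F])
qed

section \<open>Functionals on N\<F> and preimages under \<varpi>\<close>

interpretation cf: char_module A \<xi> F
  by unfold_locales (rule F_sub preserves_F cls_F_zero, assumption?)+

definition Flin :: "(('a => 'a tvec) => ('a => 'a tvec)) => bool" where
  "Flin B \<longleftrightarrow> (\<forall>m\<in>lsec F. B m \<in> lsec \<xi>) \<and> (\<forall>m\<in>lsec F. \<forall>n\<in>lsec F. B (m + n) = B m + B n) \<and>
     (\<forall>h\<in>R. \<forall>m\<in>lsec F. B (smulsec h m) = smulsec h (B m))"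

lemma FlinD:
  assumes "Flin B"
  shows "m \<in> lsec F ==> B m \<in> lsec \<xi>" "m \<in> lsec F ==> n \<in> lsec F ==> B (m + n) = B m + B n"
    "h \<in> R ==> m \<in> lsec F ==> B (smulsec h m) = smulsec h (B m)"
  using assms unfolding Flin_def by blast+

lemma Flin_zero: "Flin B ==> B 0 = 0"
  using FlinD(2)[of B 0 0] lsec_zero[OF F_sub] by simp

lemma Flin_uminus: "Flin B ==> m \<in> lsec F ==> B (- m) = - B m"
  using FlinD(2)[of B "- m" m] Flin_zero[of B] lsec_uminus[OF F_sub, of m] by (simp add: eq_neg_iff_add_eq_0)

lemma Flin_diff: "Flin B ==> m \<in> lsec F ==> n \<in> lsec F ==> B (m - n) = B m - B n"
  unfolding diff_conv_add_uminus by (simp only: FlinD(2) Flin_uminus lsec_uminus[OF F_sub])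

definition jB :: "('a qsection => 'a qsection) => ('a => 'a tvec) => ('a => 'a tvec)" where
  "jB \<beta> m = js \<xi> (\<beta> (qs F m))"

lemma Flin_jB:
  assumes \<beta>: "linear_map R (NF A \<xi>) (ell A \<xi>) \<beta>"
  shows "Flin (jB \<beta>)" "s \<in> carrier (NF A \<xi>) ==> \<beta> s \<in> carrier (ell A \<xi>)" "s \<in> carrier (NF A \<xi>) ==> js \<xi> (\<beta> s) = jB \<beta> (js F s)"
proof -
  have c: "\<beta> s \<in> carrier (ell A \<xi>)" if "s \<in> carrier (NF A \<xi>)" for s using \<beta> that unfolding linear_map_def by blast
  show "s \<in> carrier (NF A \<xi>) ==> \<beta> s \<in> carrier (ell A \<xi>)" by (rule c)
  show "s \<in> carrier (NF A \<xi>) ==> js \<xi> (\<beta> s) = jB \<beta> (js F s)" by (simp add: jB_def js_lsec(2)[OF F_sub])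
  note q = qs_carrier[OF F_sub]
  show "Flin (jB \<beta>)"
    unfolding Flin_def
  proof (intro conjI ballI)
    show "jB \<beta> m \<in> lsec \<xi>" if "m \<in> lsec F" for m
      unfolding jB_def by (rule js_lsec(1)[OF xi_sub c[OF q[OF that]]])
    show "jB \<beta> (m + n) = jB \<beta> m + jB \<beta> n" if m: "m \<in> lsec F" and n: "n \<in> lsec F" for m n
    proof -
      have "\<beta> (qs F m \<oplus>\<^bsub>NF A \<xi>\<^esub> qs F n) = \<beta> (qs F m) \<oplus>\<^bsub>ell A \<xi>\<^esub> \<beta> (qs F n)"
        using \<beta> q[OF m] q[OF n] unfolding linear_map_def by blast
      then show ?thesis by (simp add: jB_def qs_add[OF F_sub] cx.me.J_add c q m n)
    qed
    show "jB \<beta> (smulsec h m) = smulsec h (jB \<beta> m)" if h: "h \<in> R" and m: "m \<in> lsec F" for h m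
    proof -
      have "\<beta> (h \<odot>\<^bsub>NF A \<xi>\<^esub> qs F m) = h \<odot>\<^bsub>ell A \<xi>\<^esub> \<beta> (qs F m)"
        using \<beta> q[OF m] h unfolding linear_map_def by blast
      then show ?thesis by (simp add: jB_def qs_smul[OF F_sub] qsec_smul(2)[OF xi_sub h] c q m)
    qed
  qed
qed

lemma Flin_beta:
  assumes B: "Flin B"
  shows "linear_map R (NF A \<xi>) (ell A \<xi>) (\<lambda>s. qs \<xi> (B (js F s)))"
  unfolding linear_map_def
  using FlinD[OF B] by (auto simp: qs_carrier[OF xi_sub] js_lsec[OF F_sub] cf.me.J_add qsec_smul[OF F_sub]
    qs_add[OF xi_sub] qs_smul[OF xi_sub])

lemma jB_beta: "Flin B ==> m \<in> lsec F ==> jB (\<lambda>s. qs \<xi> (B (js F s))) m = B m"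
  by (simp add: jB_def js_qs[OF F_sub] js_qs[OF xi_sub] FlinD)

text \<open>The functional \<theta> of the lift shows that the lift is in \<xi>. Cut-off functionals
  built from the bracket with a Y in \<xi> \<inter> G then show that its bracket data vanish too, so
  the section is 0. This yields the uniqueness of the value of \<Phi>.\<close>

lemma Flin_separates:
  assumes m: "m \<in> lsec F" and z: "\<And>B. Flin B ==> B m = 0"
  shows "m = 0"
proof (rule nf_eqI[OF m lsec_zero[OF F_sub]])
  let ?N = "repG m"
  have NV: "?N \<in> VF" by (rule repG_VF[OF m])
  have "Flin (\<lambda>m. cls \<xi> (repG m))"
    unfolding Flin_def
    by (intro conjI ballI cls_lsec[OF xi_sub repG_VF])
      (simp_all only: repG_add repG_smul cls_add'[OF xi_sub] cls_smul'[OF xi_sub])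
  then have c0: "cls \<xi> ?N = 0" by (rule z)
  then show "cls \<xi> ?N = cls \<xi> (repG 0)" by (simp only: repG_zero cls_zero'[OF xi_sub])
  have N: "?N \<in> Gam \<xi>" using c0 cls_zero_secs[OF xi_sub NV] by simp
  fix Y assume Y: "Y \<in> Gam xG"
  note YV = secs_VF[OF Y]
  have "cls \<xi> (lie Y ?N) p = 0" for p
  proof -
    obtain Q Z c where t: "open Q" "p \<in> Q" "Z \<in> VF" "\<And>q. tlin (c q)"
      "\<And>W. W \<in> VF ==> (\<lambda>q. c q (vec_at W q)) \<in> R"
      "\<And>q v. q \<in> Q ==> v \<in> T q ==> v \<in> \<xi> q \<longleftrightarrow> c q v = 0" "\<And>q. q \<in> Q ==> c q (vec_at Z q) = 1"
      by (rule xi_triv[of p]) (rule that)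
    from bump_ex[OF t(1,2)] obtain b Q' where b: "b \<in> R" "\<forall>q. q \<notin> Q \<longrightarrow> b q = 0" "p \<in> Q'" "\<forall>q\<in>Q'. b q = 1"
      by (elim exE conjE)
    \<comment> \<open>Removing the \<open>Z\<close>-component moves the field into \<xi> near
      \<open>p\<close>. There \<theta>[Y, W N] is linear over functions in N, and for N in \<xi> it
      is \<theta>[Y,N].\<close>
    define W where "W N = N - smul (\<lambda>q. c q (vec_at N q)) Z" for N
    have WV: "W N \<in> VF" if "N \<in> VF" for N
      unfolding W_def by (rule VF_minus[OF that VF_smul[OF t(5)[OF that] t(3)]])
    have W_add: "W (N + N') = W N + W N'" for N N'
      by (simp add: W_def fun_eq_iff vec_at_simps tlin_add[OF t(4)] algebra_simps)
    have W_smul: "W (smul h N) = smul h (W N)" for h N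
      by (simp add: W_def fun_eq_iff vec_at_simps tlin_scale[OF t(4)] algebra_simps)
    have W_xi: "cls \<xi> (W N) q = 0" if "q \<in> Q" "N \<in> VF" for q N
    proof -
      have "c q (vec_at (W N) q) = 0"
        using t(7)[OF that(1)] by (simp only: W_def vec_at_simps tlin_diff[OF t(4)] tlin_scale[OF t(4)] mult_1_right diff_self)
      then show ?thesis unfolding cls_zero_iff[OF xi_sub] t(6)[OF that(1) VF_T[OF WV[OF that(2)]]] .
    qed
    let ?B = "\<lambda>m. smulsec b (cls \<xi> (lie Y (W (repG m))))"
    have "Flin ?B"
      unfolding Flin_def
    proof (intro conjI ballI)
      show "?B m \<in> lsec \<xi>" if "m \<in> lsec F" for m
        by (intro lsec_smul[OF xi_sub b(1)] cls_lsec[OF xi_sub] lie_VF YV WV repG_VF that)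
      show "?B (m + n) = ?B m + ?B n" if "m \<in> lsec F" "n \<in> lsec F" for m n
        by (simp only: repG_add that W_add lie_add_right[OF YV WV WV] repG_VF cls_add'[OF xi_sub] smulsec_add)
      show "?B (smulsec h m) = smulsec h (?B m)" if h: "h \<in> R" and m: "m \<in> lsec F" for h m
      proof
        fix q
        have e: "cls \<xi> (lie Y (W (repG (smulsec h m)))) =
            smulsec h (cls \<xi> (lie Y (W (repG m)))) + smulsec (Y h) (cls \<xi> (W (repG m)))"
          by (simp only: repG_smul[OF h m] W_smul lie_smul_right[OF h YV WV[OF repG_VF[OF m]]] cls_add'[OF xi_sub] cls_smul'[OF xi_sub])
        show "?B (smulsec h m) q = smulsec h (?B m) q"
          using b(2) W_xi[OF _ repG_VF[OF m], of q] unfolding e by (cases "q \<in> Q") (simp_all add: smulsec_def fun_eq_iff)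
      qed
    qed
    then have "?B m p = 0" using z by fastforce
    moreover have "b p = 1" using b(3,4) by blast
    ultimately have "cls \<xi> (lie Y (W ?N)) p = 0" by (simp add: smulsec_def)
    moreover have "vec_at (lie Y (W ?N)) p = vec_at (lie Y ?N) p"
    proof (rule lie_local_right[OF YV WV[OF NV] NV t(1) _ t(2)])
      fix q assume q: "q \<in> Q"
      have "c q (vec_at ?N q) = 0" using t(6)[OF q VF_T[OF NV]] secs_at[OF N UNIV_I] by simp
      then show "vec_at (W ?N) q = vec_at ?N q" by (simp add: W_def vec_at_simps fun_eq_iff)
    qed
    ultimately show ?thesis by (simp only: cls_def)
  qed
  then have "cls \<xi> (lie Y ?N) = 0" by (simp add: fun_eq_iff)
  then show "cls \<xi> (lie ?N Y) = cls \<xi> (lie (repG 0) Y)"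
    using lie_antisym[of ?N Y] by (simp only: repG_zero lie_zero_left[OF YV] cls_zero'[OF xi_sub] cls_uminus'[OF xi_sub] minus_zero)
qed

text \<open>The symbol Y is the section of G with \<theta> Y = 0 and \<theta>[Y,Z] = -\<beta>(Z).
  The rule N \<mapsto> \<theta>[Y,N] + \<beta>(N) then vanishes on \<xi> and defines a derivation;
  in \<varpi> the bracket cancels and \<beta> remains.\<close>

lemma varpi_inv:
  assumes \<beta>: "linear_map R (NF A \<xi>) (ell A \<xi>) \<beta>"
  shows "varpi_inv A \<xi> G \<beta> \<in> carrier (Dl A \<xi>)" "symb A \<xi> (varpi_inv A \<xi> G \<beta>) \<in> Gam xG"
    "N \<in> VF ==> jd (varpi_inv A \<xi> G \<beta>) (cls \<xi> N) = cls \<xi> (lie (symb A \<xi> (varpi_inv A \<xi> G \<beta>)) N) + jB \<beta> (cls F N)"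
proof -
  let ?B = "jB \<beta>"
  note B = FlinD[OF Flin_jB(1)[OF \<beta>]]
  have Fl: "cls F X \<in> lsec F" if "X \<in> VF" for X by (rule cls_lsec[OF F_sub that])
  have "xG_linear (\<lambda>Z. - ?B (cls F Z))"
    unfolding xG_linear_def
  proof (intro conjI ballI)
    show "- ?B (cls F Z) \<in> lsec \<xi>" if "Z \<in> Gam xG" for Z
      by (intro lsec_uminus[OF xi_sub] B(1) Fl secs_VF[OF that])
    show "- ?B (cls F (Z + Z')) = - ?B (cls F Z) + - ?B (cls F Z')" if "Z \<in> Gam xG" "Z' \<in> Gam xG" for Z Z'
      by (simp only: cls_add'[OF F_sub] B(2)[OF Fl[OF secs_VF[OF that(1)]] Fl[OF secs_VF[OF that(2)]]] minus_add_distrib)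
    show "- ?B (cls F (smul h Z)) = smulsec h (- ?B (cls F Z))" if "Z \<in> Gam xG" "h \<in> R" for Z h
      by (simp only: cls_smul'[OF F_sub] B(3)[OF that(2) Fl[OF secs_VF[OF that(1)]]]) (simp add: smulsec_def fun_eq_iff)
  qed
  from solve[OF lsec_zero[OF xi_sub] this]
  obtain Y where Y: "Y \<in> Gam G" "cls \<xi> Y = 0" "\<And>Z. Z \<in> Gam xG ==> cls \<xi> (lie Y Z) = - ?B (cls F Z)" by blast
  note YV = secs_VF[OF Y(1)]
  have Yxi: "Y \<in> Gam \<xi>" using Y(2) cls_zero_secs[OF xi_sub YV] by simp
  have YxG: "Y \<in> Gam xG" using QG_xG[OF Yxi] by (simp add: QG_G[OF Y(1)])
  have Yl: "cls \<xi> (lie Y Z) + ?B (cls F Z) = 0" if Z: "Z \<in> Gam \<xi>" for Z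
  proof -
    note ZV = secs_VF[OF Z]
    have PF: "PF Z \<in> Gam F" by (rule QG_spec(2)[OF ZV])
    have "lie Y Z = lie Y (PF Z) + lie Y (QG Z)"
      using lie_add_right[OF YV PF_VF[OF ZV] QG_VF[OF ZV]] by (simp add: PF_def)
    moreover have "cls \<xi> (lie Y (PF Z)) = 0"
      using cls_xi_zero[OF lie_F_xi[OF PF Yxi open_UNIV]] lie_antisym[of Y "PF Z"] by (simp add: cls_uminus'[OF xi_sub])
    ultimately show ?thesis using Y(3)[OF QG_xG[OF Z]] cls_F_QG[OF ZV] by (simp add: cls_add'[OF xi_sub])
  qed
  let ?r = "\<lambda>N. cls \<xi> (lie Y N) + ?B (cls F N)"
  have rl: "?r N \<in> lsec \<xi>" if "N \<in> VF" for N
    by (intro lsec_add[OF xi_sub] cls_lsec[OF xi_sub] lie_VF YV that B(1) Fl)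
  have ra: "?r (N + N') = ?r N + ?r N'" if "N \<in> VF" "N' \<in> VF" for N N'
    by (simp only: lie_add_right[OF YV that] cls_add'[OF xi_sub] cls_add'[OF F_sub] B(2)[OF Fl[OF that(1)] Fl[OF that(2)]])
      (simp only: ac_simps)
  have rs: "?r (smul s N) = smulsec (Y s) (cls \<xi> N) + smulsec s (?r N)" if "s \<in> R" "N \<in> VF" for s N
    by (simp only: lie_smul_right[OF that(1) YV that(2)] cls_add'[OF xi_sub] cls_smul'[OF xi_sub] cls_smul'[OF F_sub]
      B(3)[OF that(1) Fl[OF that(2)]] smulsec_add) (simp only: ac_simps)
  have rd: "isder (der ?r) Y" "\<And>N. N \<in> VF ==> der ?r (cls \<xi> N) = ?r N"
    by (rule rule_der[OF YV]; (rule rl ra Yl rs)?; assumption)+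
  let ?E = "dq (der ?r)"
  note E = dq[OF rd(1)]
  have jE: "jd ?E (cls \<xi> N) = ?r N" if "N \<in> VF" for N
    using E(2)[OF cls_lsec[OF xi_sub that]] rd(2)[OF that] by simp
  have v: "js \<xi> (varpi A \<xi> [?E, \<Delta>']) = ?B (cls F (symb A \<xi> \<Delta>'))" if \<Delta>': "\<Delta>' \<in> carrier (Dl A \<xi>)" for \<Delta>'
    using varpi(2)[OF E(1) \<Delta>'] jE[OF symb_VF[OF \<Delta>']] Y(2) isder_zero[OF symb_Dl[OF \<Delta>']] by (simp add: E(3))
  have qF: "quot_proj A F X \<in> carrier (NF A \<xi>)" if "X \<in> VF" for X
    unfolding quot_proj_qs[OF F_sub] by (rule qs_carrier[OF F_sub Fl[OF that]])
  have jq: "js \<xi> (\<beta> (quot_proj A F X)) = ?B (cls F X)" if "X \<in> VF" for X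
    using Flin_jB(3)[OF \<beta> qF[OF that]] js_quot_proj[OF F_sub that] by simp
  have "varpi_inv A \<xi> G \<beta> = ?E"
    unfolding varpi_inv_def
  proof (rule the_equality)
    show "?E \<in> carrier (G_tilde A \<xi> G) \<and>
      (\<forall>\<Delta>'\<in>carrier (G_tilde A \<xi> G). varpi A \<xi> [?E, \<Delta>'] = \<beta> (quot_proj A F (symb A \<xi> \<Delta>')))"
    proof (intro conjI ballI)
      show "?E \<in> carrier (G_tilde A \<xi> G)" using E Y(1) by (simp add: carrier_G_tilde)
      fix \<Delta>' assume "\<Delta>' \<in> carrier (G_tilde A \<xi> G)"
      then have \<Delta>': "\<Delta>' \<in> carrier (Dl A \<xi>)" by (simp add: carrier_G_tilde)
      show "varpi A \<xi> [?E, \<Delta>'] = \<beta> (quot_proj A F (symb A \<xi> \<Delta>'))"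
        by (rule cx.me.J_eq[OF varpi(1)[OF E(1) \<Delta>'] Flin_jB(2)[OF \<beta> qF[OF symb_VF[OF \<Delta>']]]])
          (simp only: v[OF \<Delta>'] jq[OF symb_VF[OF \<Delta>']])
    qed
    fix E' assume E': "E' \<in> carrier (G_tilde A \<xi> G) \<and>
      (\<forall>\<Delta>'\<in>carrier (G_tilde A \<xi> G). varpi A \<xi> [E', \<Delta>'] = \<beta> (quot_proj A F (symb A \<xi> \<Delta>')))"
    then have E'D: "E' \<in> carrier (Dl A \<xi>)" and E'G: "symb A \<xi> E' \<in> Gam G" by (simp_all add: carrier_G_tilde)
    \<comment> \<open>\<varpi> annihilates the difference of two preimages against all symbols in G,
      so the difference is a covariant derivative along a field in T\<F> \<inter> G, that is,
      0.\<close>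
    let ?D = "E' \<ominus>\<^bsub>Dl A \<xi>\<^esub> ?E"
    have D: "?D \<in> carrier (Dl A \<xi>)" by (rule dl.grp.minus_closed[OF E'D E(1)])
    have sD: "symb A \<xi> ?D = symb A \<xi> E' - Y" using symb_minus[OF E'D E(1)] E(3) by simp
    have DG: "symb A \<xi> ?D \<in> Gam G" unfolding sD by (rule secs_diff[OF G_sub E'G Y(1)])
    have t: "varpi A \<xi> [?D, \<Delta>'] = \<zero>\<^bsub>ell A \<xi>\<^esub>" if \<Delta>': "\<Delta>' \<in> carrier (Dl A \<xi>)" and G: "symb A \<xi> \<Delta>' \<in> Gam G" for \<Delta>'
    proof -
      have "varpi A \<xi> [E', \<Delta>'] = \<beta> (quot_proj A F (symb A \<xi> \<Delta>'))"
        using E' \<Delta>' G by (simp add: carrier_G_tilde)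
      then have w: "js \<xi> (varpi A \<xi> [E', \<Delta>']) = js \<xi> (varpi A \<xi> [?E, \<Delta>'])"
        by (simp only: v[OF \<Delta>'] jq[OF symb_VF[OF \<Delta>']])
      note j = isderD(3)[OF symb_Dl[OF \<Delta>']]
      have l: "cls \<xi> (symb A \<xi> E') \<in> lsec \<xi>" by (rule cls_lsec[OF xi_sub symb_VF[OF E'D]])
      have e: "jd ?D = jd E' - jd ?E" by (rule dl.J_minus[OF E'D E(1)])
      show ?thesis
        unfolding varpi_zero_iff[OF D \<Delta>'] sD e
        using w varpi(2)[OF E'D \<Delta>'] varpi(2)[OF E(1) \<Delta>']
        by (simp add: E(3) cls_diff'[OF xi_sub] Y(2) isder_zero[OF symb_Dl[OF \<Delta>']] lie_diff_left symb_VF E'D \<Delta>' YV algebra_simps)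
    qed
    have DF: "symb A \<xi> ?D \<in> Gam F" by (rule test_varpi(1)[OF D t])
    have D0: "symb A \<xi> ?D = 0" by (rule FG_sections_zero[OF DF DG])
    show "E' = ?E"
    proof (rule jd_inj[OF E'D E(1)])
      fix m assume m: "m \<in> lsec \<xi>"
      have "jd ?D m = nabD \<xi> 0 m" using test_varpi(2)[OF D t m] D0 by simp
      also have "\<dots> = 0" using xi.nab_add_left[OF xi.L_zero xi.L_zero m] by simp
      finally show "jd E' m = jd ?E m" by (simp only: dl.J_minus[OF E'D E(1)] minus_apply right_minus_eq)
    qed
  qed
  then show "varpi_inv A \<xi> G \<beta> \<in> carrier (Dl A \<xi>)" "symb A \<xi> (varpi_inv A \<xi> G \<beta>) \<in> Gam xG"
    "N \<in> VF ==> jd (varpi_inv A \<xi> G \<beta>) (cls \<xi> N) = cls \<xi> (lie (symb A \<xi> (varpi_inv A \<xi> G \<beta>)) N) + jB \<beta> (cls F N)"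
    using E(1,3) YxG jE by simp_all
qed

section \<open>Evaluation of \<Phi>\<close>

lemma is_form_jf: "\<eta> \<in> carrier (cx.Om n) ==> is_form n (cx.jf n \<eta>)"
  using cx.js_form[of \<eta> n] by (simp add: is_form_def)

lemma pullback_K:
  assumes \<eta>: "\<eta> \<in> carrier (cx.Om n)" and Ds: "Ds \<in> tuples (Dl A \<xi>) n"
  shows "pullback_K A \<xi> G n \<eta> Ds \<in> carrier (ell A \<xi>)"
    "js \<xi> (pullback_K A \<xi> G n \<eta> Ds) = cx.jf n \<eta> (map (\<lambda>\<Delta>. PF (symb A \<xi> \<Delta>)) Ds)"
proof -
  have m: "map (\<lambda>\<Delta>. symb A \<xi> (pr_K A \<xi> G \<Delta>)) Ds = map (\<lambda>\<Delta>. PF (symb A \<xi> \<Delta>)) Ds"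
    using Ds by (intro map_cong refl) (auto simp: tuples_def pr_K)
  have d: "map (\<lambda>\<Delta>. PF (symb A \<xi> \<Delta>)) Ds \<in> xi.dom n"
    using Ds by (auto simp: tuples_def xi.dom_def QG_spec(2) symb_VF)
  show "pullback_K A \<xi> G n \<eta> Ds \<in> carrier (ell A \<xi>)"
    "js \<xi> (pullback_K A \<xi> G n \<eta> Ds) = cx.jf n \<eta> (map (\<lambda>\<Delta>. PF (symb A \<xi> \<Delta>)) Ds)"
    using Ds d by (simp_all add: pullback_K_def m cx.form_closed[OF \<eta>] cx.jf_def)
qed

text \<open>The symbol of \<open>E\<close> is annihilated by the projection to T\<F>. The surviving
  terms are the one where \<open>E\<close> acts and those where it is bracketed with some X_i; in
  the latter the bracket is moved from the front into slot i, which leaves the common sign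
  (-1)^n.\<close>

lemma d_D_pullback:
  assumes \<eta>: "\<eta> \<in> carrier (cx.Om n)" and Ds: "Ds \<in> tuples (Ker A \<xi>) n"
    and E: "E \<in> carrier (Dl A \<xi>)" and Y: "symb A \<xi> E \<in> Gam xG"
  defines "Xs \<equiv> map (symb A \<xi>) Ds" and "\<omega> \<equiv> cx.jf n \<eta>"
  shows "d_D A \<xi> n (pullback_K A \<xi> G n \<eta>) (Ds @ [E]) \<in> carrier (ell A \<xi>)"
    "js \<xi> (d_D A \<xi> n (pullback_K A \<xi> G n \<eta>) (Ds @ [E])) = sg n (jd E (\<omega> Xs) + ins (AY (symb A \<xi> E)) \<omega> Xs)"
proof -
  let ?xs = "Ds @ [E]" and ?Y = "symb A \<xi> E" and ?P = "\<lambda>\<Delta>. PF (symb A \<xi> \<Delta>)" and ?pb = "pullback_K A \<xi> G n \<eta>"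
  have len: "length Ds = n" and K: "set Ds \<subseteq> carrier (Ker A \<xi>)" using Ds by (simp_all add: tuples_def)
  have a: "xi.aalt n \<omega>" using is_form_jf[OF \<eta>] by (simp add: is_form_def \<omega>_def)
  have KD: "set Ds \<subseteq> carrier (Dl A \<xi>)" and KF: "\<And>\<Delta>. \<Delta> \<in> set Ds ==> symb A \<xi> \<Delta> \<in> Gam F" using K by (auto simp: Ker_iff)
  have Xs: "Xs \<in> dm n" using KF len by (auto simp: xi.dom_def Xs_def)
  have lX: "length Xs = n" using len by (simp add: Xs_def)
  have PXs: "map ?P Ds = Xs" unfolding Xs_def by (intro map_cong refl PF_F KF)
  have PE: "?P E = 0" by (rule PF_G[OF xG_G[OF Y]])
  have YV: "?Y \<in> VF" by (rule symb_VF[OF E])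
  have xD: "set ?xs \<subseteq> carrier (Dl A \<xi>)" using KD E by simp
  have xi': "?xs ! i \<in> carrier (Dl A \<xi>)" if "i \<le> n" for i using xD len that nth_mem[of i ?xs] by auto
  have t: "?xs \<in> tuples (Dl A \<xi>) (Suc n)" using xD len by (simp add: tuples_def)
  have t1: "nths ?xs (- {i}) \<in> tuples (Dl A \<xi>) n" if "i \<le> n" for i
    using that len set_nths_in[OF xD] by (simp add: tuples_def length_nths_compl)
  have t2: "commutator A \<xi> (?xs ! i) (?xs ! j) # nths ?xs (- {i, j}) \<in> tuples (Dl A \<xi>) n" if ij: "i < j" "j \<le> n" for i j
    using ij len set_nths_in[OF xD] commutator(1)[OF xi' xi', of i j] length_nths_compl2[of i j ?xs] by (simp add: tuples_def)
  have 1: "(?xs ! i) (?pb (nths ?xs (- {i}))) \<in> carrier (ell A \<xi>)" if "i \<le> n" for i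
    by (rule Dl_closed[OF xi'[OF that] pullback_K(1)[OF \<eta> t1[OF that]]])
  have 2: "?pb (commutator A \<xi> (?xs ! i) (?xs ! j) # nths ?xs (- {i, j})) \<in> carrier (ell A \<xi>)" if "i < j" "j \<le> n" for i j
    by (rule pullback_K(1)[OF \<eta> t2[OF that]])
  have k: "d_D A \<xi> n ?pb ?xs \<in> carrier (ell A \<xi>)"
    "js \<xi> (d_D A \<xi> n ?pb ?xs) = (\<Sum>i<Suc n. sg i (js \<xi> ((?xs ! i) (?pb (nths ?xs (- {i})))))) +
      (\<Sum>j<Suc n. \<Sum>i<j. sg (i + j) (js \<xi> (?pb (commutator A \<xi> (?xs ! i) (?xs ! j) # nths ?xs (- {i, j})))))"
    using cx.me.koszul_closed_J[OF t, where nab = "\<lambda>\<Delta>. \<Delta>" and br = "commutator A \<xi>" and \<eta> = ?pb, OF 1 2]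
    unfolding d_D_def by blast+
  show "d_D A \<xi> n ?pb ?xs \<in> carrier (ell A \<xi>)" by (rule k(1))
  \<comment> \<open>If \<open>E\<close> neither acts nor is bracketed, it stays at the end of the
    list and contributes the entry 0.\<close>
  have z: "\<omega> zs = 0" if "zs \<in> dm n" "zs = ys @ [0]" for zs ys
    by (rule xi.aalt_zero_arg[OF a that(1), of "length ys"]) (use that xi.domD(2)[OF that(1)] in auto)
  have mP: "map ?P (nths ?xs I) = nths (Xs @ [0]) I" for I
    by (simp only: nths_map[symmetric] map_append PXs list.map PE)
  have dP: "map ?P zs \<in> dm n" if "zs \<in> tuples (Dl A \<xi>) n" for zs
    using that by (auto simp: tuples_def xi.dom_def QG_spec(2) symb_VF)
  have j1: "js \<xi> ((?xs ! i) (?pb (nths ?xs (- {i})))) = (if i = n then jd E (\<omega> Xs) else 0)" if i: "i \<le> n" for i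
  proof -
    have e: "js \<xi> ((?xs ! i) (?pb (nths ?xs (- {i})))) = jd (?xs ! i) (\<omega> (nths (Xs @ [0]) (- {i})))"
      unfolding jd_js[OF xi'[OF i] pullback_K(1)[OF \<eta> t1[OF i]]] pullback_K(2)[OF \<eta> t1[OF i]] mP \<omega>_def ..
    show ?thesis
    proof (cases "i = n")
      case True
      then show ?thesis unfolding e using nths_snoc(2)[OF lX[symmetric]] len by (simp add: nth_append)
    next
      case False
      have "\<omega> (nths (Xs @ [0]) (- {i})) = 0"
        by (rule z[OF _ nths_snoc(1)[OF lX[symmetric]]]) (use dP[OF t1[OF i]] mP i False in simp_all)
      then show ?thesis unfolding e using False isder_zero[OF symb_Dl[OF xi'[OF i]]] by simp
    qed
  qed
  have j2: "js \<xi> (?pb (commutator A \<xi> (?xs ! i) (?xs ! j) # nths ?xs (- {i, j}))) =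
    (if j = n then sg i (\<omega> (Xs[i := AY ?Y (Xs ! i)])) else 0)" if ij: "i < j" "j \<le> n" for i j
  proof -
    let ?c = "commutator A \<xi> (?xs ! i) (?xs ! j)"
    have e: "js \<xi> (?pb (?c # nths ?xs (- {i, j}))) = \<omega> (?P ?c # nths (Xs @ [0]) (- {i, j}))"
      unfolding pullback_K(2)[OF \<eta> t2[OF ij]] list.map mP \<omega>_def ..
    have d: "?P ?c # nths (Xs @ [0]) (- {i, j}) \<in> dm n"
      using dP[OF t2[OF ij]] by (simp only: list.map mP)
    show ?thesis
    proof (cases "j = n")
      case True
      have i: "i < n" using ij True by simp
      have "?xs ! i = Ds ! i" "?xs ! j = E" using i True len by (simp_all add: nth_append)
      then have "?P ?c = AY ?Y (Xs ! i)"
        using commutator(2)[OF xi' xi', of i j] ij i len by (simp add: AY_def Xs_def)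
      moreover have "\<omega> (AY ?Y (Xs ! i) # nths Xs (- {i})) = sg i (\<omega> (Xs[i := AY ?Y (Xs ! i)]))"
        by (rule xi.aalt_move[OF a Xs AY_F[OF YV secs_VF[OF xi.dom_nth[OF Xs i]]] i])
      ultimately show ?thesis unfolding e using True nths_snoc(4)[OF lX[symmetric] i] by simp
    next
      case False
      have "?P ?c # nths (Xs @ [0]) (- {i, j}) = (?P ?c # nths Xs (- {i, j})) @ [0]"
        using nths_snoc(3)[OF lX[symmetric] ij(1)] ij(2) False by simp
      then show ?thesis unfolding e using False z[OF d] by simp
    qed
  qed
  have "(\<Sum>i<Suc n. sg i (js \<xi> ((?xs ! i) (?pb (nths ?xs (- {i})))))) = sg n (jd E (\<omega> Xs))"
  proof -
    have "(\<Sum>i<Suc n. sg i (js \<xi> ((?xs ! i) (?pb (nths ?xs (- {i})))))) = (\<Sum>i<Suc n. sg i (if i = n then jd E (\<omega> Xs) else 0))"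
      by (rule sum.cong[OF refl]) (simp only: j1 lessThan_iff less_Suc_eq_le)
    also have "\<dots> = sg n (jd E (\<omega> Xs))"
      unfolding sum.lessThan_Suc by (simp cong: sum.cong_simp)
    finally show ?thesis .
  qed
  moreover have "(\<Sum>j<Suc n. \<Sum>i<j. sg (i + j) (js \<xi> (?pb (commutator A \<xi> (?xs ! i) (?xs ! j) # nths ?xs (- {i, j}))))) =
      sg n (ins (AY ?Y) \<omega> Xs)"
  proof -
    have "(\<Sum>i<j. sg (i + j) (js \<xi> (?pb (commutator A \<xi> (?xs ! i) (?xs ! j) # nths ?xs (- {i, j}))))) =
        (if j = n then sg n (ins (AY ?Y) \<omega> Xs) else 0)" if j: "j < Suc n" for j
    proof (cases "j = n")
      case True
      have c: "sg (i + n) (sg i m) = sg n m" for i and m :: "'a => 'a tvec" by (simp add: sg_def)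
      show ?thesis
        unfolding ins_def lX sg_sum using True by (simp add: j2 c)
    next
      case False
      then show ?thesis using j by (simp add: j2)
    qed
    then have "(\<Sum>j<Suc n. \<Sum>i<j. sg (i + j) (js \<xi> (?pb (commutator A \<xi> (?xs ! i) (?xs ! j) # nths ?xs (- {i, j}))))) =
        (\<Sum>j<Suc n. if j = n then sg n (ins (AY ?Y) \<omega> Xs) else 0)"
      by (intro sum.cong refl) simp
    also have "\<dots> = sg n (ins (AY ?Y) \<omega> Xs)" unfolding sum.lessThan_Suc by (simp cong: sum.cong_simp)
    finally show ?thesis .
  qed
  ultimately show "js \<xi> (d_D A \<xi> n ?pb ?xs) = sg n (jd E (\<omega> Xs) + ins (AY ?Y) \<omega> Xs)"
    unfolding k(2) sg_add by simp
qed

text \<open>With N = \<open>Nu\<close> the terms \<theta>[Y,N] from the action of the preimage and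
  \<theta>[N,Y] from the insertion cancel, and \<beta>(N) is left. The value is unique because
  functionals separate sections of N\<F>.\<close>

lemma Phi_eq:
  assumes \<eta>: "\<eta> \<in> carrier (cx.Om n)"
  shows "\<Phi> A \<xi> G n \<eta> = cf.qf n (\<lambda>Xs. sg n (NuF (cx.jf n \<eta>) Xs))"
proof -
  let ?\<omega> = "cx.jf n \<eta>"
  note \<omega> = is_form_jf[OF \<eta>]
  have "(THE \<nu>. \<nu> \<in> carrier (NF A \<xi>) \<and>
      (\<forall>\<beta>. linear_map R (NF A \<xi>) (ell A \<xi>) \<beta> \<longrightarrow>
         (\<forall>\<Delta>s\<in>tuples (Ker A \<xi>) n. map (symb A \<xi>) \<Delta>s = Xs \<longrightarrow>
            \<beta> \<nu> = d_D A \<xi> n (pullback_K A \<xi> G n \<eta>) (\<Delta>s @ [varpi_inv A \<xi> G \<beta>])))) = qs F (sg n (NuF ?\<omega> Xs))"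
    (is "(THE \<nu>. ?Q \<nu>) = _") if Xs: "Xs \<in> dm n" for Xs
  proof (rule the_equality)
    let ?m = "sg n (NuF ?\<omega> Xs)"
    have ml: "?m \<in> lsec F" by (rule nf.M_sg[OF NuF_lsec[OF \<omega> Xs]])
    note c = qs_carrier[OF F_sub ml]
    have Bd: "js \<xi> (d_D A \<xi> n (pullback_K A \<xi> G n \<eta>) (\<Delta>s @ [varpi_inv A \<xi> G \<beta>])) = jB \<beta> ?m"
      if \<beta>: "linear_map R (NF A \<xi>) (ell A \<xi>) \<beta>" and \<Delta>s: "\<Delta>s \<in> tuples (Ker A \<xi>) n" "map (symb A \<xi>) \<Delta>s = Xs" for \<beta> \<Delta>s
    proof -
      note v = varpi_inv[OF \<beta>]
      let ?E = "varpi_inv A \<xi> G \<beta>" and ?N = "Nu ?\<omega> Xs"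
      note N = Nu[OF \<omega> Xs]
      have NV: "?N \<in> VF" by (rule secs_VF[OF N(1)])
      have "jd ?E (?\<omega> Xs) + ins (AY (symb A \<xi> ?E)) ?\<omega> Xs =
          cls \<xi> (lie (symb A \<xi> ?E) ?N) + jB \<beta> (cls F ?N) + cls \<xi> (lie ?N (symb A \<xi> ?E))"
        using v(3)[OF NV] by (simp only: N(2) N(3)[OF v(2)])
      also have "\<dots> = jB \<beta> (NuF ?\<omega> Xs)"
        using lie_antisym[of ?N "symb A \<xi> ?E"] by (simp add: cls_uminus'[OF xi_sub] NuF_def)
      finally have "js \<xi> (d_D A \<xi> n (pullback_K A \<xi> G n \<eta>) (\<Delta>s @ [?E])) = sg n (jB \<beta> (NuF ?\<omega> Xs))"
        using d_D_pullback(2)[OF \<eta> \<Delta>s(1) v(1,2)] \<Delta>s(2) by simp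
      also have "\<dots> = jB \<beta> ?m"
        using Flin_uminus[OF Flin_jB(1)[OF \<beta>] NuF_lsec[OF \<omega> Xs]] by (simp add: sg_def)
      finally show ?thesis .
    qed
    show "?Q (qs F ?m)"
    proof (intro conjI allI impI ballI)
      show "qs F ?m \<in> carrier (NF A \<xi>)" by (rule c)
      fix \<beta> \<Delta>s assume \<beta>: "linear_map R (NF A \<xi>) (ell A \<xi>) \<beta>" and \<Delta>s: "\<Delta>s \<in> tuples (Ker A \<xi>) n" "map (symb A \<xi>) \<Delta>s = Xs"
      have "js \<xi> (\<beta> (qs F ?m)) = jB \<beta> ?m" unfolding jB_def ..
      then show "\<beta> (qs F ?m) = d_D A \<xi> n (pullback_K A \<xi> G n \<eta>) (\<Delta>s @ [varpi_inv A \<xi> G \<beta>])"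
        using Bd[OF \<beta> \<Delta>s] by (intro cx.me.J_eq[OF Flin_jB(2)[OF \<beta> c] d_D_pullback(1)[OF \<eta> \<Delta>s(1) varpi_inv(1,2)[OF \<beta>]]]) simp
    qed
    fix \<nu> assume \<nu>: "?Q \<nu>"
    then have \<nu>c: "\<nu> \<in> carrier (NF A \<xi>)" by blast
    note \<nu>l = js_lsec[OF F_sub \<nu>c]
    \<comment> \<open>There is a tuple of kernel derivations with the given symbols, so the
      condition on \<nu> is not vacuous.\<close>
    let ?Ds = "map kerD Xs"
    have XF: "set Xs \<subseteq> Gam F" using xi.domD(1)[OF Xs] .
    have Ds: "?Ds \<in> tuples (Ker A \<xi>) n" "map (symb A \<xi>) ?Ds = Xs"
      using XF xi.domD(2)[OF Xs] by (auto simp: tuples_def kerD intro!: map_idI)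
    have "js F \<nu> - ?m = 0"
    proof (rule Flin_separates[OF lsec_diff[OF F_sub \<nu>l(1) ml]])
      fix B assume B: "Flin B"
      let ?\<beta> = "\<lambda>s. qs \<xi> (B (js F s))"
      note \<beta> = Flin_beta[OF B]
      have "?\<beta> \<nu> = d_D A \<xi> n (pullback_K A \<xi> G n \<eta>) (?Ds @ [varpi_inv A \<xi> G ?\<beta>])"
        using \<nu> \<beta> Ds by blast
      then have "js \<xi> (?\<beta> \<nu>) = jB ?\<beta> ?m" using Bd[OF \<beta> Ds] by simp
      then have "B (js F \<nu>) = B ?m"
        by (simp only: jB_beta[OF B ml] js_qs[OF xi_sub FlinD(1)[OF B \<nu>l(1)]])
      then show "B (js F \<nu> - ?m) = 0" by (simp add: Flin_diff[OF B \<nu>l(1) ml])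
    qed
    then have "js F \<nu> = ?m" by simp
    then show "\<nu> = qs F ?m" using \<nu>l(2) by simp
  qed
  then show ?thesis
    unfolding \<Phi>_def cf.qf_def cx.tuples_TF by (intro restrict_ext)
qed

end

section \<open>Cohomology\<close>

locale real_cochains =
  fixes \<Omega> :: "nat => (real, 'w) module" and d :: "nat => 'w => 'w"
  assumes group: "abelian_group (\<Omega> n)"
    and smult_closed: "x \<in> carrier (\<Omega> n) ==> c \<odot>\<^bsub>\<Omega> n\<^esub> x \<in> carrier (\<Omega> n)"
    and smult_add: "x \<in> carrier (\<Omega> n) ==> y \<in> carrier (\<Omega> n) ==>
      c \<odot>\<^bsub>\<Omega> n\<^esub> (x \<oplus>\<^bsub>\<Omega> n\<^esub> y) = c \<odot>\<^bsub>\<Omega> n\<^esub> x \<oplus>\<^bsub>\<Omega> n\<^esub> c \<odot>\<^bsub>\<Omega> n\<^esub> y"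
    and d_linear: "linear_map UNIV (\<Omega> n) (\<Omega> (Suc n)) (d n)"
begin

sublocale G: abelian_group "\<Omega> n" for n by (rule group)

lemma d_props:
  "x \<in> carrier (\<Omega> n) ==> d n x \<in> carrier (\<Omega> (Suc n))"
  "x \<in> carrier (\<Omega> n) ==> y \<in> carrier (\<Omega> n) ==> d n (x \<oplus>\<^bsub>\<Omega> n\<^esub> y) = d n x \<oplus>\<^bsub>\<Omega> (Suc n)\<^esub> d n y"
  "x \<in> carrier (\<Omega> n) ==> d n (c \<odot>\<^bsub>\<Omega> n\<^esub> x) = c \<odot>\<^bsub>\<Omega> (Suc n)\<^esub> d n x"
  using d_linear[of n] unfolding linear_map_def by blast+

lemma idempotent_zero: "x \<in> carrier (\<Omega> n) ==> x \<oplus>\<^bsub>\<Omega> n\<^esub> x = x ==> x = \<zero>\<^bsub>\<Omega> n\<^esub>"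
  using G.add.l_cancel_one by blast

lemma smult_zero: "c \<odot>\<^bsub>\<Omega> n\<^esub> \<zero>\<^bsub>\<Omega> n\<^esub> = \<zero>\<^bsub>\<Omega> n\<^esub>"
  using smult_add[of "\<zero>\<^bsub>\<Omega> n\<^esub>" n "\<zero>\<^bsub>\<Omega> n\<^esub>" c] by (intro idempotent_zero smult_closed) simp_all

lemma d_zero: "d n \<zero>\<^bsub>\<Omega> n\<^esub> = \<zero>\<^bsub>\<Omega> (Suc n)\<^esub>"
  using d_props(2)[of "\<zero>\<^bsub>\<Omega> n\<^esub>" n "\<zero>\<^bsub>\<Omega> n\<^esub>"] by (intro idempotent_zero d_props) simp_all

lemma cocycles_closed:
  "x \<in> cocycles \<Omega> d n ==> x \<in> carrier (\<Omega> n)"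
  "\<zero>\<^bsub>\<Omega> n\<^esub> \<in> cocycles \<Omega> d n"
  "x \<in> cocycles \<Omega> d n ==> y \<in> cocycles \<Omega> d n ==> x \<oplus>\<^bsub>\<Omega> n\<^esub> y \<in> cocycles \<Omega> d n"
  "x \<in> cocycles \<Omega> d n ==> c \<odot>\<^bsub>\<Omega> n\<^esub> x \<in> cocycles \<Omega> d n"
  by (simp_all add: cocycles_def d_zero d_props smult_closed smult_zero)

lemma coboundaries_closed:
  "x \<in> coboundaries \<Omega> d n ==> x \<in> carrier (\<Omega> n)"
  "\<zero>\<^bsub>\<Omega> n\<^esub> \<in> coboundaries \<Omega> d n"
  "x \<in> coboundaries \<Omega> d n ==> y \<in> coboundaries \<Omega> d n ==> x \<oplus>\<^bsub>\<Omega> n\<^esub> y \<in> coboundaries \<Omega> d n"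
  "x \<in> coboundaries \<Omega> d n ==> c \<odot>\<^bsub>\<Omega> n\<^esub> x \<in> coboundaries \<Omega> d n"
  "x \<in> coboundaries \<Omega> d n ==> \<ominus>\<^bsub>\<Omega> n\<^esub> x \<in> coboundaries \<Omega> d n"
proof -
  have neg: "\<ominus>\<^bsub>\<Omega> (Suc m)\<^esub> d m y = d m (\<ominus>\<^bsub>\<Omega> m\<^esub> y)" if "y \<in> carrier (\<Omega> m)" for m y
    using d_props(2)[of "\<ominus>\<^bsub>\<Omega> m\<^esub> y" m y] that
    by (intro G.minus_equality d_props) (simp_all add: G.l_neg d_zero)
  have S: "coboundaries \<Omega> d (Suc m) = d m ` carrier (\<Omega> m)" for m by (simp add: coboundaries_def)
  have N: "coboundaries \<Omega> d 0 = {\<zero>\<^bsub>\<Omega> 0\<^esub>}" by (simp add: coboundaries_def)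
  show "\<zero>\<^bsub>\<Omega> n\<^esub> \<in> coboundaries \<Omega> d n"
    by (cases n) (auto simp: S N d_zero[symmetric] simp del: d_zero)
  assume x: "x \<in> coboundaries \<Omega> d n"
  show "x \<in> carrier (\<Omega> n)" using x by (cases n) (auto simp: S N d_props)
  show "c \<odot>\<^bsub>\<Omega> n\<^esub> x \<in> coboundaries \<Omega> d n"
  proof (cases n)
    case (Suc m)
    then obtain u where u: "u \<in> carrier (\<Omega> m)" "x = d m u" using x by (auto simp: S)
    show ?thesis unfolding Suc S u(2) d_props(3)[OF u(1), symmetric] by (rule imageI[OF smult_closed[OF u(1)]])
  qed (use x in \<open>simp add: N smult_zero\<close>)
  show "\<ominus>\<^bsub>\<Omega> n\<^esub> x \<in> coboundaries \<Omega> d n"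
  proof (cases n)
    case (Suc m)
    then obtain u where u: "u \<in> carrier (\<Omega> m)" "x = d m u" using x by (auto simp: S)
    then show ?thesis using neg[OF u(1)] by (simp add: Suc S)
  next
    case 0
    have "\<ominus>\<^bsub>\<Omega> 0\<^esub> \<zero>\<^bsub>\<Omega> 0\<^esub> = \<zero>\<^bsub>\<Omega> 0\<^esub>" by (rule G.minus_equality) simp_all
    then show ?thesis using x by (simp add: 0 N)
  qed
  assume y: "y \<in> coboundaries \<Omega> d n"
  show "x \<oplus>\<^bsub>\<Omega> n\<^esub> y \<in> coboundaries \<Omega> d n"
  proof (cases n)
    case (Suc m)
    then obtain u v where u: "u \<in> carrier (\<Omega> m)" "x = d m u" and v: "v \<in> carrier (\<Omega> m)" "y = d m v"
      using x y by (auto simp: S)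
    show ?thesis unfolding Suc S u(2) v(2) d_props(2)[OF u(1) v(1), symmetric] by (rule imageI[OF G.a_closed[OF u(1) v(1)]])
  qed (use x y in \<open>simp add: N\<close>)
qed

lemma class_eq: "cohomology_class \<Omega> d n x = (\<lambda>b. b \<oplus>\<^bsub>\<Omega> n\<^esub> x) ` coboundaries \<Omega> d n"
  by (auto simp: cohomology_class_def a_r_coset_def r_coset_def submod_def)

lemma class_eqI:
  assumes x: "x \<in> carrier (\<Omega> n)" and b: "b \<in> coboundaries \<Omega> d n"
  shows "cohomology_class \<Omega> d n (b \<oplus>\<^bsub>\<Omega> n\<^esub> x) = cohomology_class \<Omega> d n x"
proof -
  note c = coboundaries_closed
  have 1: "cohomology_class \<Omega> d n (b \<oplus>\<^bsub>\<Omega> n\<^esub> x) \<subseteq> cohomology_class \<Omega> d n x"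
    if x: "x \<in> carrier (\<Omega> n)" and b: "b \<in> coboundaries \<Omega> d n" for x b
    unfolding class_eq
  proof (rule image_subsetI)
    fix b' assume b': "b' \<in> coboundaries \<Omega> d n"
    have "b' \<oplus>\<^bsub>\<Omega> n\<^esub> (b \<oplus>\<^bsub>\<Omega> n\<^esub> x) = (b' \<oplus>\<^bsub>\<Omega> n\<^esub> b) \<oplus>\<^bsub>\<Omega> n\<^esub> x" using c(1)[OF b] c(1)[OF b'] x by (simp add: G.a_assoc)
    then show "b' \<oplus>\<^bsub>\<Omega> n\<^esub> (b \<oplus>\<^bsub>\<Omega> n\<^esub> x) \<in> (\<lambda>b. b \<oplus>\<^bsub>\<Omega> n\<^esub> x) ` coboundaries \<Omega> d n"
      using c(3)[OF b' b] by blast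
  qed
  have "\<ominus>\<^bsub>\<Omega> n\<^esub> b \<oplus>\<^bsub>\<Omega> n\<^esub> (b \<oplus>\<^bsub>\<Omega> n\<^esub> x) = x"
    using c(1)[OF b] x by (simp add: G.r_neg1)
  then show ?thesis
    using 1[OF x b] 1[OF G.a_closed[OF c(1)[OF b] x] c(5)[OF b]] by auto
qed

lemma class_eqD:
  assumes "x \<in> carrier (\<Omega> n)" "cohomology_class \<Omega> d n x = cohomology_class \<Omega> d n y"
  shows "\<exists>b\<in>coboundaries \<Omega> d n. x = b \<oplus>\<^bsub>\<Omega> n\<^esub> y"
proof -
  have e: "x \<in> cohomology_class \<Omega> d n x"
    unfolding class_eq using coboundaries_closed(2) assms(1) by (intro image_eqI[of _ _ "\<zero>\<^bsub>\<Omega> n\<^esub>"]) simp_all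
  show ?thesis using e[unfolded assms(2), unfolded class_eq] by blast
qed

lemma cohomology_carrier: "carrier (cohomology \<Omega> d n) = cohomology_class \<Omega> d n ` cocycles \<Omega> d n"
  by (auto simp: cohomology_def quot_module_def A_RCOSETS_def RCOSETS_def cohomology_class_def submod_def a_r_coset_def)

lemma cohomology_add:
  assumes x: "x \<in> carrier (\<Omega> n)" and y: "y \<in> carrier (\<Omega> n)"
  shows "cohomology_class \<Omega> d n x \<oplus>\<^bsub>cohomology \<Omega> d n\<^esub> cohomology_class \<Omega> d n y = cohomology_class \<Omega> d n (x \<oplus>\<^bsub>\<Omega> n\<^esub> y)"
proof -
  note c = coboundaries_closed
  have "cohomology_class \<Omega> d n x \<oplus>\<^bsub>cohomology \<Omega> d n\<^esub> cohomology_class \<Omega> d n y =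
      (\<Union>b\<in>coboundaries \<Omega> d n. \<Union>b'\<in>coboundaries \<Omega> d n. {(b \<oplus>\<^bsub>\<Omega> n\<^esub> x) \<oplus>\<^bsub>\<Omega> n\<^esub> (b' \<oplus>\<^bsub>\<Omega> n\<^esub> y)})"
    by (auto simp: cohomology_def quot_module_def set_add_def set_mult_def submod_def class_eq)
  also have "\<dots> = (\<Union>b\<in>coboundaries \<Omega> d n. \<Union>b'\<in>coboundaries \<Omega> d n. {(b \<oplus>\<^bsub>\<Omega> n\<^esub> b') \<oplus>\<^bsub>\<Omega> n\<^esub> (x \<oplus>\<^bsub>\<Omega> n\<^esub> y)})"
    by (intro SUP_cong refl arg_cong[where f = "\<lambda>z. {z}"]) (use c(1) x y in \<open>simp add: G.a_ac\<close>)
  also have "\<dots> = cohomology_class \<Omega> d n (x \<oplus>\<^bsub>\<Omega> n\<^esub> y)"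
  proof (intro equalityI subsetI)
    fix z assume "z \<in> cohomology_class \<Omega> d n (x \<oplus>\<^bsub>\<Omega> n\<^esub> y)"
    then obtain b where b: "b \<in> coboundaries \<Omega> d n" "z = b \<oplus>\<^bsub>\<Omega> n\<^esub> (x \<oplus>\<^bsub>\<Omega> n\<^esub> y)" unfolding class_eq by blast
    then have "z = (b \<oplus>\<^bsub>\<Omega> n\<^esub> \<zero>\<^bsub>\<Omega> n\<^esub>) \<oplus>\<^bsub>\<Omega> n\<^esub> (x \<oplus>\<^bsub>\<Omega> n\<^esub> y)" using c(1) by simp
    then show "z \<in> (\<Union>b\<in>coboundaries \<Omega> d n. \<Union>b'\<in>coboundaries \<Omega> d n. {(b \<oplus>\<^bsub>\<Omega> n\<^esub> b') \<oplus>\<^bsub>\<Omega> n\<^esub> (x \<oplus>\<^bsub>\<Omega> n\<^esub> y)})"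
      using b(1) c(2) by blast
  qed (use c(3) in \<open>auto simp: class_eq\<close>)
  finally show ?thesis .
qed

lemma cohomology_smult:
  assumes x: "x \<in> carrier (\<Omega> n)"
  shows "c \<odot>\<^bsub>cohomology \<Omega> d n\<^esub> cohomology_class \<Omega> d n x = cohomology_class \<Omega> d n (c \<odot>\<^bsub>\<Omega> n\<^esub> x)"
proof -
  have "c \<odot>\<^bsub>cohomology \<Omega> d n\<^esub> cohomology_class \<Omega> d n x =
      (\<Union>b\<in>coboundaries \<Omega> d n. cohomology_class \<Omega> d n (c \<odot>\<^bsub>\<Omega> n\<^esub> (b \<oplus>\<^bsub>\<Omega> n\<^esub> x)))"
    by (auto simp: cohomology_def quot_module_def class_eq a_r_coset_def r_coset_def submod_def)
  also have "\<dots> = (\<Union>b\<in>coboundaries \<Omega> d n. cohomology_class \<Omega> d n (c \<odot>\<^bsub>\<Omega> n\<^esub> x))"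
  proof (rule SUP_cong[OF refl])
    fix b assume b: "b \<in> coboundaries \<Omega> d n"
    show "cohomology_class \<Omega> d n (c \<odot>\<^bsub>\<Omega> n\<^esub> (b \<oplus>\<^bsub>\<Omega> n\<^esub> x)) = cohomology_class \<Omega> d n (c \<odot>\<^bsub>\<Omega> n\<^esub> x)"
      unfolding smult_add[OF coboundaries_closed(1)[OF b] x]
      by (rule class_eqI[OF smult_closed[OF x] coboundaries_closed(4)[OF b]])
  qed
  also have "\<dots> = cohomology_class \<Omega> d n (c \<odot>\<^bsub>\<Omega> n\<^esub> x)" using coboundaries_closed(2) by blast
  finally show ?thesis .
qed

end

text \<open>The coboundaries need not be cocycles here, so \<open>d \<circ> d = 0\<close> is never established.\<close>

lemma linear_map_cohomology:
  assumes "real_cochains \<Omega> d" "real_cochains \<Omega>' d'"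
    and f: "linear_map UNIV (\<Omega> n) (\<Omega>' n) f"
    and Z: "\<And>x. x \<in> cocycles \<Omega> d n ==> f x \<in> cocycles \<Omega>' d' n"
    and B: "\<And>x. x \<in> coboundaries \<Omega> d n ==> f x \<in> coboundaries \<Omega>' d' n"
  shows "\<exists>h. linear_map UNIV (cohomology \<Omega> d n) (cohomology \<Omega>' d' n) h \<and>
    (\<forall>x\<in>cocycles \<Omega> d n. h (cohomology_class \<Omega> d n x) = cohomology_class \<Omega>' d' n (f x))"
proof -
  interpret C: real_cochains \<Omega> d by (rule assms)
  interpret C': real_cochains \<Omega>' d' by (rule assms)
  let ?k = "cohomology_class \<Omega> d n" and ?k' = "cohomology_class \<Omega>' d' n" and ?Z = "cocycles \<Omega> d n"
  define h where "h S = ?k' (f (SOME x. x \<in> ?Z \<and> ?k x = S))" for S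
  note ZC = C.cocycles_closed(1)
  have fc: "f x \<in> carrier (\<Omega>' n)" if "x \<in> carrier (\<Omega> n)" for x using f that unfolding linear_map_def by blast
  have fa: "f (x \<oplus>\<^bsub>\<Omega> n\<^esub> y) = f x \<oplus>\<^bsub>\<Omega>' n\<^esub> f y" if "x \<in> carrier (\<Omega> n)" "y \<in> carrier (\<Omega> n)" for x y
    using f that unfolding linear_map_def by blast
  have fs: "f (c \<odot>\<^bsub>\<Omega> n\<^esub> x) = c \<odot>\<^bsub>\<Omega>' n\<^esub> f x" if "x \<in> carrier (\<Omega> n)" for c x
    using f that unfolding linear_map_def by blast
  have h: "h (?k x) = ?k' (f x)" if x: "x \<in> ?Z" for x
  proof -
    have "\<exists>y. y \<in> ?Z \<and> ?k y = ?k x" using x by blast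
    from someI_ex[OF this] obtain y where y: "y \<in> ?Z" "?k y = ?k x" and hy: "h (?k x) = ?k' (f y)" unfolding h_def by blast
    obtain b where b: "b \<in> coboundaries \<Omega> d n" "y = b \<oplus>\<^bsub>\<Omega> n\<^esub> x"
      using C.class_eqD[OF ZC[OF y(1)] y(2)] by blast
    have "f y = f b \<oplus>\<^bsub>\<Omega>' n\<^esub> f x" unfolding b(2) by (rule fa[OF C.coboundaries_closed(1)[OF b(1)] ZC[OF x]])
    then show ?thesis unfolding hy using C'.class_eqI[OF fc[OF ZC[OF x]] B[OF b(1)]] by simp
  qed
  have "linear_map UNIV (cohomology \<Omega> d n) (cohomology \<Omega>' d' n) h"
    unfolding linear_map_def C.cohomology_carrier C'.cohomology_carrier
  proof (intro conjI ballI funcsetI)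
    fix S assume "S \<in> ?k ` ?Z"
    then obtain x where x: "x \<in> ?Z" "S = ?k x" by blast
    show "h S \<in> ?k' ` cocycles \<Omega>' d' n" unfolding x(2) h[OF x(1)] using Z[OF x(1)] by blast
    show "h (c \<odot>\<^bsub>cohomology \<Omega> d n\<^esub> S) = c \<odot>\<^bsub>cohomology \<Omega>' d' n\<^esub> h S" for c
      unfolding x(2) h[OF x(1)] C.cohomology_smult[OF ZC[OF x(1)]] C'.cohomology_smult[OF fc[OF ZC[OF x(1)]]]
        h[OF C.cocycles_closed(4)[OF x(1)]] fs[OF ZC[OF x(1)]] ..
    fix T assume "T \<in> ?k ` ?Z"
    then obtain y where y: "y \<in> ?Z" "T = ?k y" by blast
    show "h (S \<oplus>\<^bsub>cohomology \<Omega> d n\<^esub> T) = h S \<oplus>\<^bsub>cohomology \<Omega>' d' n\<^esub> h T"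
      unfolding x(2) y(2) h[OF x(1)] h[OF y(1)] C.cohomology_add[OF ZC[OF x(1)] ZC[OF y(1)]]
        C'.cohomology_add[OF fc[OF ZC[OF x(1)]] fc[OF ZC[OF y(1)]]] h[OF C.cocycles_closed(3)[OF x(1) y(1)]]
        fa[OF ZC[OF x(1)] ZC[OF y(1)]] ..
  qed
  then show ?thesis using h by blast
qed

lemma chain_map_closed:
  assumes "real_cochains \<Omega> d" "real_cochains \<Omega>' d'" and f: "chain_map \<Omega> d \<Omega>' d' f"
  shows "x \<in> cocycles \<Omega> d n ==> f n x \<in> cocycles \<Omega>' d' n"
    and "x \<in> coboundaries \<Omega> d n ==> f n x \<in> coboundaries \<Omega>' d' n"
proof -
  interpret C: real_cochains \<Omega> d by (rule assms)
  interpret C': real_cochains \<Omega>' d' by (rule assms)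
  have fc: "f n x \<in> carrier (\<Omega>' n)" if "x \<in> carrier (\<Omega> n)" for n x
    using f that unfolding chain_map_def linear_map_def by blast
  have fa: "f n (x \<oplus>\<^bsub>\<Omega> n\<^esub> y) = f n x \<oplus>\<^bsub>\<Omega>' n\<^esub> f n y" if "x \<in> carrier (\<Omega> n)" "y \<in> carrier (\<Omega> n)" for n x y
    using f that unfolding chain_map_def linear_map_def by blast
  have fd: "f (Suc n) (d n x) = d' n (f n x)" if "x \<in> carrier (\<Omega> n)" for n x
    using f that unfolding chain_map_def by blast
  have f0: "f n \<zero>\<^bsub>\<Omega> n\<^esub> = \<zero>\<^bsub>\<Omega>' n\<^esub>" for n
    using fa[of "\<zero>\<^bsub>\<Omega> n\<^esub>" n "\<zero>\<^bsub>\<Omega> n\<^esub>"] by (intro C'.idempotent_zero fc) simp_all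
  show "x \<in> cocycles \<Omega> d n ==> f n x \<in> cocycles \<Omega>' d' n"
    by (simp add: cocycles_def fc fd[symmetric] f0)
  show "f n x \<in> coboundaries \<Omega>' d' n" if x: "x \<in> coboundaries \<Omega> d n"
  proof (cases n)
    case 0
    then show ?thesis using x f0[of 0] by (simp add: coboundaries_def)
  next
    case (Suc m)
    then obtain y where y: "y \<in> carrier (\<Omega> m)" "x = d m y" using x by (auto simp: coboundaries_def)
    show ?thesis
      unfolding Suc y(2) fd[OF y(1)] using fc[OF y(1)] by (simp add: coboundaries_def)
  qed
qed

lemma (in bracket_action) kz_sg:
  assumes "\<And>ys. ys \<in> dom n ==> \<eta> ys \<in> M" "xs \<in> dom (Suc n)"
  shows "d (\<lambda>ys. sg k (\<eta> ys)) xs = sg k (d \<eta> xs)"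
  using kz_uminus[of n \<eta> xs] assms by (cases "even k") (simp_all add: sg_def)

lemma (in bracket_action) aalt_sg: "aalt n \<eta> ==> aalt n (\<lambda>xs. sg k (\<eta> xs))"
  using aalt_uminus[of n \<eta>] by (cases "even k") (simp_all add: sg_def)

lemma (in bracket_module) hom_sg: "hom n \<eta> ==> hom n (\<lambda>xs. sg k (\<eta> xs))"
  by (simp add: hom_def sm_sg)

section \<open>The two complexes of forms as cochain complexes\<close>

context char_module begin

lemma jf_dK_add:
  assumes "\<eta> \<in> carrier (Om n)" "\<zeta> \<in> carrier (Om n)" "xs \<in> bm.dom (Suc n)"
  shows "bm.d (jf n \<eta> + jf n \<zeta>) xs = bm.d (jf n \<eta>) xs + bm.d (jf n \<zeta>) xs"
  using bm.kz_plus[of n "jf n \<eta>" "jf n \<zeta>" xs, OF bm.aalt_M[OF js_form(1)[OF assms(1)]] bm.aalt_M[OF js_form(1)[OF assms(2)]] assms(3)]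
  by (simp only: plus_fun_def)

lemma dK_smult:
  assumes "\<eta> \<in> carrier (Om n)" "xs \<in> bm.dom (Suc n)"
  shows "bm.d (\<lambda>ys. smulsec (\<lambda>p. c) (jf n \<eta> ys)) xs = smulsec (\<lambda>p. c) (bm.d (jf n \<eta>) xs)"
proof -
  have "asum (\<lambda>x zs. smulsec (x (\<lambda>p. c)) (jf n \<eta> zs)) xs = 0"
    unfolding asum_def
  proof (rule sum.neutral, rule ballI)
    fix i assume "i \<in> {..<length xs}"
    then have "xs ! i \<in> VF" using secs_VF[OF bm.dom_nth[OF assms(2)]] bm.domD(2)[OF assms(2)] by simp
    then have "smulsec ((xs ! i) (\<lambda>p. c)) m = 0" for m :: "'a => 'a tvec" by (simp add: VF_const smulsec_def fun_eq_iff)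
    then show "sg i (smulsec ((xs ! i) (\<lambda>p. c)) (jf n \<eta> (nths xs (- {i})))) = 0" by simp
  qed
  then show ?thesis
    using bm.kz_sm[of n "jf n \<eta>" xs "\<lambda>p. c", OF bm.aalt_M[OF js_form(1)[OF assms(1)]] assms(2) R_const] by simp
qed

lemma Om_group: "abelian_group (Om n)"
  by (rule module_embedding.is_abelian_group[OF module_embedding_Om])

lemma Om_uminus:
  assumes "\<eta> \<in> carrier (Om n)"
  shows "\<ominus>\<^bsub>Om n\<^esub> \<eta> \<in> carrier (Om n)" "jf n (\<ominus>\<^bsub>Om n\<^esub> \<eta>) xs = - jf n \<eta> xs"
  using abelian_group.a_inv_closed[OF Om_group assms] module_embedding.J_uminus[OF module_embedding_Om assms] by simp_all

text \<open>The sign \<open>k\<close> covers both \<open>d\<close> and \<open>-d\<close>.\<close>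

lemma real_cochains_dK:
  assumes e: "\<And>n \<eta>. \<eta> \<in> carrier (Om n) ==> e n \<eta> \<in> carrier (Om (Suc n))"
    and je: "\<And>n \<eta> xs. \<eta> \<in> carrier (Om n) ==> xs \<in> bm.dom (Suc n) ==> jf (Suc n) (e n \<eta>) xs = sg k (bm.d (jf n \<eta>) xs)"
  shows "real_cochains Om e"
proof (rule real_cochains.intro)
  show "abelian_group (Om n)" for n by (rule Om_group)
  show "c \<odot>\<^bsub>Om n\<^esub> x \<in> carrier (Om n)" if "x \<in> carrier (Om n)" for x n c by (rule Om_smul(1)[OF that])
  show "c \<odot>\<^bsub>Om n\<^esub> (x \<oplus>\<^bsub>Om n\<^esub> y) = c \<odot>\<^bsub>Om n\<^esub> x \<oplus>\<^bsub>Om n\<^esub> c \<odot>\<^bsub>Om n\<^esub> y"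
    if x: "x \<in> carrier (Om n)" and y: "y \<in> carrier (Om n)" for x y n c
    by (rule jf_ext[OF Om_smul(1)[OF Om_add(1)[OF x y]] Om_add(1)[OF Om_smul(1)[OF x] Om_smul(1)[OF y]]])
      (simp only: Om_smul Om_add x y plus_fun_apply smulsec_add)
  have sgm: "sg k (smulsec h m) = smulsec h (sg k m)" for h and m :: "'a => 'a tvec"
    by (simp add: bm.sm_sg)
  show "linear_map UNIV (Om n) (Om (Suc n)) (e n)" for n
    unfolding linear_map_def
  proof (intro conjI ballI funcsetI)
    fix x assume x: "x \<in> carrier (Om n)"
    show "e n x \<in> carrier (Om (Suc n))" by (rule e[OF x])
    show "e n (c \<odot>\<^bsub>Om n\<^esub> x) = c \<odot>\<^bsub>Om (Suc n)\<^esub> e n x" for c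
      by (rule jf_ext[OF e[OF Om_smul(1)[OF x]] Om_smul(1)[OF e[OF x]]])
        (simp only: je Om_smul x e dK_smult sgm)
    fix y assume y: "y \<in> carrier (Om n)"
    show "e n (x \<oplus>\<^bsub>Om n\<^esub> y) = e n x \<oplus>\<^bsub>Om (Suc n)\<^esub> e n y"
      by (rule jf_ext[OF e[OF Om_add(1)[OF x y]] Om_add(1)[OF e[OF x] e[OF y]]])
        (simp only: je Om_add x y e jf_dK_add plus_fun_apply sg_add)
  qed
qed

end

context pre_contact_manifold begin

interpretation cx: char_module A \<xi> \<xi>
  by unfold_locales (rule xi_sub preserves_xi cls_xi_zero secs_F_xi, assumption?)+

interpretation cf: char_module A \<xi> F
  by unfold_locales (rule F_sub preserves_F cls_F_zero, assumption?)+

lemma cochains_ell: "real_cochains (\<Omega>_ell A \<xi>) (d_ell A \<xi>)"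
  unfolding d_ell_def by (rule cx.real_cochains_dK[of _ 0]) (simp_all add: cx.dK_form)

lemma minus_d_NF:
  assumes "\<eta> \<in> carrier (cf.Om n)"
  shows "minus_d_NF A \<xi> n \<eta> \<in> carrier (cf.Om (Suc n))"
    "xs \<in> xi.dom (Suc n) ==> cf.jf (Suc n) (minus_d_NF A \<xi> n \<eta>) xs = - nf.d (cf.jf n \<eta>) xs"
  using cf.Om_uminus[OF cf.dK_form(1)[OF assms]] cf.dK_form(2)[OF assms] by (simp_all add: minus_d_NF_def d_NF_def)

lemma cochains_NF: "real_cochains (\<Omega>_NF A \<xi>) (minus_d_NF A \<xi>)"
  by (rule cf.real_cochains_dK[of _ 1]) (simp_all add: minus_d_NF)

end

section \<open>\<Phi> as a chain map\<close>

context pre_contact_complement begin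

interpretation cx: char_module A \<xi> \<xi>
  by unfold_locales (rule xi_sub preserves_xi cls_xi_zero secs_F_xi, assumption?)+

interpretation cf: char_module A \<xi> F
  by unfold_locales (rule F_sub preserves_F cls_F_zero, assumption?)+

text \<open>Translating the differential of a form and differentiating its translation agree on
  tuples of sections only, not as functions on all lists.\<close>

lemma NuF_cong:
  assumes \<omega>: "is_form n \<omega>" and \<omega>': "is_form n \<omega>'" and e: "\<And>ys. ys \<in> dm n ==> \<omega>' ys = \<omega> ys" and xs: "xs \<in> dm n"
  shows "NuF \<omega>' xs = NuF \<omega> xs"
proof -
  have "Nu \<omega>' xs = Nu \<omega> xs"
  proof (rule Nu_unique[OF \<omega>' xs Nu(1)[OF \<omega> xs]])
    show "cls \<xi> (Nu \<omega> xs) = \<omega>' xs" using Nu(2)[OF \<omega> xs] e[OF xs] by simp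
    fix Y assume Y: "Y \<in> Gam xG"
    have "ins (AY Y) \<omega>' xs = ins (AY Y) \<omega> xs"
      by (rule xi.ins_cong[OF e AY_F[OF secs_VF[OF Y] secs_VF] xs])
    then show "cls \<xi> (lie (Nu \<omega> xs) Y) = ins (AY Y) \<omega>' xs" using Nu(3)[OF \<omega> xs Y] by simp
  qed
  then show ?thesis by (simp add: NuF_def)
qed

lemma NuF_plus:
  assumes \<omega>: "is_form n \<omega>" and \<omega>': "is_form n \<omega>'" and s: "is_form n (\<omega> + \<omega>')" and xs: "xs \<in> dm n"
  shows "NuF (\<omega> + \<omega>') xs = NuF \<omega> xs + NuF \<omega>' xs"
proof -
  note N = Nu[OF \<omega> xs] and N' = Nu[OF \<omega>' xs]
  have "Nu (\<omega> + \<omega>') xs = Nu \<omega> xs + Nu \<omega>' xs"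
  proof (rule Nu_unique[OF s xs secs_add[OF G_sub N(1) N'(1)]])
    show "cls \<xi> (Nu \<omega> xs + Nu \<omega>' xs) = (\<omega> + \<omega>') xs"
      by (simp only: cls_add'[OF xi_sub] N(2) N'(2) plus_fun_apply)
    fix Y assume Y: "Y \<in> Gam xG"
    have "ins (AY Y) (\<omega> + \<omega>') xs = ins (AY Y) \<omega> xs + ins (AY Y) \<omega>' xs"
      unfolding xi.ins_plus[symmetric] by (simp only: plus_fun_def)
    then show "cls \<xi> (lie (Nu \<omega> xs + Nu \<omega>' xs) Y) = ins (AY Y) (\<omega> + \<omega>') xs"
      by (simp only: lie_add_left[OF secs_VF[OF N(1)] secs_VF[OF N'(1)] secs_VF[OF Y]] cls_add'[OF xi_sub] N(3)[OF Y] N'(3)[OF Y])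
  qed
  then show ?thesis by (simp only: NuF_def cls_add'[OF F_sub])
qed

lemma NuF_smult:
  assumes \<omega>: "is_form n \<omega>" and s: "is_form n (\<lambda>ys. smulsec (\<lambda>p. c) (\<omega> ys))" and xs: "xs \<in> dm n"
  shows "NuF (\<lambda>ys. smulsec (\<lambda>p. c) (\<omega> ys)) xs = smulsec (\<lambda>p. c) (NuF \<omega> xs)"
proof -
  note N = Nu[OF \<omega> xs] and R = R_const[of c]
  have "Nu (\<lambda>ys. smulsec (\<lambda>p. c) (\<omega> ys)) xs = smul (\<lambda>p. c) (Nu \<omega> xs)"
  proof (rule Nu_unique[OF s xs secs_smul[OF G_sub R N(1)]])
    show "cls \<xi> (smul (\<lambda>p. c) (Nu \<omega> xs)) = smulsec (\<lambda>p. c) (\<omega> xs)"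
      by (simp only: cls_smul'[OF xi_sub] N(2))
    fix Y assume Y: "Y \<in> Gam xG"
    have z: "smulsec (Y (\<lambda>p. c)) m = 0" for m :: "'a => 'a tvec"
      by (simp add: VF_const[OF secs_VF[OF Y]] smulsec_def fun_eq_iff)
    show "cls \<xi> (lie (smul (\<lambda>p. c) (Nu \<omega> xs)) Y) = ins (AY Y) (\<lambda>ys. smulsec (\<lambda>p. c) (\<omega> ys)) xs"
      by (simp only: cls_lie_smul_left[OF R secs_VF[OF N(1)] secs_VF[OF Y]] z diff_zero N(3)[OF Y] ins_def xi.sm_sum)
  qed
  then show ?thesis by (simp only: NuF_def cls_smul'[OF F_sub])
qed

lemma Phi_form:
  assumes "\<eta> \<in> carrier (cx.Om n)"
  shows "\<Phi> A \<xi> G n \<eta> \<in> carrier (cf.Om n)"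
    "xs \<in> dm n ==> cf.jf n (\<Phi> A \<xi> G n \<eta>) xs = sg n (NuF (cx.jf n \<eta>) xs)"
proof -
  note \<omega> = is_form_jf[OF assms]
  have "nf.aalt n (\<lambda>xs. sg n (NuF (cx.jf n \<eta>) xs))" "nf.hom n (\<lambda>xs. sg n (NuF (cx.jf n \<eta>) xs))"
    by (rule nf.aalt_sg[OF NuF_aalt[OF \<omega>]], rule nf.hom_sg[OF NuF_hom[OF \<omega>]])
  note q = cf.qf_form[OF this]
  show "\<Phi> A \<xi> G n \<eta> \<in> carrier (cf.Om n)" "xs \<in> dm n ==> cf.jf n (\<Phi> A \<xi> G n \<eta>) xs = sg n (NuF (cx.jf n \<eta>) xs)"
    unfolding Phi_eq[OF assms] by (rule q(1), rule q(2))
qed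

lemma Phi_linear: "linear_map UNIV (\<Omega>_ell A \<xi> n) (\<Omega>_NF A \<xi> n) (\<Phi> A \<xi> G n)"
  unfolding linear_map_def
proof (intro conjI ballI funcsetI)
  fix x assume x: "x \<in> carrier (cx.Om n)"
  note P = Phi_form and fx = is_form_jf[OF x]
  show "\<Phi> A \<xi> G n x \<in> carrier (cf.Om n)" by (rule P(1)[OF x])
  show "\<Phi> A \<xi> G n (c \<odot>\<^bsub>cx.Om n\<^esub> x) = c \<odot>\<^bsub>cf.Om n\<^esub> \<Phi> A \<xi> G n x" for c
  proof (rule cf.jf_ext[OF P(1)[OF cx.Om_smul(1)[OF x]] cf.Om_smul(1)[OF P(1)[OF x]]])
    fix xs assume xs: "xs \<in> dm n"
    show "cf.jf n (\<Phi> A \<xi> G n (c \<odot>\<^bsub>cx.Om n\<^esub> x)) xs = cf.jf n (c \<odot>\<^bsub>cf.Om n\<^esub> \<Phi> A \<xi> G n x) xs"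
      using NuF_smult[OF fx is_form_jf[OF cx.Om_smul(1)[OF x], unfolded cx.Om_smul(2)[OF x]] xs]
      by (simp only: P(2)[OF cx.Om_smul(1)[OF x] xs] cx.Om_smul(2)[OF x] cf.Om_smul(2)[OF P(1)[OF x]] P(2)[OF x xs] nf.sm_sg)
  qed
  fix y assume y: "y \<in> carrier (cx.Om n)"
  show "\<Phi> A \<xi> G n (x \<oplus>\<^bsub>cx.Om n\<^esub> y) = \<Phi> A \<xi> G n x \<oplus>\<^bsub>cf.Om n\<^esub> \<Phi> A \<xi> G n y"
  proof (rule cf.jf_ext[OF P(1)[OF cx.Om_add(1)[OF x y]] cf.Om_add(1)[OF P(1)[OF x] P(1)[OF y]]])
    fix xs assume xs: "xs \<in> dm n"
    show "cf.jf n (\<Phi> A \<xi> G n (x \<oplus>\<^bsub>cx.Om n\<^esub> y)) xs = cf.jf n (\<Phi> A \<xi> G n x \<oplus>\<^bsub>cf.Om n\<^esub> \<Phi> A \<xi> G n y) xs"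
      using NuF_plus[OF fx is_form_jf[OF y] is_form_jf[OF cx.Om_add(1)[OF x y], unfolded cx.Om_add(2)[OF x y]] xs]
      by (simp only: P(2)[OF cx.Om_add(1)[OF x y] xs] cx.Om_add(2)[OF x y] cf.Om_add(2)[OF P(1)[OF x] P(1)[OF y]]
        P(2)[OF x xs] P(2)[OF y xs] plus_fun_apply sg_add)
  qed
qed

text \<open>\<open>NuF\<close> commutes with the differentials without a sign; the minus sign comes
  from passing from (-1)^n to (-1)^(n+1).\<close>

lemma Phi_chain:
  assumes \<eta>: "\<eta> \<in> carrier (cx.Om n)"
  shows "\<Phi> A \<xi> G (Suc n) (d_ell A \<xi> n \<eta>) = minus_d_NF A \<xi> n (\<Phi> A \<xi> G n \<eta>)"
proof -
  have d: "d_ell A \<xi> n \<eta> \<in> carrier (cx.Om (Suc n))" unfolding d_ell_def by (rule cx.dK_form(1)[OF \<eta>])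
  note \<omega> = is_form_jf[OF \<eta>] and P = Phi_form[OF \<eta>]
  show ?thesis
  proof (rule cf.jf_ext[OF Phi_form(1)[OF d] minus_d_NF(1)[OF P(1)]])
    fix xs assume xs: "xs \<in> dm (Suc n)"
    have "NuF (cx.jf (Suc n) (d_ell A \<xi> n \<eta>)) xs = NuF (xi.d (cx.jf n \<eta>)) xs"
      by (rule NuF_cong[OF is_form_d[OF \<omega>] is_form_jf[OF d] _ xs]) (simp add: d_ell_def cx.dK_form(2)[OF \<eta>])
    also have "\<dots> = nf.d (NuF (cx.jf n \<eta>)) xs" by (rule NuF_chain[OF \<omega> xs])
    finally have l: "cf.jf (Suc n) (\<Phi> A \<xi> G (Suc n) (d_ell A \<xi> n \<eta>)) xs = - sg n (nf.d (NuF (cx.jf n \<eta>)) xs)"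
      using Phi_form(2)[OF d xs] by simp
    have "nf.d (cf.jf n (\<Phi> A \<xi> G n \<eta>)) xs = nf.d (\<lambda>ys. sg n (NuF (cx.jf n \<eta>) ys)) xs"
      by (rule nf.kz_cong[OF P(2) xs])
    also have "\<dots> = sg n (nf.d (NuF (cx.jf n \<eta>)) xs)"
      by (rule nf.kz_sg[OF NuF_lsec[OF \<omega>] xs])
    finally show "cf.jf (Suc n) (\<Phi> A \<xi> G (Suc n) (d_ell A \<xi> n \<eta>)) xs =
        cf.jf (Suc n) (minus_d_NF A \<xi> n (\<Phi> A \<xi> G n \<eta>)) xs"
      unfolding l minus_d_NF(2)[OF P(1) xs] by simp
  qed
qed

lemma Phi_chain_map: "chain_map (\<Omega>_ell A \<xi>) (d_ell A \<xi>) (\<Omega>_NF A \<xi>) (minus_d_NF A \<xi>) (\<Phi> A \<xi> G)"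
  unfolding chain_map_def using Phi_linear Phi_chain by blast

end

section \<open>Comparison of the cohomology classes for two complements\<close>

context two_complements begin

interpretation c2: pre_contact_complement A \<xi> G' by (rule G')

interpretation cx: char_module A \<xi> \<xi>
  by unfold_locales (rule xi_sub preserves_xi cls_xi_zero secs_F_xi, assumption?)+

interpretation cf: char_module A \<xi> F
  by unfold_locales (rule F_sub preserves_F cls_F_zero, assumption?)+

interpretation N: real_cochains "\<Omega>_NF A \<xi>" "minus_d_NF A \<xi>" by (rule cochains_NF)

text \<open>In degree 0 the two cochains are equal. In positive degree \<open>NuF_change\<close>
  gives their difference as the image of (-1)^n \<open>psi\<close> under the differential -d of the
  target.\<close>

lemma Phi_class:
  assumes \<eta>: "\<eta> \<in> cocycles (\<Omega>_ell A \<xi>) (d_ell A \<xi>) n"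
  shows "cohomology_class (\<Omega>_NF A \<xi>) (minus_d_NF A \<xi>) n (\<Phi> A \<xi> G' n \<eta>) =
    cohomology_class (\<Omega>_NF A \<xi>) (minus_d_NF A \<xi>) n (\<Phi> A \<xi> G n \<eta>)"
proof -
  have c: "\<eta> \<in> carrier (cx.Om n)" and z: "d_ell A \<xi> n \<eta> = \<zero>\<^bsub>cx.Om (Suc n)\<^esub>" using \<eta> by (simp_all add: cocycles_def)
  let ?\<omega> = "cx.jf n \<eta>"
  note \<omega> = is_form_jf[OF c]
  have closed: "xi.d ?\<omega> ys = 0" if "ys \<in> dm (Suc n)" for ys
    using cx.dK_form(2)[OF c that] z cx.Om_zero(2)[of "Suc n"] by (simp add: d_ell_def)
  have change: "c2.NuF ?\<omega> xs = NuF ?\<omega> xs - (case n of 0 => 0 | Suc k => nf.d (psi ?\<omega>) xs)" if "xs \<in> dm n" for xs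
    by (rule NuF_change[OF \<omega> closed that])
  have P: "\<Phi> A \<xi> G n \<eta> \<in> carrier (cf.Om n)" "\<Phi> A \<xi> G' n \<eta> \<in> carrier (cf.Om n)"
    by (rule Phi_form(1)[OF c], rule c2.Phi_form(1)[OF c])
  have "\<exists>b\<in>coboundaries (\<Omega>_NF A \<xi>) (minus_d_NF A \<xi>) n. \<Phi> A \<xi> G' n \<eta> = b \<oplus>\<^bsub>cf.Om n\<^esub> \<Phi> A \<xi> G n \<eta>"
  proof (cases n)
    case 0
    have "\<Phi> A \<xi> G' n \<eta> = \<Phi> A \<xi> G n \<eta>"
      by (rule cf.jf_ext[OF P(2,1)]) (simp add: Phi_form(2)[OF c] c2.Phi_form(2)[OF c] change, simp add: 0)
    then show ?thesis
      using N.coboundaries_closed(2)[of n] N.G.l_zero[OF P(1)] by (intro bexI[of _ "\<zero>\<^bsub>cf.Om n\<^esub>"]) simp_all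
  next
    case (Suc k)
    let ?p = "psi ?\<omega>"
    note pf = psi_form[OF \<omega>[unfolded Suc], folded Suc]
    have a: "nf.aalt k (\<lambda>xs. sg n (?p xs))" and h: "nf.hom k (\<lambda>xs. sg n (?p xs))"
      by (rule nf.aalt_sg[OF pf(1)], rule nf.hom_sg[OF pf(2)])
    note q = cf.qf_form[OF a h]
    let ?b = "minus_d_NF A \<xi> k (cf.qf k (\<lambda>xs. sg n (?p xs)))"
    have b: "?b \<in> carrier (cf.Om n)" unfolding Suc by (rule minus_d_NF(1)[OF q(1)[unfolded Suc]])
    have "\<Phi> A \<xi> G' n \<eta> = ?b \<oplus>\<^bsub>cf.Om n\<^esub> \<Phi> A \<xi> G n \<eta>"
    proof (rule cf.jf_ext[OF P(2) cf.Om_add(1)[OF b P(1)]])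
      fix xs assume xs: "xs \<in> dm n"
      note xk = xs[unfolded Suc]
      have "nf.d (cf.jf k (cf.qf k (\<lambda>xs. sg n (?p xs)))) xs = nf.d (\<lambda>xs. sg n (?p xs)) xs"
        by (rule nf.kz_cong[OF q(2) xk])
      also have "\<dots> = sg n (nf.d ?p xs)" by (rule nf.kz_sg[OF nf.aalt_M[OF pf(1)] xk])
      finally have "cf.jf n ?b xs = - sg n (nf.d ?p xs)"
        using minus_d_NF(2)[OF q(1) xk] by (simp add: Suc)
      moreover have "c2.NuF ?\<omega> xs = NuF ?\<omega> xs - nf.d ?p xs" using change[OF xs] by (simp add: Suc)
      ultimately show "cf.jf n (\<Phi> A \<xi> G' n \<eta>) xs = cf.jf n (?b \<oplus>\<^bsub>cf.Om n\<^esub> \<Phi> A \<xi> G n \<eta>) xs"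
        by (simp only: c2.Phi_form(2)[OF c xs] cf.Om_add(2)[OF b P(1)] plus_fun_apply Phi_form(2)[OF c xs] sg_diff)
          (simp only: diff_conv_add_uminus add.commute)
    qed
    moreover have "?b \<in> coboundaries (\<Omega>_NF A \<xi>) (minus_d_NF A \<xi>) n"
      using q(1) by (auto simp: Suc coboundaries_def)
    ultimately show ?thesis by blast
  qed
  then obtain b where b: "b \<in> coboundaries (\<Omega>_NF A \<xi>) (minus_d_NF A \<xi>) n" "\<Phi> A \<xi> G' n \<eta> = b \<oplus>\<^bsub>cf.Om n\<^esub> \<Phi> A \<xi> G n \<eta>" by blast
  show ?thesis unfolding b(2) by (rule N.class_eqI[OF P(1) b(1)])
qed

end

theorem theorem2p19:
  fixes A :: "('a::{t2_space,second_countable_topology}, 'b::euclidean_space) chart set"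
    and \<xi> :: "'a distribution"
  assumes "smooth_atlas A"
    and "pre_contact A \<xi>"
  shows
    "(\<forall>G. complementary A (char_dist A \<xi>) G \<longrightarrow>
        chain_map (\<Omega>_ell A \<xi>) (d_ell A \<xi>) (\<Omega>_NF A \<xi>) (minus_d_NF A \<xi>) (\<Phi> A \<xi> G)) \<and>
     (\<exists>h. (\<forall>n. linear_map UNIV (cohomology (\<Omega>_ell A \<xi>) (d_ell A \<xi>) n)
                              (cohomology (\<Omega>_NF A \<xi>) (minus_d_NF A \<xi>) n) (h n)) \<and>
          (\<forall>G. complementary A (char_dist A \<xi>) G \<longrightarrow>
             (\<forall>n. \<forall>\<eta>\<in>cocycles (\<Omega>_ell A \<xi>) (d_ell A \<xi>) n.
                \<Phi> A \<xi> G n \<eta> \<in> cocycles (\<Omega>_NF A \<xi>) (minus_d_NF A \<xi>) n \<and>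
                h n (cohomology_class (\<Omega>_ell A \<xi>) (d_ell A \<xi>) n \<eta>) =
                  cohomology_class (\<Omega>_NF A \<xi>) (minus_d_NF A \<xi>) n (\<Phi> A \<xi> G n \<eta>))))"
proof -
  interpret pre_contact_manifold A \<xi> by unfold_locales (rule assms)+
  have loc: "pre_contact_complement A \<xi> G" if "complementary A F G" for G by unfold_locales (rule that)
  let ?L = "\<Omega>_ell A \<xi>" and ?d = "d_ell A \<xi>" and ?N = "\<Omega>_NF A \<xi>" and ?e = "minus_d_NF A \<xi>"
  have chain: "chain_map ?L ?d ?N ?e (\<Phi> A \<xi> G)" if "complementary A F G" for G
    by (rule pre_contact_complement.Phi_chain_map[OF loc[OF that]])
  note closed = chain_map_closed[OF cochains_ell cochains_NF]
  have ex: "\<exists>h. \<forall>n. linear_map UNIV (cohomology ?L ?d n) (cohomology ?N ?e n) (h n) \<and>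
      (\<forall>\<eta>\<in>cocycles ?L ?d n. h n (cohomology_class ?L ?d n \<eta>) = cohomology_class ?N ?e n (f n \<eta>))"
    if f: "chain_map ?L ?d ?N ?e f" for f
  proof (rule choice, rule allI)
    fix n
    have "linear_map UNIV (?L n) (?N n) (f n)" using f unfolding chain_map_def by blast
    then show "\<exists>h. linear_map UNIV (cohomology ?L ?d n) (cohomology ?N ?e n) h \<and>
        (\<forall>\<eta>\<in>cocycles ?L ?d n. h (cohomology_class ?L ?d n \<eta>) = cohomology_class ?N ?e n (f n \<eta>))"
      by (rule linear_map_cohomology[OF cochains_ell cochains_NF]) (rule closed[OF f], assumption)+
  qed
  show ?thesis
  proof (intro conjI allI impI)
    show "chain_map ?L ?d ?N ?e (\<Phi> A \<xi> G)" if "complementary A F G" for G by (rule chain[OF that])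
    show "\<exists>h. (\<forall>n. linear_map UNIV (cohomology ?L ?d n) (cohomology ?N ?e n) (h n)) \<and>
      (\<forall>G. complementary A F G \<longrightarrow> (\<forall>n. \<forall>\<eta>\<in>cocycles ?L ?d n. \<Phi> A \<xi> G n \<eta> \<in> cocycles ?N ?e n \<and>
        h n (cohomology_class ?L ?d n \<eta>) = cohomology_class ?N ?e n (\<Phi> A \<xi> G n \<eta>)))"
    proof (cases "\<exists>G. complementary A F G")
      case True
      then obtain G where G: "complementary A F G" by blast
      from ex[OF chain[OF G]] obtain h where h: "\<And>n. linear_map UNIV (cohomology ?L ?d n) (cohomology ?N ?e n) (h n)"
        "\<And>n \<eta>. \<eta> \<in> cocycles ?L ?d n ==> h n (cohomology_class ?L ?d n \<eta>) = cohomology_class ?N ?e n (\<Phi> A \<xi> G n \<eta>)"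
        by blast
      have "h n (cohomology_class ?L ?d n \<eta>) = cohomology_class ?N ?e n (\<Phi> A \<xi> G' n \<eta>)"
        if G': "complementary A F G'" and \<eta>: "\<eta> \<in> cocycles ?L ?d n" for G' n \<eta>
      proof -
        have "two_complements A \<xi> G G'"
          by (rule two_complements.intro[OF loc[OF G]]) (rule two_complements_axioms.intro[OF loc[OF G']])
        from two_complements.Phi_class[OF this \<eta>] show ?thesis using h(2)[OF \<eta>] by simp
      qed
      then show ?thesis using h(1) closed(1)[OF chain] by (intro exI[of _ h]) blast
    next
      case False
      interpret N: real_cochains ?N ?e by (rule cochains_NF)
      interpret L: real_cochains ?L ?d by (rule cochains_ell)
      \<comment> \<open>If there is no complement, the condition on \<open>h\<close> is linearity
        alone, and the map induced by the zero chain map satisfies it.\<close>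
      have "chain_map ?L ?d ?N ?e (\<lambda>n \<eta>. \<zero>\<^bsub>?N n\<^esub>)"
        by (simp add: chain_map_def linear_map_def N.smult_zero N.d_zero)
      from ex[OF this] show ?thesis using False by blast
    qed
  qed
qed

end
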